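(* (i) Assume that the measurement channel $Q$ is continuous in total variation: for any sequence $a_n\to a\in\mathcal{X}$, $\|Q(\cdot|a_n)-Q(\cdot|a)\|_{TV}\to0$. If the predictor is universally stable in weak merging a.s., then the filter is universally stable in weak merging in expectation. (ii) The filter is universally stable in total variation in expectation if and only if the predictor is universally stable in total variation in expectation. (iii) The filter is universally stable in total variation in expectation if and only if it is universally stable in total variation a.s. (iv) Let $\mu\ll\nu$, and assume that for any policy $\gamma$ there exists some finite $n$ such that $E^{\mu,\gamma}[D(\pi_n^{\mu,\gamma}\|\pi_n^{\nu,\gamma})]<\infty$ and some $m$ such that $E^{\mu,\gamma}\big[D\big(P^{\mu,\gamma}|_{\mathcal{F}^{\mathcal{Y}}_{0,m}}\,\big\|\,P^{\nu,\gamma}|_{\mathcal{F}^{\mathcal{Y}}_{0,m}}\big)\big]<\infty$. Then the filter is universally stable in relative entropy if and only if it is universally stable in total variation in expectation.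
   Context: Setting (POMDP). $\mathcal{X},\mathcal{Y},\mathcal{U}$ (state, measurement, action spaces) are Polish spaces with their Borel sigma fields; $\mathcal{X}$ is also $\sigma$-compact. $\mathcal{P}(\mathcal{X})$ is the set of Borel probability measures on $\mathcal{X}$ and $C_b(\mathcal{X})$ the set of bounded continuous functions $\mathcal{X}\to\mathbb{R}$. Priors $\mu$ (the true one) and $\nu$ are elements of $\mathcal{P}(\mathcal{X})$, and $\mu\ll\nu$ means $\mu$ is absolutely continuous with respect to $\nu$. $T(dx'|x,u)$ is a transition kernel from $\mathcal{X}\times\mathcal{U}$ to $\mathcal{X}$, and $Q(dy|x)$ is an observation kernel (the measurement channel) from $\mathcal{X}$ to $\mathcal{Y}$. An admissible policy $\gamma=\{\gamma_n\}_{n\ge0}$ is a sequence of measurable maps $\gamma_n:\mathcal{Y}^{n+1}\times\mathcal{U}^{n}\to\mathcal{U}$, with actions $U_n=\gamma_n(Y_{[0,n]},U_{[0,n-1]})$ (so each $U_n$ is a function of $Y_{[0,n]}=(Y_0,\dots,Y_n)$); $\Gamma$ is the set of admissible policies. For a prior $\mu\in\mathcal{P}(\mathcal{X})$ and $\gamma\in\Gamma$, the strategic measure $P^{\mu,\gamma}$ (expectation $E^{\mu,\gamma}$) is the law of $(X_n,Y_n)_{n\ge0}$ on $\mathcal{X}^{\mathbb{Z}_+}\times\mathcal{Y}^{\mathbb{Z}_+}$ with $P^{\mu,\gamma}((X_0,Y_0)\in A)=\int_A Q(dy|x)\mu(dx)$ and, for $n\ge1$, $P^{\mu,\gamma}((X_n,Y_n)\in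 A\mid (X,Y)_{[0,n-1]}=(x,y)_{[0,n-1]})=\int_A Q(dy|x)T(dx|x_{n-1},u_{n-1})$, where $u_{n-1}=\gamma_{n-1}(y_{[0,n-1]},u_{[0,n-2]})$. $\mathcal{F}^{\mathcal{Y}}_{0,m}=\sigma(Y_0,\dots,Y_m)$, and $P|_{\mathcal{G}}$ is the restriction of $P$ to the sigma field $\mathcal{G}$. Predictor: $\pi_{n-}^{\mu,\gamma}(\cdot)=P^{\mu,\gamma}(X_n\in\cdot\mid Y_{[0,n-1]})$, $n\ge1$. Filter: $\pi_n^{\mu,\gamma}(\cdot)=P^{\mu,\gamma}(X_n\in\cdot\mid Y_{[0,n]})$, $n\ge0$. Those for $\mu$ and $\nu$ are evaluated along the same measurement sequence, generated under $P^{\mu,\gamma}$. Total variation: $\|P-Q\|_{TV}=\sup_{\|f\|_\infty\le1}|\int f\,dP-\int f\,dQ|$ over measurable $f$. Relative entropy: $D(P\|Q)=\int\log\frac{dP}{dQ}\,dP$ for $P\ll Q$. Stability notions for the filter with respect to a policy $\gamma$: - weak merging a.s.: there exists a set of measurement sequences $A\subset\mathcal{Y}^{\mathbb{Z}_+}$ with $P^{\mu,\gamma}$ probability 1 such that for any sequence in $A$, for any $f\in C_b(\mathcal{X})$ and any prior $\nu$ with $\mu\ll\nu$, $\lim_{n\to\infty}|\int f\,d\pi_n^{\mu,\gamma}-\int f\,d\pi_n^{\nu,\gamma}|=0$; - weak merging in expectation: for any $f\in C_b(\mathcal{X})$ and any prior $\nu$ with $\mu\ll\nu$, $\lim_{n\to\infty}E^{\mu,\gamma}\big[|\int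 f\,d\pi_n^{\mu,\gamma}-\int f\,d\pi_n^{\nu,\gamma}|\big]=0$; - total variation in expectation: for any $\nu$ with $\mu\ll\nu$, $\lim_{n\to\infty}E^{\mu,\gamma}[\|\pi_n^{\mu,\gamma}-\pi_n^{\nu,\gamma}\|_{TV}]=0$; - total variation a.s.: there exists a set of measurement sequences $A\subset\mathcal{Y}^{\mathbb{Z}_+}$ with $P^{\mu,\gamma}$ probability 1 such that for any sequence in $A$, for any $\nu$ with $\mu\ll\nu$, $\lim_{n\to\infty}\|\pi_n^{\mu,\gamma}-\pi_n^{\nu,\gamma}\|_{TV}=0$; - relative entropy: for any $\nu$ with $\mu\ll\nu$, $\lim_{n\to\infty}E^{\mu,\gamma}[D(\pi_n^{\mu,\gamma}\|\pi_n^{\nu,\gamma})]=0$. The notions for the predictor are defined analogously, with $\pi_{n-}$ in place of $\pi_n$. "Universally" stable in one of these senses means stable in that sense with respect to every admissible policy $\gamma\in\Gamma$.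
   Formalization: In the almost sure notions, the probability-one set A may depend on the prior ν (uniform in f), because with A chosen before ν part (iii) is false; in (iv), the finiteness assumption and both stability notions refer to the one given ν. *)

theory Defs
  imports "HOL-Probability.Probability"
begin

definition sigma_compact_space :: "'a::topological_space itself \<Rightarrow> bool" where
  "sigma_compact_space _ \<longleftrightarrow> (\<exists>K :: nat \<Rightarrow> 'a set. (\<forall>n. compact (K n)) \<and> (\<Union>n. K n) = UNIV)"

definition tv_norm :: "'a::topological_space measure \<Rightarrow> 'a measure \<Rightarrow> real" where
  "tv_norm P Q = (SUP f \<in> {f :: 'a \<Rightarrow> real. f \<in> borel_measurable borel \<and> (\<forall>x. \<bar>f x\<bar> \<le> 1)}.
     \<bar>(\<integral>x. f x \<partial>P) - (\<integral>x. f x \<partial>Q)\<bar>)"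

(* KL_divergence b Q P is the integral of log b (dP/dQ) against P, so P is its last argument. It is
   a Bochner integral, hence 0 when the integrand is not integrable. For probability measures
   P << Q the negative part of log (dP/dQ) is always P-integrable, so in that case the integral is
   infinite. *)
definition rel_entropy :: "'a measure \<Rightarrow> 'a measure \<Rightarrow> ennreal" where
  "rel_entropy P Q =
     (if absolutely_continuous Q P \<and> integrable P (entropy_density (exp 1) Q P)
      then ennreal (KL_divergence (exp 1) Q P) else \<infinity>)"

abbreviation priors :: "'x::topological_space measure set" where
  "priors \<equiv> space (prob_algebra borel)"

definition tv_continuous :: "('x::topological_space \<Rightarrow> 'y::topological_space measure) \<Rightarrow> bool" where
  "tv_continuous Q \<longleftrightarrow>
     (\<forall>(a :: nat \<Rightarrow> 'x) l. a \<longlonglongrightarrow> l \<longrightarrow> (\<lambda>n. tv_norm (Q (a n)) (Q l)) \<longlonglongrightarrow> 0)"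


section \<open>Policies and strategic measures\<close>

(* The history arguments (y_0, ..., y_n) and (u_0, ..., u_(n-1)) are functions on {..n} and {..<n},
   extended by undefined, as in the product measures PiM. *)
type_synonym ('y, 'u) policy = "nat \<Rightarrow> (nat \<Rightarrow> 'y) \<times> (nat \<Rightarrow> 'u) \<Rightarrow> 'u"

definition policies :: "('y::topological_space, 'u::topological_space) policy set" where
  "policies = {\<gamma>. \<forall>n. \<gamma> n \<in> PiM {..n} (\<lambda>_. borel) \<Otimes>\<^sub>M PiM {..<n} (\<lambda>_. borel) \<rightarrow>\<^sub>M borel}"

fun action :: "('y, 'u) policy \<Rightarrow> (nat \<Rightarrow> 'y) \<Rightarrow> nat \<Rightarrow> 'u" where
  "action \<gamma> y n = \<gamma> n (restrict y {..n}, (\<lambda>i. if i < n then action \<gamma> y i else undefined))"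

declare action.simps [simp del]

(* The law Q(dy|x) rho(dx) of a state with law rho together with its measurement. *)
definition observed ::
  "('x::topological_space \<Rightarrow> 'y::topological_space measure) \<Rightarrow> 'x measure \<Rightarrow> ('x \<times> 'y) measure" where
  "observed Q \<rho> = \<rho> \<bind> (\<lambda>x. distr (Q x) borel (Pair x))"

definition obs_seq :: "(nat \<Rightarrow> 'x \<times> 'y) \<Rightarrow> nat \<Rightarrow> 'y" where
  "obs_seq \<omega> n = snd (\<omega> n)"

(* The conditional law of (X_n, Y_n) given the path before time n. *)
primrec step_kernel ::
  "('x::topological_space \<times> 'u \<Rightarrow> 'x measure) \<Rightarrow> ('x \<Rightarrow> 'y::topological_space measure) \<Rightarrow>
   'x measure \<Rightarrow> ('y, 'u) policy \<Rightarrow> nat \<Rightarrow> (nat \<Rightarrow> 'x \<times> 'y) \<Rightarrow> ('x \<times> 'y) measure" where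
  "step_kernel T Q \<mu> \<gamma> 0 \<omega> = observed Q \<mu>"
| "step_kernel T Q \<mu> \<gamma> (Suc n) \<omega> = observed Q (T (fst (\<omega> n), action \<gamma> (obs_seq \<omega>) n))"

definition strategic ::
  "('x::topological_space \<times> 'u \<Rightarrow> 'x measure) \<Rightarrow> ('x \<Rightarrow> 'y::topological_space measure) \<Rightarrow>
   'x measure \<Rightarrow> ('y, 'u) policy \<Rightarrow> (nat \<Rightarrow> 'x \<times> 'y) measure" where
  "strategic T Q \<mu> \<gamma> =
     projective_family.lim UNIV (Ionescu_Tulcea.CI (step_kernel T Q \<mu> \<gamma>) (\<lambda>_. borel)) (\<lambda>_. borel)"

lemma action_measurable:
  fixes \<gamma> :: "('y::topological_space, 'u::topological_space) policy"
  assumes "\<gamma> \<in> policies"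
    and Y: "\<And>i. i \<le> n \<Longrightarrow> (\<lambda>w. Y w i) \<in> M \<rightarrow>\<^sub>M borel"
  shows "(\<lambda>w. action \<gamma> (Y w) n) \<in> M \<rightarrow>\<^sub>M borel"
  using Y
proof (induction n rule: less_induct)
  case (less n)
  have 1: "(\<lambda>w. restrict (Y w) {..n}) \<in> M \<rightarrow>\<^sub>M PiM {..n} (\<lambda>_. borel)"
    using less.prems by (intro measurable_restrict) auto
  have "(\<lambda>w. \<lambda>i\<in>{..<n}. action \<gamma> (Y w) i) \<in> M \<rightarrow>\<^sub>M PiM {..<n} (\<lambda>_. borel)"
    using less by (intro measurable_restrict) auto
  then have 2: "(\<lambda>w i. if i < n then action \<gamma> (Y w) i else undefined) \<in> M \<rightarrow>\<^sub>M PiM {..<n} (\<lambda>_. borel)"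
    by (simp add: restrict_def)
  have \<gamma>: "\<gamma> n \<in> PiM {..n} (\<lambda>_. borel) \<Otimes>\<^sub>M PiM {..<n} (\<lambda>_. borel) \<rightarrow>\<^sub>M borel"
    using assms(1) by (simp add: policies_def)
  show ?case
    unfolding action.simps[of \<gamma> _ n]
    by (rule measurable_compose[OF measurable_Pair[OF 1 2] \<gamma>])
qed

lemma observed_measurable:
  fixes Q :: "'x::second_countable_topology \<Rightarrow> 'y::second_countable_topology measure"
  assumes Q: "Q \<in> borel \<rightarrow>\<^sub>M prob_algebra borel"
  shows "observed Q \<in> prob_algebra borel \<rightarrow>\<^sub>M prob_algebra borel"
proof -
  have [measurable]: "Q \<in> borel \<rightarrow>\<^sub>M prob_algebra borel" by fact
  have 1: "(\<lambda>x. distr (Q x) (borel :: ('x \<times> 'y) measure) (Pair x)) \<in> borel \<rightarrow>\<^sub>M prob_algebra borel"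
    unfolding borel_prod[symmetric] by measurable
  have "(\<lambda>\<rho>. \<rho> \<bind> (\<lambda>x. distr (Q x) (borel :: ('x \<times> 'y) measure) (Pair x)))
     \<in> prob_algebra borel \<rightarrow>\<^sub>M prob_algebra borel"
    by (rule measurable_bind_prob_space[OF _ 1]) simp
  then show ?thesis
    by (simp add: observed_def[abs_def])
qed

lemma Ionescu_Tulcea_step_kernel:
  fixes T :: "'x::polish_space \<times> 'u::polish_space \<Rightarrow> 'x measure"
    and Q :: "'x \<Rightarrow> 'y::polish_space measure"
  assumes T: "T \<in> borel \<rightarrow>\<^sub>M prob_algebra borel" and Q: "Q \<in> borel \<rightarrow>\<^sub>M prob_algebra borel"
    and \<mu>: "\<mu> \<in> priors" and \<gamma>: "\<gamma> \<in> policies"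
  shows "Ionescu_Tulcea (step_kernel T Q \<mu> \<gamma>) (\<lambda>_. borel)"
proof -
  have K: "step_kernel T Q \<mu> \<gamma> i \<in> PiM {0..<i} (\<lambda>_. borel) \<rightarrow>\<^sub>M prob_algebra borel" for i
  proof (cases i)
    case 0
    have "step_kernel T Q \<mu> \<gamma> 0 = (\<lambda>_. observed Q \<mu>)"
      by (rule ext) simp
    then show ?thesis
      using 0 measurable_space[OF observed_measurable[OF Q] \<mu>] by simp
  next
    case (Suc n)
    let ?M = "PiM {0..<i} (\<lambda>_. borel :: ('x \<times> 'y) measure)"
    have c: "(\<lambda>\<omega>. \<omega> k) \<in> ?M \<rightarrow>\<^sub>M borel" if "k \<le> n" for k
      using that Suc by (intro measurable_component_singleton) auto
    have f: "fst \<in> (borel :: ('x \<times> 'y) measure) \<rightarrow>\<^sub>M borel"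
      and s: "snd \<in> (borel :: ('x \<times> 'y) measure) \<rightarrow>\<^sub>M borel"
      unfolding borel_prod[symmetric] by measurable
    have 1: "(\<lambda>\<omega>. fst (\<omega> n)) \<in> ?M \<rightarrow>\<^sub>M borel"
      using measurable_compose[OF c f] by simp
    have 2: "(\<lambda>\<omega>. action \<gamma> (obs_seq \<omega>) n) \<in> ?M \<rightarrow>\<^sub>M borel"
      using measurable_compose[OF c s] by (intro action_measurable \<gamma>) (simp add: obs_seq_def)
    have "(\<lambda>\<omega>. (fst (\<omega> n), action \<gamma> (obs_seq \<omega>) n)) \<in> ?M \<rightarrow>\<^sub>M borel"
      using measurable_Pair[OF 1 2] by (simp add: borel_prod)
    from measurable_compose[OF measurable_compose[OF this T] observed_measurable[OF Q]]
    have "(\<lambda>\<omega>. step_kernel T Q \<mu> \<gamma> (Suc n) \<omega>) \<in> ?M \<rightarrow>\<^sub>M prob_algebra borel"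
      by simp
    then show ?thesis
      by (simp only: Suc)
  qed
  show ?thesis
  proof (rule Ionescu_Tulcea.intro)
    fix i
    show "step_kernel T Q \<mu> \<gamma> i \<in> PiM {0..<i} (\<lambda>_. borel) \<rightarrow>\<^sub>M subprob_algebra borel"
      by (rule measurable_prob_algebraD[OF K])
  next
    fix i and \<omega> :: "nat \<Rightarrow> 'x \<times> 'y"
    assume "\<omega> \<in> space (PiM {0..<i} (\<lambda>_. borel))"
    from measurable_space[OF K this] show "prob_space (step_kernel T Q \<mu> \<gamma> i \<omega>)"
      by (simp only: space_prob_algebra mem_Collect_eq)
  qed
qed


section \<open>Filter and predictor\<close>

(* kappa, evaluated along Z, is a version of the regular conditional distribution M(X in . | Z). *)
definition reg_cond_distr ::
  "'w measure \<Rightarrow> ('w \<Rightarrow> 'x::topological_space) \<Rightarrow> 'z measure \<Rightarrow> ('w \<Rightarrow> 'z) \<Rightarrow> ('z \<Rightarrow> 'x measure) \<Rightarrow> bool" where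
  "reg_cond_distr M X N Z \<kappa> \<longleftrightarrow>
     \<kappa> \<in> N \<rightarrow>\<^sub>M prob_algebra borel \<and>
     (\<forall>A \<in> sets borel. \<forall>B \<in> sets N.
        emeasure M {\<omega> \<in> space M. X \<omega> \<in> A \<and> Z \<omega> \<in> B} =
        (\<integral>\<^sup>+\<omega>. emeasure (\<kappa> (Z \<omega>)) A * indicator B (Z \<omega>) \<partial>M))"

(* The sigma field on measurement sequences generated by the coordinates in J. A measure-valued map
   that is measurable for it depends on the measurements with index in J only. *)
definition obs_sigma :: "nat set \<Rightarrow> (nat \<Rightarrow> 'y::topological_space) measure" where
  "obs_sigma J = vimage_algebra UNIV (\<lambda>y. restrict y J) (PiM J (\<lambda>_. borel))"

definition filter_version where
  "filter_version T Q \<mu> \<gamma> n \<kappa> \<longleftrightarrow>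
     reg_cond_distr (strategic T Q \<mu> \<gamma>) (\<lambda>\<omega>. fst (\<omega> n)) (obs_sigma {..n}) obs_seq \<kappa>"

definition predictor_version where
  "predictor_version T Q \<mu> \<gamma> n \<kappa> \<longleftrightarrow>
     reg_cond_distr (strategic T Q \<mu> \<gamma>) (\<lambda>\<omega>. fst (\<omega> n)) (obs_sigma {..<n}) obs_seq \<kappa>"

definition restrict_FY ::
  "nat \<Rightarrow> (nat \<Rightarrow> 'x \<times> 'y::topological_space) measure \<Rightarrow> (nat \<Rightarrow> 'x \<times> 'y) measure" where
  "restrict_FY m P = restr_to_subalg P (vimage_algebra (space P) obs_seq (obs_sigma {..m}))"


section \<open>Stability\<close>

(* A notion of stability is a relation between the strategic measure P of the true prior mu and the
   sequences p, q of filters (or predictors) for mu and for nu, as functions of the measurement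
   sequence.

   The filter for nu is determined only up to null sets that depend on nu. In the almost sure
   notions the set A is therefore chosen for each nu, uniformly in f. It cannot be chosen
   uniformly in nu: every y in A may be explained better by some initial state x_y than by the true
   one, and then nu = (mu + delta_(x_y)) / 2 can fail to merge along that y, although each fixed
   nu >> mu merges almost surely. *)
type_synonym ('x, 'y) posterior = "nat \<Rightarrow> (nat \<Rightarrow> 'y) \<Rightarrow> 'x measure"

type_synonym ('x, 'y) stability =
  "(nat \<Rightarrow> 'x \<times> 'y) measure \<Rightarrow> ('x, 'y) posterior \<Rightarrow> ('x, 'y) posterior \<Rightarrow> bool"

definition weak_as :: "('x::topological_space, 'y::topological_space) stability" where
  "weak_as P p q \<longleftrightarrow>
     (\<exists>A \<in> sets (PiM UNIV (\<lambda>_. borel)). measure P {\<omega> \<in> space P. obs_seq \<omega> \<in> A} = 1 \<and>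
       (\<forall>y \<in> A. \<forall>f :: 'x \<Rightarrow> real. f \<in> bcontfun \<longrightarrow>
          (\<lambda>n. \<bar>(\<integral>x. f x \<partial>p n y) - (\<integral>x. f x \<partial>q n y)\<bar>) \<longlonglongrightarrow> 0))"

definition weak_exp :: "('x::topological_space, 'y) stability" where
  "weak_exp P p q \<longleftrightarrow>
     (\<forall>f :: 'x \<Rightarrow> real. f \<in> bcontfun \<longrightarrow>
        (\<lambda>n. \<integral>\<^sup>+\<omega>. ennreal \<bar>(\<integral>x. f x \<partial>p n (obs_seq \<omega>)) - (\<integral>x. f x \<partial>q n (obs_seq \<omega>))\<bar> \<partial>P)
          \<longlonglongrightarrow> 0)"

definition tv_exp :: "('x::topological_space, 'y) stability" where
  "tv_exp P p q \<longleftrightarrow>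
     (\<lambda>n. \<integral>\<^sup>+\<omega>. ennreal (tv_norm (p n (obs_seq \<omega>)) (q n (obs_seq \<omega>))) \<partial>P) \<longlonglongrightarrow> 0"

definition tv_as :: "('x::topological_space, 'y::topological_space) stability" where
  "tv_as P p q \<longleftrightarrow>
     (\<exists>A \<in> sets (PiM UNIV (\<lambda>_. borel)). measure P {\<omega> \<in> space P. obs_seq \<omega> \<in> A} = 1 \<and>
       (\<forall>y \<in> A. (\<lambda>n. tv_norm (p n y) (q n y)) \<longlonglongrightarrow> 0))"

definition entropy_exp ::
  "(nat \<Rightarrow> 'x \<times> 'y) measure \<Rightarrow> ('x, 'y) posterior \<Rightarrow> ('x, 'y) posterior \<Rightarrow> nat \<Rightarrow> ennreal" where
  "entropy_exp P p q n = (\<integral>\<^sup>+\<omega>. rel_entropy (p n (obs_seq \<omega>)) (q n (obs_seq \<omega>)) \<partial>P)"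

definition rel_entropy_stable :: "('x, 'y) stability" where
  "rel_entropy_stable P p q \<longleftrightarrow> entropy_exp P p q \<longlonglongrightarrow> 0"

definition universally_stable_wrt where
  "universally_stable_wrt S T Q e \<mu> \<nu> \<longleftrightarrow>
     (\<forall>\<gamma> \<in> policies. S (strategic T Q \<mu> \<gamma>) (e \<mu> \<gamma>) (e \<nu> \<gamma>))"

definition universally_stable where
  "universally_stable S T Q e \<mu> \<longleftrightarrow>
     (\<forall>\<nu> \<in> priors. absolutely_continuous \<nu> \<mu> \<longrightarrow> universally_stable_wrt S T Q e \<mu> \<nu>)"

end

theory Submission
  imports Defs
begin

text \<open>Fix a policy and priors with \<open>\<mu> = h \<nu>\<close>, and write \<open>R\<close> and \<open>P\<close> for the strategic measures of
\<open>\<nu>\<close> and \<open>\<mu>\<close>. Both are built from the same transition and observation kernels and differ only in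
the law of \<open>X\<^sub>0\<close>, so \<open>P\<close> has the density \<open>Z = h(X\<^sub>0)\<close> with respect to \<open>R\<close> (\<open>law_density\<close>). All
stability notions can then be read off from conditional expectations of the single variable \<open>Z\<close>.
Let \<open>F\<^sub>k\<close> be generated by \<open>Y\<^sub>0, \<dots>, Y\<^bsub>k-1\<^esub>\<close>, let \<open>G\<^sub>n\<close> be generated by all measurements and by the
states \<open>X\<^sub>i\<close> with \<open>i \<ge> n\<close>, and put \<open>L\<^sub>k = E\<^sub>R[Z | F\<^sub>k]\<close> and \<open>M\<^sub>n = E\<^sub>R[Z | G\<^sub>n]\<close>. The \<open>F\<^sub>k\<close> increase, the \<open>G\<^sub>n\<close>
decrease, and every \<open>F\<^sub>k\<close> is contained in every \<open>G\<^sub>n\<close>.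

Bayes' formula says that the filter of \<open>\<mu>\<close> has a density with respect to the filter of \<open>\<nu>\<close>, namely
the conditional expectation of \<open>Z\<close> given \<open>X\<^sub>n, Y\<^sub>0, \<dots>, Y\<^sub>n\<close> divided by \<open>L\<^bsub>n+1\<^esub>\<close>. By the Markov property
the numerator is \<open>M\<^sub>n\<close>, since the past states influence the future only through \<open>X\<^sub>n\<close> and the
measurements made so far. It is also the numerator for the predictor, because given \<open>X\<^sub>n\<close> the
measurement \<open>Y\<^sub>n\<close> carries no further information on \<open>X\<^sub>0\<close>. Hence (\<open>posterior_tv_gap\<close>,
\<open>posterior_entropy_gap\<close>) the expected total variation distance of the filters is
\<open>E\<^sub>R|M\<^sub>n - L\<^bsub>n+1\<^esub>|\<close>, that of the predictors is \<open>E\<^sub>R|M\<^sub>n - L\<^sub>n|\<close>, and the expected relative entropy of the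
filters is \<open>E\<^sub>R[L\<^bsub>n+1\<^esub> \<Phi>(M\<^sub>n / L\<^bsub>n+1\<^esub>)]\<close> with \<open>\<Phi>(t) = t ln t - t + 1\<close>.

The equivalences in total variation and entropy follow from properties of these martingales.
Filter and predictor: \<open>E\<^sub>R|L\<^bsub>n+1\<^esub> - L\<^sub>n|\<close> tends to \<open>0\<close>, because \<open>L\<close> is a uniformly integrable martingale
(\<open>cond_exp_L1_Cauchy\<close>). Expectation and almost sure convergence: the distances are bounded by \<open>2\<close>,
which gives one direction; for the other, \<open>|M\<^sub>n - L\<^bsub>n+1\<^esub>|\<close> is compared with \<open>|M\<^sub>m - L\<^bsub>m+1\<^esub>|\<close> for \<open>m \<le> n\<close> by
contraction of conditional expectations, which yields a maximal inequality of Doob's type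
(\<open>maximal_inequality\<close>). Relative entropy: an inequality of Pinsker's type shows that entropy
controls total variation; conversely, if the entropy is finite at one time, then the later densities
are conditional expectations of a density of finite entropy, so that their entropies are uniformly
integrable and the entropy gap is small as soon as the \<open>L\<^sup>1\<close> gap is (\<open>cond_entropy_gap_le\<close>).

For weak merging, let \<open>f\<close> be bounded and continuous, and let \<open>s\<close> be the sign of the difference of the two filter
integrals of \<open>f\<close>, a function of \<open>Y\<^sub>0, \<dots>, Y\<^sub>n\<close>. Averaging \<open>s\<close> over \<open>Y\<^sub>n\<close> turns the expected distance
of the filters into a difference of predictor integrals of two functions of \<open>X\<^sub>n\<close> whose predictor
integrals under \<open>\<nu>\<close> coincide. These functions depend on the past measurements, so weak merging does not apply to
them directly. But continuity of the channel in total variation makes them nearly constant on small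
balls whose size does not depend on the measurements, and a partition of unity \<open>\<phi>\<^sub>i\<close> subordinate to such balls
bounds the distance by \<open>\<Sum>\<^sub>i |\<integral> \<phi>\<^sub>i d\<pi>\<^sup>\<mu> - \<integral> \<phi>\<^sub>i d\<pi>\<^sup>\<nu>|\<close> for the predictors (\<open>filter_diff_le_predictor_part_diff\<close>).
Every bounded combination of the \<open>\<phi>\<^sub>i\<close> is continuous, so weak merging says that the sequences
inside this sum converge to \<open>0\<close> weakly in \<open>l\<^sup>1\<close>, and by Schur's theorem they converge in norm (\<open>schur_l1\<close>).\<close>

section \<open>Integrals over paths of a controlled process\<close>

text \<open>Elements of a product over \<open>J\<close> are functions that take a default value outside \<open>J\<close>, so each of them
is also an infinite path. This allows one product space of infinite paths to be used throughout,
with finite histories as truncated paths.\<close>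
lemma measurable_PiM_extend:
  fixes J :: "'i set"
  shows "(\<lambda>\<omega>. \<omega>) \<in> PiM J (\<lambda>_. borel :: 'a::topological_space measure) \<rightarrow>\<^sub>M PiM UNIV (\<lambda>_. borel)"
proof (rule measurable_PiM_single')
  fix i :: 'i
  show "(\<lambda>\<omega>. \<omega> i) \<in> PiM J (\<lambda>_. borel :: 'a measure) \<rightarrow>\<^sub>M borel"
  proof (cases "i \<in> J")
    case False
    then have "(\<lambda>\<omega>. \<omega> i) \<in> PiM J (\<lambda>_. borel :: 'a measure) \<rightarrow>\<^sub>M borel \<longleftrightarrow>
      (\<lambda>\<omega>. undefined) \<in> PiM J (\<lambda>_. borel :: 'a measure) \<rightarrow>\<^sub>M (borel :: 'a measure)"
      by (intro measurable_cong) (auto simp: space_PiM PiE_def extensional_def)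
    then show ?thesis by simp
  qed (auto intro: measurable_component_singleton)
qed auto

context Ionescu_Tulcea
begin

lemma nn_integral_lim:
  assumes [measurable]: "f \<in> borel_measurable (PiM {0..<n} M)"
  shows "(\<integral>\<^sup>+\<omega>. f (restrict \<omega> {0..<n}) \<partial>PF.lim) = (\<integral>\<^sup>+\<omega>. f \<omega> \<partial>C 0 n (\<lambda>_. undefined))"
proof -
  have u: "(\<lambda>_. undefined) \<in> space (PiM {0..<0} M)"
    by simp
  have "distr PF.lim (PiM {0..<n} M) (\<lambda>\<omega>. restrict \<omega> {0..<n}) = C 0 n (\<lambda>_. undefined)"
  proof (rule measure_eqI)
    show "sets (distr PF.lim (PiM {0..<n} M) (\<lambda>\<omega>. restrict \<omega> {0..<n})) = sets (C 0 n (\<lambda>_. undefined))"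
      using sets_C[OF u, of n] by simp
    fix A assume "A \<in> sets (distr PF.lim (PiM {0..<n} M) (\<lambda>\<omega>. restrict \<omega> {0..<n}))"
    then have A: "A \<in> sets (PiM {0..<n} M)" by simp
    then have "emeasure (distr PF.lim (PiM {0..<n} M) (\<lambda>\<omega>. restrict \<omega> {0..<n})) A
      = emeasure PF.lim (PF.emb UNIV {0..<n} A)"
      by (intro emeasure_distr_restrict) auto
    also have "\<dots> = emeasure (C 0 n (\<lambda>_. undefined)) A"
      using A u sets.sets_into_space[OF A] by (simp add: lim emeasure_CI[of _ n] prod_emb_id space_PiM)
    finally show "emeasure (distr PF.lim (PiM {0..<n} M) (\<lambda>\<omega>. restrict \<omega> {0..<n})) A
      = emeasure (C 0 n (\<lambda>_. undefined)) A" .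
  qed
  then have "(\<integral>\<^sup>+\<omega>. f \<omega> \<partial>C 0 n (\<lambda>_. undefined))
     = (\<integral>\<^sup>+\<omega>. f \<omega> \<partial>distr PF.lim (PiM {0..<n} M) (\<lambda>\<omega>. restrict \<omega> {0..<n}))" by simp
  also have "\<dots> = (\<integral>\<^sup>+\<omega>. f (restrict \<omega> {0..<n}) \<partial>PF.lim)"
    by (subst nn_integral_distr) (auto simp: measurable_cong_sets[OF PF.sets_lim refl] measurable_restrict_subset)
  finally show ?thesis by simp
qed

text \<open>The form of the Ionescu-Tulcea theorem that is used below: the expectation of a function of the
first \<open>n + 1\<close> coordinates is computed by integrating out the last one.\<close>
lemma nn_integral_lim_step:
  assumes f[measurable]: "f \<in> borel_measurable (PiM {0..<Suc n} M)"
  shows "(\<integral>\<^sup>+\<omega>. f (restrict \<omega> {0..<Suc n}) \<partial>PF.lim)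
    = (\<integral>\<^sup>+\<omega>. \<integral>\<^sup>+w. f ((restrict \<omega> {0..<n})(n := w)) \<partial>P n (restrict \<omega> {0..<n}) \<partial>PF.lim)"
proof -
  have u: "(\<lambda>_. undefined) \<in> space (PiM {0..<0} M)"
    by simp
  have m: "(\<lambda>\<omega>. \<integral>\<^sup>+w. f w \<partial>eP n \<omega>) \<in> borel_measurable (PiM {0..<n} M)"
    by measurable
  have "(\<integral>\<^sup>+\<omega>. f (restrict \<omega> {0..<Suc n}) \<partial>PF.lim) = (\<integral>\<^sup>+\<omega>. f \<omega> \<partial>C 0 (Suc n) (\<lambda>_. undefined))"
    by (rule nn_integral_lim[OF f])
  also have "\<dots> = (\<integral>\<^sup>+\<omega>. \<integral>\<^sup>+w. f w \<partial>eP n \<omega> \<partial>C 0 n (\<lambda>_. undefined))"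
    using u by (simp add: nn_integral_bind[where B="PiM {0..<Suc n} M"] space_C measurable_cong_sets[OF sets_C])
  also have "\<dots> = (\<integral>\<^sup>+\<omega>. (\<integral>\<^sup>+w. f w \<partial>eP n (restrict \<omega> {0..<n})) \<partial>PF.lim)"
    using nn_integral_lim[OF m] by simp
  also have "\<dots> = (\<integral>\<^sup>+\<omega>. \<integral>\<^sup>+w. f ((restrict \<omega> {0..<n})(n := w)) \<partial>P n (restrict \<omega> {0..<n}) \<partial>PF.lim)"
    by (intro nn_integral_cong nn_integral_eP) (auto simp: space_PiM)
  finally show ?thesis .
qed

end

lemma nn_integral_observed:
  fixes Q :: "'x::second_countable_topology \<Rightarrow> 'y::second_countable_topology measure"
  assumes Q[measurable]: "Q \<in> borel \<rightarrow>\<^sub>M prob_algebra borel" and \<rho>: "\<rho> \<in> priors"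
    and f[measurable]: "f \<in> borel_measurable borel"
  shows "(\<integral>\<^sup>+w. f w \<partial>observed Q \<rho>) = (\<integral>\<^sup>+x. \<integral>\<^sup>+v. f (x, v) \<partial>Q x \<partial>\<rho>)"
proof -
  have [measurable_cong]: "sets \<rho> = sets borel"
    using \<rho> by (simp add: space_prob_algebra)
  have ne: "space \<rho> \<noteq> {}"
    using \<rho> by (auto simp: space_prob_algebra prob_space.not_empty)
  have [measurable]: "f \<in> borel_measurable (borel \<Otimes>\<^sub>M borel)"
    using f by (simp add: borel_prod)
  have P: "Pair x \<in> borel \<rightarrow>\<^sub>M (borel :: ('x \<times> 'y) measure)" for x :: 'x
    unfolding borel_prod[symmetric] by simp
  have sQ: "sets (Q x) = sets borel" for x
    using measurable_space[OF Q, of x] by (simp add: space_prob_algebra)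
  have 1: "(\<lambda>x. distr (Q x) (borel :: ('x \<times> 'y) measure) (Pair x)) \<in> borel \<rightarrow>\<^sub>M subprob_algebra borel"
    unfolding borel_prod[symmetric] by (intro measurable_prob_algebraD) measurable
  have "(\<integral>\<^sup>+w. f w \<partial>observed Q \<rho>) = (\<integral>\<^sup>+x. \<integral>\<^sup>+w. f w \<partial>distr (Q x) borel (Pair x) \<partial>\<rho>)"
    unfolding observed_def using 1 ne
    by (intro nn_integral_bind[where B=borel]) (auto cong: measurable_cong_sets[OF \<open>sets \<rho> = sets borel\<close> refl])
  also have "\<dots> = (\<integral>\<^sup>+x. \<integral>\<^sup>+v. f (x, v) \<partial>Q x \<partial>\<rho>)"
    by (intro nn_integral_cong nn_integral_distr)
       (auto simp: P cong: measurable_cong_sets[OF sQ refl])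
  finally show ?thesis .
qed

abbreviation paths :: "(nat \<Rightarrow> 'a::topological_space) measure" where
  "paths \<equiv> PiM UNIV (\<lambda>_. borel)"

lemma measurable_fst_borel: "fst \<in> (borel :: ('x::second_countable_topology \<times> 'y::second_countable_topology) measure) \<rightarrow>\<^sub>M borel"
  and measurable_snd_borel: "snd \<in> (borel :: ('x \<times> 'y) measure) \<rightarrow>\<^sub>M borel"
  unfolding borel_prod[symmetric] by measurable

lemma measurable_Pair_borel:
  assumes "f \<in> M \<rightarrow>\<^sub>M (borel :: 'x::second_countable_topology measure)"
    "g \<in> M \<rightarrow>\<^sub>M (borel :: 'y::second_countable_topology measure)"
  shows "(\<lambda>w. (f w, g w)) \<in> M \<rightarrow>\<^sub>M borel"
  unfolding borel_prod[symmetric] using assms by measurable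

lemma measurable_upd_paths:
  assumes "f \<in> M \<rightarrow>\<^sub>M paths" "g \<in> M \<rightarrow>\<^sub>M borel"
  shows "(\<lambda>w. (f w)(n := g w)) \<in> M \<rightarrow>\<^sub>M paths"
  using assms by (intro measurable_fun_upd[where J="UNIV"]) auto

locale controlled_process =
  fixes T :: "'x::polish_space \<times> 'u::polish_space \<Rightarrow> 'x measure"
    and Q :: "'x \<Rightarrow> 'y::polish_space measure"
    and \<gamma> :: "('y, 'u) policy"
  assumes T: "T \<in> borel \<rightarrow>\<^sub>M prob_algebra borel"
    and Q: "Q \<in> borel \<rightarrow>\<^sub>M prob_algebra borel"
    and \<gamma>: "\<gamma> \<in> policies"
begin

abbreviation law :: "'x measure \<Rightarrow> (nat \<Rightarrow> 'x \<times> 'y) measure" where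
  "law \<mu> \<equiv> strategic T Q \<mu> \<gamma>"

abbreviation past :: "nat \<Rightarrow> (nat \<Rightarrow> 'x \<times> 'y) \<Rightarrow> (nat \<Rightarrow> 'x \<times> 'y)" where
  "past n \<omega> \<equiv> restrict \<omega> {0..<n}"

text \<open>The conditional law of \<open>X\<^sub>n\<close> given the path before time \<open>n\<close>; the step kernel is this law followed by
a measurement. Being defined on all paths, it is applied to \<open>\<omega>\<close> itself and needs no truncation.\<close>
definition state_kernel :: "'x measure \<Rightarrow> nat \<Rightarrow> (nat \<Rightarrow> 'x \<times> 'y) \<Rightarrow> 'x measure" where
  "state_kernel \<mu> n \<omega> =
     (case n of 0 \<Rightarrow> \<mu> | Suc k \<Rightarrow> T (fst (\<omega> k), action \<gamma> (obs_seq \<omega>) k))"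

lemma step_kernel_eq: "step_kernel T Q \<mu> \<gamma> n \<omega> = observed Q (state_kernel \<mu> n \<omega>)"
  by (cases n) (simp_all add: state_kernel_def)

lemma measurable_state[measurable]: "(\<lambda>\<omega>. fst (\<omega> n)) \<in> (paths :: (nat \<Rightarrow> 'x \<times> 'y) measure) \<rightarrow>\<^sub>M borel"
  by (rule measurable_compose[where f="\<lambda>\<omega>. \<omega> n", OF _ measurable_fst_borel]) simp

lemma measurable_obs[measurable]: "(\<lambda>\<omega>. snd (\<omega> n)) \<in> (paths :: (nat \<Rightarrow> 'x \<times> 'y) measure) \<rightarrow>\<^sub>M borel"
  by (rule measurable_compose[where f="\<lambda>\<omega>. \<omega> n", OF _ measurable_snd_borel]) simp

lemma measurable_obs_seq[measurable]: "(obs_seq :: (nat \<Rightarrow> 'x \<times> 'y) \<Rightarrow> nat \<Rightarrow> 'y) \<in> paths \<rightarrow>\<^sub>M paths"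
  unfolding obs_seq_def[abs_def] by (rule measurable_PiM_single') auto

lemma measurable_state_kernel:
  assumes \<mu>: "\<mu> \<in> priors"
  shows "state_kernel \<mu> n \<in> paths \<rightarrow>\<^sub>M prob_algebra borel"
proof (cases n)
  case (Suc k)
  have "(\<lambda>\<omega>. (fst (\<omega> k), action \<gamma> (obs_seq \<omega>) k)) \<in> paths \<rightarrow>\<^sub>M (borel :: ('x \<times> 'u) measure)"
    by (intro measurable_Pair_borel action_measurable[OF \<gamma>]) (auto simp: obs_seq_def)
  from measurable_compose[OF this T] show ?thesis
    by (simp add: Suc state_kernel_def[abs_def])
qed (simp add: state_kernel_def[abs_def] \<mu>)

lemma action_cong:
  "(\<And>i. i \<le> n \<Longrightarrow> y i = y' i) \<Longrightarrow> action \<gamma> y n = action \<gamma> y' n"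
proof (induction n rule: less_induct)
  case (less n)
  have "restrict y {..n} = restrict y' {..n}"
    using less.prems by (auto simp: restrict_def)
  moreover have "(\<lambda>i. if i < n then action \<gamma> y i else undefined) = (\<lambda>i. if i < n then action \<gamma> y' i else undefined)"
    using less by auto
  ultimately show ?case
    by (simp only: action.simps[of \<gamma> _ n])
qed

lemma state_kernel_cong:
  assumes "n > 0 \<Longrightarrow> fst (\<omega> (n - 1)) = fst (\<omega>' (n - 1))" "\<And>i. i < n \<Longrightarrow> snd (\<omega> i) = snd (\<omega>' i)"
  shows "state_kernel \<mu> n \<omega> = state_kernel \<mu> n \<omega>'"
proof (cases n)
  case (Suc k)
  then have "action \<gamma> (obs_seq \<omega>) k = action \<gamma> (obs_seq \<omega>') k"
    using assms(2) by (intro action_cong) (auto simp: obs_seq_def)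
  then show ?thesis
    using assms(1) Suc by (simp add: state_kernel_def)
qed (simp add: state_kernel_def)

lemma
  assumes \<mu>: "\<mu> \<in> priors"
  shows prob_space_law: "prob_space (law \<mu>)"
    and sets_law[measurable_cong]: "sets (law \<mu>) = sets paths"
    and space_law: "space (law \<mu>) = UNIV"
proof -
  interpret IT: Ionescu_Tulcea "step_kernel T Q \<mu> \<gamma>" "\<lambda>_. borel"
    by (rule Ionescu_Tulcea_step_kernel[OF T Q \<mu> \<gamma>])
  have u: "(\<lambda>_. undefined) \<in> space (PiM {0..<0::nat} (\<lambda>_. borel :: ('x \<times> 'y) measure))"
    by simp
  have "(\<integral>\<^sup>+\<omega>. 1 \<partial>law \<mu>) = (\<integral>\<^sup>+\<omega>. 1 \<partial>IT.C 0 0 (\<lambda>_. undefined))"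
    unfolding strategic_def by (rule IT.nn_integral_lim) simp
  also have "\<dots> = 1"
    using prob_space.emeasure_space_1[OF IT.prob_space_C[OF u]] by simp
  finally show "prob_space (law \<mu>)"
    by (intro prob_spaceI) simp
  show "sets (law \<mu>) = sets paths"
    by (simp add: strategic_def)
  then show "space (law \<mu>) = UNIV"
    by (auto dest: sets_eq_imp_space_eq simp: space_PiM)
qed

lemma state_kernel_prior:
  assumes "\<mu> \<in> priors"
  shows "state_kernel \<mu> n \<omega> \<in> priors"
  using measurable_space[OF measurable_state_kernel[OF assms], of \<omega>] by (simp add: space_PiM)

lemma measurable_nn_integral_state_kernel:
  assumes \<mu>: "\<mu> \<in> priors" and f: "(\<lambda>(\<omega>, x). f \<omega> x) \<in> borel_measurable (paths \<Otimes>\<^sub>M borel)"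
  shows "(\<lambda>\<omega>. \<integral>\<^sup>+x. f \<omega> x \<partial>state_kernel \<mu> n \<omega>) \<in> borel_measurable paths"
  by (rule nn_integral_measurable_subprob_algebra2[OF f measurable_prob_algebraD[OF measurable_state_kernel[OF \<mu>]]])

lemma measurable_nn_integral_channel:
  assumes g: "g \<in> M \<rightarrow>\<^sub>M borel" and f: "(\<lambda>(\<omega>, v). f \<omega> v) \<in> borel_measurable (M \<Otimes>\<^sub>M borel)"
  shows "(\<lambda>\<omega>. \<integral>\<^sup>+v. f \<omega> v \<partial>Q (g \<omega>)) \<in> borel_measurable M"
  by (rule nn_integral_measurable_subprob_algebra2[OF f measurable_prob_algebraD[OF measurable_compose[OF g Q]]])

text \<open>Functions of the first \<open>n + 1\<close> coordinates are described by invariance under truncation of the path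
rather than by their domain, which keeps all integrands on the same space.\<close>
lemma nn_integral_law_step:
  assumes \<mu>: "\<mu> \<in> priors" and f[measurable]: "f \<in> borel_measurable paths"
    and past: "\<And>\<omega>. f (past (Suc n) \<omega>) = f \<omega>"
  shows "(\<integral>\<^sup>+\<omega>. f \<omega> \<partial>law \<mu>)
    = (\<integral>\<^sup>+\<omega>. \<integral>\<^sup>+x. \<integral>\<^sup>+v. f (\<omega> (n := (x, v))) \<partial>Q x \<partial>state_kernel \<mu> n \<omega> \<partial>law \<mu>)"
proof -
  interpret IT: Ionescu_Tulcea "step_kernel T Q \<mu> \<gamma>" "\<lambda>_. borel"
    by (rule Ionescu_Tulcea_step_kernel[OF T Q \<mu> \<gamma>])
  have "f \<in> borel_measurable (PiM {0..<Suc n} (\<lambda>_. borel))"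
    by (rule measurable_compose[OF measurable_PiM_extend f])
  from IT.nn_integral_lim_step[OF this]
  have "(\<integral>\<^sup>+\<omega>. f \<omega> \<partial>law \<mu>) = (\<integral>\<^sup>+\<omega>. \<integral>\<^sup>+w. f ((past n \<omega>)(n := w)) \<partial>step_kernel T Q \<mu> \<gamma> n (past n \<omega>) \<partial>law \<mu>)"
    by (simp only: past strategic_def)
  also have "\<dots> = (\<integral>\<^sup>+\<omega>. \<integral>\<^sup>+x. \<integral>\<^sup>+v. f (\<omega> (n := (x, v))) \<partial>Q x \<partial>state_kernel \<mu> n \<omega> \<partial>law \<mu>)"
  proof (rule nn_integral_cong)
    fix \<omega>
    have 1: "f ((past n \<omega>)(n := w)) = f (\<omega> (n := w))" for w
      by (subst (1 2) past[symmetric]) (auto intro!: arg_cong[where f=f] simp: fun_eq_iff)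
    have 2: "state_kernel \<mu> n (past n \<omega>) = state_kernel \<mu> n \<omega>"
      by (rule state_kernel_cong) auto
    have "(\<lambda>w. f (\<omega> (n := w))) \<in> borel_measurable borel"
      by (rule measurable_compose[OF measurable_upd_paths f]) (auto simp: space_PiM)
    then show "(\<integral>\<^sup>+w. f ((past n \<omega>)(n := w)) \<partial>step_kernel T Q \<mu> \<gamma> n (past n \<omega>)) =
      (\<integral>\<^sup>+x. \<integral>\<^sup>+v. f (\<omega> (n := (x, v))) \<partial>Q x \<partial>state_kernel \<mu> n \<omega>)"
      unfolding 1 2 step_kernel_eq by (rule nn_integral_observed[OF Q state_kernel_prior[OF \<mu>]])
  qed
  finally show ?thesis .
qed

text \<open>Resampling the measurement \<open>Y\<^sub>n\<close> from the channel leaves the law unchanged: both sides reduce to the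
same integral over one step, as \<open>Q\<close> has total mass 1.\<close>
lemma nn_integral_law_channel:
  assumes \<mu>: "\<mu> \<in> priors" and f[measurable]: "f \<in> borel_measurable paths"
    and past: "\<And>\<omega>. f (past (Suc n) \<omega>) = f \<omega>"
  shows "(\<integral>\<^sup>+\<omega>. f \<omega> \<partial>law \<mu>) = (\<integral>\<^sup>+\<omega>. \<integral>\<^sup>+v. f (\<omega> (n := (fst (\<omega> n), v))) \<partial>Q (fst (\<omega> n)) \<partial>law \<mu>)"
proof -
  let ?g = "\<lambda>\<omega>. \<integral>\<^sup>+v. f (\<omega> (n := (fst (\<omega> n), v))) \<partial>Q (fst (\<omega> n))"
  have "(\<lambda>(\<omega>, v). \<omega> (n := (fst (\<omega> n), v))) \<in> paths \<Otimes>\<^sub>M borel \<rightarrow>\<^sub>M (paths :: (nat \<Rightarrow> 'x \<times> 'y) measure)"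
    unfolding split_beta by (intro measurable_upd_paths measurable_Pair_borel) measurable
  from measurable_compose[OF this f]
  have g: "?g \<in> borel_measurable paths"
    by (intro measurable_nn_integral_channel) (simp_all add: split_beta)
  have p: "?g (past (Suc n) \<omega>) = ?g \<omega>" for \<omega>
  proof -
    have "f ((past (Suc n) \<omega>)(n := w)) = f (\<omega> (n := w))" for w
      by (subst (1 2) past[symmetric]) (auto intro!: arg_cong[where f=f] simp: fun_eq_iff)
    then show ?thesis by simp
  qed
  have *: "prob_space (Q x)" for x
    using measurable_space[OF Q, of x] by (simp add: space_prob_algebra)
  show ?thesis
    unfolding nn_integral_law_step[OF \<mu> f past] nn_integral_law_step[OF \<mu> g p]
    by (simp add: prob_space.emeasure_space_1[OF *])
qed

end

section \<open>Measurability with respect to part of the coordinates\<close>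

text \<open>Forgetting a part of a path by overwriting it with default values is an idempotent map \<open>p\<close>. The sigma
field generated by \<open>p\<close> consists of the \<open>p\<close>-invariant measurable sets, and by the next lemma its
measurable functions are the \<open>p\<close>-invariant ones. Inclusions between such sigma fields
then follow from identities between the overwriting maps.\<close>
lemma sets_vimage_idempotent:
  assumes p: "p \<in> M \<rightarrow>\<^sub>M M" and sp: "space M = UNIV" and idem: "\<And>w. p (p w) = p w"
  shows "A \<in> sets (vimage_algebra UNIV p M) \<longleftrightarrow> A \<in> sets M \<and> p -` A = A"
proof
  assume "A \<in> sets (vimage_algebra UNIV p M)"
  then obtain B where B: "B \<in> sets M" "A = p -` B"
    by (auto simp: sets_vimage_algebra2 sp)
  then show "A \<in> sets M \<and> p -` A = A"
    using measurable_sets[OF p B(1)] by (auto simp: sp idem)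
next
  assume A: "A \<in> sets M \<and> p -` A = A"
  then show "A \<in> sets (vimage_algebra UNIV p M)"
    using in_vimage_algebra[of A M p UNIV] by simp
qed

lemma borel_measurable_vimage_idempotent:
  fixes f :: "'w \<Rightarrow> 'b::t1_space"
  assumes p: "p \<in> M \<rightarrow>\<^sub>M M" and sp: "space M = UNIV" and idem: "\<And>w. p (p w) = p w"
  shows "f \<in> borel_measurable (vimage_algebra UNIV p M) \<longleftrightarrow> f \<in> borel_measurable M \<and> (\<forall>w. f (p w) = f w)"
proof
  assume f: "f \<in> borel_measurable (vimage_algebra UNIV p M)"
  have "sets (vimage_algebra UNIV p M) \<subseteq> sets M"
    using sets_vimage_idempotent[OF p sp idem] by blast
  then have "f \<in> borel_measurable M"
    using f sp by (auto simp: measurable_def)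
  moreover have "f (p w) = f w" for w
  proof -
    have "f -` {f w} \<in> sets (vimage_algebra UNIV p M)"
      using measurable_sets[OF f, of "{f w}"] by simp
    then show ?thesis
      unfolding sets_vimage_idempotent[OF p sp idem] by auto
  qed
  ultimately show "f \<in> borel_measurable M \<and> (\<forall>w. f (p w) = f w)" by simp
next
  assume f: "f \<in> borel_measurable M \<and> (\<forall>w. f (p w) = f w)"
  have "(\<lambda>w. f (p w)) \<in> borel_measurable (vimage_algebra UNIV p M)"
    using f by (intro measurable_compose[OF measurable_vimage_algebra1]) (auto simp: sp)
  with f show "f \<in> borel_measurable (vimage_algebra UNIV p M)" by simp
qed

lemma space_obs_sigma[simp]: "space (obs_sigma J) = UNIV"
  by (simp add: obs_sigma_def)

lemma measurable_restrict_obs_sigma: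
  "(\<lambda>y. restrict y J) \<in> obs_sigma J \<rightarrow>\<^sub>M (paths :: (nat \<Rightarrow> 'y::topological_space) measure)"
  unfolding obs_sigma_def
  by (rule measurable_compose[OF measurable_vimage_algebra1 measurable_PiM_extend]) (auto simp: space_PiM)

lemma measurable_restrict_paths:
  "(\<lambda>y. restrict y J) \<in> paths \<rightarrow>\<^sub>M (paths :: (nat \<Rightarrow> 'y::topological_space) measure)"
  by (rule measurable_compose[OF measurable_restrict_subset measurable_PiM_extend]) simp

lemma measurable_ident_obs_sigma:
  "(\<lambda>y. y) \<in> paths \<rightarrow>\<^sub>M (obs_sigma J :: (nat \<Rightarrow> 'y::topological_space) measure)"
  unfolding obs_sigma_def
  by (rule measurable_vimage_algebra2) (auto intro: measurable_restrict_subset)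

lemma borel_measurable_obs_sigma:
  fixes f :: "(nat \<Rightarrow> 'y::topological_space) \<Rightarrow> 'b::t1_space"
  shows "f \<in> borel_measurable (obs_sigma J) \<longleftrightarrow> f \<in> borel_measurable paths \<and> (\<forall>y. f (restrict y J) = f y)"
proof -
  have "sets (obs_sigma J) = sets (vimage_algebra UNIV (\<lambda>y. restrict y J) (paths :: (nat \<Rightarrow> 'y) measure))"
  proof (intro equalityI)
    show "sets (vimage_algebra UNIV (\<lambda>y. restrict y J) (paths :: (nat \<Rightarrow> 'y) measure)) \<subseteq> sets (obs_sigma J)"
      by (rule sets_image_in_sets[OF _ measurable_restrict_obs_sigma]) simp
    show "sets (obs_sigma J) \<subseteq> sets (vimage_algebra UNIV (\<lambda>y. restrict y J) (paths :: (nat \<Rightarrow> 'y) measure))"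
      unfolding obs_sigma_def
    proof (rule sets_image_in_sets)
      have "(\<lambda>y. restrict (restrict y J) J) \<in> vimage_algebra UNIV (\<lambda>y. restrict y J) (paths :: (nat \<Rightarrow> 'y) measure) \<rightarrow>\<^sub>M PiM J (\<lambda>_. borel)"
        by (rule measurable_compose[OF measurable_vimage_algebra1 measurable_restrict_subset]) (auto simp: space_PiM)
      then show "(\<lambda>y. restrict y J) \<in> vimage_algebra UNIV (\<lambda>y. restrict y J) (paths :: (nat \<Rightarrow> 'y) measure) \<rightarrow>\<^sub>M PiM J (\<lambda>_. borel)"
        by simp
    qed simp
  qed
  then show ?thesis
    unfolding measurable_cong_sets[OF \<open>sets (obs_sigma J) = _\<close> refl]
    by (intro borel_measurable_vimage_idempotent[OF measurable_restrict_paths]) (auto simp: space_PiM)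
qed

lemma borel_measurable_pair_obs_sigma:
  fixes f :: "'x \<times> (nat \<Rightarrow> 'y::topological_space) \<Rightarrow> 'b::t1_space"
  shows "f \<in> borel_measurable (N \<Otimes>\<^sub>M obs_sigma J) \<longleftrightarrow>
    f \<in> borel_measurable (N \<Otimes>\<^sub>M paths) \<and> (\<forall>x\<in>space N. \<forall>y. f (x, restrict y J) = f (x, y))"
proof
  assume f: "f \<in> borel_measurable (N \<Otimes>\<^sub>M obs_sigma J)"
  have "(\<lambda>z. f (fst z, snd z)) \<in> borel_measurable (N \<Otimes>\<^sub>M paths)"
    by (intro measurable_compose[OF _ f] measurable_Pair measurable_fst
        measurable_compose[OF measurable_snd measurable_ident_obs_sigma])
  moreover have "(\<lambda>y. f (x, y)) \<in> borel_measurable (obs_sigma J)" if "x \<in> space N" for x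
    by (rule measurable_compose[OF _ f]) (use that in measurable)
  ultimately show "f \<in> borel_measurable (N \<Otimes>\<^sub>M paths) \<and> (\<forall>x\<in>space N. \<forall>y. f (x, restrict y J) = f (x, y))"
    by (auto simp: borel_measurable_obs_sigma)
next
  assume f: "f \<in> borel_measurable (N \<Otimes>\<^sub>M paths) \<and> (\<forall>x\<in>space N. \<forall>y. f (x, restrict y J) = f (x, y))"
  have "(\<lambda>z. f (fst z, restrict (snd z) J)) \<in> borel_measurable (N \<Otimes>\<^sub>M obs_sigma J)"
    using f by (intro measurable_compose[OF measurable_Pair[OF measurable_fst
        measurable_compose[OF measurable_snd measurable_restrict_obs_sigma]]]) auto
  then show "f \<in> borel_measurable (N \<Otimes>\<^sub>M obs_sigma J)"
    using f by (subst measurable_cong[where g="\<lambda>z. f (fst z, restrict (snd z) J)"]) (auto simp: space_pair_measure)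
qed

section \<open>The Markov property\<close>

text \<open>Paths on which the states before time \<open>n\<close>, or everything but the first \<open>k\<close> measurements, have been
forgotten. These maps generate the sigma fields \<open>G\<^sub>n\<close> and \<open>F\<^sub>k\<close>.\<close>
definition mask_states :: "nat \<Rightarrow> (nat \<Rightarrow> 'x \<times> 'y) \<Rightarrow> nat \<Rightarrow> 'x \<times> 'y" where
  "mask_states n \<omega> = (\<lambda>i. if i < n then (undefined, snd (\<omega> i)) else \<omega> i)"

definition obs_past :: "nat \<Rightarrow> (nat \<Rightarrow> 'x \<times> 'y) \<Rightarrow> nat \<Rightarrow> 'x \<times> 'y" where
  "obs_past k \<omega> = (\<lambda>i. (undefined, if i < k then snd (\<omega> i) else undefined))"

context controlled_process
begin

lemma measurable_mask_states[measurable]: "mask_states n \<in> paths \<rightarrow>\<^sub>M (paths :: (nat \<Rightarrow> 'x \<times> 'y) measure)"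
proof (rule measurable_PiM_single')
  show "(\<lambda>\<omega>. mask_states n \<omega> i) \<in> paths \<rightarrow>\<^sub>M (borel :: ('x \<times> 'y) measure)" for i
    unfolding mask_states_def
    by (cases "i < n") (auto intro!: measurable_Pair_borel)
qed (auto simp: space_PiM)

lemma measurable_obs_past[measurable]: "obs_past k \<in> paths \<rightarrow>\<^sub>M (paths :: (nat \<Rightarrow> 'x \<times> 'y) measure)"
proof (rule measurable_PiM_single')
  show "(\<lambda>\<omega>. obs_past k \<omega> i) \<in> paths \<rightarrow>\<^sub>M (borel :: ('x \<times> 'y) measure)" for i
    unfolding obs_past_def
    by (cases "i < k") (auto intro!: measurable_Pair_borel)
qed (auto simp: space_PiM)

text \<open>The conditional expectation of \<open>f\<close> given the path before time \<open>n\<close>, for \<open>f\<close> a function of the first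
\<open>n + 1\<close> coordinates.\<close>
definition step_exp :: "'x measure \<Rightarrow> nat \<Rightarrow> ((nat \<Rightarrow> 'x \<times> 'y) \<Rightarrow> ennreal) \<Rightarrow> (nat \<Rightarrow> 'x \<times> 'y) \<Rightarrow> ennreal" where
  "step_exp \<mu> n f \<omega> = (\<integral>\<^sup>+x. \<integral>\<^sup>+v. f (\<omega> (n := (x, v))) \<partial>Q x \<partial>state_kernel \<mu> n \<omega>)"

lemma sets_channel: "sets (Q x) = sets borel"
  using measurable_space[OF Q, of x] by (simp add: space_prob_algebra)

lemma measurable_step_exp_inner:
  assumes f: "f \<in> borel_measurable (paths :: (nat \<Rightarrow> 'x \<times> 'y) measure)"
  shows "(\<lambda>(\<omega>, x). \<integral>\<^sup>+v. f (\<omega> (n := (x, v))) \<partial>Q x) \<in> borel_measurable (paths \<Otimes>\<^sub>M borel)"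
proof -
  have "(\<lambda>z. f ((fst (fst z))(n := (snd (fst z), snd z)))) \<in> borel_measurable ((paths \<Otimes>\<^sub>M borel) \<Otimes>\<^sub>M borel)"
    by (rule measurable_compose[OF _ f]) (intro measurable_upd_paths measurable_Pair_borel; measurable)
  then show ?thesis
    unfolding split_beta by (intro measurable_nn_integral_channel) (simp_all add: split_beta)
qed

lemma measurable_step_exp:
  assumes \<mu>: "\<mu> \<in> priors" and f: "f \<in> borel_measurable paths"
  shows "step_exp \<mu> n f \<in> borel_measurable paths"
  unfolding step_exp_def[abs_def]
  by (rule measurable_nn_integral_state_kernel[OF \<mu> measurable_step_exp_inner[OF f]])

lemma step_exp_past:
  assumes "\<And>\<omega>. f (past (Suc n) \<omega>) = f \<omega>"
  shows "step_exp \<mu> n f (past n \<omega>) = step_exp \<mu> n f \<omega>"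
proof -
  have "f ((past n \<omega>)(n := w)) = f (\<omega> (n := w))" for w
    by (subst (1 2) assms[symmetric]) (auto intro!: arg_cong[where f=f] simp: fun_eq_iff)
  moreover have "state_kernel \<mu> n (past n \<omega>) = state_kernel \<mu> n \<omega>"
    by (rule state_kernel_cong) auto
  ultimately show ?thesis by (simp add: step_exp_def)
qed

lemma nn_integral_law_mult:
  assumes \<mu>: "\<mu> \<in> priors" and f[measurable]: "f \<in> borel_measurable paths"
    and past_f: "\<And>\<omega>. f (past (Suc n) \<omega>) = f \<omega>"
    and W[measurable]: "W \<in> borel_measurable paths" and past_W: "\<And>\<omega>. W (past n \<omega>) = W \<omega>"
  shows "(\<integral>\<^sup>+\<omega>. W \<omega> * f \<omega> \<partial>law \<mu>) = (\<integral>\<^sup>+\<omega>. W \<omega> * step_exp \<mu> n f \<omega> \<partial>law \<mu>)"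
proof -
  have W_upd: "W (\<omega> (n := w)) = W \<omega>" for \<omega> w
    by (subst (1 2) past_W[symmetric]) (auto intro!: arg_cong[where f=W] simp: fun_eq_iff)
  have p: "W (past (Suc n) \<omega>) = W \<omega>" for \<omega>
    by (subst (1 2) past_W[symmetric]) (auto intro!: arg_cong[where f=W] simp: fun_eq_iff)
  have "(\<integral>\<^sup>+\<omega>. W \<omega> * f \<omega> \<partial>law \<mu>) = (\<integral>\<^sup>+\<omega>. \<integral>\<^sup>+x. \<integral>\<^sup>+v. W \<omega> * f (\<omega> (n := (x, v))) \<partial>Q x \<partial>state_kernel \<mu> n \<omega> \<partial>law \<mu>)"
    by (subst nn_integral_law_step[OF \<mu>, of _ n]) (auto simp: past_f p W_upd)
  also have "\<dots> = (\<integral>\<^sup>+\<omega>. W \<omega> * step_exp \<mu> n f \<omega> \<partial>law \<mu>)"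
  proof (rule nn_integral_cong)
    fix \<omega>
    have sk: "sets (state_kernel \<mu> n \<omega>) = sets borel"
      using state_kernel_prior[OF \<mu>, of n \<omega>] by (simp add: space_prob_algebra)
    have "(\<lambda>x. \<integral>\<^sup>+v. f (\<omega> (n := (x, v))) \<partial>Q x) \<in> borel_measurable (state_kernel \<mu> n \<omega>)"
      using measurable_compose[OF measurable_Pair1'[of \<omega> paths] measurable_step_exp_inner[OF f, of n]]
      by (simp add: space_PiM measurable_cong_sets[OF sk refl])
    moreover have "(\<lambda>v. f (\<omega> (n := (x, v)))) \<in> borel_measurable (Q x)" for x
      unfolding measurable_cong_sets[OF sets_channel refl]
      by (rule measurable_compose[OF measurable_upd_paths f]) (auto simp: space_PiM intro!: measurable_Pair_borel)
    ultimately show "(\<integral>\<^sup>+x. \<integral>\<^sup>+v. W \<omega> * f (\<omega> (n := (x, v))) \<partial>Q x \<partial>state_kernel \<mu> n \<omega>) = W \<omega> * step_exp \<mu> n f \<omega>"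
      by (simp add: nn_integral_cmult step_exp_def)
  qed
  finally show ?thesis .
qed

text \<open>The prior enters the construction of the strategic measure only through the law of \<open>X\<^sub>0\<close>. For
functions of finitely many coordinates, later steps are integrated out one at a time by kernels
that are the same for both priors, until only the initial step remains; a path measure is determined
by such functions.\<close>
theorem law_density:
  assumes \<nu>: "\<nu> \<in> priors" and h[measurable]: "h \<in> borel_measurable borel" and \<mu>: "density \<nu> h \<in> priors"
  shows "law (density \<nu> h) = density (law \<nu>) (\<lambda>\<omega>. h (fst (\<omega> 0)))"
proof -
  have s\<nu>[measurable_cong, simp]: "sets \<nu> = sets borel"
    using \<nu> by (simp add: space_prob_algebra)
  let ?Z = "\<lambda>\<omega>. h (fst (\<omega> 0)) :: ennreal"
  let ?\<mu> = "density \<nu> h"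
  have eq: "(\<integral>\<^sup>+\<omega>. f \<omega> \<partial>law ?\<mu>) = (\<integral>\<^sup>+\<omega>. ?Z \<omega> * f \<omega> \<partial>law \<nu>)"
    if "f \<in> borel_measurable paths" "\<And>\<omega>. f (past (Suc n) \<omega>) = f \<omega>" for f n
    using that
  proof (induction n arbitrary: f)
    case (0 f)
    note [measurable] = 0(1)
    have f: "f (\<omega> (0 := w)) = f (\<lambda>_. w)" for \<omega> w
      by (subst (1 2) 0(2)[symmetric]) (auto intro!: arg_cong[where f=f] simp: fun_eq_iff)
    have [measurable]: "(\<lambda>(x, v). f (\<lambda>_. (x, v))) \<in> borel_measurable (borel \<Otimes>\<^sub>M borel)"
      unfolding split_beta
      by (rule measurable_compose[OF _ 0(1)], rule measurable_PiM_single') (auto simp: borel_prod)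
    have sQ[measurable_cong]: "sets (Q x) = sets borel" for x
      using measurable_space[OF Q, of x] by (simp add: space_prob_algebra)
    have [measurable]: "(\<lambda>x. \<integral>\<^sup>+v. f (\<lambda>_. (x, v)) \<partial>Q x) \<in> borel_measurable borel"
      by (intro measurable_nn_integral_channel) (measurable)
    have Zf: "(\<lambda>\<omega>. ?Z \<omega> * f \<omega>) \<in> borel_measurable paths"
      by measurable
    have Zp: "?Z (past (Suc 0) \<omega>) * f (past (Suc 0) \<omega>) = ?Z \<omega> * f \<omega>" for \<omega>
      by (subst 0(2)) simp
    have e1: "emeasure (law ?\<mu>) UNIV = 1" "emeasure (law \<nu>) UNIV = 1"
      using prob_space.emeasure_space_1[OF prob_space_law[OF \<mu>]] prob_space.emeasure_space_1[OF prob_space_law[OF \<nu>]]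
      by (simp_all add: space_law \<mu> \<nu>)
    have "(\<integral>\<^sup>+\<omega>. f \<omega> \<partial>law ?\<mu>) = (\<integral>\<^sup>+x. \<integral>\<^sup>+v. f (\<lambda>_. (x, v)) \<partial>Q x \<partial>?\<mu>)"
      by (subst nn_integral_law_step[OF \<mu> 0]) (simp add: f state_kernel_def e1 space_law \<mu>)
    also have "\<dots> = (\<integral>\<^sup>+x. h x * (\<integral>\<^sup>+v. f (\<lambda>_. (x, v)) \<partial>Q x) \<partial>\<nu>)"
      by (simp add: nn_integral_density)
    also have "\<dots> = (\<integral>\<^sup>+x. (\<integral>\<^sup>+v. h x * f (\<lambda>_. (x, v)) \<partial>Q x) \<partial>\<nu>)"
      by (intro nn_integral_cong nn_integral_cmult[symmetric]) measurable
    also have "\<dots> = (\<integral>\<^sup>+\<omega>. ?Z \<omega> * f \<omega> \<partial>law \<nu>)"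
      by (subst nn_integral_law_step[OF \<nu> Zf Zp]) (simp add: f state_kernel_def e1 space_law \<nu>)
    finally show ?case .
  next
    case (Suc n f)
    note [measurable] = Suc.prems(1)
    \<comment> \<open>From time 1 on, the kernels are the same for all priors.\<close>
    have k: "step_exp ?\<mu> (Suc n) f = step_exp \<nu> (Suc n) f"
      by (rule ext) (simp add: step_exp_def state_kernel_def)
    have p: "step_exp \<nu> (Suc n) f (past (Suc n) \<omega>) = step_exp \<nu> (Suc n) f \<omega>" for \<omega>
      using Suc.prems(2) by (rule step_exp_past)
    have "(\<integral>\<^sup>+\<omega>. f \<omega> \<partial>law ?\<mu>) = (\<integral>\<^sup>+\<omega>. step_exp \<nu> (Suc n) f \<omega> \<partial>law ?\<mu>)"
      using nn_integral_law_mult[OF \<mu> Suc.prems, of "\<lambda>_. 1"] by (simp add: k)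
    also have "\<dots> = (\<integral>\<^sup>+\<omega>. ?Z \<omega> * step_exp \<nu> (Suc n) f \<omega> \<partial>law \<nu>)"
      by (rule Suc.IH[OF measurable_step_exp[OF \<nu> Suc.prems(1)] p])
    also have "\<dots> = (\<integral>\<^sup>+\<omega>. ?Z \<omega> * f \<omega> \<partial>law \<nu>)"
      by (rule nn_integral_law_mult[OF \<nu> Suc.prems, symmetric]) auto
    finally show ?case .
  qed
  show ?thesis
  proof (rule measure_eqI_PiM_infinite)
    show "sets (law ?\<mu>) = sets paths" "sets (density (law \<nu>) ?Z) = sets paths"
      using sets_law[OF \<mu>] sets_law[OF \<nu>] by auto
    show "finite_measure (law ?\<mu>)"
      using prob_space_law[OF \<mu>] by (simp add: prob_space_def)
    fix A :: "nat \<Rightarrow> ('x \<times> 'y) set" and J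
    assume J: "finite J" and A: "\<And>i. i \<in> J \<Longrightarrow> A i \<in> sets borel"
    obtain n where n: "\<And>i. i \<in> J \<Longrightarrow> i < Suc n"
      using finite_nat_bounded[OF J] by (metis less_SucI lessThan_iff subsetD)
    let ?E = "prod_emb UNIV (\<lambda>_. borel) J (Pi\<^sub>E J A) :: (nat \<Rightarrow> 'x \<times> 'y) set"
    have E: "?E \<in> sets paths"
      using A J by (intro sets_PiM_I) auto
    have "indicator ?E (past (Suc n) \<omega>) = (indicator ?E \<omega> :: ennreal)" for \<omega>
      using n by (auto simp: indicator_def prod_emb_def space_PiM PiE_iff)
    from eq[OF borel_measurable_indicator[OF E] this]
    have "(\<integral>\<^sup>+\<omega>. indicator ?E \<omega> \<partial>law ?\<mu>) = (\<integral>\<^sup>+\<omega>. ?Z \<omega> * indicator ?E \<omega> \<partial>law \<nu>)" .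
    then show "emeasure (law ?\<mu>) ?E = emeasure (density (law \<nu>) ?Z) ?E"
      using E by (simp add: emeasure_density sets_law \<mu> \<nu> measurable_cong_sets[OF sets_law[OF \<nu>] refl])
  qed
qed

lemma measurable_state_obs[measurable]:
  "(\<lambda>\<omega>. (fst (\<omega> n), obs_seq \<omega>)) \<in> (paths :: (nat \<Rightarrow> 'x \<times> 'y) measure) \<rightarrow>\<^sub>M borel \<Otimes>\<^sub>M obs_sigma J"
  by (intro measurable_Pair measurable_compose[OF measurable_obs_seq measurable_ident_obs_sigma]) measurable

lemma measurable_obs_law:
  assumes "\<rho> \<in> priors"
  shows "obs_seq \<in> law \<rho> \<rightarrow>\<^sub>M obs_sigma J"
  unfolding measurable_cong_sets[OF sets_law[OF assms] refl]
  by (rule measurable_compose[OF measurable_obs_seq measurable_ident_obs_sigma])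

lemma measurable_state_law:
  assumes "\<rho> \<in> priors"
  shows "(\<lambda>\<omega>. fst (\<omega> n)) \<in> law \<rho> \<rightarrow>\<^sub>M borel"
  unfolding measurable_cong_sets[OF sets_law[OF assms] refl] by (rule measurable_state)

lemma state_obs_past:
  fixes \<phi> :: "'x \<times> (nat \<Rightarrow> 'y) \<Rightarrow> 'b::t1_space"
  assumes "\<phi> \<in> borel_measurable (borel \<Otimes>\<^sub>M obs_sigma {..<k})" "n < N" "k \<le> N"
  shows "\<phi> (fst (past N \<omega> n), obs_seq (past N \<omega>)) = \<phi> (fst (\<omega> n), obs_seq \<omega>)"
proof -
  have eq: "\<phi> (x, y) = \<phi> (x, restrict y {..<k})" for x y
    using assms(1) by (simp add: borel_measurable_pair_obs_sigma)
  have "restrict (obs_seq (past N \<omega>)) {..<k} = restrict (obs_seq \<omega>) {..<k}"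
    using assms(3) by (auto simp: obs_seq_def fun_eq_iff restrict_def)
  then show ?thesis
    using assms(2) by (subst (1 2) eq) simp
qed

text \<open>The conditional expectation, given the path up to time \<open>n\<close>, of a function that does not depend on the states before
time \<open>n\<close> is a function \<open>\<phi>\<close> of \<open>X\<^sub>n\<close> and the measurements up to time \<open>n\<close>: integrating
out the last coordinate preserves the invariance under changes of the earlier states, because the kernel at time
\<open>n + k + 1\<close> depends on the path through the last state and the measurements only.\<close>
lemma future_reduces_to_state:
  assumes \<nu>: "\<nu> \<in> priors" and "f \<in> borel_measurable paths"
    and "\<And>\<omega>. f (past (Suc n + k) \<omega>) = f \<omega>" and "\<And>\<omega>. f (mask_states n \<omega>) = f \<omega>"
  shows "\<exists>\<phi>\<in>borel_measurable (borel \<Otimes>\<^sub>M obs_sigma {..<Suc n}).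
    \<forall>W\<in>borel_measurable paths. (\<forall>\<omega>. W (past (Suc n) \<omega>) = W \<omega>) \<longrightarrow>
      (\<integral>\<^sup>+\<omega>. W \<omega> * f \<omega> \<partial>law \<nu>) = (\<integral>\<^sup>+\<omega>. W \<omega> * \<phi> (fst (\<omega> n), obs_seq \<omega>) \<partial>law \<nu>)"
  using assms(2-)
proof (induction k arbitrary: f)
  case (0 f)
  note [measurable] = 0(1)
  \<comment> \<open>Rebuilds from \<open>X\<^sub>n\<close> and the measurements a path that \<open>f\<close> cannot distinguish from the original one.\<close>
  let ?e = "\<lambda>(x, y) i. if i < n then (undefined, y i) else if i = n then (x, y n) else undefined"
  have e: "?e \<in> borel \<Otimes>\<^sub>M paths \<rightarrow>\<^sub>M (paths :: (nat \<Rightarrow> 'x \<times> 'y) measure)"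
  proof (rule measurable_PiM_single')
    fix i
    have "(\<lambda>z. snd z i) \<in> (borel :: 'x measure) \<Otimes>\<^sub>M (paths :: (nat \<Rightarrow> 'y) measure) \<rightarrow>\<^sub>M borel" for i
      by measurable
    then show "(\<lambda>z. ?e z i) \<in> (borel :: 'x measure) \<Otimes>\<^sub>M (paths :: (nat \<Rightarrow> 'y) measure) \<rightarrow>\<^sub>M (borel :: ('x \<times> 'y) measure)"
      unfolding split_beta
      by (cases i n rule: linorder_cases) (auto intro!: measurable_Pair_borel)
  qed (auto simp: space_PiM)
  define \<phi> where "\<phi> z = f (?e z)" for z
  have "\<phi> \<in> borel_measurable (borel \<Otimes>\<^sub>M paths)"
    unfolding \<phi>_def by (rule measurable_compose[OF e 0(1)])
  moreover have "\<phi> (x, restrict y {..<Suc n}) = \<phi> (x, y)" for x y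
    unfolding \<phi>_def by (auto intro!: arg_cong[where f=f])
  ultimately have m: "\<phi> \<in> borel_measurable (borel \<Otimes>\<^sub>M obs_sigma {..<Suc n})"
    by (simp add: borel_measurable_pair_obs_sigma)
  have "f \<omega> = \<phi> (fst (\<omega> n), obs_seq \<omega>)" for \<omega>
  proof -
    have "f \<omega> = f (past (Suc n) (mask_states n \<omega>))"
      using 0(2)[of "mask_states n \<omega>"] 0(3)[of \<omega>] by (simp only: add_0_right)
    also have "past (Suc n) (mask_states n \<omega>) = ?e (fst (\<omega> n), obs_seq \<omega>)"
      by (auto simp: fun_eq_iff mask_states_def obs_seq_def restrict_def)
    finally show ?thesis by (simp add: \<phi>_def)
  qed
  with m show ?case by (intro bexI[of _ \<phi>]) simp_all
next
  case (Suc k f)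
  let ?N = "Suc n + k"
  have p: "f (past (Suc ?N) \<omega>) = f \<omega>" for \<omega>
    using Suc.prems(2)[of \<omega>] by (simp only: add_Suc_right)
  have mk: "step_exp \<nu> ?N f (mask_states n \<omega>) = step_exp \<nu> ?N f \<omega>" for \<omega>
  proof -
    have "f ((mask_states n \<omega>)(?N := w)) = f (\<omega> (?N := w))" for w
    proof -
      have "(mask_states n \<omega>)(?N := w) = mask_states n (\<omega> (?N := w))"
        by (auto simp: mask_states_def fun_eq_iff)
      then show ?thesis by (simp only: Suc.prems(3))
    qed
    moreover have "state_kernel \<nu> ?N (mask_states n \<omega>) = state_kernel \<nu> ?N \<omega>"
      by (rule state_kernel_cong) (auto simp: mask_states_def)
    ultimately show ?thesis by (simp add: step_exp_def)
  qed
  obtain \<phi> where \<phi>: "\<phi> \<in> borel_measurable (borel \<Otimes>\<^sub>M obs_sigma {..<Suc n})"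
    "\<forall>W\<in>borel_measurable paths. (\<forall>\<omega>. W (past (Suc n) \<omega>) = W \<omega>) \<longrightarrow>
      (\<integral>\<^sup>+\<omega>. W \<omega> * step_exp \<nu> ?N f \<omega> \<partial>law \<nu>) = (\<integral>\<^sup>+\<omega>. W \<omega> * \<phi> (fst (\<omega> n), obs_seq \<omega>) \<partial>law \<nu>)"
    using Suc.IH[OF measurable_step_exp[OF \<nu> Suc.prems(1)] step_exp_past[where f=f, OF p] mk] by blast
  show ?case
  proof (intro bexI[OF _ \<phi>(1)] ballI impI)
    fix W :: "(nat \<Rightarrow> 'x \<times> 'y) \<Rightarrow> ennreal" assume W: "W \<in> borel_measurable (paths :: (nat \<Rightarrow> 'x \<times> 'y) measure)" "\<forall>\<omega>. W (past (Suc n) \<omega>) = W \<omega>"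
    have pW: "W (past ?N \<omega>) = W \<omega>" for \<omega>
    proof -
      have "past (Suc n) (past ?N \<omega>) = past (Suc n) \<omega>"
        by (auto simp: fun_eq_iff restrict_def)
      then show ?thesis using W(2) by metis
    qed
    show "(\<integral>\<^sup>+\<omega>. W \<omega> * f \<omega> \<partial>law \<nu>) = (\<integral>\<^sup>+\<omega>. W \<omega> * \<phi> (fst (\<omega> n), obs_seq \<omega>) \<partial>law \<nu>)"
      using nn_integral_law_mult[OF \<nu> Suc.prems(1) p, where W=W, OF W(1) pW] \<phi>(2) W by simp
  qed
qed

text \<open>To identify a conditional expectation given \<open>G\<^sub>n\<close> of a variable \<open>W\<close> that depends on the path up to
time \<open>n\<close>, it suffices to test against functions of \<open>X\<^sub>n\<close> and \<open>Y\<^sub>0, \<dots>, Y\<^sub>n\<close>. Indeed, events in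
\<open>G\<^sub>n\<close> that involve finitely many coordinates reduce to such functions, and they generate \<open>G\<^sub>n\<close>.\<close>
theorem markov_property:
  assumes \<nu>: "\<nu> \<in> priors"
    and W[measurable]: "W \<in> borel_measurable paths" "V \<in> borel_measurable paths"
    and past_W: "\<And>\<omega>. W (past (Suc n) \<omega>) = W \<omega>" "\<And>\<omega>. V (past (Suc n) \<omega>) = V \<omega>"
    and fin: "(\<integral>\<^sup>+\<omega>. W \<omega> \<partial>law \<nu>) < \<infinity>"
    and eq: "\<And>\<phi>. \<phi> \<in> borel_measurable (borel \<Otimes>\<^sub>M obs_sigma {..<Suc n}) \<Longrightarrow>
      (\<integral>\<^sup>+\<omega>. W \<omega> * \<phi> (fst (\<omega> n), obs_seq \<omega>) \<partial>law \<nu>) = (\<integral>\<^sup>+\<omega>. V \<omega> * \<phi> (fst (\<omega> n), obs_seq \<omega>) \<partial>law \<nu>)"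
    and A: "A \<in> sets (vimage_algebra UNIV (mask_states n) paths)"
  shows "(\<integral>\<^sup>+\<omega>. W \<omega> * indicator A \<omega> \<partial>law \<nu>) = (\<integral>\<^sup>+\<omega>. V \<omega> * indicator A \<omega> \<partial>law \<nu>)"
proof -
  have idem: "mask_states n (mask_states n \<omega>) = mask_states n \<omega>" for \<omega> :: "nat \<Rightarrow> 'x \<times> 'y"
    by (auto simp: mask_states_def fun_eq_iff)
  have A: "A \<in> sets paths" "mask_states n -` A = A"
    using A sets_vimage_idempotent[OF measurable_mask_states _ idem] by (auto simp: space_PiM)
  note [measurable_cong] = sets_law[OF \<nu>]
  \<comment> \<open>Two finite measures on paths that agree on finite-dimensional cylinders are equal.\<close>
  have "distr (density (law \<nu>) W) paths (mask_states n) = distr (density (law \<nu>) V) paths (mask_states n)"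
  proof (rule measure_eqI_PiM_infinite)
    show "finite_measure (distr (density (law \<nu>) W) paths (mask_states n))"
    proof
      have "mask_states n -` space paths \<inter> space (law \<nu>) = space (law \<nu>)"
        by (auto simp: space_PiM)
      then show "emeasure (distr (density (law \<nu>) W) paths (mask_states n)) (space (distr (density (law \<nu>) W) paths (mask_states n))) \<noteq> \<infinity>"
        using fin by (simp add: emeasure_distr emeasure_density less_top[symmetric])
    qed
    fix E :: "nat \<Rightarrow> ('x \<times> 'y) set" and J
    assume J: "finite J" and E: "\<And>i. i \<in> J \<Longrightarrow> E i \<in> sets borel"
    obtain k where k: "\<And>i. i \<in> J \<Longrightarrow> i < k"
      using finite_nat_bounded[OF J] by (metis lessThan_iff subsetD)
    let ?E = "prod_emb UNIV (\<lambda>_. borel) J (Pi\<^sub>E J E) :: (nat \<Rightarrow> 'x \<times> 'y) set"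
    have E'[measurable]: "?E \<in> sets paths"
      using E J by (intro sets_PiM_I) auto
    let ?f = "\<lambda>\<omega>. indicator ?E (mask_states n \<omega>) :: ennreal"
    have f: "?f \<in> borel_measurable paths"
      by measurable
    have "?f (past (Suc n + k) \<omega>) = ?f \<omega>" for \<omega>
    proof -
      have "mask_states n (past (Suc n + k) \<omega>) i = mask_states n \<omega> i" if "i \<in> J" for i
        using k[OF that] by (auto simp: mask_states_def)
      then show ?thesis
        by (auto simp: indicator_def prod_emb_iff PiE_iff)
    qed
    moreover have "?f (mask_states n \<omega>) = ?f \<omega>" for \<omega>
      by (simp add: idem)
    ultimately obtain \<phi> where \<phi>: "\<phi> \<in> borel_measurable (borel \<Otimes>\<^sub>M obs_sigma {..<Suc n})"
      "\<forall>W\<in>borel_measurable paths. (\<forall>\<omega>. W (past (Suc n) \<omega>) = W \<omega>) \<longrightarrow>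
        (\<integral>\<^sup>+\<omega>. W \<omega> * ?f \<omega> \<partial>law \<nu>) = (\<integral>\<^sup>+\<omega>. W \<omega> * \<phi> (fst (\<omega> n), obs_seq \<omega>) \<partial>law \<nu>)"
      using future_reduces_to_state[OF \<nu> f] by blast
    have "(\<integral>\<^sup>+\<omega>. W \<omega> * ?f \<omega> \<partial>law \<nu>) = (\<integral>\<^sup>+\<omega>. V \<omega> * ?f \<omega> \<partial>law \<nu>)"
      using \<phi> W past_W eq by simp
    moreover have "emeasure (distr (density (law \<nu>) U) paths (mask_states n)) ?E = (\<integral>\<^sup>+\<omega>. U \<omega> * ?f \<omega> \<partial>law \<nu>)"
      if [measurable]: "U \<in> borel_measurable paths" for U
    proof -
      have "emeasure (distr (density (law \<nu>) U) paths (mask_states n)) ?E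
        = emeasure (density (law \<nu>) U) (mask_states n -` ?E \<inter> space (law \<nu>))"
        by (simp add: emeasure_distr)
      also have "\<dots> = (\<integral>\<^sup>+\<omega>. U \<omega> * indicator (mask_states n -` ?E \<inter> space (law \<nu>)) \<omega> \<partial>law \<nu>)"
        by (intro emeasure_density) measurable
      also have "\<dots> = (\<integral>\<^sup>+\<omega>. U \<omega> * ?f \<omega> \<partial>law \<nu>)"
        by (intro nn_integral_cong) (auto simp: indicator_def)
      finally show ?thesis .
    qed
    ultimately show "emeasure (distr (density (law \<nu>) W) paths (mask_states n)) ?E = emeasure (distr (density (law \<nu>) V) paths (mask_states n)) ?E"
      using W by simp
  qed simp_all
  then have eq: "emeasure (distr (density (law \<nu>) W) paths (mask_states n)) A = emeasure (distr (density (law \<nu>) V) paths (mask_states n)) A"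
    by simp
  have "emeasure (distr (density (law \<nu>) U) paths (mask_states n)) A = (\<integral>\<^sup>+\<omega>. U \<omega> * indicator A \<omega> \<partial>law \<nu>)"
    if [measurable]: "U \<in> borel_measurable paths" for U
    using A by (simp add: emeasure_distr emeasure_density space_law \<nu>)
  with eq W show ?thesis by simp
qed

text \<open>Given \<open>X\<^sub>n\<close>, the measurement \<open>Y\<^sub>n\<close> is independent of every \<open>W\<close> that does not involve it, so it can be
averaged over the channel. For \<open>W = Z\<close> this is why a density known before the measurement \<open>Y\<^sub>n\<close> is still
valid after it.\<close>
lemma nn_integral_law_channel_mult:
  assumes \<nu>: "\<nu> \<in> priors" and \<phi>: "\<phi> \<in> borel_measurable (borel \<Otimes>\<^sub>M obs_sigma {..<Suc n})"
  defines "\<phi>' \<equiv> (\<lambda>(x, y). \<integral>\<^sup>+v. \<phi> (x, y(n := v)) \<partial>Q x)"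
  shows "\<phi>' \<in> borel_measurable (borel \<Otimes>\<^sub>M obs_sigma {..<n})"
    and "\<And>W. W \<in> borel_measurable paths \<Longrightarrow> (\<And>\<omega>. W (past (Suc n) \<omega>) = W \<omega>) \<Longrightarrow>
      (\<And>\<omega> v. W (\<omega> (n := (fst (\<omega> n), v))) = W \<omega>) \<Longrightarrow>
      (\<integral>\<^sup>+\<omega>. W \<omega> * \<phi> (fst (\<omega> n), obs_seq \<omega>) \<partial>law \<nu>) = (\<integral>\<^sup>+\<omega>. W \<omega> * \<phi>' (fst (\<omega> n), obs_seq \<omega>) \<partial>law \<nu>)"
proof -
  have \<phi>m: "\<phi> \<in> borel_measurable (borel \<Otimes>\<^sub>M paths)" and \<phi>r: "\<And>x y. \<phi> (x, restrict y {..<Suc n}) = \<phi> (x, y)"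
    using \<phi> by (simp_all add: borel_measurable_pair_obs_sigma)
  have upd: "(\<lambda>z. (fst (fst z), (snd (fst z))(n := snd z))) \<in> (borel \<Otimes>\<^sub>M paths) \<Otimes>\<^sub>M borel \<rightarrow>\<^sub>M (borel :: 'x measure) \<Otimes>\<^sub>M (paths :: (nat \<Rightarrow> 'y) measure)"
    by (intro measurable_Pair measurable_upd_paths) measurable
  have "\<phi>' \<in> borel_measurable (borel \<Otimes>\<^sub>M paths)"
    unfolding \<phi>'_def split_beta
    using measurable_compose[OF upd \<phi>m] by (intro measurable_nn_integral_channel) (simp_all add: split_beta)
  moreover have "\<phi>' (x, restrict y {..<n}) = \<phi>' (x, y)" for x y
  proof -
    have "\<phi> (x, (restrict y {..<n})(n := v)) = \<phi> (x, y(n := v))" for v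
    proof -
      have "restrict ((restrict y {..<n})(n := v)) {..<Suc n} = restrict (y(n := v)) {..<Suc n}"
        by (auto simp: fun_eq_iff)
      then show ?thesis by (metis \<phi>r)
    qed
    then show ?thesis by (simp add: \<phi>'_def)
  qed
  ultimately show "\<phi>' \<in> borel_measurable (borel \<Otimes>\<^sub>M obs_sigma {..<n})"
    by (simp add: borel_measurable_pair_obs_sigma)
  fix W :: "(nat \<Rightarrow> 'x \<times> 'y) \<Rightarrow> ennreal" assume W[measurable]: "W \<in> borel_measurable paths"
    and W_past: "\<And>\<omega>. W (past (Suc n) \<omega>) = W \<omega>"
    and W_upd: "\<And>\<omega> v. W (\<omega> (n := (fst (\<omega> n), v))) = W \<omega>"
  have obs_upd: "obs_seq (\<omega> (n := (x, v))) = (obs_seq \<omega>)(n := v)" for \<omega> :: "nat \<Rightarrow> 'x \<times> 'y" and x v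
    by (auto simp: obs_seq_def fun_eq_iff)
  have [measurable]: "(\<lambda>\<omega>. \<phi> (fst (\<omega> n), obs_seq \<omega>)) \<in> borel_measurable (paths :: (nat \<Rightarrow> 'x \<times> 'y) measure)"
    by (rule measurable_compose[OF measurable_state_obs \<phi>])
  have Wp: "W (past (Suc n) \<omega>) * \<phi> (fst (past (Suc n) \<omega> n), obs_seq (past (Suc n) \<omega>)) = W \<omega> * \<phi> (fst (\<omega> n), obs_seq \<omega>)" for \<omega>
    by (simp only: W_past state_obs_past[OF \<phi> lessI order_refl])
  have "(\<integral>\<^sup>+\<omega>. W \<omega> * \<phi> (fst (\<omega> n), obs_seq \<omega>) \<partial>law \<nu>)
    = (\<integral>\<^sup>+\<omega>. \<integral>\<^sup>+v. W \<omega> * \<phi> (fst (\<omega> n), (obs_seq \<omega>)(n := v)) \<partial>Q (fst (\<omega> n)) \<partial>law \<nu>)"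
    by (subst nn_integral_law_channel[OF \<nu>, where f="\<lambda>\<omega>. W \<omega> * \<phi> (fst (\<omega> n), obs_seq \<omega>)" and n=n, OF _ Wp]) (simp_all add: W_upd obs_upd)
  also have "\<dots> = (\<integral>\<^sup>+\<omega>. W \<omega> * \<phi>' (fst (\<omega> n), obs_seq \<omega>) \<partial>law \<nu>)"
  proof (rule nn_integral_cong)
    fix \<omega> :: "nat \<Rightarrow> 'x \<times> 'y"
    have "(\<lambda>v. (fst (\<omega> n), (obs_seq \<omega>)(n := v))) \<in> borel \<rightarrow>\<^sub>M borel \<Otimes>\<^sub>M paths"
      by (intro measurable_Pair measurable_upd_paths) (auto simp: space_PiM)
    from measurable_compose[OF this \<phi>m]
    show "(\<integral>\<^sup>+v. W \<omega> * \<phi> (fst (\<omega> n), (obs_seq \<omega>)(n := v)) \<partial>Q (fst (\<omega> n))) = W \<omega> * \<phi>' (fst (\<omega> n), obs_seq \<omega>)"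
      unfolding \<phi>'_def by (simp add: nn_integral_cmult measurable_cong_sets[OF sets_channel refl])
  qed
  finally show "(\<integral>\<^sup>+\<omega>. W \<omega> * \<phi> (fst (\<omega> n), obs_seq \<omega>) \<partial>law \<nu>) = (\<integral>\<^sup>+\<omega>. W \<omega> * \<phi>' (fst (\<omega> n), obs_seq \<omega>) \<partial>law \<nu>)" .
qed

end

section \<open>Densities between conditional distributions\<close>

text \<open>Disintegration: the defining property of a regular conditional distribution on rectangles extends
to all measurable functions, because rectangles generate the product sigma field.\<close>
lemma reg_cond_distr_nn_integral:
  fixes X :: "'w \<Rightarrow> 'x::topological_space"
  assumes M: "prob_space M" and r: "reg_cond_distr M X N Y \<kappa>"
    and X[measurable]: "X \<in> M \<rightarrow>\<^sub>M borel" and Y[measurable]: "Y \<in> M \<rightarrow>\<^sub>M N"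
    and f[measurable]: "f \<in> borel_measurable (borel \<Otimes>\<^sub>M N)"
  shows "(\<integral>\<^sup>+\<omega>. f (X \<omega>, Y \<omega>) \<partial>M) = (\<integral>\<^sup>+\<omega>. \<integral>\<^sup>+x. f (x, Y \<omega>) \<partial>\<kappa> (Y \<omega>) \<partial>M)"
proof -
  interpret prob_space M by fact
  have \<kappa>[measurable]: "\<kappa> \<in> N \<rightarrow>\<^sub>M prob_algebra borel"
    using r by (simp add: reg_cond_distr_def)
  have s\<kappa>: "sets (\<kappa> y) = sets borel" if "y \<in> space N" for y
    using measurable_space[OF \<kappa> that] by (simp add: space_prob_algebra)
  let ?J = "distr M (borel \<Otimes>\<^sub>M N) (\<lambda>\<omega>. (X \<omega>, Y \<omega>))"
  let ?K = "distr M N Y \<bind> (\<lambda>y. distr (\<kappa> y) (borel \<Otimes>\<^sub>M N) (\<lambda>x. (x, y)))"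
  have k: "(\<lambda>y. distr (\<kappa> y) (borel \<Otimes>\<^sub>M N) (\<lambda>x. (x, y))) \<in> N \<rightarrow>\<^sub>M prob_algebra (borel \<Otimes>\<^sub>M N)"
    by measurable
  have ne: "space (distr M N Y) \<noteq> {}"
    using measurable_space[OF Y] not_empty by auto
  have k': "(\<lambda>y. distr (\<kappa> y) (borel \<Otimes>\<^sub>M N) (\<lambda>x. (x, y))) \<in> distr M N Y \<rightarrow>\<^sub>M subprob_algebra (borel \<Otimes>\<^sub>M N)"
    using measurable_prob_algebraD[OF k] by simp
  have "?J = ?K"
  proof (rule measure_eqI_generator_eq[OF Int_stable_pair_measure_generator[of borel N]])
    show "{a \<times> b |a b. a \<in> sets borel \<and> b \<in> sets N} \<subseteq> Pow (space borel \<times> space N)"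
      using sets.space_closed[of N] by auto
    show "sets ?J = sigma_sets (space borel \<times> space N) {a \<times> b |a b. a \<in> sets borel \<and> b \<in> sets N}"
      by (simp add: sets_pair_measure)
    show "sets ?K = sigma_sets (space borel \<times> space N) {a \<times> b |a b. a \<in> sets borel \<and> b \<in> sets N}"
      using ne by (subst sets_bind[where N="borel \<Otimes>\<^sub>M N"]) (auto simp: sets_pair_measure)
    show "range (\<lambda>_::nat. space borel \<times> space N) \<subseteq> {a \<times> b |a b. a \<in> sets borel \<and> b \<in> sets N}"
      by (auto intro!: exI[of _ UNIV] exI[of _ "space N"])
    show "emeasure ?J (space borel \<times> space N) \<noteq> \<infinity>" for i :: nat
      using X by (simp add: emeasure_distr space_pair_measure[symmetric] emeasure_eq_measure)
    fix E assume "E \<in> {a \<times> b |a b. a \<in> sets (borel :: 'x measure) \<and> b \<in> sets N}"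
    then obtain A B where E: "E = A \<times> B" and A[measurable]: "A \<in> sets borel" and B[measurable]: "B \<in> sets N" by auto
    have "emeasure ?J E = emeasure M {\<omega> \<in> space M. X \<omega> \<in> A \<and> Y \<omega> \<in> B}"
      using A B unfolding E by (subst emeasure_distr) (auto intro!: arg_cong2[where f=emeasure])
    also have "\<dots> = (\<integral>\<^sup>+\<omega>. emeasure (\<kappa> (Y \<omega>)) A * indicator B (Y \<omega>) \<partial>M)"
      using r A B by (simp add: reg_cond_distr_def)
    also have "\<dots> = (\<integral>\<^sup>+\<omega>. emeasure (distr (\<kappa> (Y \<omega>)) (borel \<Otimes>\<^sub>M N) (\<lambda>x. (x, Y \<omega>))) E \<partial>M)"
    proof (rule nn_integral_cong)
      fix \<omega> assume "\<omega> \<in> space M"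
      then have y: "Y \<omega> \<in> space N" using measurable_space[OF Y] by simp
      have "emeasure (distr (\<kappa> (Y \<omega>)) (borel \<Otimes>\<^sub>M N) (\<lambda>x. (x, Y \<omega>))) E
        = emeasure (\<kappa> (Y \<omega>)) ((\<lambda>x. (x, Y \<omega>)) -` E \<inter> space (\<kappa> (Y \<omega>)))"
        using y unfolding E by (intro emeasure_distr) (auto simp: measurable_cong_sets[OF s\<kappa>[OF y] refl])
      also have "(\<lambda>x. (x, Y \<omega>)) -` E \<inter> space (\<kappa> (Y \<omega>)) = (if Y \<omega> \<in> B then A else {})"
        using sets_eq_imp_space_eq[OF s\<kappa>[OF y]] unfolding E by auto
      finally show "emeasure (\<kappa> (Y \<omega>)) A * indicator B (Y \<omega>) = emeasure (distr (\<kappa> (Y \<omega>)) (borel \<Otimes>\<^sub>M N) (\<lambda>x. (x, Y \<omega>))) E"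
        by simp
    qed
    also have "\<dots> = (\<integral>\<^sup>+y. emeasure (distr (\<kappa> y) (borel \<Otimes>\<^sub>M N) (\<lambda>x. (x, y))) E \<partial>distr M N Y)"
      using A B unfolding E
      by (subst nn_integral_distr) (auto intro!: measurable_compose[OF measurable_prob_algebraD[OF k] measurable_emeasure_subprob_algebra])
    also have "\<dots> = emeasure ?K E"
      using A B ne unfolding E by (intro emeasure_bind[symmetric, OF _ k']) auto
    finally show "emeasure ?J E = emeasure ?K E" .
  qed auto
  then have "(\<integral>\<^sup>+z. f z \<partial>?J) = (\<integral>\<^sup>+z. f z \<partial>?K)" by simp
  moreover have "(\<integral>\<^sup>+z. f z \<partial>?J) = (\<integral>\<^sup>+\<omega>. f (X \<omega>, Y \<omega>) \<partial>M)"
    by (intro nn_integral_distr) auto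
  moreover have "(\<integral>\<^sup>+z. f z \<partial>?K) = (\<integral>\<^sup>+\<omega>. \<integral>\<^sup>+x. f (x, Y \<omega>) \<partial>\<kappa> (Y \<omega>) \<partial>M)"
  proof -
    have "(\<integral>\<^sup>+z. f z \<partial>?K) = (\<integral>\<^sup>+y. \<integral>\<^sup>+z. f z \<partial>distr (\<kappa> y) (borel \<Otimes>\<^sub>M N) (\<lambda>x. (x, y)) \<partial>distr M N Y)"
      by (rule nn_integral_bind[OF f k'])
    also have "\<dots> = (\<integral>\<^sup>+\<omega>. \<integral>\<^sup>+z. f z \<partial>distr (\<kappa> (Y \<omega>)) (borel \<Otimes>\<^sub>M N) (\<lambda>x. (x, Y \<omega>)) \<partial>M)"
      by (rule nn_integral_distr[OF Y]) (simp add: measurable_compose[OF measurable_prob_algebraD[OF k] nn_integral_measurable_subprob_algebra[OF f]])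
    also have "\<dots> = (\<integral>\<^sup>+\<omega>. \<integral>\<^sup>+x. f (x, Y \<omega>) \<partial>\<kappa> (Y \<omega>) \<partial>M)"
    proof (rule nn_integral_cong)
      fix \<omega> assume "\<omega> \<in> space M"
      then have y: "Y \<omega> \<in> space N" using measurable_space[OF Y] by simp
      then show "(\<integral>\<^sup>+z. f z \<partial>distr (\<kappa> (Y \<omega>)) (borel \<Otimes>\<^sub>M N) (\<lambda>x. (x, Y \<omega>))) = (\<integral>\<^sup>+x. f (x, Y \<omega>) \<partial>\<kappa> (Y \<omega>))"
        by (intro nn_integral_distr) (auto simp: measurable_cong_sets[OF s\<kappa>[OF y] refl])
    qed
    finally show ?thesis .
  qed
  ultimately show ?thesis by simp
qed

lemma measurable_nn_integral_kernel:
  assumes \<kappa>: "\<kappa> \<in> N \<rightarrow>\<^sub>M prob_algebra K" and f: "(\<lambda>(y, x). f x y) \<in> borel_measurable (N \<Otimes>\<^sub>M K)"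
  shows "(\<lambda>y. \<integral>\<^sup>+x. f x y \<partial>\<kappa> y) \<in> borel_measurable N"
  by (rule nn_integral_measurable_subprob_algebra2[OF f measurable_prob_algebraD[OF \<kappa>]])

lemma absolutely_continuous_distr_density:
  assumes W: "W \<in> borel_measurable R" and V[measurable]: "V \<in> R \<rightarrow>\<^sub>M N"
  shows "absolutely_continuous (distr R N V) (distr (density R W) N V)"
  unfolding absolutely_continuous_def
proof
  fix A assume "A \<in> null_sets (distr R N V)"
  then have A: "A \<in> sets N" "emeasure R (V -` A \<inter> space R) = 0"
    by (auto simp: emeasure_distr null_sets_def)
  then have "V -` A \<inter> space R \<in> null_sets R"
    by (auto simp: null_sets_def)
  then have "V -` A \<inter> space R \<in> null_sets (density R W)"
    using absolutely_continuousI_density[OF W] by (auto simp: absolutely_continuous_def)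
  then show "A \<in> null_sets (distr (density R W) N V)"
    using A by (auto simp: null_sets_def emeasure_distr)
qed

text \<open>This is \<open>E[W | V]\<close> written as a function of \<open>V\<close>. Such a factorisation is needed in order to evaluate
conditional densities under the kernel that integrates over the state with the measurements fixed.\<close>
lemma pushforward_density_exists:
  assumes R: "prob_space R" and W[measurable]: "W \<in> borel_measurable R" and P: "prob_space (density R W)"
    and V[measurable]: "V \<in> R \<rightarrow>\<^sub>M N"
  obtains l :: "'n \<Rightarrow> real" where "l \<in> borel_measurable N" "\<And>y. 0 \<le> l y"
    "\<And>\<phi>. \<phi> \<in> borel_measurable N \<Longrightarrow> (\<integral>\<^sup>+\<omega>. W \<omega> * \<phi> (V \<omega>) \<partial>R) = (\<integral>\<^sup>+\<omega>. ennreal (l (V \<omega>)) * \<phi> (V \<omega>) \<partial>R)"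
proof -
  interpret R: prob_space R by fact
  interpret r: prob_space "distr R N V" by (rule R.prob_space_distr) simp
  let ?p = "distr (density R W) N V"
  interpret p: prob_space ?p
    using P by (rule prob_space.prob_space_distr) simp
  have ac: "absolutely_continuous (distr R N V) ?p"
    by (rule absolutely_continuous_distr_density[OF W V])
  obtain l where l: "l \<in> borel_measurable N" "AE x in distr R N V. RN_deriv (distr R N V) ?p x = ennreal (l x)" "\<And>x. 0 \<le> l x"
    using r.real_RN_deriv[OF p.finite_measure_axioms ac] by auto
  have d: "density (distr R N V) l = ?p"
    using r.density_RN_deriv[OF ac] density_cong[OF borel_measurable_RN_deriv _ l(2)] l(1) by simp
  show ?thesis
  proof
    fix \<phi> :: "'n \<Rightarrow> ennreal" assume [measurable]: "\<phi> \<in> borel_measurable N"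
    note [measurable] = l(1)
    have "(\<integral>\<^sup>+\<omega>. W \<omega> * \<phi> (V \<omega>) \<partial>R) = (\<integral>\<^sup>+y. \<phi> y \<partial>?p)"
      by (simp add: nn_integral_distr nn_integral_density)
    also have "\<dots> = (\<integral>\<^sup>+\<omega>. ennreal (l (V \<omega>)) * \<phi> (V \<omega>) \<partial>R)"
      unfolding d[symmetric] by (simp add: nn_integral_distr nn_integral_density)
    finally show "(\<integral>\<^sup>+\<omega>. W \<omega> * \<phi> (V \<omega>) \<partial>R) = (\<integral>\<^sup>+\<omega>. ennreal (l (V \<omega>)) * \<phi> (V \<omega>) \<partial>R)" .
  qed fact+
qed

lemma AE_eq_if_integrals_eq:
  assumes R: "prob_space R" and Y[measurable]: "Y \<in> R \<rightarrow>\<^sub>M N"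
    and [measurable]: "f \<in> borel_measurable N" "g \<in> borel_measurable N"
    and eq: "\<And>B. B \<in> sets N \<Longrightarrow> (\<integral>\<^sup>+\<omega>. f (Y \<omega>) * indicator B (Y \<omega>) \<partial>R) = (\<integral>\<^sup>+\<omega>. g (Y \<omega>) * indicator B (Y \<omega>) \<partial>R)"
  shows "AE y in distr R N Y. f y = g y"
proof -
  interpret r: prob_space "distr R N Y" using R by (rule prob_space.prob_space_distr) simp
  show ?thesis
    by (rule r.density_unique_finite_measure) (use eq in \<open>auto simp: nn_integral_distr\<close>)
qed

lemma borel_countable_generator:
  obtains E :: "'x::second_countable_topology set set" where
    "countable E" "Int_stable E" "UNIV \<in> E" "sets borel = sigma_sets UNIV E"
proof -
  obtain B :: "'x set set" where B: "countable B" "topological_basis B"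
    using ex_countable_basis by auto
  define E where "E = {\<Inter>F |F. F \<subseteq> B \<and> finite F}"
  have E: "E = Inter ` {F. F \<subseteq> B \<and> finite F}" by (auto simp: E_def)
  have c: "countable E"
    unfolding E using countable_Collect_finite_subset[OF B(1)] by (auto simp: conj_commute)
  have i: "Int_stable E"
  proof (rule Int_stableI)
    fix a b assume "a \<in> E" "b \<in> E"
    then obtain F G where "a = \<Inter>F" "b = \<Inter>G" "F \<subseteq> B" "finite F" "G \<subseteq> B" "finite G"
      by (auto simp: E_def)
    then have "a \<inter> b = \<Inter>(F \<union> G)" "F \<union> G \<subseteq> B" "finite (F \<union> G)" by auto
    then show "a \<inter> b \<in> E" unfolding E_def by blast
  qed
  have u: "UNIV \<in> E" unfolding E_def by (auto intro!: exI[of _ "{}"])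
  have o: "open a" if "a \<in> E" for a
    using that topological_basis_open[OF B(2)] unfolding E_def by (auto intro!: open_Inter)
  have "sets (borel :: 'x measure) = sigma_sets UNIV E"
  proof
    show "sigma_sets UNIV E \<subseteq> sets (borel :: 'x measure)"
    proof -
      have "E \<subseteq> sets borel" using o by (auto intro: borel_open)
      from sets.sigma_sets_subset[OF this] show ?thesis by simp
    qed
    have "S \<in> sigma_sets UNIV E" if "open S" for S
    proof -
      have "\<exists>C. C \<subseteq> B \<and> \<Union>C = S"
        using B(2) that unfolding topological_basis_def by blast
      then obtain C where C: "C \<subseteq> B" "S = \<Union>C" by blast
      have "c \<in> sigma_sets UNIV E" if "c \<in> C" for c
        using that C(1) by (intro sigma_sets.Basic) (auto simp: E_def intro!: exI[of _ "{c}"])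
      moreover have "countable C" using C(1) B(1) countable_subset by blast
      ultimately show ?thesis
        unfolding C(2) by (intro sigma_sets_UNION) auto
    qed
    then show "sets (borel :: 'x measure) \<subseteq> sigma_sets UNIV E"
      unfolding borel_def by (intro order_trans[OF eq_refl[OF sets_measure_of] sigma_sets_mono]) auto
  qed
  with c i u show ?thesis using that by blast
qed

text \<open>Bayes' formula \<open>l dp = m dq\<close> for conditional distributions under \<open>R\<close> and under the reweighted measure, where \<open>m = E[W | X, Y]\<close> and
\<open>l = E[W | Y]\<close>. It is stated without division so that it also holds where \<open>l\<close> vanishes.\<close>
lemma posterior_density:
  fixes X :: "'w \<Rightarrow> 'x::second_countable_topology" and m :: "'x \<times> 'n \<Rightarrow> real" and l :: "'n \<Rightarrow> real"
  assumes R: "prob_space R" and W[measurable]: "W \<in> borel_measurable R"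
    and X[measurable]: "X \<in> R \<rightarrow>\<^sub>M borel" and Y[measurable]: "Y \<in> R \<rightarrow>\<^sub>M N"
    and q: "reg_cond_distr R X N Y q" and p: "reg_cond_distr (density R W) X N Y p"
    and m[measurable]: "m \<in> borel_measurable (borel \<Otimes>\<^sub>M N)" and l[measurable]: "l \<in> borel_measurable N"
    and m_eq: "\<And>\<phi>. \<phi> \<in> borel_measurable (borel \<Otimes>\<^sub>M N) \<Longrightarrow>
      (\<integral>\<^sup>+\<omega>. W \<omega> * \<phi> (X \<omega>, Y \<omega>) \<partial>R) = (\<integral>\<^sup>+\<omega>. ennreal (m (X \<omega>, Y \<omega>)) * \<phi> (X \<omega>, Y \<omega>) \<partial>R)"
    and l_eq: "\<And>\<phi>. \<phi> \<in> borel_measurable N \<Longrightarrow>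
      (\<integral>\<^sup>+\<omega>. W \<omega> * \<phi> (Y \<omega>) \<partial>R) = (\<integral>\<^sup>+\<omega>. ennreal (l (Y \<omega>)) * \<phi> (Y \<omega>) \<partial>R)"
  shows "AE y in distr R N Y. \<forall>A\<in>sets borel. ennreal (l y) * emeasure (p y) A = (\<integral>\<^sup>+x. ennreal (m (x, y)) * indicator A x \<partial>q y)"
proof -
  have pk[measurable]: "p \<in> N \<rightarrow>\<^sub>M prob_algebra borel" and qk[measurable]: "q \<in> N \<rightarrow>\<^sub>M prob_algebra borel"
    using p q by (simp_all add: reg_cond_distr_def)
  have sp: "sets (p y) = sets borel" "sets (q y) = sets borel" "prob_space (p y)" if "y \<in> space N" for y
    using measurable_space[OF pk that] measurable_space[OF qk that] by (simp_all add: space_prob_algebra)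
  note pm[measurable] = measurable_prob_algebraD[OF pk] 
  \<comment> \<open>The exceptional null set must not depend on \<open>A\<close>, so a countable generator is used.\<close>
  obtain E :: "'x set set" where E: "countable E" "Int_stable E" "UNIV \<in> E" "sets borel = sigma_sets UNIV E"
    using borel_countable_generator by blast
  have 1: "AE y in distr R N Y. ennreal (l y) * emeasure (p y) A = (\<integral>\<^sup>+x. ennreal (m (x, y)) * indicator A x \<partial>q y)"
    if A[measurable]: "A \<in> sets borel" for A
  proof (rule AE_eq_if_integrals_eq[OF R Y])
    have pA[measurable]: "(\<lambda>y. emeasure (p y) A) \<in> borel_measurable N"
      by (rule measurable_compose[OF pm measurable_emeasure_subprob_algebra[OF A]])
    show "(\<lambda>y. ennreal (l y) * emeasure (p y) A) \<in> borel_measurable N"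
      by measurable
    show "(\<lambda>y. \<integral>\<^sup>+x. ennreal (m (x, y)) * indicator A x \<partial>q y) \<in> borel_measurable N"
      by (rule measurable_nn_integral_kernel[OF qk]) measurable
    fix B assume B[measurable]: "B \<in> sets N"
    have "(\<integral>\<^sup>+\<omega>. ennreal (l (Y \<omega>)) * emeasure (p (Y \<omega>)) A * indicator B (Y \<omega>) \<partial>R)
      = (\<integral>\<^sup>+\<omega>. W \<omega> * (emeasure (p (Y \<omega>)) A * indicator B (Y \<omega>)) \<partial>R)"
      by (subst l_eq) (auto simp: mult.assoc)
    also have "\<dots> = (\<integral>\<^sup>+\<omega>. emeasure (p (Y \<omega>)) A * indicator B (Y \<omega>) \<partial>density R W)"
      by (subst nn_integral_density) auto
    also have "\<dots> = emeasure (density R W) {\<omega> \<in> space R. X \<omega> \<in> A \<and> Y \<omega> \<in> B}"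
      using p A B by (simp add: reg_cond_distr_def)
    also have "\<dots> = (\<integral>\<^sup>+\<omega>. W \<omega> * indicator (A \<times> B) (X \<omega>, Y \<omega>) \<partial>R)"
      by (subst emeasure_density) (auto intro!: nn_integral_cong simp: indicator_def)
    also have "\<dots> = (\<integral>\<^sup>+\<omega>. ennreal (m (X \<omega>, Y \<omega>)) * indicator (A \<times> B) (X \<omega>, Y \<omega>) \<partial>R)"
      by (rule m_eq) auto
    also have "\<dots> = (\<integral>\<^sup>+\<omega>. \<integral>\<^sup>+x. ennreal (m (x, Y \<omega>)) * indicator (A \<times> B) (x, Y \<omega>) \<partial>q (Y \<omega>) \<partial>R)"
      by (rule reg_cond_distr_nn_integral[OF R q X Y]) measurable
    also have "\<dots> = (\<integral>\<^sup>+\<omega>. (\<integral>\<^sup>+x. ennreal (m (x, Y \<omega>)) * indicator A x \<partial>q (Y \<omega>)) * indicator B (Y \<omega>) \<partial>R)"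
      by (intro nn_integral_cong) (auto simp: indicator_times split: split_indicator)
    finally show "(\<integral>\<^sup>+\<omega>. ennreal (l (Y \<omega>)) * emeasure (p (Y \<omega>)) A * indicator B (Y \<omega>) \<partial>R) =
      (\<integral>\<^sup>+\<omega>. (\<integral>\<^sup>+x. ennreal (m (x, Y \<omega>)) * indicator A x \<partial>q (Y \<omega>)) * indicator B (Y \<omega>) \<partial>R)" .
  qed
  have "AE y in distr R N Y. \<forall>A\<in>E. ennreal (l y) * emeasure (p y) A = (\<integral>\<^sup>+x. ennreal (m (x, y)) * indicator A x \<partial>q y)"
    using 1 E by (subst AE_ball_countable) auto
  then show ?thesis
  proof (rule AE_mp, intro AE_I2 impI ballI)
    fix y A assume "y \<in> space (distr R N Y)" and A: "A \<in> sets (borel :: 'x measure)"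
      and eq: "\<forall>A\<in>E. ennreal (l y) * emeasure (p y) A = (\<integral>\<^sup>+x. ennreal (m (x, y)) * indicator A x \<partial>q y)"
    then have y[simp]: "y \<in> space N" by simp
    have my: "(\<lambda>x. m (x, y)) \<in> borel_measurable (q y)"
      unfolding measurable_cong_sets[OF sp(2)[OF y] refl] by simp
    have em: "emeasure (density (q y) (\<lambda>x. ennreal (m (x, y)))) B = (\<integral>\<^sup>+x. ennreal (m (x, y)) * indicator B x \<partial>q y)"
      if "B \<in> sets borel" for B
      using that my sp[OF y] by (intro emeasure_density) auto
    have "scale_measure (ennreal (l y)) (p y) = density (q y) (\<lambda>x. ennreal (m (x, y)))"
    proof (rule measure_eqI_generator_eq[OF E(2), of UNIV _ _ "\<lambda>_. UNIV"])
      show "emeasure (scale_measure (ennreal (l y)) (p y)) B = emeasure (density (q y) (\<lambda>x. ennreal (m (x, y)))) B" if "B \<in> E" for B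
        using that eq E by (simp add: em sigma_sets.Basic)
      have "emeasure (p y) UNIV \<le> 1"
        using prob_space.measure_le_1[OF sp(3)[OF y]] by simp
      then show "emeasure (scale_measure (ennreal (l y)) (p y)) UNIV \<noteq> \<infinity>"
        by (auto simp: ennreal_mult_eq_top_iff top_unique)
    qed (use E sp[OF y] in auto)
    then have "emeasure (scale_measure (ennreal (l y)) (p y)) A = emeasure (density (q y) (\<lambda>x. ennreal (m (x, y)))) A"
      by simp
    then show "ennreal (l y) * emeasure (p y) A = (\<integral>\<^sup>+x. ennreal (m (x, y)) * indicator A x \<partial>q y)"
      using em[OF A] by simp
  qed
qed

section \<open>Total variation and relative entropy as integrals of densities\<close>

lemma tv_norm_density:
  fixes d :: "'a::topological_space \<Rightarrow> real"
  assumes q: "prob_space q" "sets q = sets borel" and d[measurable]: "d \<in> borel_measurable borel"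
    and d0: "\<And>x. 0 \<le> d x" and p: "prob_space (density q d)"
  shows "ennreal (tv_norm (density q d) q) = (\<integral>\<^sup>+x. ennreal \<bar>d x - 1\<bar> \<partial>q)"
proof -
  interpret q: prob_space q by fact
  note [measurable_cong] = q(2)
  have "(\<integral>\<^sup>+x. ennreal (d x) \<partial>q) = 1"
    using prob_space.emeasure_space_1[OF p] by (simp add: emeasure_density cong: nn_integral_cong)
  then have id: "integrable q d"
    by (intro integrableI_nonneg) (auto simp: d0)
  then have i: "integrable q (\<lambda>x. d x - 1)" by auto
  have diff: "(\<integral>x. f x \<partial>density q d) - (\<integral>x. f x \<partial>q) = (\<integral>x. f x * (d x - 1) \<partial>q)"
    and bnd: "\<bar>\<integral>x. f x * (d x - 1) \<partial>q\<bar> \<le> (\<integral>x. \<bar>d x - 1\<bar> \<partial>q)"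
    if f[measurable]: "f \<in> borel_measurable borel" and f1: "\<forall>x. \<bar>f x\<bar> \<le> 1" for f :: "'a \<Rightarrow> real"
  proof -
    have if': "integrable q f"
      by (rule q.integrable_const_bound[where B=1]) (auto simp: f1)
    have ifd: "integrable q (\<lambda>x. f x * d x)"
      by (rule Bochner_Integration.integrable_bound[OF id]) (use f1 d0 in \<open>auto simp: abs_mult intro!: mult_left_le_one_le\<close>)
    have "(\<integral>x. f x \<partial>density q d) = (\<integral>x. f x * d x \<partial>q)"
      by (subst integral_real_density) (auto simp: d0 mult.commute)
    then show "(\<integral>x. f x \<partial>density q d) - (\<integral>x. f x \<partial>q) = (\<integral>x. f x * (d x - 1) \<partial>q)"
      using if' ifd by (simp add: right_diff_distrib)
    have ifd1: "integrable q (\<lambda>x. f x * (d x - 1))"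
      using if' ifd by (simp add: right_diff_distrib)
    have "\<bar>\<integral>x. f x * (d x - 1) \<partial>q\<bar> \<le> (\<integral>x. \<bar>f x * (d x - 1)\<bar> \<partial>q)"
      by (rule integral_abs_bound)
    also have "\<dots> \<le> (\<integral>x. \<bar>d x - 1\<bar> \<partial>q)"
      using i f1 integrable_abs[OF ifd1]
      by (intro integral_mono) (auto simp: abs_mult intro!: mult_left_le_one_le)
    finally show "\<bar>\<integral>x. f x * (d x - 1) \<partial>q\<bar> \<le> (\<integral>x. \<bar>d x - 1\<bar> \<partial>q)" .
  qed
  have "tv_norm (density q d) q = (\<integral>x. \<bar>d x - 1\<bar> \<partial>q)"
    unfolding tv_norm_def
  proof (rule cSup_eq_maximum)
    \<comment> \<open>The sign of \<open>d - 1\<close> attains the supremum.\<close>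
    let ?s = "\<lambda>x. if d x \<ge> 1 then 1 else (-1::real)"
    have s[measurable]: "?s \<in> borel_measurable borel" by measurable
    have "(\<integral>x. \<bar>d x - 1\<bar> \<partial>q) = \<bar>\<integral>x. ?s x * (d x - 1) \<partial>q\<bar>"
    proof -
      have "(\<integral>x. ?s x * (d x - 1) \<partial>q) = (\<integral>x. \<bar>d x - 1\<bar> \<partial>q)"
        by (intro Bochner_Integration.integral_cong) auto
      then show ?thesis by simp
    qed
    then show "(\<integral>x. \<bar>d x - 1\<bar> \<partial>q) \<in> (\<lambda>f. \<bar>(\<integral>x. f x \<partial>density q d) - (\<integral>x. f x \<partial>q)\<bar>) `
        {f :: 'a \<Rightarrow> real. f \<in> borel_measurable borel \<and> (\<forall>x. \<bar>f x\<bar> \<le> 1)}"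
      using diff[OF s] by (intro image_eqI[of _ _ ?s]) auto
  next
    fix y assume "y \<in> (\<lambda>f. \<bar>(\<integral>x. f x \<partial>density q d) - (\<integral>x. f x \<partial>q)\<bar>) `
        {f :: 'a \<Rightarrow> real. f \<in> borel_measurable borel \<and> (\<forall>x. \<bar>f x\<bar> \<le> 1)}"
    then show "y \<le> (\<integral>x. \<bar>d x - 1\<bar> \<partial>q)"
      using diff bnd by auto
  qed
  then show ?thesis
    using i by (simp add: nn_integral_eq_integral)
qed

text \<open>The integrand of relative entropy, normalised to be nonnegative: the added terms \<open>- t + 1\<close> integrate
to \<open>0\<close> for a probability density, so its integral always makes sense. With
\<open>0 * ln 0 = 0\<close> it takes the correct value \<open>1\<close> at \<open>0\<close>.\<close>
definition entropy_fn :: "real \<Rightarrow> real" where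
  "entropy_fn t = t * ln t - t + 1"

lemma borel_measurable_entropy_fn[measurable]: "entropy_fn \<in> borel_measurable borel"
  unfolding entropy_fn_def[abs_def] by measurable

text \<open>Young's inequality: \<open>exp s - 1\<close> is the convex conjugate of \<open>entropy_fn\<close>. It serves below in place of
derivatives: with \<open>s = ln u\<close> it states that the graph lies above its tangent at \<open>u\<close>.\<close>
lemma entropy_fn_young:
  assumes "0 \<le> t"
  shows "s * t - (exp s - 1) \<le> entropy_fn t"
proof (cases "t = 0")
  case False
  with assms have t: "0 < t" by simp
  have "1 + (s - ln t) \<le> exp (s - ln t)" by (rule exp_ge_add_one_self)
  then have "t * (1 + (s - ln t)) \<le> t * exp (s - ln t)" using t by simp
  also have "\<dots> = exp s" using t by (simp add: exp_diff)
  finally show ?thesis by (simp add: entropy_fn_def algebra_simps)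
qed (simp add: entropy_fn_def)

lemma entropy_fn_nonneg: "0 \<le> t \<Longrightarrow> 0 \<le> entropy_fn t"
  using entropy_fn_young[of t 0] by simp

text \<open>The two sides agree also when the entropy is infinite, since \<open>d * ln d\<close> and \<open>entropy_fn d\<close> differ by
an integrable function.\<close>
lemma rel_entropy_density:
  fixes d :: "'a::topological_space \<Rightarrow> real"
  assumes q: "prob_space q" "sets q = sets borel" and d[measurable]: "d \<in> borel_measurable borel"
    and d0: "\<And>x. 0 \<le> d x" and p: "prob_space (density q d)"
  shows "rel_entropy (density q d) q = (\<integral>\<^sup>+x. ennreal (entropy_fn (d x)) \<partial>q)"
proof -
  interpret q: prob_space q by fact
  note [measurable_cong] = q(2)
  let ?p = "density q d"
  have one: "(\<integral>\<^sup>+x. ennreal (d x) \<partial>q) = 1"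
    using prob_space.emeasure_space_1[OF p] by (simp add: emeasure_density cong: nn_integral_cong)
  then have id: "integrable q d"
    by (intro integrableI_nonneg) (auto simp: d0)
  have d1: "(\<integral>x. d x \<partial>q) = 1"
    using one id d0 by (simp add: nn_integral_eq_integral)
  have ac: "absolutely_continuous q ?p"
    by (rule absolutely_continuousI_density) measurable
  have RN: "AE x in q. RN_deriv q ?p x = ennreal (d x)"
  proof -
    have "AE x in q. ennreal (d x) = RN_deriv q ?p x"
      by (rule q.RN_deriv_unique) auto
    then show ?thesis by eventually_elim simp
  qed
  have ed: "AE x in q. entropy_density (exp 1) q ?p x = ln (d x)"
    using RN by eventually_elim (simp add: entropy_density_def d0 log_def)
  have "integrable ?p (entropy_density (exp 1) q ?p) \<longleftrightarrow> integrable q (\<lambda>x. d x * entropy_density (exp 1) q ?p x)"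
    using d0 by (subst integrable_real_density) auto
  also have "\<dots> \<longleftrightarrow> integrable q (\<lambda>x. d x * ln (d x))"
    using ed by (intro integrable_cong_AE) auto
  also have "\<dots> \<longleftrightarrow> integrable q (\<lambda>x. entropy_fn (d x))"
  proof
    assume i: "integrable q (\<lambda>x. d x * ln (d x))"
    show "integrable q (\<lambda>x. entropy_fn (d x))"
      unfolding entropy_fn_def using i id by auto
  next
    assume i: "integrable q (\<lambda>x. entropy_fn (d x))"
    have "integrable q (\<lambda>x. entropy_fn (d x) + d x - 1)"
      using i id by auto
    then show "integrable q (\<lambda>x. d x * ln (d x))" by (simp add: entropy_fn_def)
  qed
  finally have iff: "integrable ?p (entropy_density (exp 1) q ?p) \<longleftrightarrow> integrable q (\<lambda>x. entropy_fn (d x))" .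
  show ?thesis
  proof (cases "integrable q (\<lambda>x. entropy_fn (d x))")
    case True
    have i: "integrable q (\<lambda>x. d x * ln (d x))"
    proof -
      have "integrable q (\<lambda>x. entropy_fn (d x) + d x - 1)"
        using True id by auto
      then show ?thesis by (simp add: entropy_fn_def)
    qed
    have "KL_divergence (exp 1) q ?p = (\<integral>x. d x * log (exp 1) (d x) \<partial>q)"
      by (rule q.KL_density) (auto simp: d0)
    also have "\<dots> = (\<integral>x. entropy_fn (d x) \<partial>q)"
      unfolding entropy_fn_def using i id d1 by (simp add: log_def q.prob_space)
    finally show ?thesis
      using True ac iff by (simp add: rel_entropy_def nn_integral_eq_integral entropy_fn_nonneg d0)
  next
    case False
    have "(\<integral>\<^sup>+x. ennreal (entropy_fn (d x)) \<partial>q) = \<infinity>"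
    proof (rule ccontr)
      assume "(\<integral>\<^sup>+x. ennreal (entropy_fn (d x)) \<partial>q) \<noteq> \<infinity>"
      then have "integrable q (\<lambda>x. entropy_fn (d x))"
        by (intro integrableI_nonneg) (auto simp: entropy_fn_nonneg d0 less_top)
      with False show False by simp
    qed
    then show ?thesis using iff False by (simp add: rel_entropy_def)
  qed
qed

text \<open>The formulas for the distances in terms of a density \<open>g / a\<close>, multiplied by \<open>a\<close>. With \<open>a\<close> the density
of the measurement, the right-hand sides can be integrated further under the reference measure. All
sides vanish if \<open>a = 0\<close>.\<close>
lemma
  fixes g :: "'a::topological_space \<Rightarrow> real"
  assumes q: "prob_space q" "sets q = sets borel" and p: "prob_space p" "sets p = sets borel"
    and g[measurable]: "g \<in> borel_measurable borel" and g0: "\<And>x. 0 \<le> g x" and a: "0 \<le> a"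
    and eq: "\<And>A. A \<in> sets borel \<Longrightarrow> ennreal a * emeasure p A = (\<integral>\<^sup>+x. ennreal (g x) * indicator A x \<partial>q)"
  shows scaled_tv_norm: "ennreal a * ennreal (tv_norm p q) = (\<integral>\<^sup>+x. ennreal \<bar>g x - a\<bar> \<partial>q)"
    and scaled_rel_entropy: "ennreal a * rel_entropy p q = (\<integral>\<^sup>+x. ennreal (a * entropy_fn (g x / a)) \<partial>q)"
proof -
  note [measurable_cong] = q(2)
  have z: "AE x in q. g x = 0" if "a = 0"
  proof -
    have "(\<integral>\<^sup>+x. ennreal (g x) \<partial>q) = 0"
      using eq[of UNIV] that by simp
    then have "AE x in q. ennreal (g x) = 0"
      by (subst (asm) nn_integral_0_iff_AE) auto
    then show ?thesis
    proof eventually_elim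
      case (elim x)
      then have "g x \<le> 0" by (simp add: ennreal_eq_0_iff)
      with g0[of x] show ?case by simp
    qed
  qed
  have pd: "p = density q (\<lambda>x. ennreal (g x / a))" if "a > 0"
  proof (rule measure_eqI)
    fix A assume "A \<in> sets p"
    then have A[measurable]: "A \<in> sets borel" using p by simp
    have "ennreal (1/a) * (ennreal a * emeasure p A) = (\<integral>\<^sup>+x. ennreal (1/a) * (ennreal (g x) * indicator A x) \<partial>q)"
      unfolding eq[OF A] by (rule nn_integral_cmult[symmetric]) measurable
    also have "\<dots> = emeasure (density q (\<lambda>x. ennreal (g x / a))) A"
      using that g0 by (subst emeasure_density) (auto intro!: nn_integral_cong simp: mult.assoc[symmetric] ennreal_mult'[symmetric] q)
    finally show "emeasure p A = emeasure (density q (\<lambda>x. ennreal (g x / a))) A"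
      using that by (simp add: mult.assoc[symmetric] ennreal_mult'[symmetric])
  qed (use p q in simp)
  show "ennreal a * ennreal (tv_norm p q) = (\<integral>\<^sup>+x. ennreal \<bar>g x - a\<bar> \<partial>q)"
  proof (cases "a = 0")
    case True
    then have "(\<integral>\<^sup>+x. ennreal \<bar>g x - a\<bar> \<partial>q) = (\<integral>\<^sup>+x. 0 \<partial>q)"
      using z[OF True] by (intro nn_integral_cong_AE) (auto elim: eventually_mono)
    then show ?thesis using True by simp
  next
    case False
    with a have a: "a > 0" by simp
    have "ennreal (tv_norm p q) = (\<integral>\<^sup>+x. ennreal \<bar>g x / a - 1\<bar> \<partial>q)"
      using tv_norm_density[OF q, of "\<lambda>x. g x / a"] p(1) g0 a pd[OF a] by simp
    then have "ennreal a * ennreal (tv_norm p q) = (\<integral>\<^sup>+x. ennreal a * ennreal \<bar>g x / a - 1\<bar> \<partial>q)"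
      by (simp add: nn_integral_cmult)
    also have "\<dots> = (\<integral>\<^sup>+x. ennreal \<bar>g x - a\<bar> \<partial>q)"
    proof (intro nn_integral_cong)
      fix x
      have "a * \<bar>g x / a - 1\<bar> = \<bar>a * (g x / a - 1)\<bar>" using a by (simp add: abs_mult)
      also have "a * (g x / a - 1) = g x - a" using a by (simp add: right_diff_distrib)
      finally show "ennreal a * ennreal \<bar>g x / a - 1\<bar> = ennreal \<bar>g x - a\<bar>"
        using a by (simp add: ennreal_mult'[symmetric])
    qed
    finally show ?thesis .
  qed
  show "ennreal a * rel_entropy p q = (\<integral>\<^sup>+x. ennreal (a * entropy_fn (g x / a)) \<partial>q)"
  proof (cases "a = 0")
    case False
    with a have a: "a > 0" by simp
    have "rel_entropy p q = (\<integral>\<^sup>+x. ennreal (entropy_fn (g x / a)) \<partial>q)"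
      using rel_entropy_density[OF q, of "\<lambda>x. g x / a"] p(1) g0 a pd[OF a] by simp
    then have "ennreal a * rel_entropy p q = (\<integral>\<^sup>+x. ennreal a * ennreal (entropy_fn (g x / a)) \<partial>q)"
      by (simp add: nn_integral_cmult)
    then show ?thesis using a by (simp add: ennreal_mult')
  qed simp
qed

text \<open>Averaging the previous formulas over the measurement: the factor \<open>l\<close> that turns the reference measure into the
law of \<open>Y\<close> under the reweighted measure cancels the denominator in \<open>m / l\<close>. As a supremum over
uncountably many functions, the total variation norm of the posteriors is not visibly measurable in the
measurement; \<open>t\<close> is a measurable version of it.\<close>
lemma
  fixes X :: "'w \<Rightarrow> 'x::second_countable_topology" and m :: "'x \<times> 'n \<Rightarrow> real" and l :: "'n \<Rightarrow> real"
  assumes R: "prob_space R" and W[measurable]: "W \<in> borel_measurable R" and P: "prob_space (density R W)"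
    and X[measurable]: "X \<in> R \<rightarrow>\<^sub>M borel" and Y[measurable]: "Y \<in> R \<rightarrow>\<^sub>M N"
    and q: "reg_cond_distr R X N Y q" and p: "reg_cond_distr (density R W) X N Y p"
    and m[measurable]: "m \<in> borel_measurable (borel \<Otimes>\<^sub>M N)" and l[measurable]: "l \<in> borel_measurable N"
    and m0: "\<And>z. 0 \<le> m z" and l0: "\<And>y. 0 \<le> l y"
    and m_eq: "\<And>\<phi>. \<phi> \<in> borel_measurable (borel \<Otimes>\<^sub>M N) \<Longrightarrow>
      (\<integral>\<^sup>+\<omega>. W \<omega> * \<phi> (X \<omega>, Y \<omega>) \<partial>R) = (\<integral>\<^sup>+\<omega>. ennreal (m (X \<omega>, Y \<omega>)) * \<phi> (X \<omega>, Y \<omega>) \<partial>R)"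
    and l_eq: "\<And>\<phi>. \<phi> \<in> borel_measurable N \<Longrightarrow>
      (\<integral>\<^sup>+\<omega>. W \<omega> * \<phi> (Y \<omega>) \<partial>R) = (\<integral>\<^sup>+\<omega>. ennreal (l (Y \<omega>)) * \<phi> (Y \<omega>) \<partial>R)"
  shows posterior_tv_norm: "\<exists>t\<in>borel_measurable N. (AE y in distr (density R W) N Y. ennreal (tv_norm (p y) (q y)) = t y) \<and>
      (\<forall>B\<in>sets N. (\<integral>\<^sup>+\<omega>. W \<omega> * (t (Y \<omega>) * indicator B (Y \<omega>)) \<partial>R)
         = (\<integral>\<^sup>+\<omega>. ennreal \<bar>m (X \<omega>, Y \<omega>) - l (Y \<omega>)\<bar> * indicator B (Y \<omega>) \<partial>R))"
    and posterior_rel_entropy: "(\<integral>\<^sup>+\<omega>. rel_entropy (p (Y \<omega>)) (q (Y \<omega>)) \<partial>density R W)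
      = (\<integral>\<^sup>+\<omega>. ennreal (l (Y \<omega>) * entropy_fn (m (X \<omega>, Y \<omega>) / l (Y \<omega>))) \<partial>R)"
proof -
  have pk[measurable]: "p \<in> N \<rightarrow>\<^sub>M prob_algebra borel" and qk[measurable]: "q \<in> N \<rightarrow>\<^sub>M prob_algebra borel"
    using p q by (simp_all add: reg_cond_distr_def)
  have sp: "sets (p y) = sets borel" "prob_space (p y)" "sets (q y) = sets borel" "prob_space (q y)" if "y \<in> space N" for y
    using measurable_space[OF pk that] measurable_space[OF qk that] by (simp_all add: space_prob_algebra)
  have RP: "AE y in distr (density R W) N Y. Pr y" if "AE y in distr R N Y. Pr y" for Pr
    by (rule absolutely_continuous_AE[OF _ absolutely_continuous_distr_density[OF W Y] that]) simp
  \<comment> \<open>A density is positive almost everywhere under the measure that it defines.\<close>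
  have lpos: "AE y in distr (density R W) N Y. 0 < l y"
  proof -
    have "(\<integral>\<^sup>+\<omega>. W \<omega> * indicator {y\<in>space N. \<not> 0 < l y} (Y \<omega>) \<partial>R) = (\<integral>\<^sup>+\<omega>. ennreal (l (Y \<omega>)) * indicator {y\<in>space N. \<not> 0 < l y} (Y \<omega>) \<partial>R)"
      by (rule l_eq) measurable
    also have "\<dots> = (\<integral>\<^sup>+\<omega>. 0 \<partial>R)"
      by (intro nn_integral_cong) (auto simp: indicator_def not_less ennreal_neg)
    finally have z: "(\<integral>\<^sup>+\<omega>. W \<omega> * indicator {y\<in>space N. \<not> 0 < l y} (Y \<omega>) \<partial>R) = 0" by simp
    have "emeasure (distr (density R W) N Y) {y\<in>space N. \<not> 0 < l y} = (\<integral>\<^sup>+y. indicator {y\<in>space N. \<not> 0 < l y} y \<partial>distr (density R W) N Y)"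
      by (intro nn_integral_indicator[symmetric]) simp
    also have "\<dots> = (\<integral>\<^sup>+\<omega>. W \<omega> * indicator {y\<in>space N. \<not> 0 < l y} (Y \<omega>) \<partial>R)"
      by (subst nn_integral_distr, simp, simp, subst nn_integral_density) (simp_all del: nn_integral_indicator)
    finally show ?thesis
      using z by (subst AE_iff_measurable[OF _ refl]) auto
  qed
  have base: "AE y in distr R N Y. y \<in> space N \<and> (\<forall>A\<in>sets borel. ennreal (l y) * emeasure (p y) A = (\<integral>\<^sup>+x. ennreal (m (x, y)) * indicator A x \<partial>q y))"
    using posterior_density[OF R W X Y q p m l m_eq l_eq] by (auto elim: AE_mp intro!: AE_I2)
  have my: "(\<lambda>x. m (x, y)) \<in> borel_measurable borel" if "y \<in> space N" for y
    using that by measurable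
  have tv: "AE y in distr R N Y. ennreal (l y) * ennreal (tv_norm (p y) (q y)) = (\<integral>\<^sup>+x. ennreal \<bar>m (x, y) - l y\<bar> \<partial>q y)"
    using base
  proof eventually_elim
    case (elim y)
    then show ?case
      by (intro scaled_tv_norm sp my m0 l0) auto
  qed
  have en: "AE y in distr R N Y. ennreal (l y) * rel_entropy (p y) (q y) = (\<integral>\<^sup>+x. ennreal (l y * entropy_fn (m (x, y) / l y)) \<partial>q y)"
    using base
  proof eventually_elim
    case (elim y)
    then show ?case
      by (intro scaled_rel_entropy sp my m0 l0) auto
  qed
  have divl: "ennreal (1 / l y) * (ennreal (l y) * c) = c" if "0 < l y" for y c
    using that by (simp add: mult.assoc[symmetric] ennreal_mult'[symmetric])
  have divl2: "ennreal (l y) * (ennreal (1 / l y) * c) = c" if "0 < l y" for y c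
    by (subst mult.left_commute) (rule divl[OF that])
  have [measurable]: "(\<lambda>y. \<integral>\<^sup>+x. ennreal \<bar>m (x, y) - l y\<bar> \<partial>q y) \<in> borel_measurable N"
    by (rule measurable_nn_integral_kernel[OF qk]) measurable
  have [measurable]: "(\<lambda>y. \<integral>\<^sup>+x. ennreal (l y * entropy_fn (m (x, y) / l y)) \<partial>q y) \<in> borel_measurable N"
    by (rule measurable_nn_integral_kernel[OF qk]) measurable
  show "\<exists>t\<in>borel_measurable N. (AE y in distr (density R W) N Y. ennreal (tv_norm (p y) (q y)) = t y) \<and>
      (\<forall>B\<in>sets N. (\<integral>\<^sup>+\<omega>. W \<omega> * (t (Y \<omega>) * indicator B (Y \<omega>)) \<partial>R)
         = (\<integral>\<^sup>+\<omega>. ennreal \<bar>m (X \<omega>, Y \<omega>) - l (Y \<omega>)\<bar> * indicator B (Y \<omega>) \<partial>R))"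
  proof (intro bexI conjI ballI)
    let ?t = "\<lambda>y. ennreal (1 / l y) * (\<integral>\<^sup>+x. ennreal \<bar>m (x, y) - l y\<bar> \<partial>q y)"
    show t: "?t \<in> borel_measurable N" by measurable
    show "AE y in distr (density R W) N Y. ennreal (tv_norm (p y) (q y)) = ?t y"
      using RP[OF tv] lpos
    proof eventually_elim
      case (elim y)
      show ?case by (simp only: elim(1)[symmetric] divl[OF elim(2)])
    qed
    fix B assume B[measurable]: "B \<in> sets N"
    have "(\<integral>\<^sup>+\<omega>. W \<omega> * (?t (Y \<omega>) * indicator B (Y \<omega>)) \<partial>R) = (\<integral>\<^sup>+\<omega>. ennreal (l (Y \<omega>)) * (?t (Y \<omega>) * indicator B (Y \<omega>)) \<partial>R)"
      by (rule l_eq) measurable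
    also have "\<dots> = (\<integral>\<^sup>+\<omega>. (\<integral>\<^sup>+x. ennreal \<bar>m (x, Y \<omega>) - l (Y \<omega>)\<bar> \<partial>q (Y \<omega>)) * indicator B (Y \<omega>) \<partial>R)"
    proof (rule nn_integral_cong_AE)
      show "AE \<omega> in R. ennreal (l (Y \<omega>)) * (?t (Y \<omega>) * indicator B (Y \<omega>))
        = (\<integral>\<^sup>+x. ennreal \<bar>m (x, Y \<omega>) - l (Y \<omega>)\<bar> \<partial>q (Y \<omega>)) * indicator B (Y \<omega>)"
        using AE_distrD[OF Y tv]
      proof eventually_elim
        case (elim \<omega>)
        then have "ennreal (l (Y \<omega>)) * ?t (Y \<omega>) = (\<integral>\<^sup>+x. ennreal \<bar>m (x, Y \<omega>) - l (Y \<omega>)\<bar> \<partial>q (Y \<omega>))"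
          using l0[of "Y \<omega>"] divl2[of "Y \<omega>"] by (cases "l (Y \<omega>) = 0") auto
        then show ?case by (simp add: mult.assoc[symmetric])
      qed
    qed
    also have "\<dots> = (\<integral>\<^sup>+\<omega>. \<integral>\<^sup>+x. ennreal \<bar>m (x, Y \<omega>) - l (Y \<omega>)\<bar> * indicator B (Y \<omega>) \<partial>q (Y \<omega>) \<partial>R)"
      by (intro nn_integral_cong) (auto split: split_indicator)
    also have "\<dots> = (\<integral>\<^sup>+\<omega>. ennreal \<bar>m (X \<omega>, Y \<omega>) - l (Y \<omega>)\<bar> * indicator B (Y \<omega>) \<partial>R)"
      using reg_cond_distr_nn_integral[OF R q X Y, of "\<lambda>(x, y). ennreal \<bar>m (x, y) - l y\<bar> * indicator B y"] by simp
    finally show "(\<integral>\<^sup>+\<omega>. W \<omega> * (?t (Y \<omega>) * indicator B (Y \<omega>)) \<partial>R)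
       = (\<integral>\<^sup>+\<omega>. ennreal \<bar>m (X \<omega>, Y \<omega>) - l (Y \<omega>)\<bar> * indicator B (Y \<omega>) \<partial>R)" .
  qed
  let ?e = "\<lambda>y. ennreal (1 / l y) * (\<integral>\<^sup>+x. ennreal (l y * entropy_fn (m (x, y) / l y)) \<partial>q y)"
  have "AE y in distr (density R W) N Y. rel_entropy (p y) (q y) = ?e y"
    using RP[OF en] lpos
  proof eventually_elim
    case (elim y)
    show ?case by (simp only: elim(1)[symmetric] divl[OF elim(2)])
  qed
  then have "AE \<omega> in density R W. rel_entropy (p (Y \<omega>)) (q (Y \<omega>)) = ?e (Y \<omega>)"
    by (rule AE_distrD[rotated]) simp
  then have "(\<integral>\<^sup>+\<omega>. rel_entropy (p (Y \<omega>)) (q (Y \<omega>)) \<partial>density R W) = (\<integral>\<^sup>+\<omega>. ?e (Y \<omega>) \<partial>density R W)"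
    by (rule nn_integral_cong_AE)
  also have "\<dots> = (\<integral>\<^sup>+\<omega>. W \<omega> * ?e (Y \<omega>) \<partial>R)"
    by (rule nn_integral_density) auto
  also have "\<dots> = (\<integral>\<^sup>+\<omega>. ennreal (l (Y \<omega>)) * ?e (Y \<omega>) \<partial>R)"
    by (rule l_eq) measurable
  also have "\<dots> = (\<integral>\<^sup>+\<omega>. (\<integral>\<^sup>+x. ennreal (l (Y \<omega>) * entropy_fn (m (x, Y \<omega>) / l (Y \<omega>))) \<partial>q (Y \<omega>)) \<partial>R)"
  proof (rule nn_integral_cong)
    fix \<omega>
    show "ennreal (l (Y \<omega>)) * ?e (Y \<omega>) = (\<integral>\<^sup>+x. ennreal (l (Y \<omega>) * entropy_fn (m (x, Y \<omega>) / l (Y \<omega>))) \<partial>q (Y \<omega>))"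
      using l0[of "Y \<omega>"]
      by (cases "l (Y \<omega>) = 0") (auto simp: mult.assoc[symmetric] ennreal_mult'[symmetric])
  qed
  also have "\<dots> = (\<integral>\<^sup>+\<omega>. ennreal (l (Y \<omega>) * entropy_fn (m (X \<omega>, Y \<omega>) / l (Y \<omega>))) \<partial>R)"
    using reg_cond_distr_nn_integral[OF R q X Y, of "\<lambda>(x, y). ennreal (l y * entropy_fn (m (x, y) / l y))"] by simp
  finally show "(\<integral>\<^sup>+\<omega>. rel_entropy (p (Y \<omega>)) (q (Y \<omega>)) \<partial>density R W)
      = (\<integral>\<^sup>+\<omega>. ennreal (l (Y \<omega>) * entropy_fn (m (X \<omega>, Y \<omega>) / l (Y \<omega>))) \<partial>R)" .
qed

section \<open>Forward and backward conditional expectations\<close>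

lemma sigma_finite_subalgebraI: "prob_space R \<Longrightarrow> subalgebra R F \<Longrightarrow> sigma_finite_subalgebra R F"
  by (intro finite_measure_subalgebra_is_sigma_finite finite_measure_subalgebra.intro prob_space.axioms(1)
      finite_measure_subalgebra_axioms.intro)

lemma (in sigma_finite_subalgebra) nn_integral_abs_cond_exp_le:
  assumes V[measurable]: "V \<in> borel_measurable M" and A[measurable]: "A \<in> sets F"
  shows "(\<integral>\<^sup>+x. ennreal \<bar>real_cond_exp M F V x\<bar> * indicator A x \<partial>M) \<le> (\<integral>\<^sup>+x. ennreal \<bar>V x\<bar> * indicator A x \<partial>M)"
proof -
  have "(\<integral>\<^sup>+x. ennreal \<bar>real_cond_exp M F V x\<bar> * indicator A x \<partial>M)
    \<le> (\<integral>\<^sup>+x. indicator A x * nn_cond_exp M F (\<lambda>x. ennreal \<bar>V x\<bar>) x \<partial>M)"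
    using real_cond_exp_abs[OF V]
    by (intro nn_integral_mono_AE) (auto elim!: eventually_mono split: split_indicator)
  also have "\<dots> = (\<integral>\<^sup>+x. indicator A x * ennreal \<bar>V x\<bar> \<partial>M)"
    by (intro nn_cond_exp_intg) auto
  finally show ?thesis by (simp add: mult.commute)
qed

locale filtration = prob_space R for R :: "'a measure" +
  fixes F :: "nat \<Rightarrow> 'a measure" and Z :: "'a \<Rightarrow> real"
  assumes F: "\<And>k. subalgebra R (F k)" and F_mono: "\<And>k l. k \<le> l \<Longrightarrow> subalgebra (F l) (F k)"
    and Z: "integrable R Z"
begin

abbreviation "L k \<equiv> real_cond_exp R (F k) Z"

lemma sub_F: "sigma_finite_subalgebra R (F k)"
  by (rule sigma_finite_subalgebraI[OF prob_space_axioms F])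

lemma L_measurable: "k \<le> l \<Longrightarrow> L k \<in> borel_measurable (F l)"
  by (rule measurable_from_subalg[OF F_mono]) auto

lemma L_integrable: "integrable R (L k)"
  using sigma_finite_subalgebra.real_cond_exp_int(1)[OF sub_F Z] .

lemma Z_meas[measurable]: "Z \<in> borel_measurable R"
  using Z by auto

text \<open>For bounded \<open>Z\<close> the increments are orthogonal in \<open>L\<^sup>2\<close>, so the energies \<open>E[L\<^sub>k\<^sup>2]\<close> increase and, being
bounded, form a Cauchy sequence whose differences are the squared \<open>L\<^sup>2\<close> distances.\<close>
lemma bounded_cond_exp_L1_Cauchy:
  fixes c :: real
  assumes bnd: "\<And>x. \<bar>Z x\<bar> \<le> c" and e: "0 < e"
  shows "\<exists>m0. \<forall>m\<ge>m0. \<forall>N\<ge>m. (\<integral>\<^sup>+x. ennreal \<bar>L N x - L m x\<bar> \<partial>R) \<le> ennreal e"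
proof -
  have Lc: "AE x in R. \<bar>L k x\<bar> \<le> c" for k
  proof -
    interpret sigma_finite_subalgebra R "F k" by (rule sub_F)
    have "AE x in R. L k x \<le> c"
      by (rule real_cond_exp_le_c[OF Z]) (use bnd in \<open>simp add: abs_le_iff\<close>)
    moreover have "AE x in R. - c \<le> L k x"
      by (rule real_cond_exp_ge_c[OF Z]) (use bnd in \<open>simp add: abs_le_iff minus_le_iff\<close>)
    ultimately show ?thesis by eventually_elim auto
  qed
  have Lc2: "AE x in R. \<bar>L k x * L j x\<bar> \<le> c * c" for k j
    using Lc[of k] Lc[of j] by eventually_elim (simp add: abs_mult mult_mono')
  have LL: "integrable R (\<lambda>x. L k x * L j x)" for k j
    using Lc2[of k j] by (intro integrable_const_bound[where B="c * c"]) auto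
  have LZ: "integrable R (\<lambda>x. L k x * Z x)" for k
  proof (rule integrable_const_bound[where B="c * c"])
    show "AE x in R. norm (L k x * Z x) \<le> c * c"
      using Lc[of k] by eventually_elim (simp add: abs_mult mult_mono' bnd)
  qed auto
  define a where "a k = (\<integral>x. L k x * L k x \<partial>R)" for k
  have proj: "(\<integral>x. L m x * L N x \<partial>R) = a m" if "m \<le> N" for m N
  proof -
    have "(\<integral>x. L m x * L k x \<partial>R) = (\<integral>x. L m x * Z x \<partial>R)" if "m \<le> k" for k
      by (rule sigma_finite_subalgebra.real_cond_exp_intg(2)[OF sub_F LZ L_measurable[OF that]]) simp
    from this[OF that] this[of m] show ?thesis by (simp add: a_def)
  qed
  have sq: "(\<integral>x. (L N x - L m x)\<^sup>2 \<partial>R) = a N - a m" if "m \<le> N" for m N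
  proof -
    have "(\<integral>x. (L N x - L m x)\<^sup>2 \<partial>R) = (\<integral>x. L N x * L N x - 2 * (L m x * L N x) + L m x * L m x \<partial>R)"
      by (intro Bochner_Integration.integral_cong) (auto simp: power2_eq_square algebra_simps)
    also have "\<dots> = a N - 2 * a m + a m"
      using LL by (simp add: proj[OF that] a_def[symmetric])
    finally show ?thesis by simp
  qed
  have mono: "a m \<le> a N" if "m \<le> N" for m N
  proof -
    have "0 \<le> (\<integral>x. (L N x - L m x)\<^sup>2 \<partial>R)" by (rule integral_nonneg_AE) simp
    then show ?thesis unfolding sq[OF that] by simp
  qed
  have "a k \<le> c * c" for k
  proof -
    have "a k \<le> (\<integral>x. c * c \<partial>R)"
      unfolding a_def using LL Lc2[of k k] by (intro integral_mono_AE) (auto elim: eventually_mono)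
    then show ?thesis by (simp add: prob_space)
  qed
  moreover have "0 \<le> a k" for k
    unfolding a_def by (rule integral_nonneg_AE) simp
  ultimately have "Bseq a"
    by (intro BseqI'[where K="c * c"]) simp
  then have "convergent a"
    using mono by (intro Bseq_monoseq_convergent monoI1) auto
  then have "Cauchy a" by (rule convergent_Cauchy)
  define \<delta> where "\<delta> = e / 2"
  have \<delta>: "0 < \<delta>" using e by (simp add: \<delta>_def)
  obtain m0 where m0: "\<And>m n. m \<ge> m0 \<Longrightarrow> n \<ge> m0 \<Longrightarrow> dist (a m) (a n) < \<delta> * \<delta>"
    using \<open>Cauchy a\<close> \<delta> unfolding Cauchy_def by (metis mult_pos_pos)
  show ?thesis
  proof (intro exI allI impI)
    fix m N assume mN: "m \<ge> m0" "N \<ge> m"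
    have i2: "integrable R (\<lambda>x. (L N x - L m x)\<^sup>2)"
    proof -
      have "(\<lambda>x. (L N x - L m x)\<^sup>2) = (\<lambda>x. L N x * L N x - 2 * (L m x * L N x) + L m x * L m x)"
        by (auto simp: power2_eq_square algebra_simps)
      then show ?thesis using LL by simp
    qed
    \<comment> \<open>Passes from \<open>L\<^sup>2\<close> to \<open>L\<^sup>1\<close> with integrals of real functions only.\<close>
    have "\<bar>x\<bar> \<le> \<delta> + x\<^sup>2 / \<delta>" for x :: real
    proof (cases "\<bar>x\<bar> \<le> \<delta>")
      case False
      then have "\<bar>x\<bar> * \<delta> \<le> \<bar>x\<bar> * \<bar>x\<bar>" by (intro mult_left_mono) auto
      then have "\<bar>x\<bar> \<le> x\<^sup>2 / \<delta>" using \<delta> by (simp add: pos_le_divide_eq power2_eq_square)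
      then show ?thesis using \<delta> by simp
    qed (use \<delta> in \<open>auto intro: add_increasing2\<close>)
    then have "(\<integral>x. \<bar>L N x - L m x\<bar> \<partial>R) \<le> (\<integral>x. \<delta> + (L N x - L m x)\<^sup>2 / \<delta> \<partial>R)"
      using L_integrable i2 by (intro integral_mono) auto
    also have "\<dots> = \<delta> + (a N - a m) / \<delta>"
      using i2 by (simp add: prob_space sq[OF mN(2)])
    also have "\<dots> \<le> \<delta> + \<delta>"
    proof -
      have "a N - a m \<le> \<delta> * \<delta>"
        using m0[of N m] mN by (auto simp: dist_real_def)
      then show ?thesis using \<delta> by (simp add: pos_divide_le_eq)
    qed
    finally have "(\<integral>x. \<bar>L N x - L m x\<bar> \<partial>R) \<le> e" by (simp add: \<delta>_def)
    then show "(\<integral>\<^sup>+x. ennreal \<bar>L N x - L m x\<bar> \<partial>R) \<le> ennreal e"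
      using L_integrable by (subst nn_integral_eq_integral) (auto intro: ennreal_leI)
  qed
qed

end

text \<open>Levy's upward theorem in the form of a Cauchy property. Truncation of \<open>Z\<close> reduces it to the bounded case, since
conditional expectation is a contraction of \<open>L\<^sup>1\<close>.\<close>
theorem (in filtration) cond_exp_L1_Cauchy:
  assumes e: "0 < e"
  shows "\<exists>m0. \<forall>m\<ge>m0. \<forall>N\<ge>m. (\<integral>\<^sup>+x. ennreal \<bar>L N x - L m x\<bar> \<partial>R) \<le> ennreal e"
proof -
  define T where "T c x = max (- real c) (min (real c) (Z x))" for c :: nat and x
  have [measurable]: "T c \<in> borel_measurable R" for c unfolding T_def by measurable
  have Tb: "\<bar>T c x\<bar> \<le> real c" for c x unfolding T_def by auto
  have iT: "integrable R (T c)" for c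
    by (rule integrable_const_bound[where B="real c"]) (auto simp: Tb)
  have "(\<lambda>c. \<integral>x. \<bar>Z x - T c x\<bar> \<partial>R) \<longlonglongrightarrow> (\<integral>x. 0 \<partial>R)"
  proof (rule integral_dominated_convergence[where w="\<lambda>x. \<bar>Z x\<bar>"])
    show "AE x in R. (\<lambda>c. \<bar>Z x - T c x\<bar>) \<longlonglongrightarrow> 0"
    proof (rule AE_I2)
      fix x
      obtain c0 where "\<bar>Z x\<bar> \<le> real c0" using real_arch_simple by blast
      then have "\<forall>c\<ge>c0. \<bar>Z x - T c x\<bar> = 0" by (auto simp: T_def max_def min_def)
      then show "(\<lambda>c. \<bar>Z x - T c x\<bar>) \<longlonglongrightarrow> 0"
        by (intro tendsto_eventually) (auto simp: eventually_sequentially)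
    qed
    show "AE x in R. norm \<bar>Z x - T c x\<bar> \<le> \<bar>Z x\<bar>" for c
      by (rule AE_I2) (auto simp: T_def max_def min_def)
  qed (use Z in auto)
  then have "eventually (\<lambda>c. (\<integral>x. \<bar>Z x - T c x\<bar> \<partial>R) < e / 3) sequentially"
    using e by (intro order_tendstoD(2)) auto
  then obtain c where c: "(\<integral>x. \<bar>Z x - T c x\<bar> \<partial>R) < e / 3"
    by (auto simp: eventually_sequentially)
  interpret T: filtration R F "T c"
    using F F_mono iT by unfold_locales
  obtain m0 where m0: "\<And>m N. m \<ge> m0 \<Longrightarrow> N \<ge> m \<Longrightarrow> (\<integral>\<^sup>+x. ennreal \<bar>T.L N x - T.L m x\<bar> \<partial>R) \<le> ennreal (e / 3)"
    using T.bounded_cond_exp_L1_Cauchy[OF Tb, of "e / 3"] e by (metis divide_pos_pos zero_less_numeral)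
  have near: "(\<integral>\<^sup>+x. ennreal \<bar>L k x - T.L k x\<bar> \<partial>R) \<le> ennreal (e / 3)" for k
  proof -
    interpret sigma_finite_subalgebra R "F k" by (rule sub_F)
    have "(\<integral>\<^sup>+x. ennreal \<bar>L k x - T.L k x\<bar> \<partial>R) = (\<integral>\<^sup>+x. ennreal \<bar>real_cond_exp R (F k) (\<lambda>x. Z x - T c x) x\<bar> * indicator (space R) x \<partial>R)"
    proof (rule nn_integral_cong_AE)
      show "AE x in R. ennreal \<bar>L k x - T.L k x\<bar> = ennreal \<bar>real_cond_exp R (F k) (\<lambda>x. Z x - T c x) x\<bar> * indicator (space R) x"
        using real_cond_exp_diff[OF Z iT[of c]] AE_space by eventually_elim simp
    qed
    also have "\<dots> \<le> (\<integral>\<^sup>+x. ennreal \<bar>Z x - T c x\<bar> * indicator (space R) x \<partial>R)"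
    proof (rule nn_integral_abs_cond_exp_le)
      show "space R \<in> sets (F k)"
        using F[of k] by (metis subalgebra_def sets.top)
    qed simp
    also have "\<dots> = (\<integral>\<^sup>+x. ennreal \<bar>Z x - T c x\<bar> \<partial>R)"
      by (intro nn_integral_cong) auto
    also have "\<dots> = ennreal (\<integral>x. \<bar>Z x - T c x\<bar> \<partial>R)"
      using Z iT by (intro nn_integral_eq_integral) auto
    also have "\<dots> \<le> ennreal (e / 3)" using c by (intro ennreal_leI) simp
    finally show ?thesis .
  qed
  show ?thesis
  proof (intro exI allI impI)
    fix m N assume mN: "m \<ge> m0" "N \<ge> m"
    have "(\<integral>\<^sup>+x. ennreal \<bar>L N x - L m x\<bar> \<partial>R)
      \<le> (\<integral>\<^sup>+x. ennreal \<bar>L N x - T.L N x\<bar> + (ennreal \<bar>T.L N x - T.L m x\<bar> + ennreal \<bar>L m x - T.L m x\<bar>) \<partial>R)"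
      by (intro nn_integral_mono) (simp flip: ennreal_plus)
    also have "\<dots> = (\<integral>\<^sup>+x. ennreal \<bar>L N x - T.L N x\<bar> \<partial>R) + ((\<integral>\<^sup>+x. ennreal \<bar>T.L N x - T.L m x\<bar> \<partial>R) + (\<integral>\<^sup>+x. ennreal \<bar>L m x - T.L m x\<bar> \<partial>R))"
      by (simp add: nn_integral_add)
    also have "\<dots> \<le> ennreal (e/3) + (ennreal (e/3) + ennreal (e/3))"
      by (intro add_mono near m0 mN)
    also have "\<dots> = ennreal e" using e by (simp flip: ennreal_plus)
    finally show "(\<integral>\<^sup>+x. ennreal \<bar>L N x - L m x\<bar> \<partial>R) \<le> ennreal e" .
  qed
qed

text \<open>The decreasing sigma fields \<open>G\<close> all contain the increasing sigma fields \<open>F\<close>. In the application, a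
later \<open>G\<close> forgets more of the past states but none of the measurements.\<close>
locale two_sided_filtration = filtration R F Z for R :: "'a measure" and F Z +
  fixes G :: "nat \<Rightarrow> 'a measure"
  assumes G: "\<And>n. subalgebra R (G n)" and G_anti: "\<And>n k. n \<le> k \<Longrightarrow> subalgebra (G n) (G k)"
    and F_le_G: "\<And>n k. subalgebra (G n) (F k)"
begin

abbreviation "M n \<equiv> real_cond_exp R (G n) Z"

lemma sub_G: "sigma_finite_subalgebra R (G k)"
  by (rule sigma_finite_subalgebraI[OF prob_space_axioms G])

lemma M_integrable: "integrable R (M k)"
  using sigma_finite_subalgebra.real_cond_exp_int(1)[OF sub_G Z] .

lemma sets_F: "A \<in> sets (F k) \<Longrightarrow> A \<in> sets R"
  using F[of k] by (auto simp: subalgebra_def)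

text \<open>\<open>M\<^sub>n - L\<^sub>j\<close> is the conditional expectation of \<open>M\<^sub>m - L\<^sub>j\<close> given \<open>G\<^sub>n\<close>, because \<open>L\<^sub>j\<close> is \<open>G\<^sub>n\<close>-measurable.\<close>
lemma backward_contraction:
  assumes "m \<le> n" "A \<in> sets (F k)"
  shows "(\<integral>\<^sup>+x. ennreal \<bar>M n x - L j x\<bar> * indicator A x \<partial>R) \<le> (\<integral>\<^sup>+x. ennreal \<bar>M m x - L j x\<bar> * indicator A x \<partial>R)"
proof -
  interpret sigma_finite_subalgebra R "G n" by (rule sub_G)
  have A: "A \<in> sets (G n)" using assms(2) F_le_G[of n k] by (auto simp: subalgebra_def)
  have LG: "L j \<in> borel_measurable (G n)" by (rule measurable_from_subalg[OF F_le_G[of n j]]) simp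
  have 1: "AE x in R. real_cond_exp R (G n) (\<lambda>x. M m x - L j x) x = M n x - L j x"
    using real_cond_exp_diff[OF M_integrable[of m] L_integrable[of j]]
      real_cond_exp_nested_subalg[OF G[of m] G_anti[OF assms(1)] Z] real_cond_exp_F_meas[OF L_integrable LG]
    by eventually_elim simp
  then have "(\<integral>\<^sup>+x. ennreal \<bar>M n x - L j x\<bar> * indicator A x \<partial>R)
    = (\<integral>\<^sup>+x. ennreal \<bar>real_cond_exp R (G n) (\<lambda>x. M m x - L j x) x\<bar> * indicator A x \<partial>R)"
    by (intro nn_integral_cong_AE) (auto elim: eventually_mono)
  also have "\<dots> \<le> (\<integral>\<^sup>+x. ennreal \<bar>M m x - L j x\<bar> * indicator A x \<partial>R)"
    using A by (intro nn_integral_abs_cond_exp_le) auto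
  finally show ?thesis .
qed

text \<open>Likewise, \<open>L\<^sub>k - L\<^sub>j\<close> is the conditional expectation of \<open>L\<^sub>N - L\<^sub>j\<close> given \<open>F\<^sub>k\<close>.\<close>
lemma forward_contraction:
  assumes "j \<le> k" "k \<le> N" "A \<in> sets (F k)"
  shows "(\<integral>\<^sup>+x. ennreal \<bar>L k x - L j x\<bar> * indicator A x \<partial>R) \<le> (\<integral>\<^sup>+x. ennreal \<bar>L N x - L j x\<bar> * indicator A x \<partial>R)"
proof -
  interpret sigma_finite_subalgebra R "F k" by (rule sub_F)
  have 1: "AE x in R. real_cond_exp R (F k) (\<lambda>x. L N x - L j x) x = L k x - L j x"
    using real_cond_exp_diff[OF L_integrable[of N] L_integrable[of j]]
      real_cond_exp_nested_subalg[OF F[of N] F_mono[OF assms(2)] Z] real_cond_exp_F_meas[OF L_integrable L_measurable[OF assms(1)]]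
    by eventually_elim simp
  then have "(\<integral>\<^sup>+x. ennreal \<bar>L k x - L j x\<bar> * indicator A x \<partial>R)
    = (\<integral>\<^sup>+x. ennreal \<bar>real_cond_exp R (F k) (\<lambda>x. L N x - L j x) x\<bar> * indicator A x \<partial>R)"
    by (intro nn_integral_cong_AE) (auto elim: eventually_mono)
  also have "\<dots> \<le> (\<integral>\<^sup>+x. ennreal \<bar>L N x - L j x\<bar> * indicator A x \<partial>R)"
    using assms by (intro nn_integral_abs_cond_exp_le) auto
  finally show ?thesis .
qed

text \<open>Here \<open>W\<close> is the density of the true measure, and \<open>t\<^sub>n\<close> plays the role of the total variation distance of
the filters at time \<open>n\<close>: its integrals over events in \<open>F\<^bsub>n+1\<^esub>\<close> under the true measure are those of
\<open>|M\<^sub>n - L\<^bsub>n+1\<^esub>|\<close> under the reference measure.\<close>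
context
  fixes W :: "'a \<Rightarrow> ennreal" and t :: "nat \<Rightarrow> 'a \<Rightarrow> ennreal"
  assumes W: "W \<in> borel_measurable R" and t: "\<And>n. t n \<in> borel_measurable (F (Suc n))"
    and tv: "\<And>n A. A \<in> sets (F (Suc n)) \<Longrightarrow> (\<integral>\<^sup>+x. W x * (t n x * indicator A x) \<partial>R)
      = (\<integral>\<^sup>+x. ennreal \<bar>M n x - L (Suc n) x\<bar> * indicator A x \<partial>R)"
begin

lemma t_meas[measurable]: "t n \<in> borel_measurable R"
  by (rule measurable_from_subalg[OF F t])

text \<open>As in Doob's inequality, the event is split according to the first time \<open>n\<close> at which \<open>t\<^sub>n\<close> exceeds \<open>e\<close>. On
that \<open>F\<^bsub>n+1\<^esub>\<close>-measurable piece, the mass is at most the integral of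
\<open>|M\<^sub>n - L\<^bsub>n+1\<^esub>| \<le> |M\<^sub>n - L\<^bsub>m+1\<^esub>| + |L\<^bsub>n+1\<^esub> - L\<^bsub>m+1\<^esub>|\<close> divided by \<open>e\<close>; the two contractions replace \<open>n\<close> by \<open>m\<close> in the first
term and by \<open>N\<close> in the second, after which the pieces can be summed.\<close>
lemma maximal_inequality:
  fixes e :: real
  assumes "m \<le> N" and e: "0 < e"
  shows "ennreal e * emeasure (density R W) {x\<in>space R. \<exists>n\<in>{m..N}. e < t n x}
    \<le> (\<integral>\<^sup>+x. ennreal \<bar>M m x - L (Suc m) x\<bar> \<partial>R) + (\<integral>\<^sup>+x. ennreal \<bar>L (Suc N) x - L (Suc m) x\<bar> \<partial>R)"
proof -
  note [measurable] = W
  \<comment> \<open>\<open>?A n\<close>: the first excess happens at time \<open>n\<close>.\<close>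
  let ?A = "\<lambda>n. {x\<in>space R. e < t n x \<and> (\<forall>i\<in>{m..<n}. t i x \<le> e)}"
  let ?V = "\<lambda>x. ennreal \<bar>M m x - L (Suc m) x\<bar> + ennreal \<bar>L (Suc N) x - L (Suc m) x\<bar>"
  have A: "?A n \<in> sets (F (Suc n))" for n
  proof -
    have t_le: "{x\<in>space (F (Suc n)). t i x \<le> e} \<in> sets (F (Suc n))"
      and t_gt: "{x\<in>space (F (Suc n)). e < t i x} \<in> sets (F (Suc n))" if "i \<le> n" for i
    proof -
      have ti: "t i \<in> borel_measurable (F (Suc n))"
        using that by (intro measurable_from_subalg[OF F_mono t]) simp
      have "t i -` {..ennreal e} \<inter> space (F (Suc n)) \<in> sets (F (Suc n))"
        "t i -` {ennreal e<..} \<inter> space (F (Suc n)) \<in> sets (F (Suc n))"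
        by (intro measurable_sets[OF ti] borel_closed borel_open closed_atMost open_greaterThan)+
      then show "{x\<in>space (F (Suc n)). t i x \<le> e} \<in> sets (F (Suc n))"
        "{x\<in>space (F (Suc n)). e < t i x} \<in> sets (F (Suc n))"
        by (simp_all add: vimage_def Int_def conj_commute)
    qed
    have "?A n = {x\<in>space (F (Suc n)). e < t n x} \<inter> {x\<in>space (F (Suc n)). \<forall>i\<in>{m..<n}. t i x \<le> e}"
    proof -
      have sp: "space (F (Suc n)) = space R"
        using F[of "Suc n"] by (simp add: subalgebra_def)
      show ?thesis
        unfolding sp by (simp only: set_eq_iff Int_iff mem_Collect_eq) iprover
    qed
    moreover have "{x\<in>space (F (Suc n)). \<forall>i\<in>{m..<n}. t i x \<le> e} \<in> sets (F (Suc n))"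
      by (rule sets.sets_Collect_finite_All) (simp_all add: t_le)
    ultimately show ?thesis using t_gt[of n] by simp
  qed
  have AR[measurable]: "?A n \<in> sets R" for n using sets_F[OF A] .
  have disj: "disjoint_family_on ?A {m..N}"
    unfolding disjoint_family_on_def
  proof (intro ballI impI)
    fix i j assume ij: "i \<in> {m..N}" "j \<in> {m..N}" "i \<noteq> j"
    have *: "?A a \<inter> ?A b = {}" if "a \<in> {m..<b}" for a b
    proof (rule ccontr)
      assume "?A a \<inter> ?A b \<noteq> {}"
      then obtain x where "e < t a x" "\<forall>i\<in>{m..<b}. t i x \<le> e" by blast
      with that show False by (meson leD)
    qed
    show "?A i \<inter> ?A j = {}"
    proof (cases "i < j")
      case True
      then show ?thesis using ij by (intro *) auto
    next
      case False
      then have "?A j \<inter> ?A i = {}" using ij by (intro *) auto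
      then show ?thesis by blast
    qed
  qed
  have U: "{x\<in>space R. \<exists>n\<in>{m..N}. e < t n x} = (\<Union>n\<in>{m..N}. ?A n)"
  proof (intro equalityI subsetI)
    fix x assume x: "x \<in> {x\<in>space R. \<exists>n\<in>{m..N}. e < t n x}"
    define n where "n = (LEAST n. n \<in> {m..N} \<and> e < t n x)"
    have n: "n \<in> {m..N} \<and> e < t n x"
      unfolding n_def by (rule LeastI_ex) (use x in blast)
    have "t i x \<le> e" if "i \<in> {m..<n}" for i
    proof (rule ccontr)
      assume "\<not> t i x \<le> e"
      then have "i \<in> {m..N} \<and> e < t i x" using that n by auto
      then have "n \<le> i" unfolding n_def by (rule Least_le)
      with that show False by simp
    qed
    then have "x \<in> ?A n" using n x by blast
    then show "x \<in> (\<Union>n\<in>{m..N}. ?A n)" using n by blast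
  qed blast
  have step: "ennreal e * emeasure (density R W) (?A n) \<le> (\<integral>\<^sup>+x. ?V x * indicator (?A n) x \<partial>R)" if n: "n \<in> {m..N}" for n
  proof -
    have "ennreal e * emeasure (density R W) (?A n) = (\<integral>\<^sup>+x. ennreal e * (W x * indicator (?A n) x) \<partial>R)"
      by (subst emeasure_density) (auto simp: nn_integral_cmult)
    also have "\<dots> \<le> (\<integral>\<^sup>+x. W x * (t n x * indicator (?A n) x) \<partial>R)"
      by (intro nn_integral_mono) (auto split: split_indicator simp: mult.commute[of "ennreal e"] intro!: mult_left_mono)
    also have "\<dots> = (\<integral>\<^sup>+x. ennreal \<bar>M n x - L (Suc n) x\<bar> * indicator (?A n) x \<partial>R)"
      by (rule tv[OF A])
    also have "\<dots> \<le> (\<integral>\<^sup>+x. ennreal \<bar>M n x - L (Suc m) x\<bar> * indicator (?A n) x + ennreal \<bar>L (Suc n) x - L (Suc m) x\<bar> * indicator (?A n) x \<partial>R)"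
      by (intro nn_integral_mono) (auto split: split_indicator simp flip: ennreal_plus)
    also have "\<dots> = (\<integral>\<^sup>+x. ennreal \<bar>M n x - L (Suc m) x\<bar> * indicator (?A n) x \<partial>R) + (\<integral>\<^sup>+x. ennreal \<bar>L (Suc n) x - L (Suc m) x\<bar> * indicator (?A n) x \<partial>R)"
      by (intro nn_integral_add) auto
    also have "\<dots> \<le> (\<integral>\<^sup>+x. ennreal \<bar>M m x - L (Suc m) x\<bar> * indicator (?A n) x \<partial>R) + (\<integral>\<^sup>+x. ennreal \<bar>L (Suc N) x - L (Suc m) x\<bar> * indicator (?A n) x \<partial>R)"
      using n by (intro add_mono backward_contraction[OF _ A] forward_contraction[OF _ _ A]) auto
    also have "\<dots> = (\<integral>\<^sup>+x. ?V x * indicator (?A n) x \<partial>R)"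
      by (subst nn_integral_add[symmetric]) (auto simp: distrib_right)
    finally show ?thesis .
  qed
  have "ennreal e * emeasure (density R W) {x\<in>space R. \<exists>n\<in>{m..N}. e < t n x} = (\<Sum>n\<in>{m..N}. ennreal e * emeasure (density R W) (?A n))"
  proof -
    have "(\<Sum>n\<in>{m..N}. emeasure (density R W) (?A n)) = emeasure (density R W) (\<Union>n\<in>{m..N}. ?A n)"
      using disj by (intro sum_emeasure) auto
    then show ?thesis by (simp only: U sum_distrib_left[symmetric])
  qed
  also have "\<dots> \<le> (\<Sum>n\<in>{m..N}. (\<integral>\<^sup>+x. ?V x * indicator (?A n) x \<partial>R))"
    by (rule sum_mono[OF step])
  also have "\<dots> = (\<integral>\<^sup>+x. ?V x * indicator (\<Union>n\<in>{m..N}. ?A n) x \<partial>R)"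
  proof (subst nn_integral_sum[symmetric])
    show "(\<integral>\<^sup>+x. (\<Sum>n\<in>{m..N}. ?V x * indicator (?A n) x) \<partial>R) = (\<integral>\<^sup>+x. ?V x * indicator (\<Union>n\<in>{m..N}. ?A n) x \<partial>R)"
      by (simp only: sum_distrib_left[symmetric] indicator_UN_disjoint[OF finite_atLeastAtMost disj])
  qed measurable
  also have "\<dots> \<le> (\<integral>\<^sup>+x. ?V x \<partial>R)"
    by (intro nn_integral_mono) (auto split: split_indicator)
  also have "\<dots> = (\<integral>\<^sup>+x. ennreal \<bar>M m x - L (Suc m) x\<bar> \<partial>R) + (\<integral>\<^sup>+x. ennreal \<bar>L (Suc N) x - L (Suc m) x\<bar> \<partial>R)"
    by (intro nn_integral_add) auto
  finally show ?thesis .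
qed

text \<open>If the gaps tend to \<open>0\<close>, both terms of the maximal inequality are small for large \<open>m\<close>, uniformly in \<open>N\<close>.\<close>
lemma eventually_small:
  fixes e :: real
  assumes d: "(\<lambda>n. \<integral>\<^sup>+x. ennreal \<bar>M n x - L (Suc n) x\<bar> \<partial>R) \<longlonglongrightarrow> 0" and e: "0 < e"
  shows "AE x in density R W. eventually (\<lambda>n. t n x \<le> e) sequentially"
proof -
  note [measurable] = W
  let ?P = "density R W"
  let ?B = "\<lambda>m. {x\<in>space R. \<exists>n\<ge>m. e < t n x}"
  let ?C = "{x\<in>space R. \<forall>m. \<exists>n\<ge>m. e < t n x}"
  have bound: "ennreal e * emeasure ?P ?C \<le> ennreal \<eta>" if \<eta>: "0 < \<eta>" for \<eta>
  proof -
    obtain m0 where m0: "\<And>m N. m \<ge> m0 \<Longrightarrow> N \<ge> m \<Longrightarrow> (\<integral>\<^sup>+x. ennreal \<bar>L N x - L m x\<bar> \<partial>R) \<le> ennreal (\<eta>/2)"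
      using cond_exp_L1_Cauchy[of "\<eta>/2"] \<eta> by (metis half_gt_zero)
    have "eventually (\<lambda>n. (\<integral>\<^sup>+x. ennreal \<bar>M n x - L (Suc n) x\<bar> \<partial>R) < ennreal (\<eta>/2)) sequentially"
      using d \<eta> by (intro order_tendstoD(2)) auto
    then obtain m1 where m1: "\<And>n. n \<ge> m1 \<Longrightarrow> (\<integral>\<^sup>+x. ennreal \<bar>M n x - L (Suc n) x\<bar> \<partial>R) < ennreal (\<eta>/2)"
      by (auto simp: eventually_sequentially)
    define m where "m = max m0 m1"
    have fin: "ennreal e * emeasure ?P {x\<in>space R. \<exists>n\<in>{m..m + N}. e < t n x} \<le> ennreal \<eta>" for N
    proof -
      have "ennreal e * emeasure ?P {x\<in>space R. \<exists>n\<in>{m..m + N}. e < t n x}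
        \<le> (\<integral>\<^sup>+x. ennreal \<bar>M m x - L (Suc m) x\<bar> \<partial>R) + (\<integral>\<^sup>+x. ennreal \<bar>L (Suc (m + N)) x - L (Suc m) x\<bar> \<partial>R)"
        by (rule maximal_inequality) (use e in auto)
      also have "\<dots> \<le> ennreal (\<eta>/2) + ennreal (\<eta>/2)"
        by (intro add_mono m0 less_imp_le[OF m1]) (auto simp: m_def)
      finally show ?thesis using \<eta> by (simp flip: ennreal_plus)
    qed
    have "emeasure ?P ?C \<le> emeasure ?P (\<Union>N. {x\<in>space R. \<exists>n\<in>{m..m + N}. e < t n x})"
    proof (intro emeasure_mono subsetI)
      fix x assume "x \<in> ?C"
      then obtain n where "x \<in> space R" "n \<ge> m" "e < t n x" by auto
      then show "x \<in> (\<Union>N. {x\<in>space R. \<exists>n\<in>{m..m + N}. e < t n x})"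
        by (auto intro!: exI[of _ "n - m"] bexI[of _ n])
    qed auto
    also have "\<dots> = (SUP N. emeasure ?P {x\<in>space R. \<exists>n\<in>{m..m + N}. e < t n x})"
      by (intro SUP_emeasure_incseq[symmetric]) (auto simp: incseq_def)
    finally have "ennreal e * emeasure ?P ?C \<le> ennreal e * (SUP N. emeasure ?P {x\<in>space R. \<exists>n\<in>{m..m + N}. e < t n x})"
      by (intro mult_left_mono) auto
    also have "\<dots> \<le> ennreal \<eta>"
      unfolding SUP_mult_left_ennreal by (intro SUP_least fin)
    finally show ?thesis .
  qed
  have "ennreal e * emeasure ?P ?C = 0"
  proof (rule ccontr)
    assume "ennreal e * emeasure ?P ?C \<noteq> 0"
    then have "0 < ennreal e * emeasure ?P ?C" by (simp add: zero_less_iff_neq_zero)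
    then obtain y where y: "0 < y" "y < ennreal e * emeasure ?P ?C" using dense by blast
    moreover from y obtain \<eta> where "y = ennreal \<eta>" "0 < \<eta>"
      by (cases y) (auto simp: top_unique less_top)
    ultimately show False using bound[of \<eta>] by (simp add: not_le[symmetric])
  qed
  then have "emeasure ?P ?C = 0" using e by simp
  then have "AE x in ?P. x \<notin> ?C"
    by (intro AE_not_in) (auto simp: null_sets_def)
  then show ?thesis
    by (rule AE_mp) (auto intro!: AE_I2 simp: eventually_sequentially not_less)
qed

theorem AE_tendsto_0:
  assumes d: "(\<lambda>n. \<integral>\<^sup>+x. ennreal \<bar>M n x - L (Suc n) x\<bar> \<partial>R) \<longlonglongrightarrow> 0"
  shows "AE x in density R W. (\<lambda>n. t n x) \<longlonglongrightarrow> 0"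
proof -
  have "AE x in density R W. \<forall>j::nat. eventually (\<lambda>n. t n x \<le> 1 / Suc j) sequentially"
    unfolding AE_all_countable
  proof
    fix j :: nat
    have "AE x in density R W. eventually (\<lambda>n. t n x \<le> ennreal (1 / Suc j)) sequentially"
      by (rule eventually_small[OF d]) simp
    then show "AE x in density R W. eventually (\<lambda>n. t n x \<le> 1 / Suc j) sequentially"
      by simp
  qed
  then show ?thesis
  proof eventually_elim
    case (elim x)
    show ?case
    proof (rule order_tendstoI)
      fix a :: ennreal assume "0 < a"
      then obtain y where y: "0 < y" "y < a" using dense by blast
      moreover from y obtain \<eta> where \<eta>: "y = ennreal \<eta>" "0 < \<eta>"
        by (cases y) (auto simp: top_unique less_top)
      obtain j where j: "1 / Suc j < \<eta>" using nat_approx_posE[OF \<eta>(2)] by blast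
      have "eventually (\<lambda>n. t n x \<le> ennreal (1 / Suc j)) sequentially" using elim by simp
      then show "eventually (\<lambda>n. t n x < a) sequentially"
      proof eventually_elim
        case (elim n)
        also have "ennreal (1 / Suc j) < ennreal \<eta>" using j by (simp add: ennreal_lessI \<eta>(2))
        finally show ?case using y \<eta> by simp
      qed
    qed auto
  qed
qed

end

end

section \<open>Entropy of conditional densities\<close>

text \<open>The part of \<open>entropy_fn\<close> above its tangent at \<open>exp K\<close>, cut off to the left of the point of tangency: convex, below
\<open>entropy_fn\<close>, and zero on bounded sets for large \<open>K\<close>. By Jensen's inequality its integral decreases
under conditional expectation, which is how uniform integrability of the entropies is expressed.\<close>
definition entropy_tail :: "real \<Rightarrow> real \<Rightarrow> real" where
  "entropy_tail K t = (if exp K \<le> t then t * ln t - (K + 1) * t + exp K else 0)"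

lemma borel_measurable_entropy_tail[measurable]: "entropy_tail K \<in> borel_measurable borel"
  unfolding entropy_tail_def[abs_def] by measurable

lemma entropy_fn_tangent:
  assumes "0 < s" "0 \<le> t"
  shows "entropy_fn s + ln s * (t - s) \<le> entropy_fn t"
  using entropy_fn_young[OF assms(2), of "ln s"] assms(1) by (simp add: entropy_fn_def algebra_simps)

lemma entropy_tail_nonneg: "0 \<le> entropy_tail K t"
  using entropy_fn_young[of t K] order_trans[OF exp_ge_zero[of K], of t]
  by (auto simp: entropy_tail_def entropy_fn_def algebra_simps)

lemma entropy_tail_le:
  assumes K: "0 \<le> K" and t: "0 \<le> t"
  shows "entropy_tail K t \<le> entropy_fn t"
proof (cases "exp K \<le> t")
  case True
  then have "K * exp K \<le> K * t" using K by (rule mult_left_mono)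
  moreover have "0 \<le> entropy_fn (exp K)" by (rule entropy_fn_nonneg) simp
  ultimately show ?thesis using True by (simp add: entropy_tail_def entropy_fn_def algebra_simps)
qed (simp add: entropy_tail_def entropy_fn_nonneg t)

lemma entropy_tail_tangent:
  assumes "exp K \<le> s"
  shows "entropy_tail K s + (ln s - K) * (t - s) \<le> entropy_tail K t"
proof -
  have s: "0 < s" using assms by (rule less_le_trans[OF exp_gt_zero])
  have eq: "entropy_tail K s + (ln s - K) * (t - s) = t * (ln s - K) - (s - exp K)"
    using assms by (simp add: entropy_tail_def algebra_simps)
  show ?thesis
  proof (cases "exp K \<le> t")
    case True
    then have "0 \<le> t" by (rule order_trans[OF exp_ge_zero])
    from entropy_fn_young[OF this, of "ln s"] True s show ?thesis
      unfolding eq by (simp add: entropy_tail_def entropy_fn_def algebra_simps)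
  next
    case False
    have lK: "K \<le> ln s" using assms s by (simp add: ln_ge_iff)
    have "t * (ln s - K) \<le> exp K * (ln s - K)"
      using False lK by (intro mult_right_mono) auto
    also have "\<dots> \<le> exp K * (exp (ln s - K) - 1)"
    proof (rule mult_left_mono)
      show "ln s - K \<le> exp (ln s - K) - 1"
        using exp_ge_add_one_self[of "ln s - K"] by linarith
    qed simp
    also have "\<dots> = s - exp K"
      using s by (simp add: exp_diff right_diff_distrib)
    finally show ?thesis unfolding eq using False by (simp add: entropy_tail_def)
  qed
qed

text \<open>A function with a supporting line at every point is convex.\<close>
lemma convex_entropy_tail: "convex_on UNIV (entropy_tail K)"
proof (rule convex_onI)
  fix u x y :: real assume u: "0 < u" "u < 1"
  let ?z = "(1 - u) *\<^sub>R x + u *\<^sub>R y"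
  define c where "c = (if exp K \<le> ?z then ln ?z - K else 0)"
  have sup: "entropy_tail K ?z + c * (t - ?z) \<le> entropy_tail K t" for t
  proof (cases "exp K \<le> ?z")
    case True then show ?thesis using entropy_tail_tangent[OF True, of t] by (simp add: c_def)
  next
    case False then show ?thesis using entropy_tail_nonneg[of K t] by (simp add: c_def entropy_tail_def)
  qed
  have "(1 - u) * (entropy_tail K ?z + c * (x - ?z)) + u * (entropy_tail K ?z + c * (y - ?z))
      \<le> (1 - u) * entropy_tail K x + u * entropy_tail K y"
    using u by (intro add_mono mult_left_mono sup) auto
  moreover have "(1 - u) * (entropy_tail K ?z + c * (x - ?z)) + u * (entropy_tail K ?z + c * (y - ?z)) = entropy_tail K ?z"
    by (simp add: algebra_simps)
  ultimately show "entropy_tail K ?z \<le> (1 - u) * entropy_tail K x + u * entropy_tail K y" by simp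
qed simp

text \<open>Between \<open>exp (- K)\<close> and \<open>exp K\<close> the slope of \<open>entropy_fn\<close> is at most \<open>K\<close> in absolute value. The excess above is
\<open>entropy_tail\<close>; below, the function differs from the tangent at \<open>exp (- K)\<close> by at most \<open>exp (- K)\<close>.\<close>
lemma entropy_fn_diff_le:
  assumes K: "0 \<le> K" and g: "0 \<le> g" and l: "0 < l"
  shows "entropy_fn g - entropy_fn l \<le> K * \<bar>g - l\<bar> + entropy_tail K g + exp (- K)"
proof -
  consider "exp K \<le> g" | "exp (- K) < g" "g < exp K" | "g \<le> exp (- K)" by linarith
  then show ?thesis
  proof cases
    case 1
    then have "entropy_fn g = entropy_tail K g + K * g - (exp K - 1)"
      by (simp add: entropy_tail_def entropy_fn_def algebra_simps)
    moreover have "K * l - (exp K - 1) \<le> entropy_fn l" using l by (intro entropy_fn_young) simp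
    moreover have "K * (g - l) \<le> K * \<bar>g - l\<bar>" using K by (intro mult_left_mono) auto
    ultimately show ?thesis by (simp add: right_diff_distrib add_increasing2)
  next
    case 2
    have g0: "0 < g" using 2(1) by (rule less_trans[OF exp_gt_zero])
    have "-K < ln g" "ln g < K"
      by (metis 2(1) exp_less_cancel_iff exp_ln g0) (metis 2(2) exp_less_cancel_iff exp_ln g0)
    then have "\<bar>ln g\<bar> \<le> K" by auto
    then have "\<bar>ln g\<bar> * \<bar>g - l\<bar> \<le> K * \<bar>g - l\<bar>" by (rule mult_right_mono) simp
    then have "ln g * (g - l) \<le> K * \<bar>g - l\<bar>"
      using abs_ge_self[of "ln g * (g - l)"] unfolding abs_mult by linarith
    moreover have "entropy_fn g + ln g * (l - g) \<le> entropy_fn l"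
      using l g0 by (intro entropy_fn_tangent) auto
    moreover have "ln g * (l - g) = - (ln g * (g - l))" by (simp add: algebra_simps)
    ultimately show ?thesis
      using entropy_tail_nonneg[of K g] exp_ge_zero[of "- K"] by linarith
  next
    case 3
    have "entropy_fn g \<le> 1 - K * g"
    proof (cases "g = 0")
      case False
      with g have g0: "0 < g" by simp
      have "ln g \<le> - K" using 3 g0 by (metis exp_le_cancel_iff exp_ln)
      then have "g * ln g \<le> g * (- K)" using g by (rule mult_left_mono)
      then show ?thesis using g by (simp add: entropy_fn_def algebra_simps)
    qed (simp add: entropy_fn_def)
    moreover have "(- K) * l - (exp (- K) - 1) \<le> entropy_fn l" using l by (intro entropy_fn_young) simp
    moreover have "K * (l - g) \<le> K * \<bar>g - l\<bar>" using K by (intro mult_left_mono) auto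
    ultimately show ?thesis
      using entropy_tail_nonneg[of K g] by (simp add: algebra_simps)
  qed
qed

text \<open>\<open>l * entropy_fn (g / l)\<close> is the Bregman distance of \<open>entropy_fn\<close> from \<open>l\<close> to \<open>g\<close>, whose linear term
\<open>ln l * (g - l)\<close> is not controlled by \<open>|g - l|\<close> alone. Its slope is clipped to \<open>[-K, K]\<close>, and the
remainder is kept as the last term, which integrates to zero, over sets where \<open>ln l\<close> is bounded, when
\<open>l\<close> is a conditional expectation of \<open>g\<close>.\<close>
lemma scaled_entropy_fn_le:
  assumes K: "0 \<le> K" and g: "0 \<le> g" and l: "0 < l"
  defines "c \<equiv> max (- K) (min K (ln l))"
  shows "l * entropy_fn (g / l) \<le> 2 * K * \<bar>g - l\<bar> + entropy_tail K g + exp (- K) - (ln l - c) * (g - l)"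
proof -
  have "l * entropy_fn (g / l) = entropy_fn g - entropy_fn l - ln l * (g - l)"
  proof (cases "g = 0")
    case False
    with g have "0 < g" by simp
    then show ?thesis using l by (simp add: entropy_fn_def ln_div field_simps)
  qed (use l in \<open>simp add: entropy_fn_def algebra_simps\<close>)
  moreover have "- c * (g - l) \<le> K * \<bar>g - l\<bar>"
  proof -
    have "\<bar>c\<bar> \<le> K" using K by (auto simp: c_def)
    then have "\<bar>c\<bar> * \<bar>g - l\<bar> \<le> K * \<bar>g - l\<bar>" by (rule mult_right_mono) simp
    then show ?thesis
      using abs_ge_self[of "- c * (g - l)"] unfolding abs_mult abs_minus_cancel by linarith
  qed
  ultimately show ?thesis
    using entropy_fn_diff_le[OF K g l] by (simp add: algebra_simps)
qed

lemma (in prob_space) entropy_tail_integral_tendsto_0: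
  assumes m[measurable]: "m \<in> borel_measurable M" and m0: "AE x in M. 0 \<le> m x"
    and ent: "integrable M (\<lambda>x. entropy_fn (m x))"
  shows "(\<lambda>K::nat. \<integral>x. entropy_tail (real K) (m x) \<partial>M) \<longlonglongrightarrow> 0"
proof -
  have "(\<lambda>K::nat. \<integral>x. entropy_tail (real K) (m x) \<partial>M) \<longlonglongrightarrow> (\<integral>x. 0 \<partial>M)"
  proof (rule integral_dominated_convergence[where w="\<lambda>x. entropy_fn (m x)"])
    show "AE x in M. (\<lambda>K::nat. entropy_tail (real K) (m x)) \<longlonglongrightarrow> 0"
    proof (rule AE_I2)
      fix x
      obtain K0 :: nat where K0: "m x < real K0" using reals_Archimedean2 by blast
      have "entropy_tail (real K) (m x) = 0" if "K \<ge> K0" for K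
      proof -
        have "m x < real K" using K0 that by simp
        also have "\<dots> < exp (real K)" using exp_ge_add_one_self[of "real K"] by linarith
        finally show ?thesis by (simp add: entropy_tail_def)
      qed
      then show "(\<lambda>K::nat. entropy_tail (real K) (m x)) \<longlonglongrightarrow> 0"
        by (intro tendsto_eventually) (auto simp: eventually_sequentially)
    qed
    show "AE x in M. norm (entropy_tail (real K) (m x)) \<le> entropy_fn (m x)" for K
      using m0 by eventually_elim (simp add: entropy_tail_nonneg entropy_tail_le)
  qed (use ent in auto)
  then show ?thesis by simp
qed

text \<open>The entropy of \<open>g = E[m | G]\<close> relative to the coarser \<open>l = E[m | F]\<close> is small if \<open>E|g - l|\<close> is small, with
an error that depends only on \<open>m\<close> and \<open>K\<close>. The pointwise bound is integrated; the tail of \<open>g\<close> is at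
most that of \<open>m\<close> by Jensen's inequality, and the last term vanishes because \<open>g - l\<close> is orthogonal to
bounded functions of \<open>l\<close>.\<close>
lemma cond_entropy_gap_le:
  fixes S F G :: "'a measure" and m :: "'a \<Rightarrow> real"
  assumes S: "prob_space S" and F: "subalgebra S F" and G: "subalgebra S G" and FG: "subalgebra G F"
    and m: "integrable S m" "AE x in S. 0 \<le> m x" and ent: "integrable S (\<lambda>x. entropy_fn (m x))"
    and K: "0 \<le> K"
  defines "l \<equiv> real_cond_exp S F m" and "g \<equiv> real_cond_exp S G m"
  shows "(\<integral>\<^sup>+x. ennreal (l x * entropy_fn (g x / l x)) \<partial>S)
    \<le> ennreal (2 * K * (\<integral>x. \<bar>g x - l x\<bar> \<partial>S) + (\<integral>x. entropy_tail K (m x) \<partial>S) + exp (- K))"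
proof -
  interpret S: prob_space S by fact
  interpret F: sigma_finite_subalgebra S F by (rule sigma_finite_subalgebraI[OF S F])
  interpret G: sigma_finite_subalgebra S G by (rule sigma_finite_subalgebraI[OF S G])
  have [measurable]: "m \<in> borel_measurable S" using m by auto
  have lF[measurable]: "l \<in> borel_measurable F" and lS[measurable]: "l \<in> borel_measurable S"
    and gS[measurable]: "g \<in> borel_measurable S" unfolding l_def g_def by auto
  have il: "integrable S l" and ig: "integrable S g"
    unfolding l_def g_def using F.real_cond_exp_int G.real_cond_exp_int m by auto
  have l0: "AE x in S. 0 \<le> l x" and g0: "AE x in S. 0 \<le> g x"
    unfolding l_def g_def by (auto intro!: F.real_cond_exp_pos[OF m(2)] G.real_cond_exp_pos[OF m(2)])
  have tail_int: "integrable S (\<lambda>x. entropy_tail K (m x))"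
  proof (rule Bochner_Integration.integrable_bound[OF ent])
    show "AE x in S. norm (entropy_tail K (m x)) \<le> norm (entropy_fn (m x))"
      using m(2) by eventually_elim (simp add: entropy_tail_nonneg entropy_fn_nonneg entropy_tail_le K)
  qed simp
  have jensen: "AE x in S. entropy_tail K (g x) \<le> real_cond_exp S G (\<lambda>x. entropy_tail K (m x)) x"
    unfolding g_def using G.real_cond_exp_jensens_inequality(2)[OF m(1), of UNIV _ _ "entropy_tail K"]
      tail_int convex_entropy_tail by auto
  have tail_g: "integrable S (\<lambda>x. entropy_tail K (g x))"
  proof (rule Bochner_Integration.integrable_bound[OF G.real_cond_exp_int(1)[OF tail_int]])
    show "AE x in S. norm (entropy_tail K (g x)) \<le> norm (real_cond_exp S G (\<lambda>x. entropy_tail K (m x)) x)"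
      using jensen by eventually_elim (use entropy_tail_nonneg in \<open>auto intro: order_trans\<close>)
  qed simp
  have tail_le: "(\<integral>x. entropy_tail K (g x) \<partial>S) \<le> (\<integral>x. entropy_tail K (m x) \<partial>S)"
  proof -
    have "(\<integral>x. entropy_tail K (g x) \<partial>S) \<le> (\<integral>x. real_cond_exp S G (\<lambda>x. entropy_tail K (m x)) x \<partial>S)"
      by (rule integral_mono_AE[OF tail_g G.real_cond_exp_int(1)[OF tail_int] jensen])
    then show ?thesis by (simp add: G.real_cond_exp_int(2)[OF tail_int])
  qed
  let ?B = "2 * K * (\<integral>x. \<bar>g x - l x\<bar> \<partial>S) + (\<integral>x. entropy_tail K (m x) \<partial>S) + exp (- K)"
  \<comment> \<open>On these sets \<open>ln l\<close> is bounded, so the orthogonality can be used; they exhaust \<open>{l > 0}\<close>.\<close>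
  let ?C = "\<lambda>j::nat. {x\<in>space F. 1 / Suc j \<le> l x \<and> l x \<le> Suc j}"
  have C[measurable]: "?C j \<in> sets F" for j by measurable
  have CS[measurable]: "?C j \<in> sets S" for j using C[of j] F by (auto simp: subalgebra_def)
  have local: "(\<integral>\<^sup>+x. ennreal (l x * entropy_fn (g x / l x)) * indicator (?C j) x \<partial>S) \<le> ennreal ?B" for j
  proof -
    define u where "u x = indicator (?C j) x * (ln (l x) - max (- K) (min K (ln (l x))))" for x
    have uF[measurable]: "u \<in> borel_measurable F" unfolding u_def by measurable
    have uS[measurable]: "u \<in> borel_measurable S" by (rule measurable_from_subalg[OF F uF])
    have uG: "u \<in> borel_measurable G" by (rule measurable_from_subalg[OF FG uF])
    have ub: "\<bar>u x\<bar> \<le> ln (Suc j) + K" for x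
    proof (cases "x \<in> ?C j")
      case True
      then have lx: "1 / Suc j \<le> l x" "l x \<le> Suc j" by auto
      have l0: "0 < l x" using lx(1) by (rule less_le_trans[rotated]) simp
      have "ln (l x) \<le> ln (Suc j)" using lx l0 by simp
      moreover have "ln (1 / Suc j) \<le> ln (l x)" using lx l0 by (subst ln_le_cancel_iff) auto
      ultimately have "\<bar>ln (l x)\<bar> \<le> ln (Suc j)" by (simp add: ln_div abs_le_iff)
      then show ?thesis using True K by (auto simp: u_def)
    qed (use K in \<open>simp add: u_def\<close>)
    have iu: "integrable S (\<lambda>x. u x * f x)" if f: "integrable S f" for f
    proof (rule Bochner_Integration.integrable_bound)
      show "integrable S (\<lambda>x. (ln (Suc j) + K) * f x)" using f by simp
      have "0 \<le> ln (Suc j) + K" using K by simp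
      then show "AE x in S. norm (u x * f x) \<le> norm ((ln (Suc j) + K) * f x)"
        using ub by (intro AE_I2) (auto simp: abs_mult intro!: mult_right_mono)
      show "(\<lambda>x. u x * f x) \<in> borel_measurable S" using f by simp
    qed
    have "(\<integral>x. u x * g x \<partial>S) = (\<integral>x. u x * l x \<partial>S)"
      unfolding g_def l_def using F.real_cond_exp_intg(2)[OF iu[OF m(1)] uF] G.real_cond_exp_intg(2)[OF iu[OF m(1)] uG] by simp
    then have uz: "(\<integral>x. u x * (g x - l x) \<partial>S) = 0"
      using iu[OF ig] iu[OF il] by (simp add: right_diff_distrib)
    have iugl: "integrable S (\<lambda>x. u x * (g x - l x))" using iu ig il by simp
    let ?f = "\<lambda>x. 2 * K * \<bar>g x - l x\<bar> + entropy_tail K (g x) + exp (- K) - u x * (g x - l x)"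
    have int_f: "integrable S ?f" using ig il tail_g iugl by simp
    have "(\<integral>\<^sup>+x. ennreal (l x * entropy_fn (g x / l x)) * indicator (?C j) x \<partial>S) = (\<integral>\<^sup>+x. ennreal (indicator (?C j) x * (l x * entropy_fn (g x / l x))) \<partial>S)"
      by (intro nn_integral_cong) (auto split: split_indicator)
    also have "\<dots> \<le> (\<integral>\<^sup>+x. ennreal (?f x) \<partial>S)"
    proof (rule nn_integral_mono_AE)
      show "AE x in S. ennreal (indicator (?C j) x * (l x * entropy_fn (g x / l x))) \<le> ennreal (?f x)"
        using g0
      proof eventually_elim
        case (elim x)
        show ?case
        proof (cases "x \<in> ?C j")
          case True
          then have "1 / Suc j \<le> l x" by auto
          then have "0 < l x" by (rule less_le_trans[rotated]) simp
          from scaled_entropy_fn_le[OF K elim this] True show ?thesis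
            by (intro ennreal_leI) (simp add: u_def)
        qed simp
      qed
    qed
    also have "\<dots> = ennreal (\<integral>x. ?f x \<partial>S)"
    proof (rule nn_integral_eq_integral[OF int_f])
      show "AE x in S. 0 \<le> ?f x"
        using g0
      proof eventually_elim
        case (elim x)
        show ?case
        proof (cases "x \<in> ?C j")
          case True
          then have "1 / Suc j \<le> l x" by auto
          then have l: "0 < l x" by (rule less_le_trans[rotated]) simp
          have "0 \<le> l x * entropy_fn (g x / l x)" using l elim by (intro mult_nonneg_nonneg entropy_fn_nonneg) auto
          with scaled_entropy_fn_le[OF K elim l] True show ?thesis by (simp add: u_def)
        next
          case False
          then show ?thesis using K entropy_tail_nonneg[of K "g x"] by (simp add: u_def)
        qed
      qed
    qed
    also have "(\<integral>x. ?f x \<partial>S) = 2 * K * (\<integral>x. \<bar>g x - l x\<bar> \<partial>S) + (\<integral>x. entropy_tail K (g x) \<partial>S) + exp (- K)"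
      using ig il tail_g iugl uz by (simp add: S.prob_space)
    also have "ennreal \<dots> \<le> ennreal ?B"
      using tail_le by (intro ennreal_leI) simp
    finally show ?thesis .
  qed
  have "(\<integral>\<^sup>+x. ennreal (l x * entropy_fn (g x / l x)) \<partial>S)
    = (\<integral>\<^sup>+x. (SUP j. ennreal (l x * entropy_fn (g x / l x)) * indicator (?C j) x) \<partial>S)"
  proof (rule nn_integral_cong_AE)
    show "AE x in S. ennreal (l x * entropy_fn (g x / l x)) = (SUP j. ennreal (l x * entropy_fn (g x / l x)) * indicator (?C j) x)"
      using l0 AE_space
    proof eventually_elim
      case (elim x)
      show ?case
      proof (cases "l x = 0")
        case False
        with elim have lx: "0 < l x" by simp
        obtain j1 where j1: "1 / Suc j1 < l x" using nat_approx_posE[OF lx] by blast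
        obtain j2 :: nat where j2: "l x < j2" using reals_Archimedean2 by blast
        define j where "j = max j1 j2"
        have "1 / Suc j \<le> 1 / Suc j1" by (intro divide_left_mono) (auto simp: j_def)
        then have "x \<in> ?C j"
          using j1 j2 elim F by (auto simp: j_def subalgebra_def)
        then have "ennreal (l x * entropy_fn (g x / l x)) \<le> ennreal (l x * entropy_fn (g x / l x)) * indicator (?C j) x"
          by simp
        also have "\<dots> \<le> (SUP j. ennreal (l x * entropy_fn (g x / l x)) * indicator (?C j) x)"
          by (rule SUP_upper) simp
        finally show ?thesis
          by (intro antisym SUP_least) (auto split: split_indicator)
      qed simp
    qed
  qed
  also have "\<dots> = (SUP j. \<integral>\<^sup>+x. ennreal (l x * entropy_fn (g x / l x)) * indicator (?C j) x \<partial>S)"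
  proof (rule nn_integral_monotone_convergence_SUP)
    show "incseq (\<lambda>j x. ennreal (l x * entropy_fn (g x / l x)) * indicator (?C j) x)"
    proof (rule incseq_SucI, rule le_funI)
      fix j x
      have "1 / Suc (Suc j) \<le> 1 / Suc j" by (intro divide_left_mono) auto
      then have "?C j \<subseteq> ?C (Suc j)" by auto
      then show "ennreal (l x * entropy_fn (g x / l x)) * indicator (?C j) x \<le> ennreal (l x * entropy_fn (g x / l x)) * indicator (?C (Suc j)) x"
        by (intro mult_left_mono indicator_leI) auto
    qed
  next
    fix j
    show "(\<lambda>x. ennreal (l x * entropy_fn (g x / l x)) * indicator (?C j) x) \<in> borel_measurable S"
      by (intro borel_measurable_times_ennreal borel_measurable_indicator CS) measurable
  qed
  also have "\<dots> \<le> ennreal ?B"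
    by (intro SUP_least local)
  finally show ?thesis .
qed

text \<open>Bayes' formula for a density \<open>c\<close> that is already known to \<open>F\<close>.\<close>
lemma cond_exp_change_of_measure:
  fixes R F :: "'a measure" and c V :: "'a \<Rightarrow> real"
  assumes R: "prob_space R" and F: "subalgebra R F" and c[measurable]: "c \<in> borel_measurable F" and c0: "\<And>x. 0 \<le> c x"
    and P: "prob_space (density R c)" and V: "integrable R V"
  shows "AE x in density R c. real_cond_exp (density R c) F (\<lambda>x. V x / c x) x = real_cond_exp R F V x / c x"
    and "integrable (density R c) (\<lambda>x. V x / c x)"
proof -
  interpret R: sigma_finite_subalgebra R F by (rule sigma_finite_subalgebraI[OF R F])
  have FP: "subalgebra (density R c) F" using F by (simp add: subalgebra_def)
  interpret P: sigma_finite_subalgebra "density R c" F by (rule sigma_finite_subalgebraI[OF P FP])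
  have cR[measurable]: "c \<in> borel_measurable R" by (rule measurable_from_subalg[OF F c])
  have i: "integrable (density R c) (\<lambda>x. f x / c x)" if f: "integrable R f" for f
  proof -
    have [measurable]: "f \<in> borel_measurable R" using f by auto
    have "integrable R (\<lambda>x. c x * (f x / c x))"
      by (rule Bochner_Integration.integrable_bound[OF f]) auto
    then show ?thesis using c0 by (subst integrable_real_density) auto
  qed
  show "integrable (density R c) (\<lambda>x. V x / c x)" by (rule i[OF V])
  have [measurable]: "V \<in> borel_measurable R" using V by auto
  show "AE x in density R c. real_cond_exp (density R c) F (\<lambda>x. V x / c x) x = real_cond_exp R F V x / c x"
  proof (rule P.real_cond_exp_charact)
    show "integrable (density R c) (\<lambda>x. V x / c x)" by (rule i[OF V])
    show "integrable (density R c) (\<lambda>x. real_cond_exp R F V x / c x)"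
      by (rule i[OF R.real_cond_exp_int(1)[OF V]])
    show "(\<lambda>x. real_cond_exp R F V x / c x) \<in> borel_measurable F" by measurable
    fix A assume A[measurable]: "A \<in> sets F"
    have AR[measurable]: "A \<in> sets R" using A F by (auto simp: subalgebra_def)
    define u where "u x = (indicator A x * (if c x = 0 then 0 else 1) :: real)" for x
    have [measurable]: "u \<in> borel_measurable F" unfolding u_def by measurable
    have [measurable]: "u \<in> borel_measurable R" unfolding u_def by measurable
    have dens: "(\<integral>x\<in>A. f x / c x \<partial>density R c) = (\<integral>x. u x * f x \<partial>R)" if [measurable]: "f \<in> borel_measurable R" for f :: "'a \<Rightarrow> real"
    proof -
      have "(\<integral>x\<in>A. f x / c x \<partial>density R c) = (\<integral>x. c x * (indicator A x * (f x / c x)) \<partial>R)"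
        unfolding set_lebesgue_integral_def using c0 by (subst integral_real_density) auto
      also have "\<dots> = (\<integral>x. u x * f x \<partial>R)"
        by (intro Bochner_Integration.integral_cong) (auto simp: u_def)
      finally show ?thesis .
    qed
    have "integrable R (\<lambda>x. u x * V x)"
      by (rule Bochner_Integration.integrable_bound[OF V]) (auto simp: u_def split: split_indicator)
    from R.real_cond_exp_intg(2)[OF this] show "(\<integral>x\<in>A. V x / c x \<partial>density R c) = (\<integral>x\<in>A. real_cond_exp R F V x / c x \<partial>density R c)"
      by (simp add: dens)
  qed
qed

lemma ennreal_tendsto_0I:
  fixes f :: "'a \<Rightarrow> ennreal"
  assumes "\<And>e::real. 0 < e \<Longrightarrow> eventually (\<lambda>n. f n \<le> ennreal e) F"
  shows "(f \<longlongrightarrow> 0) F"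
proof (rule order_tendstoI)
  fix a :: ennreal assume "0 < a"
  then obtain y where y: "0 < y" "y < a" using dense by blast
  moreover from y obtain e where e: "y = ennreal e" "0 < e"
    by (cases y) (auto simp: top_unique less_top)
  ultimately show "eventually (\<lambda>n. f n < a) F"
    using assms[OF e(2)] by (auto elim!: eventually_mono)
qed auto

text \<open>An inequality of Pinsker's type without square roots, from Young's inequality with slopes \<open>d\<close> and
\<open>- d\<close>.\<close>
lemma abs_diff_le_entropy_fn:
  assumes d: "0 < d" "d \<le> 1" and l: "0 < l" and g: "0 \<le> g"
  shows "\<bar>g - l\<bar> \<le> d * l + l * entropy_fn (g / l) / (d::real)"
proof -
  let ?t = "g / l"
  have t: "0 \<le> ?t" using l g by simp
  have up: "exp d \<le> 1 + d + d\<^sup>2" using d by (intro exp_bound) auto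
  have "(1 + d) * (1 - d + d\<^sup>2) = 1 + d^3" by (simp add: algebra_simps power2_eq_square power3_eq_cube)
  then have "1 \<le> (1 - d + d\<^sup>2) * (1 + d)" using d by (simp add: mult.commute)
  also have "\<dots> \<le> (1 - d + d\<^sup>2) * exp d"
    using d by (intro mult_left_mono) (auto intro: add_nonneg_nonneg)
  finally have "exp (- d) \<le> 1 - d + d\<^sup>2" by (simp add: exp_minus field_simps)
  with up entropy_fn_young[OF t, of d] entropy_fn_young[OF t, of "- d"]
  have "d * \<bar>?t - 1\<bar> \<le> entropy_fn ?t + d\<^sup>2" by (auto simp: abs_if algebra_simps)
  then have "\<bar>?t - 1\<bar> \<le> entropy_fn ?t / d + d"
    using d by (simp add: field_simps power2_eq_square)
  then have "l * \<bar>?t - 1\<bar> \<le> l * (entropy_fn ?t / d + d)" using l by (intro mult_left_mono) auto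
  moreover have "l * \<bar>?t - 1\<bar> = \<bar>g - l\<bar>"
  proof -
    have "l * \<bar>?t - 1\<bar> = \<bar>l * (?t - 1)\<bar>" using l by (simp add: abs_mult)
    then show ?thesis using l by (simp add: right_diff_distrib)
  qed
  ultimately show ?thesis by (simp add: algebra_simps)
qed

lemma AE_density_pos:
  fixes c :: "'a \<Rightarrow> real"
  assumes "c \<in> borel_measurable R" "AE x in R. P x"
  shows "AE x in density R c. P x \<and> 0 < c x"
proof -
  have "AE x in R. 0 < ennreal (c x) \<longrightarrow> P x \<and> 0 < c x"
    using assms(2) by eventually_elim simp
  then show ?thesis
    using assms(1) by (subst AE_density) auto
qed

locale density_filtration = two_sided_filtration R F Z G for R :: "'a measure" and F Z G +
  assumes Z_nonneg: "\<And>x. 0 \<le> Z x" and Z_one: "(\<integral>x. Z x \<partial>R) = 1"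
begin

text \<open>The expected total variation distance and the expected relative entropy of the filters at time \<open>n\<close>, in terms of the
conditional expectations of \<open>Z\<close>. The index shift comes from \<open>F\<^bsub>n+1\<^esub>\<close> being generated by
\<open>Y\<^sub>0, \<dots>, Y\<^sub>n\<close>.\<close>
definition "gap n = (\<integral>\<^sup>+x. ennreal \<bar>M n x - L (Suc n) x\<bar> \<partial>R)"

definition "entropy_gap n = (\<integral>\<^sup>+x. ennreal (L (Suc n) x * entropy_fn (M n x / L (Suc n) x)) \<partial>R)"

lemma L_nonneg: "AE x in R. 0 \<le> L k x"
  by (rule sigma_finite_subalgebra.real_cond_exp_pos[OF sub_F]) (auto simp: Z_nonneg)

lemma M_nonneg: "AE x in R. 0 \<le> M n x"
  by (rule sigma_finite_subalgebra.real_cond_exp_pos[OF sub_G]) (auto simp: Z_nonneg)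

lemma L_one: "(\<integral>x. L k x \<partial>R) = 1"
  using sigma_finite_subalgebra.real_cond_exp_int(2)[OF sub_F Z] Z_one by simp

text \<open>The set where \<open>L\<^sub>k\<close> vanishes carries no mass of \<open>Z\<close>. Hence divisions by zero in the quotients of
densities do no harm.\<close>
lemma cond_exp_vanishes:
  assumes H: "subalgebra R H" and FH: "subalgebra H (F k)"
  shows "AE x in R. L k x = 0 \<longrightarrow> real_cond_exp R H Z x = 0"
proof -
  let ?u = "\<lambda>x. if L k x = 0 then 1 else 0 :: real"
  have u: "?u \<in> borel_measurable (F k)" by measurable
  have uH: "?u \<in> borel_measurable H" by (rule measurable_from_subalg[OF FH u])
  have [measurable]: "?u \<in> borel_measurable R" by measurable
  have i: "integrable R (\<lambda>x. ?u x * f x)" if "integrable R f" for f :: "'a \<Rightarrow> real"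
    by (rule Bochner_Integration.integrable_bound[OF that]) (use that in auto)
  have sH: "sigma_finite_subalgebra R H" by (rule sigma_finite_subalgebraI[OF prob_space_axioms H])
  have "(\<integral>x. ?u x * real_cond_exp R H Z x \<partial>R) = (\<integral>x. ?u x * L k x \<partial>R)"
    using sigma_finite_subalgebra.real_cond_exp_intg(2)[OF sH i[OF Z] uH]
      sigma_finite_subalgebra.real_cond_exp_intg(2)[OF sub_F i[OF Z] u] by simp
  also have "\<dots> = (\<integral>x. 0 \<partial>R)"
    by (intro Bochner_Integration.integral_cong) auto
  finally have z: "(\<integral>x. ?u x * real_cond_exp R H Z x \<partial>R) = 0" by simp
  have pos: "AE x in R. 0 \<le> ?u x * real_cond_exp R H Z x"
    using sigma_finite_subalgebra.real_cond_exp_pos[OF sH, of Z] Z_nonneg by (auto elim: eventually_mono)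
  have "AE x in R. ?u x * real_cond_exp R H Z x = 0"
    using z pos i[OF sigma_finite_subalgebra.real_cond_exp_int(1)[OF sH Z]] by (subst (asm) integral_nonneg_eq_0_iff_AE) auto
  then show ?thesis by eventually_elim auto
qed

theorem gap_tendsto_0_if_entropy_gap:
  assumes "entropy_gap \<longlonglongrightarrow> 0"
  shows "gap \<longlonglongrightarrow> 0"
proof (rule ennreal_tendsto_0I)
  fix e :: real assume e: "0 < e"
  define d where "d = min 1 (e / 2)"
  have d: "0 < d" "d \<le> 1" "d \<le> e / 2" using e by (auto simp: d_def)
  have le: "gap n \<le> ennreal d + ennreal (1 / d) * entropy_gap n" for n
  proof -
    have "gap n \<le> (\<integral>\<^sup>+x. ennreal (d * L (Suc n) x) + ennreal (1 / d) * ennreal (L (Suc n) x * entropy_fn (M n x / L (Suc n) x)) \<partial>R)"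
      unfolding gap_def
    proof (rule nn_integral_mono_AE)
      show "AE x in R. ennreal \<bar>M n x - L (Suc n) x\<bar> \<le>
          ennreal (d * L (Suc n) x) + ennreal (1 / d) * ennreal (L (Suc n) x * entropy_fn (M n x / L (Suc n) x))"
        using L_nonneg[of "Suc n"] M_nonneg[of n] cond_exp_vanishes[OF G[of n] F_le_G[of n "Suc n"]]
      proof eventually_elim
        case (elim x)
        show ?case
        proof (cases "L (Suc n) x = 0")
          case False
          then have l: "0 < L (Suc n) x" using elim by simp
          have "0 \<le> L (Suc n) x * entropy_fn (M n x / L (Suc n) x)"
            using l elim by (intro mult_nonneg_nonneg entropy_fn_nonneg) auto
          then have "ennreal (d * L (Suc n) x) + ennreal (1 / d) * ennreal (L (Suc n) x * entropy_fn (M n x / L (Suc n) x))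
            = ennreal (d * L (Suc n) x + L (Suc n) x * entropy_fn (M n x / L (Suc n) x) / d)"
            using d l by (simp add: ennreal_mult'[symmetric] ennreal_plus[symmetric] del: ennreal_plus)
          then show ?thesis
            using abs_diff_le_entropy_fn[OF d(1,2) l, of "M n x"] elim by (simp add: ennreal_leI)
        qed (use elim in simp)
      qed
    qed
    also have "\<dots> = (\<integral>\<^sup>+x. ennreal (d * L (Suc n) x) \<partial>R) + ennreal (1 / d) * entropy_gap n"
      unfolding entropy_gap_def by (simp add: nn_integral_add nn_integral_cmult)
    also have "(\<integral>\<^sup>+x. ennreal (d * L (Suc n) x) \<partial>R) = ennreal d"
      using L_nonneg[of "Suc n"] L_integrable[of "Suc n"] L_one[of "Suc n"] d
      by (subst nn_integral_eq_integral) (auto elim: eventually_mono)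
    finally show ?thesis .
  qed
  have "(\<lambda>n. ennreal (1 / d) * entropy_gap n) \<longlonglongrightarrow> ennreal (1 / d) * 0"
    using assms by (intro ennreal_tendsto_cmult) auto
  then have "eventually (\<lambda>n. ennreal (1 / d) * entropy_gap n < ennreal (e / 2)) sequentially"
    using e by (intro order_tendstoD(2)) auto
  then show "eventually (\<lambda>n. gap n \<le> ennreal e) sequentially"
  proof eventually_elim
    case (elim n)
    have "gap n \<le> ennreal (e / 2) + ennreal (e / 2)"
      using le[of n] elim d by (meson add_mono ennreal_leI less_imp_le order_trans)
    then show ?case using e by (simp flip: ennreal_plus)
  qed
qed

text \<open>Take \<open>S\<close> with density \<open>L\<^bsub>n0+1\<^esub>\<close> and \<open>m = M\<^bsub>n0\<^esub> / L\<^bsub>n0+1\<^esub>\<close>. Under \<open>S\<close>, the assumption says that \<open>m\<close> has finite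
entropy, and for \<open>n \<ge> n0\<close> the pairs \<open>M\<^sub>n, L\<^bsub>n+1\<^esub>\<close>, divided by the density of \<open>S\<close>, are the conditional expectations of
\<open>m\<close>. So the estimate for conditional entropies applies with an error that is uniform in \<open>n\<close>.\<close>
theorem entropy_gap_tendsto_0_if_gap:
  assumes fin: "entropy_gap n0 < \<infinity>" and gap: "gap \<longlonglongrightarrow> 0"
  shows "entropy_gap \<longlonglongrightarrow> 0"
proof -
  \<comment> \<open>\<open>max\<close> only makes the almost everywhere nonnegative function nonnegative everywhere.\<close>
  define c where "c x = max 0 (L (Suc n0) x)" for x
  have cF: "c \<in> borel_measurable (F (Suc n))" if "n \<ge> n0" for n
  proof -
    have "L (Suc n0) \<in> borel_measurable (F (Suc n))"
      by (rule L_measurable) (use that in simp)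
    then show ?thesis unfolding c_def by simp
  qed
  have [measurable]: "c \<in> borel_measurable R" unfolding c_def by measurable
  have c0: "0 \<le> c x" for x by (simp add: c_def)
  have cL: "AE x in R. c x = L (Suc n0) x"
    using L_nonneg[of "Suc n0"] by eventually_elim (simp add: c_def)
  define S where "S = density R c"
  have S: "prob_space S"
  proof
    have "emeasure S (space S) = (\<integral>\<^sup>+x. ennreal (c x) \<partial>R)"
      by (simp add: S_def emeasure_density cong: nn_integral_cong)
    also have "\<dots> = (\<integral>\<^sup>+x. ennreal (L (Suc n0) x) \<partial>R)"
    proof (rule nn_integral_cong_AE)
      show "AE x in R. ennreal (c x) = ennreal (L (Suc n0) x)" using cL by eventually_elim simp
    qed
    also have "\<dots> = 1"
      using L_nonneg[of "Suc n0"] L_integrable[of "Suc n0"] L_one[of "Suc n0"] by (subst nn_integral_eq_integral) auto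
    finally show "emeasure S (space S) = 1" .
  qed
  interpret S: prob_space S by fact
  have RS: "AE x in S. P x \<and> 0 < c x" if "AE x in R. P x" for P
    unfolding S_def by (rule AE_density_pos[OF _ that]) measurable
  have subS: "subalgebra S H" if "subalgebra R H" for H
    using that by (simp add: S_def subalgebra_def)
  define m where "m x = M n0 x / c x" for x
  have mS: "integrable S m"
    unfolding S_def m_def using cond_exp_change_of_measure(2)[OF prob_space_axioms F cF[OF order_refl] c0 _ M_integrable] S
    by (simp add: S_def)
  have [measurable]: "m \<in> borel_measurable R" unfolding m_def by measurable
  have m0: "AE x in S. 0 \<le> m x"
    using RS[OF M_nonneg[of n0]]
  proof eventually_elim
    case (elim x)
    then show ?case unfolding m_def by (intro divide_nonneg_nonneg) auto
  qed
  have cm: "(\<lambda>x. ennreal (c x)) \<in> borel_measurable R" by measurable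
  have S_nn: "(\<integral>\<^sup>+x. f x \<partial>S) = (\<integral>\<^sup>+x. ennreal (c x) * f x \<partial>R)" if "f \<in> borel_measurable R" for f
    unfolding S_def by (rule nn_integral_density[OF cm that])
  have ent: "integrable S (\<lambda>x. entropy_fn (m x))"
  proof (rule integrableI_nonneg)
    show "AE x in S. 0 \<le> entropy_fn (m x)" using m0 by eventually_elim (rule entropy_fn_nonneg)
    have "(\<integral>\<^sup>+x. ennreal (entropy_fn (m x)) \<partial>S) = (\<integral>\<^sup>+x. ennreal (c x) * ennreal (entropy_fn (m x)) \<partial>R)"
      by (rule S_nn) measurable
    also have "\<dots> = entropy_gap n0"
      unfolding entropy_gap_def
    proof (rule nn_integral_cong_AE)
      show "AE x in R. ennreal (c x) * ennreal (entropy_fn (m x)) = ennreal (L (Suc n0) x * entropy_fn (M n0 x / L (Suc n0) x))"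
        using cL
      proof eventually_elim
        case (elim x)
        show ?case
          unfolding m_def elim[symmetric] using c0[of x] by (simp add: ennreal_mult')
      qed
    qed
    finally show "(\<integral>\<^sup>+x. ennreal (entropy_fn (m x)) \<partial>S) < \<infinity>" using fin by simp
  qed (simp add: S_def)
  define D where "D n = (\<integral>x. \<bar>real_cond_exp S (G n) m x - real_cond_exp S (F (Suc n)) m x\<bar> \<partial>S)" for n
  have step: "entropy_gap n \<le> ennreal (2 * K * D n + (\<integral>x. entropy_tail K (m x) \<partial>S) + exp (- K))"
    and D_le: "ennreal (D n) \<le> gap n" if n: "n \<ge> n0" and K: "0 \<le> K" for n K
  proof -
    let ?l = "real_cond_exp S (F (Suc n)) m" and ?g = "real_cond_exp S (G n) m"
    have "AE x in S. ?g x = real_cond_exp R (G n) (M n0) x / c x"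
      unfolding S_def m_def using S
      by (intro cond_exp_change_of_measure(1)[OF prob_space_axioms G _ c0 _ M_integrable]
          measurable_from_subalg[OF F_le_G cF[OF order_refl]]) (simp add: S_def)
    moreover have "AE x in S. real_cond_exp R (G n) (M n0) x = M n x \<and> 0 < c x"
      by (rule RS[OF sigma_finite_subalgebra.real_cond_exp_nested_subalg[OF sub_G G G_anti[OF n] Z]])
    ultimately have g: "AE x in S. ?g x = M n x / c x" by eventually_elim simp
    have "AE x in S. ?l x = real_cond_exp R (F (Suc n)) (M n0) x / c x"
      unfolding S_def m_def using S
      by (intro cond_exp_change_of_measure(1)[OF prob_space_axioms F cF[OF n] c0 _ M_integrable]) (simp add: S_def)
    moreover have "AE x in S. real_cond_exp R (F (Suc n)) (M n0) x = L (Suc n) x \<and> 0 < c x"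
      by (rule RS[OF sigma_finite_subalgebra.real_cond_exp_nested_subalg[OF sub_F G F_le_G Z]])
    ultimately have l: "AE x in S. ?l x = L (Suc n) x / c x" by eventually_elim simp
    have van: "AE x in R. c x = 0 \<longrightarrow> L (Suc n) x = 0"
    proof -
      have "AE x in R. L (Suc n0) x = 0 \<longrightarrow> L (Suc n) x = 0"
        by (rule cond_exp_vanishes[OF F F_mono]) (use n in simp)
      with cL show ?thesis by eventually_elim simp
    qed
    have "entropy_gap n = (\<integral>\<^sup>+x. ennreal (c x) * ennreal (L (Suc n) x / c x * entropy_fn (M n x / c x / (L (Suc n) x / c x))) \<partial>R)"
      unfolding entropy_gap_def
    proof (rule nn_integral_cong_AE)
      show "AE x in R. ennreal (L (Suc n) x * entropy_fn (M n x / L (Suc n) x)) =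
        ennreal (c x) * ennreal (L (Suc n) x / c x * entropy_fn (M n x / c x / (L (Suc n) x / c x)))"
        using van
      proof eventually_elim
        case (elim x)
        then show ?case
          using c0[of x] by (cases "c x = 0") (auto simp: ennreal_mult'[symmetric])
      qed
    qed
    also have "\<dots> = (\<integral>\<^sup>+x. ennreal (L (Suc n) x / c x * entropy_fn (M n x / c x / (L (Suc n) x / c x))) \<partial>S)"
      by (rule S_nn[symmetric]) measurable
    also have "\<dots> = (\<integral>\<^sup>+x. ennreal (?l x * entropy_fn (?g x / ?l x)) \<partial>S)"
    proof (rule nn_integral_cong_AE)
      show "AE x in S. ennreal (L (Suc n) x / c x * entropy_fn (M n x / c x / (L (Suc n) x / c x))) = ennreal (?l x * entropy_fn (?g x / ?l x))"
        using l g by eventually_elim simp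
    qed
    also have "\<dots> \<le> ennreal (2 * K * D n + (\<integral>x. entropy_tail K (m x) \<partial>S) + exp (- K))"
      unfolding D_def by (rule cond_entropy_gap_le[OF S subS[OF F] subS[OF G] F_le_G mS m0 ent K])
    finally show "entropy_gap n \<le> ennreal (2 * K * D n + (\<integral>x. entropy_tail K (m x) \<partial>S) + exp (- K))" .
    have "ennreal (D n) = (\<integral>\<^sup>+x. ennreal \<bar>?g x - ?l x\<bar> \<partial>S)"
      unfolding D_def
      by (intro nn_integral_eq_integral[symmetric] integrable_abs Bochner_Integration.integrable_diff
          sigma_finite_subalgebra.real_cond_exp_int(1)[OF sigma_finite_subalgebraI[OF S subS] mS] F G) simp
    also have "\<dots> = (\<integral>\<^sup>+x. ennreal \<bar>M n x / c x - L (Suc n) x / c x\<bar> \<partial>S)"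
    proof (rule nn_integral_cong_AE)
      show "AE x in S. ennreal \<bar>?g x - ?l x\<bar> = ennreal \<bar>M n x / c x - L (Suc n) x / c x\<bar>"
        using l g by eventually_elim simp
    qed
    also have "\<dots> = (\<integral>\<^sup>+x. ennreal (c x) * ennreal \<bar>M n x / c x - L (Suc n) x / c x\<bar> \<partial>R)"
      by (rule S_nn) measurable
    also have "\<dots> \<le> gap n"
      unfolding gap_def
    proof (rule nn_integral_mono)
      fix x
      show "ennreal (c x) * ennreal \<bar>M n x / c x - L (Suc n) x / c x\<bar> \<le> ennreal \<bar>M n x - L (Suc n) x\<bar>"
        using c0[of x] by (cases "c x = 0") (auto simp: ennreal_mult'[symmetric] diff_divide_distrib[symmetric] abs_divide)
    qed
    finally show "ennreal (D n) \<le> gap n" .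
  qed
  have D0: "0 \<le> D n" for n unfolding D_def by simp
  have "(\<lambda>n. ennreal (D n)) \<longlonglongrightarrow> 0"
  proof (rule tendsto_sandwich[OF _ _ tendsto_const gap])
    show "eventually (\<lambda>n. ennreal (D n) \<le> gap n) sequentially"
      unfolding eventually_sequentially using D_le[of _ 0] by auto
  qed simp
  then have D: "D \<longlonglongrightarrow> 0"
    by (intro tendsto_ennrealD[where x=0]) (use D0 in auto)
  have tails: "(\<lambda>K::nat. \<integral>x. entropy_tail (real K) (m x) \<partial>S) \<longlonglongrightarrow> 0"
    by (rule S.entropy_tail_integral_tendsto_0[OF _ m0 ent]) (simp add: S_def)
  have "(\<lambda>K::nat. (\<integral>x. entropy_tail (real K) (m x) \<partial>S) + exp (- real K)) \<longlonglongrightarrow> 0 + 0"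
  proof (rule tendsto_add[OF tails])
    show "(\<lambda>K::nat. exp (- real K)) \<longlonglongrightarrow> 0"
      by (intro filterlim_compose[OF exp_at_bot] filterlim_compose[OF filterlim_uminus_at_bot_at_top] filterlim_real_sequentially)
  qed
  then have tails': "(\<lambda>K::nat. (\<integral>x. entropy_tail (real K) (m x) \<partial>S) + exp (- real K)) \<longlonglongrightarrow> 0" by simp
  show ?thesis
  proof (rule ennreal_tendsto_0I)
    fix e :: real assume e: "0 < e"
    have "eventually (\<lambda>K::nat. (\<integral>x. entropy_tail (real K) (m x) \<partial>S) + exp (- real K) < e / 2) sequentially"
      using e by (intro order_tendstoD(2)[OF tails']) auto
    then obtain K :: nat where K: "(\<integral>x. entropy_tail (real K) (m x) \<partial>S) + exp (- real K) < e / 2"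
      by (auto simp: eventually_sequentially)
    have "(\<lambda>n. 2 * real K * D n) \<longlonglongrightarrow> 2 * real K * 0" by (intro tendsto_mult_left D)
    then have "eventually (\<lambda>n. 2 * real K * D n < e / 2) sequentially"
      using e by (intro order_tendstoD(2)) auto
    then show "eventually (\<lambda>n. entropy_gap n \<le> ennreal e) sequentially"
      using eventually_ge_at_top[of n0]
    proof eventually_elim
      case (elim n)
      have "entropy_gap n \<le> ennreal (2 * real K * D n + (\<integral>x. entropy_tail (real K) (m x) \<partial>S) + exp (- real K))"
        by (rule step[OF elim(2)]) simp
      also have "\<dots> \<le> ennreal e" using K elim(1) by (intro ennreal_leI) linarith
      finally show ?case .
    qed
  qed
qed

end

section \<open>Densities of filter and predictor as conditional expectations\<close>

lemma real_cond_exp_eqI_nn_integral: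
  fixes Z g :: "'a \<Rightarrow> real"
  assumes R: "prob_space R" and F: "subalgebra R F" and Z: "integrable R Z" and Z0: "\<And>x. 0 \<le> Z x"
    and g[measurable]: "g \<in> borel_measurable F" and g0: "\<And>x. 0 \<le> g x"
    and eq: "\<And>A. A \<in> sets F \<Longrightarrow> (\<integral>\<^sup>+x. ennreal (Z x) * indicator A x \<partial>R) = (\<integral>\<^sup>+x. ennreal (g x) * indicator A x \<partial>R)"
  shows "AE x in R. g x = real_cond_exp R F Z x"
proof -
  interpret sigma_finite_subalgebra R F by (rule sigma_finite_subalgebraI[OF R F])
  have gR[measurable]: "g \<in> borel_measurable R" by (rule measurable_from_subalg[OF F g])
  have [measurable]: "Z \<in> borel_measurable R" using Z by auto
  have sp: "space R \<in> sets F" using F by (metis subalgebra_def sets.top)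
  have "(\<integral>\<^sup>+x. ennreal (g x) \<partial>R) = (\<integral>\<^sup>+x. ennreal (g x) * indicator (space R) x \<partial>R)"
    by (intro nn_integral_cong) auto
  also have "\<dots> = (\<integral>\<^sup>+x. ennreal (Z x) * indicator (space R) x \<partial>R)"
    by (rule eq[OF sp, symmetric])
  also have "\<dots> = (\<integral>\<^sup>+x. ennreal (Z x) \<partial>R)"
    by (intro nn_integral_cong) auto
  also have "\<dots> < \<infinity>" using Z Z0 by (simp add: nn_integral_eq_integral)
  finally have ig: "integrable R g" by (intro integrableI_nonneg) (auto simp: g0)
  have set_int: "(\<integral>x\<in>A. f x \<partial>R) = enn2real (\<integral>\<^sup>+x. ennreal (f x) * indicator A x \<partial>R)"
    if [measurable]: "f \<in> borel_measurable R" "A \<in> sets R" and "\<And>x. 0 \<le> f x" for f :: "'a \<Rightarrow> real" and A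
  proof -
    have "(\<integral>x\<in>A. f x \<partial>R) = enn2real (\<integral>\<^sup>+x. ennreal (indicator A x * f x) \<partial>R)"
      unfolding set_lebesgue_integral_def using that by (subst integral_eq_nn_integral) auto
    also have "(\<integral>\<^sup>+x. ennreal (indicator A x * f x) \<partial>R) = (\<integral>\<^sup>+x. ennreal (f x) * indicator A x \<partial>R)"
      by (intro nn_integral_cong) (auto split: split_indicator)
    finally show ?thesis .
  qed
  have "AE x in R. real_cond_exp R F Z x = g x"
  proof (rule real_cond_exp_charact)
    fix A assume A: "A \<in> sets F"
    then have AR: "A \<in> sets R" using F by (auto simp: subalgebra_def)
    show "(\<integral>x\<in>A. Z x \<partial>R) = (\<integral>x\<in>A. g x \<partial>R)"
      unfolding set_int[OF \<open>Z \<in> borel_measurable R\<close> AR Z0] set_int[OF gR AR g0] eq[OF A] ..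
  qed (use Z ig in auto)
  then show ?thesis by eventually_elim simp
qed

text \<open>The true prior \<open>\<mu>\<close> and the prior \<open>\<nu>\<close> of the filter to be compared, with the density \<open>h\<close> of \<open>\<mu>\<close>.\<close>
locale filter_comparison = controlled_process T Q \<gamma>
  for T :: "'x::polish_space \<times> 'u::polish_space \<Rightarrow> 'x measure"
    and Q :: "'x \<Rightarrow> 'y::polish_space measure" and \<gamma> :: "('y, 'u) policy" +
  fixes \<nu> :: "'x measure" and h :: "'x \<Rightarrow> real" and \<mu> :: "'x measure"
  assumes \<nu>: "\<nu> \<in> priors" and h[measurable]: "h \<in> borel_measurable borel" and h_nonneg: "\<And>x. 0 \<le> h x"
    and \<mu>_def: "\<mu> = density \<nu> h" and \<mu>: "\<mu> \<in> priors"
begin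

abbreviation "R \<equiv> law \<nu>"
abbreviation "P \<equiv> law \<mu>"
abbreviation "Z \<equiv> (\<lambda>\<omega>. h (fst (\<omega> 0))) :: (nat \<Rightarrow> 'x \<times> 'y) \<Rightarrow> real"
abbreviation "Fy k \<equiv> vimage_algebra UNIV (obs_past k) paths :: (nat \<Rightarrow> 'x \<times> 'y) measure"
abbreviation "Gn n \<equiv> vimage_algebra UNIV (mask_states n) paths :: (nat \<Rightarrow> 'x \<times> 'y) measure"

declare sets_law[OF \<nu>, measurable_cong] sets_law[OF \<mu>, measurable_cong]

lemma P_eq: "P = density R Z"
  using law_density[OF \<nu>, of h] \<mu> by (simp add: \<mu>_def)

lemma obs_past_idem: "obs_past k (obs_past l \<omega>) = obs_past (min k l) \<omega>"
  by (auto simp: obs_past_def fun_eq_iff)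

lemma mask_states_idem: "mask_states k (mask_states l \<omega>) = mask_states (max k l) \<omega>"
  by (auto simp: mask_states_def fun_eq_iff)

lemma obs_past_mask_states: "obs_past k (mask_states n \<omega>) = obs_past k \<omega>"
  by (auto simp: obs_past_def mask_states_def fun_eq_iff)

lemma sets_Fy: "A \<in> sets (Fy k) \<longleftrightarrow> A \<in> sets paths \<and> obs_past k -` A = A"
  by (rule sets_vimage_idempotent) (simp_all add: space_PiM obs_past_idem)

lemma sets_Gn: "A \<in> sets (Gn n) \<longleftrightarrow> A \<in> sets paths \<and> mask_states n -` A = A"
  by (rule sets_vimage_idempotent) (simp_all add: space_PiM mask_states_idem)

lemma measurable_Z[measurable]: "Z \<in> borel_measurable paths"
  by measurable

lemma measurable_Z_R: "(\<lambda>\<omega>. ennreal (Z \<omega>)) \<in> borel_measurable R"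
  unfolding measurable_cong_sets[OF sets_law[OF \<nu>] refl] by (rule measurable_compose[OF measurable_Z measurable_ennreal])

sublocale density_filtration R Fy Z Gn
proof -
  interpret prob_space R by (rule prob_space_law[OF \<nu>])
  have Z1: "(\<integral>\<^sup>+\<omega>. ennreal (Z \<omega>) \<partial>R) = 1"
  proof -
    have "UNIV \<in> sets R" by (metis sets.top space_law[OF \<nu>])
    then have "emeasure (density R (\<lambda>\<omega>. ennreal (Z \<omega>))) UNIV = (\<integral>\<^sup>+\<omega>. ennreal (Z \<omega>) * indicator UNIV \<omega> \<partial>R)"
      by (rule emeasure_density[OF measurable_Z_R])
    moreover have "emeasure P UNIV = 1"
      using prob_space.emeasure_space_1[OF prob_space_law[OF \<mu>]] by (simp add: space_law \<mu>)
    ultimately show ?thesis by (simp add: P_eq)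
  qed
  have ZR: "Z \<in> borel_measurable R"
    unfolding measurable_cong_sets[OF sets_law[OF \<nu>] refl] by (rule measurable_Z)
  then have Z: "integrable R Z"
    using Z1 by (intro integrableI_nonneg) (auto simp: h_nonneg)
  show "density_filtration R Fy Z Gn"
  proof
    show "subalgebra R (Fy k)" for k
      using sets_Fy by (auto simp: subalgebra_def space_law[OF \<nu>] sets_law[OF \<nu>])
    show "subalgebra R (Gn k)" for k
      using sets_Gn by (auto simp: subalgebra_def space_law[OF \<nu>] sets_law[OF \<nu>])
    show "subalgebra (Fy l) (Fy k)" if "k \<le> l" for k l
    proof -
      have "A \<in> sets (Fy l)" if A: "A \<in> sets (Fy k)" for A
      proof -
        have "obs_past l -` A = obs_past l -` (obs_past k -` A)" using A sets_Fy[of A k] by auto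
        also have "\<dots> = obs_past k -` A" using \<open>k \<le> l\<close> by (auto simp: obs_past_idem min_def)
        also have "\<dots> = A" using A sets_Fy[of A k] by auto
        finally show ?thesis using A by (auto simp: sets_Fy)
      qed
      then show ?thesis by (auto simp: subalgebra_def)
    qed
    show "subalgebra (Gn k) (Gn l)" if "k \<le> l" for k l
    proof -
      have "A \<in> sets (Gn k)" if A: "A \<in> sets (Gn l)" for A
      proof -
        have "mask_states k -` A = mask_states k -` (mask_states l -` A)" using A sets_Gn[of A l] by auto
        also have "\<dots> = mask_states l -` A" using \<open>k \<le> l\<close> by (auto simp: mask_states_idem max_def)
        also have "\<dots> = A" using A sets_Gn[of A l] by auto
        finally show ?thesis using A by (auto simp: sets_Gn)
      qed
      then show ?thesis by (auto simp: subalgebra_def)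
    qed
    show "subalgebra (Gn n) (Fy k)" for n k
    proof -
      have "A \<in> sets (Gn n)" if A: "A \<in> sets (Fy k)" for A
      proof -
        have "mask_states n -` A = mask_states n -` (obs_past k -` A)" using A sets_Fy[of A k] by auto
        also have "\<dots> = obs_past k -` A" by (auto simp: obs_past_mask_states)
        also have "\<dots> = A" using A sets_Fy[of A k] by auto
        finally show ?thesis using A by (auto simp: sets_Gn sets_Fy)
      qed
      then show ?thesis by (auto simp: subalgebra_def)
    qed
    show "(\<integral>\<omega>. Z \<omega> \<partial>R) = 1"
      using Z1 Z by (subst integral_eq_nn_integral) (auto simp: h_nonneg)
  qed (use Z h_nonneg in auto)
qed

lemma obs_seq_obs_past: "obs_seq (obs_past k \<omega>) = restrict (obs_seq \<omega>) {..<k}"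
  by (auto simp: obs_seq_def obs_past_def restrict_def fun_eq_iff)

lemma measurable_obs_Fy:
  fixes f :: "(nat \<Rightarrow> 'y) \<Rightarrow> 'b::t1_space"
  assumes "f \<in> borel_measurable (obs_sigma {..<k})"
  shows "(\<lambda>\<omega>. f (obs_seq \<omega>)) \<in> borel_measurable (Fy k)"
proof -
  have "(\<lambda>\<omega>. f (obs_seq \<omega>)) \<in> borel_measurable (paths :: (nat \<Rightarrow> 'x \<times> 'y) measure) \<and>
      (\<forall>\<omega>. f (obs_seq (obs_past k \<omega>)) = f (obs_seq \<omega>))"
    using assms unfolding borel_measurable_obs_sigma obs_seq_obs_past by auto
  then show ?thesis
    by (subst borel_measurable_vimage_idempotent[OF measurable_obs_past]) (auto simp: space_PiM obs_past_idem)
qed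

text \<open>The sigma field \<open>F\<^sub>k\<close> lives on the space of paths, the filter on the space of measurement sequences;
events correspond to each other.\<close>
lemma indicator_Fy:
  assumes A: "A \<in> sets (Fy k)"
  obtains B where "B \<in> sets (obs_sigma {..<k})" "\<And>\<omega>. indicator A \<omega> = (indicator B (obs_seq \<omega>) :: ennreal)"
proof
  let ?e = "\<lambda>y i. (undefined, if i < k then y i else undefined) :: 'x \<times> 'y"
  let ?B = "{y. ?e y \<in> A}"
  have e: "?e \<in> paths \<rightarrow>\<^sub>M (paths :: (nat \<Rightarrow> 'x \<times> 'y) measure)"
  proof (rule measurable_PiM_single')
    show "(\<lambda>y. ?e y i) \<in> (paths :: (nat \<Rightarrow> 'y) measure) \<rightarrow>\<^sub>M borel" for i
      by (cases "i < k") (auto intro!: measurable_Pair_borel)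
  qed (auto simp: space_PiM)
  have A': "A \<in> sets paths" using A sets_Fy by blast
  have "(\<lambda>y. indicator A (?e y) :: ennreal) \<in> borel_measurable (obs_sigma {..<k})"
    unfolding borel_measurable_obs_sigma
  proof (intro conjI allI)
    show "(\<lambda>y. indicator A (?e y) :: ennreal) \<in> borel_measurable paths"
      by (rule measurable_compose[OF e borel_measurable_indicator[OF A']])
    show "indicator A (?e (restrict y {..<k})) = (indicator A (?e y) :: ennreal)" for y
      by (auto intro!: arg_cong[where f="indicator A"])
  qed
  then have "(\<lambda>y. indicator A (?e y) :: ennreal) -` {1} \<inter> space (obs_sigma {..<k}) \<in> sets (obs_sigma {..<k})"
    by (rule measurable_sets) simp
  moreover have "(\<lambda>y. indicator A (?e y) :: ennreal) -` {1} \<inter> space (obs_sigma {..<k}) = ?B"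
    by (auto split: split_indicator_asm)
  ultimately show "?B \<in> sets (obs_sigma {..<k})"
    by (simp only:)
  have "?e (obs_seq \<omega>) = obs_past k \<omega>" for \<omega> :: "nat \<Rightarrow> 'x \<times> 'y"
    by (auto simp: obs_past_def obs_seq_def fun_eq_iff)
  moreover have "obs_past k \<omega> \<in> A \<longleftrightarrow> \<omega> \<in> A" for \<omega>
    using A sets_Fy by blast
  ultimately have "obs_seq \<omega> \<in> ?B \<longleftrightarrow> \<omega> \<in> A" for \<omega>
    by (simp only: mem_Collect_eq)
  then show "indicator A \<omega> = (indicator ?B (obs_seq \<omega>) :: ennreal)" for \<omega>
    by (simp only: indicator_def)
qed

lemma obs_density_eq_L:
  fixes l :: "(nat \<Rightarrow> 'y) \<Rightarrow> real"
  assumes l: "l \<in> borel_measurable (obs_sigma {..<k})" and l0: "\<And>y. 0 \<le> l y"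
    and eq: "\<And>\<phi>. \<phi> \<in> borel_measurable (obs_sigma {..<k}) \<Longrightarrow>
      (\<integral>\<^sup>+\<omega>. ennreal (Z \<omega>) * \<phi> (obs_seq \<omega>) \<partial>R) = (\<integral>\<^sup>+\<omega>. ennreal (l (obs_seq \<omega>)) * \<phi> (obs_seq \<omega>) \<partial>R)"
  shows "AE \<omega> in R. l (obs_seq \<omega>) = L k \<omega>"
proof (rule real_cond_exp_eqI_nn_integral[OF prob_space_axioms F Z h_nonneg measurable_obs_Fy[OF l] l0])
  fix A assume A: "A \<in> sets (Fy k)"
  obtain B where B: "B \<in> sets (obs_sigma {..<k})" "\<And>\<omega>. indicator A \<omega> = (indicator B (obs_seq \<omega>) :: ennreal)"
    using indicator_Fy[OF A] by blast
  show "(\<integral>\<^sup>+\<omega>. ennreal (Z \<omega>) * indicator A \<omega> \<partial>R) = (\<integral>\<^sup>+\<omega>. ennreal (l (obs_seq \<omega>)) * indicator A \<omega> \<partial>R)"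
    unfolding B(2) by (rule eq[OF borel_measurable_indicator[OF B(1)]])
qed

text \<open>By the Markov property, conditioning \<open>Z\<close> on \<open>X\<^sub>n\<close> and \<open>Y\<^sub>0, \<dots>, Y\<^sub>n\<close> is the same as conditioning on \<open>G\<^sub>n\<close>.\<close>
lemma state_density_eq_M:
  fixes m :: "'x \<times> (nat \<Rightarrow> 'y) \<Rightarrow> real"
  assumes m: "m \<in> borel_measurable (borel \<Otimes>\<^sub>M obs_sigma {..<Suc n})" and m0: "\<And>z. 0 \<le> m z"
    and eq: "\<And>\<phi>. \<phi> \<in> borel_measurable (borel \<Otimes>\<^sub>M obs_sigma {..<Suc n}) \<Longrightarrow>
      (\<integral>\<^sup>+\<omega>. ennreal (Z \<omega>) * \<phi> (fst (\<omega> n), obs_seq \<omega>) \<partial>R) = (\<integral>\<^sup>+\<omega>. ennreal (m (fst (\<omega> n), obs_seq \<omega>)) * \<phi> (fst (\<omega> n), obs_seq \<omega>) \<partial>R)"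
  shows "AE \<omega> in R. m (fst (\<omega> n), obs_seq \<omega>) = M n \<omega>"
proof (rule real_cond_exp_eqI_nn_integral[OF prob_space_axioms G Z h_nonneg _ m0])
  have mp[measurable]: "(\<lambda>\<omega>. m (fst (\<omega> n), obs_seq \<omega>)) \<in> borel_measurable (paths :: (nat \<Rightarrow> 'x \<times> 'y) measure)"
    by (rule measurable_compose[OF measurable_state_obs m])
  have mask: "obs_seq (mask_states n \<omega>) = obs_seq \<omega>" "fst (mask_states n \<omega> n) = fst (\<omega> n)" for \<omega> :: "nat \<Rightarrow> 'x \<times> 'y"
    by (auto simp: obs_seq_def mask_states_def fun_eq_iff)
  have "(\<lambda>\<omega>. m (fst (\<omega> n), obs_seq \<omega>)) \<in> borel_measurable (paths :: (nat \<Rightarrow> 'x \<times> 'y) measure) \<and>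
      (\<forall>\<omega> :: nat \<Rightarrow> 'x \<times> 'y. m (fst (mask_states n \<omega> n), obs_seq (mask_states n \<omega>)) = m (fst (\<omega> n), obs_seq \<omega>))"
    using mp by (simp add: mask)
  then show "(\<lambda>\<omega>. m (fst (\<omega> n), obs_seq \<omega>)) \<in> borel_measurable (Gn n)"
    by (subst borel_measurable_vimage_idempotent[OF measurable_mask_states]) (auto simp: space_PiM mask_states_idem)
  fix A assume A: "A \<in> sets (Gn n)"
  show "(\<integral>\<^sup>+\<omega>. ennreal (Z \<omega>) * indicator A \<omega> \<partial>R) = (\<integral>\<^sup>+\<omega>. ennreal (m (fst (\<omega> n), obs_seq \<omega>)) * indicator A \<omega> \<partial>R)"
  proof (rule markov_property[OF \<nu> _ _ _ _ _ eq A])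
    show "(\<lambda>\<omega>. ennreal (Z \<omega>)) \<in> borel_measurable paths" by measurable
    show "(\<lambda>\<omega>. ennreal (m (fst (\<omega> n), obs_seq \<omega>))) \<in> borel_measurable (paths :: (nat \<Rightarrow> 'x \<times> 'y) measure)" by measurable
    show "ennreal (Z (past (Suc n) \<omega>)) = ennreal (Z \<omega>)" for \<omega> by simp
    show "ennreal (m (fst (past (Suc n) \<omega> n), obs_seq (past (Suc n) \<omega>))) = ennreal (m (fst (\<omega> n), obs_seq \<omega>))" for \<omega>
      by (simp only: state_obs_past[OF m lessI order_refl])
    show "(\<integral>\<^sup>+\<omega>. ennreal (Z \<omega>) \<partial>R) < \<infinity>"
      using Z h_nonneg by (simp add: nn_integral_eq_integral)
  qed
qed

text \<open>Given \<open>X\<^sub>n\<close> and the earlier measurements, \<open>Y\<^sub>n\<close> is drawn from the channel and carries no information on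
\<open>X\<^sub>0\<close>, so \<open>Z\<close> has the same conditional expectation with and without \<open>Y\<^sub>n\<close>.\<close>
lemma predictor_density_eq_M:
  fixes m :: "'x \<times> (nat \<Rightarrow> 'y) \<Rightarrow> real"
  assumes m: "m \<in> borel_measurable (borel \<Otimes>\<^sub>M obs_sigma {..<n})" and m0: "\<And>z. 0 \<le> m z"
    and eq: "\<And>\<phi>. \<phi> \<in> borel_measurable (borel \<Otimes>\<^sub>M obs_sigma {..<n}) \<Longrightarrow>
      (\<integral>\<^sup>+\<omega>. ennreal (Z \<omega>) * \<phi> (fst (\<omega> n), obs_seq \<omega>) \<partial>R) = (\<integral>\<^sup>+\<omega>. ennreal (m (fst (\<omega> n), obs_seq \<omega>)) * \<phi> (fst (\<omega> n), obs_seq \<omega>) \<partial>R)"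
  shows "AE \<omega> in R. m (fst (\<omega> n), obs_seq \<omega>) = M n \<omega>"
proof (rule state_density_eq_M[OF _ m0])
  have inv: "m (x, restrict y {..<n}) = m (x, y)" for x y
    using m by (simp add: borel_measurable_pair_obs_sigma)
  show m': "m \<in> borel_measurable (borel \<Otimes>\<^sub>M obs_sigma {..<Suc n})"
  proof -
    have "m (x, restrict y {..<Suc n}) = m (x, y)" for x y
    proof -
      have "restrict (restrict y {..<Suc n}) {..<n} = restrict y {..<n}" by auto
      then show ?thesis by (metis inv)
    qed
    then show ?thesis using m by (simp add: borel_measurable_pair_obs_sigma)
  qed
  fix \<phi> :: "'x \<times> (nat \<Rightarrow> 'y) \<Rightarrow> ennreal" assume \<phi>: "\<phi> \<in> borel_measurable (borel \<Otimes>\<^sub>M obs_sigma {..<Suc n})"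
  let ?\<phi> = "\<lambda>(x, y). \<integral>\<^sup>+v. \<phi> (x, y(n := v)) \<partial>Q x"
  note channel = nn_integral_law_channel_mult[OF \<nu> \<phi>]
  have mp: "(\<lambda>\<omega>. ennreal (m (fst (\<omega> n), obs_seq \<omega>))) \<in> borel_measurable (paths :: (nat \<Rightarrow> 'x \<times> 'y) measure)"
    by (intro measurable_compose[OF measurable_compose[OF measurable_state_obs m']]) simp
  have "(\<integral>\<^sup>+\<omega>. ennreal (Z \<omega>) * \<phi> (fst (\<omega> n), obs_seq \<omega>) \<partial>R) = (\<integral>\<^sup>+\<omega>. ennreal (Z \<omega>) * ?\<phi> (fst (\<omega> n), obs_seq \<omega>) \<partial>R)"
    by (rule channel(2)) auto
  also have "\<dots> = (\<integral>\<^sup>+\<omega>. ennreal (m (fst (\<omega> n), obs_seq \<omega>)) * ?\<phi> (fst (\<omega> n), obs_seq \<omega>) \<partial>R)"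
    by (rule eq[OF channel(1)])
  also have "\<dots> = (\<integral>\<^sup>+\<omega>. ennreal (m (fst (\<omega> n), obs_seq \<omega>)) * \<phi> (fst (\<omega> n), obs_seq \<omega>) \<partial>R)"
  proof (rule channel(2)[symmetric, OF mp])
    show "ennreal (m (fst (past (Suc n) \<omega> n), obs_seq (past (Suc n) \<omega>))) = ennreal (m (fst (\<omega> n), obs_seq \<omega>))" for \<omega>
      by (simp only: state_obs_past[OF m' lessI order_refl])
    fix \<omega> :: "nat \<Rightarrow> 'x \<times> 'y" and v
    have "restrict (obs_seq (\<omega> (n := (fst (\<omega> n), v)))) {..<n} = restrict (obs_seq \<omega>) {..<n}"
      by (auto simp: obs_seq_def fun_eq_iff)
    then have "m (fst (\<omega> n), obs_seq (\<omega> (n := (fst (\<omega> n), v)))) = m (fst (\<omega> n), obs_seq \<omega>)"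
      by (metis inv)
    then show "ennreal (m (fst ((\<omega> (n := (fst (\<omega> n), v))) n), obs_seq (\<omega> (n := (fst (\<omega> n), v))))) = ennreal (m (fst (\<omega> n), obs_seq \<omega>))"
      by simp
  qed
  finally show "(\<integral>\<^sup>+\<omega>. ennreal (Z \<omega>) * \<phi> (fst (\<omega> n), obs_seq \<omega>) \<partial>R) = (\<integral>\<^sup>+\<omega>. ennreal (m (fst (\<omega> n), obs_seq \<omega>)) * \<phi> (fst (\<omega> n), obs_seq \<omega>) \<partial>R)" .
qed

text \<open>The bridge from posteriors to martingales, for the predictor (\<open>k = n\<close>) and the filter (\<open>k = n + 1\<close>)
at once. The only difference between them is the denominator \<open>L\<^sub>k\<close> of the posterior density. The formula on
events \<open>B\<close> is needed for the maximal inequality.\<close>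
lemma
  assumes k: "k = n \<or> k = Suc n"
    and p: "reg_cond_distr P (\<lambda>\<omega>. fst (\<omega> n)) (obs_sigma {..<k}) obs_seq p"
    and q: "reg_cond_distr R (\<lambda>\<omega>. fst (\<omega> n)) (obs_sigma {..<k}) obs_seq q"
  shows posterior_tv_gap: "\<exists>t\<in>borel_measurable (obs_sigma {..<k}).
      (AE y in distr P (obs_sigma {..<k}) obs_seq. ennreal (tv_norm (p y) (q y)) = t y) \<and>
      (\<forall>B\<in>sets (obs_sigma {..<k}). (\<integral>\<^sup>+\<omega>. ennreal (Z \<omega>) * (t (obs_seq \<omega>) * indicator B (obs_seq \<omega>)) \<partial>R)
         = (\<integral>\<^sup>+\<omega>. ennreal \<bar>M n \<omega> - L k \<omega>\<bar> * indicator B (obs_seq \<omega>) \<partial>R))" (is ?tv)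
    and posterior_entropy_gap: "(\<integral>\<^sup>+\<omega>. rel_entropy (p (obs_seq \<omega>)) (q (obs_seq \<omega>)) \<partial>P)
      = (\<integral>\<^sup>+\<omega>. ennreal (L k \<omega> * entropy_fn (M n \<omega> / L k \<omega>)) \<partial>R)" (is ?en)
proof -
  note W = measurable_Z_R
  have dP: "prob_space (density R (\<lambda>\<omega>. ennreal (Z \<omega>)))"
    using prob_space_law[OF \<mu>] by (simp add: P_eq)
  have X: "(\<lambda>\<omega>. fst (\<omega> n)) \<in> R \<rightarrow>\<^sub>M borel" by measurable
  have Y: "obs_seq \<in> R \<rightarrow>\<^sub>M obs_sigma {..<k}"
    unfolding measurable_cong_sets[OF sets_law[OF \<nu>] refl]
    by (rule measurable_compose[OF measurable_obs_seq measurable_ident_obs_sigma])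
  have XY: "(\<lambda>\<omega>. (fst (\<omega> n), obs_seq \<omega>)) \<in> R \<rightarrow>\<^sub>M borel \<Otimes>\<^sub>M obs_sigma {..<k}"
    using X Y by measurable
  obtain l where l: "l \<in> borel_measurable (obs_sigma {..<k})" "\<And>y. 0 \<le> l y"
    "\<And>\<phi>. \<phi> \<in> borel_measurable (obs_sigma {..<k}) \<Longrightarrow>
      (\<integral>\<^sup>+\<omega>. ennreal (Z \<omega>) * \<phi> (obs_seq \<omega>) \<partial>R) = (\<integral>\<^sup>+\<omega>. ennreal (l (obs_seq \<omega>)) * \<phi> (obs_seq \<omega>) \<partial>R)"
    using pushforward_density_exists[OF prob_space_axioms W dP Y] by blast
  obtain m where m: "m \<in> borel_measurable (borel \<Otimes>\<^sub>M obs_sigma {..<k})" "\<And>z. 0 \<le> m z"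
    "\<And>\<phi>. \<phi> \<in> borel_measurable (borel \<Otimes>\<^sub>M obs_sigma {..<k}) \<Longrightarrow>
      (\<integral>\<^sup>+\<omega>. ennreal (Z \<omega>) * \<phi> (fst (\<omega> n), obs_seq \<omega>) \<partial>R) = (\<integral>\<^sup>+\<omega>. ennreal (m (fst (\<omega> n), obs_seq \<omega>)) * \<phi> (fst (\<omega> n), obs_seq \<omega>) \<partial>R)"
    using pushforward_density_exists[OF prob_space_axioms W dP XY] by blast
  have lL: "AE \<omega> in R. l (obs_seq \<omega>) = L k \<omega>"
    by (rule obs_density_eq_L[OF l])
  have mM: "AE \<omega> in R. m (fst (\<omega> n), obs_seq \<omega>) = M n \<omega>"
    using k
  proof
    assume "k = n" then show ?thesis using predictor_density_eq_M[of m n] m by simp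
  next
    assume "k = Suc n" then show ?thesis using state_density_eq_M[of m n] m by simp
  qed
  note base = prob_space_axioms W dP X Y q p[unfolded P_eq] m(1) l(1) m(2) l(2) m(3) l(3)
  obtain t where t: "t \<in> borel_measurable (obs_sigma {..<k})"
    "AE y in distr P (obs_sigma {..<k}) obs_seq. ennreal (tv_norm (p y) (q y)) = t y"
    "\<And>B. B \<in> sets (obs_sigma {..<k}) \<Longrightarrow> (\<integral>\<^sup>+\<omega>. ennreal (Z \<omega>) * (t (obs_seq \<omega>) * indicator B (obs_seq \<omega>)) \<partial>R)
         = (\<integral>\<^sup>+\<omega>. ennreal \<bar>m (fst (\<omega> n), obs_seq \<omega>) - l (obs_seq \<omega>)\<bar> * indicator B (obs_seq \<omega>) \<partial>R)"
    using posterior_tv_norm[where R=R and W="\<lambda>\<omega>. ennreal (Z \<omega>)" and X="\<lambda>\<omega>. fst (\<omega> n)" and Y=obs_seq and N="obs_sigma {..<k}" and m=m and l=l and p=p and q=q, OF base] unfolding P_eq by blast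
  show ?tv
  proof (intro bexI[OF _ t(1)] conjI ballI t(2))
    fix B assume B: "B \<in> sets (obs_sigma {..<k} :: (nat \<Rightarrow> 'y) measure)"
    have "(\<integral>\<^sup>+\<omega>. ennreal \<bar>m (fst (\<omega> n), obs_seq \<omega>) - l (obs_seq \<omega>)\<bar> * indicator B (obs_seq \<omega>) \<partial>R)
      = (\<integral>\<^sup>+\<omega>. ennreal \<bar>M n \<omega> - L k \<omega>\<bar> * indicator B (obs_seq \<omega>) \<partial>R)"
    proof (rule nn_integral_cong_AE)
      show "AE \<omega> in R. ennreal \<bar>m (fst (\<omega> n), obs_seq \<omega>) - l (obs_seq \<omega>)\<bar> * indicator B (obs_seq \<omega>)
        = ennreal \<bar>M n \<omega> - L k \<omega>\<bar> * indicator B (obs_seq \<omega>)"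
        using lL mM by eventually_elim simp
    qed
    then show "(\<integral>\<^sup>+\<omega>. ennreal (Z \<omega>) * (t (obs_seq \<omega>) * indicator B (obs_seq \<omega>)) \<partial>R)
         = (\<integral>\<^sup>+\<omega>. ennreal \<bar>M n \<omega> - L k \<omega>\<bar> * indicator B (obs_seq \<omega>) \<partial>R)"
      using t(3)[OF B] by simp
  qed
  have "(\<integral>\<^sup>+\<omega>. rel_entropy (p (obs_seq \<omega>)) (q (obs_seq \<omega>)) \<partial>P)
    = (\<integral>\<^sup>+\<omega>. ennreal (l (obs_seq \<omega>) * entropy_fn (m (fst (\<omega> n), obs_seq \<omega>) / l (obs_seq \<omega>))) \<partial>R)"
    using posterior_rel_entropy[where R=R and W="\<lambda>\<omega>. ennreal (Z \<omega>)" and X="\<lambda>\<omega>. fst (\<omega> n)" and Y=obs_seq and N="obs_sigma {..<k}" and m=m and l=l and p=p and q=q, OF base] unfolding P_eq .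
  also have "\<dots> = (\<integral>\<^sup>+\<omega>. ennreal (L k \<omega> * entropy_fn (M n \<omega> / L k \<omega>)) \<partial>R)"
  proof (rule nn_integral_cong_AE)
    show "AE \<omega> in R. ennreal (l (obs_seq \<omega>) * entropy_fn (m (fst (\<omega> n), obs_seq \<omega>) / l (obs_seq \<omega>))) = ennreal (L k \<omega> * entropy_fn (M n \<omega> / L k \<omega>))"
      using lL mM by eventually_elim simp
  qed
  finally show ?en .
qed

end

section \<open>Equivalences in total variation and relative entropy\<close>

lemma abs_integral_le_1:
  fixes f :: "'a::topological_space \<Rightarrow> real"
  assumes M: "prob_space M" "sets M = sets borel" and f: "f \<in> borel_measurable borel" "\<And>x. \<bar>f x\<bar> \<le> 1"
  shows "\<bar>\<integral>x. f x \<partial>M\<bar> \<le> 1"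
proof -
  interpret prob_space M by fact
  have [measurable]: "f \<in> borel_measurable M" using f M by (simp add: measurable_cong_sets[OF M(2) refl])
  have "integrable M f" by (rule integrable_const_bound[where B=1]) (use f in auto)
  then have "(\<integral>x. \<bar>f x\<bar> \<partial>M) \<le> 1"
    using f by (intro integral_le_const) auto
  then show ?thesis by (rule order_trans[OF integral_abs_bound])
qed

lemma
  assumes P: "prob_space P" "sets P = sets borel" and Q: "prob_space Q" "sets Q = sets borel"
  shows abs_integral_diff_le_tv_norm: "f \<in> borel_measurable borel \<Longrightarrow> (\<And>x. \<bar>f x\<bar> \<le> 1) \<Longrightarrow>
      \<bar>(\<integral>x. f x \<partial>P) - (\<integral>x. f x \<partial>Q)\<bar> \<le> tv_norm P Q"
    and tv_norm_nonneg: "0 \<le> tv_norm P Q"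
    and tv_norm_le_2: "tv_norm P Q \<le> 2"
proof -
  let ?F = "{f. f \<in> borel_measurable borel \<and> (\<forall>x. \<bar>f x\<bar> \<le> (1::real))}"
  have b: "\<bar>(\<integral>x. f x \<partial>P) - (\<integral>x. f x \<partial>Q)\<bar> \<le> 2" if "f \<in> ?F" for f
    using abs_integral_le_1[OF P, of f] abs_integral_le_1[OF Q, of f] that by auto
  then show "tv_norm P Q \<le> 2"
    unfolding tv_norm_def by (intro cSUP_least) (auto intro!: exI[of _ "\<lambda>_. 0"])
  show ub: "\<bar>(\<integral>x. f x \<partial>P) - (\<integral>x. f x \<partial>Q)\<bar> \<le> tv_norm P Q"
    if "f \<in> borel_measurable borel" "\<And>x. \<bar>f x\<bar> \<le> 1" for f
    unfolding tv_norm_def using that b by (intro cSUP_upper bdd_aboveI2[where M=2]) auto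
  show "0 \<le> tv_norm P Q"
    using ub[of "\<lambda>_. 0"] by simp
qed

context filter_comparison
begin

lemma AE_obs_in:
  assumes A: "A \<in> sets paths" "measure P {\<omega> \<in> space P. obs_seq \<omega> \<in> A} = 1"
  shows "AE \<omega> in P. obs_seq \<omega> \<in> A"
proof -
  interpret P: prob_space P by (rule prob_space_law[OF \<mu>])
  have ev: "{\<omega> \<in> space P. obs_seq \<omega> \<in> A} \<in> sets P"
    using measurable_sets[OF measurable_obs_seq A(1)] by (simp add: sets_law space_law \<mu> space_PiM vimage_def)
  then show ?thesis
    using A(2) P.AE_in_set_eq_1[OF ev] by (auto elim: AE_mp)
qed

lemma tv_norm_integral:
  assumes k: "k = n \<or> k = Suc n"
    and p: "reg_cond_distr P (\<lambda>\<omega>. fst (\<omega> n)) (obs_sigma {..<k}) obs_seq p"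
    and q: "reg_cond_distr R (\<lambda>\<omega>. fst (\<omega> n)) (obs_sigma {..<k}) obs_seq q"
  shows "(\<integral>\<^sup>+\<omega>. ennreal (tv_norm (p (obs_seq \<omega>)) (q (obs_seq \<omega>))) \<partial>P) = (\<integral>\<^sup>+\<omega>. ennreal \<bar>M n \<omega> - L k \<omega>\<bar> \<partial>R)"
proof -
  obtain t where t: "t \<in> borel_measurable (obs_sigma {..<k})"
    "AE y in distr P (obs_sigma {..<k}) obs_seq. ennreal (tv_norm (p y) (q y)) = t y"
    "\<And>B. B \<in> sets (obs_sigma {..<k}) \<Longrightarrow> (\<integral>\<^sup>+\<omega>. ennreal (Z \<omega>) * (t (obs_seq \<omega>) * indicator B (obs_seq \<omega>)) \<partial>R)
         = (\<integral>\<^sup>+\<omega>. ennreal \<bar>M n \<omega> - L k \<omega>\<bar> * indicator B (obs_seq \<omega>) \<partial>R)"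
    using posterior_tv_gap[OF k p q] by blast
  have "(\<integral>\<^sup>+\<omega>. ennreal (tv_norm (p (obs_seq \<omega>)) (q (obs_seq \<omega>))) \<partial>P) = (\<integral>\<^sup>+\<omega>. t (obs_seq \<omega>) \<partial>P)"
    by (rule nn_integral_cong_AE[OF AE_distrD[OF measurable_obs_law[OF \<mu>] t(2)]])
  also have "\<dots> = (\<integral>\<^sup>+\<omega>. ennreal (Z \<omega>) * t (obs_seq \<omega>) \<partial>R)"
    unfolding P_eq
  proof (rule nn_integral_density[OF measurable_Z_R])
    show "(\<lambda>\<omega>. t (obs_seq \<omega>)) \<in> borel_measurable R"
      by (rule measurable_from_subalg[OF F measurable_obs_Fy[OF t(1)]])
  qed
  also have "\<dots> = (\<integral>\<^sup>+\<omega>. ennreal \<bar>M n \<omega> - L k \<omega>\<bar> \<partial>R)"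
    using t(3)[OF sets.top] by simp
  finally show ?thesis .
qed

context
  fixes p q :: "('x, 'y) posterior"
  assumes p: "\<And>n. filter_version T Q \<mu> \<gamma> n (p n)" and q: "\<And>n. filter_version T Q \<nu> \<gamma> n (q n)"
begin

lemma filter_cond_distr_P: "reg_cond_distr P (\<lambda>\<omega>. fst (\<omega> n)) (obs_sigma {..<Suc n}) obs_seq (p n)"
  and filter_cond_distr_R: "reg_cond_distr R (\<lambda>\<omega>. fst (\<omega> n)) (obs_sigma {..<Suc n}) obs_seq (q n)"
  using p[of n] q[of n] by (simp_all add: filter_version_def lessThan_Suc_atMost)

lemma filter_tv_exp_iff: "tv_exp P p q \<longleftrightarrow> gap \<longlonglongrightarrow> 0"
proof -
  have "(\<lambda>n. \<integral>\<^sup>+\<omega>. ennreal (tv_norm (p n (obs_seq \<omega>)) (q n (obs_seq \<omega>))) \<partial>P) = gap"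
    unfolding gap_def by (rule ext) (rule tv_norm_integral[OF _ filter_cond_distr_P filter_cond_distr_R], simp)
  then show ?thesis by (simp add: tv_exp_def)
qed

lemma filter_entropy_exp: "entropy_exp P p q = entropy_gap"
  unfolding entropy_exp_def entropy_gap_def
  by (rule ext) (rule posterior_entropy_gap[OF _ filter_cond_distr_P filter_cond_distr_R], simp)

text \<open>Filter and predictor distances are \<open>E\<^sub>R|M\<^sub>n - L\<^bsub>n+1\<^esub>|\<close> and \<open>E\<^sub>R|M\<^sub>n - L\<^sub>n|\<close>, and the increments of the martingale
\<open>L\<close> tend to \<open>0\<close> in \<open>L\<^sup>1\<close>.\<close>
lemma predictor_tv_exp_iff:
  fixes p1 q1 :: "('x, 'y) posterior"
  assumes p1: "\<And>n. n \<ge> 1 \<Longrightarrow> predictor_version T Q \<mu> \<gamma> n (p1 n)"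
    and q1: "\<And>n. n \<ge> 1 \<Longrightarrow> predictor_version T Q \<nu> \<gamma> n (q1 n)"
  shows "tv_exp P p1 q1 \<longleftrightarrow> gap \<longlonglongrightarrow> 0"
proof -
  let ?g = "\<lambda>n. \<integral>\<^sup>+\<omega>. ennreal \<bar>M n \<omega> - L n \<omega>\<bar> \<partial>R"
  let ?d = "\<lambda>n. \<integral>\<^sup>+\<omega>. ennreal \<bar>L (Suc n) \<omega> - L n \<omega>\<bar> \<partial>R"
  have e: "(\<integral>\<^sup>+\<omega>. ennreal (tv_norm (p1 n (obs_seq \<omega>)) (q1 n (obs_seq \<omega>))) \<partial>P) = ?g n" if "n \<ge> 1" for n
    using p1[OF that] q1[OF that] by (intro tv_norm_integral) (auto simp: predictor_version_def)
  have "eventually (\<lambda>n. (\<integral>\<^sup>+\<omega>. ennreal (tv_norm (p1 n (obs_seq \<omega>)) (q1 n (obs_seq \<omega>))) \<partial>P) = ?g n) sequentially"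
    using eventually_ge_at_top[of 1] by eventually_elim (rule e)
  then have 1: "tv_exp P p1 q1 \<longleftrightarrow> ?g \<longlonglongrightarrow> 0"
    unfolding tv_exp_def by (rule tendsto_cong)
  have d: "?d \<longlonglongrightarrow> 0"
  proof (rule ennreal_tendsto_0I)
    fix e :: real assume "0 < e"
    from cond_exp_L1_Cauchy[OF this] obtain m0 where
      m0: "\<forall>m\<ge>m0. \<forall>N\<ge>m. (\<integral>\<^sup>+\<omega>. ennreal \<bar>L N \<omega> - L m \<omega>\<bar> \<partial>R) \<le> ennreal e" by blast
    then show "eventually (\<lambda>n. ?d n \<le> ennreal e) sequentially"
      unfolding eventually_sequentially by (intro exI[of _ m0] allI impI) auto
  qed
  have tri: "(\<integral>\<^sup>+\<omega>. ennreal \<bar>M n \<omega> - L i \<omega>\<bar> \<partial>R) \<le> (\<integral>\<^sup>+\<omega>. ennreal \<bar>M n \<omega> - L j \<omega>\<bar> \<partial>R) + (\<integral>\<^sup>+\<omega>. ennreal \<bar>L j \<omega> - L i \<omega>\<bar> \<partial>R)" for n i j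
  proof -
    have "(\<integral>\<^sup>+\<omega>. ennreal \<bar>M n \<omega> - L i \<omega>\<bar> \<partial>R) \<le> (\<integral>\<^sup>+\<omega>. ennreal \<bar>M n \<omega> - L j \<omega>\<bar> + ennreal \<bar>L j \<omega> - L i \<omega>\<bar> \<partial>R)"
      by (intro nn_integral_mono) (simp flip: ennreal_plus)
    then show ?thesis by (simp add: nn_integral_add)
  qed
  have "?g \<longlonglongrightarrow> 0 \<longleftrightarrow> gap \<longlonglongrightarrow> 0"
  proof
    assume g: "?g \<longlonglongrightarrow> 0"
    have s: "(\<lambda>n. ?g n + ?d n) \<longlonglongrightarrow> 0" using tendsto_add[OF g d] by simp
    have "gap n \<le> ?g n + ?d n" for n
      unfolding gap_def using tri[of n "Suc n" n] by (simp add: abs_minus_commute)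
    then show "gap \<longlonglongrightarrow> 0"
      by (intro tendsto_sandwich[OF _ _ tendsto_const s]) auto
  next
    assume g: "gap \<longlonglongrightarrow> 0"
    have s: "(\<lambda>n. gap n + ?d n) \<longlonglongrightarrow> 0" using tendsto_add[OF g d] by simp
    have "?g n \<le> gap n + ?d n" for n
      unfolding gap_def using tri[of n n "Suc n"] by simp
    then show "?g \<longlonglongrightarrow> 0"
      by (intro tendsto_sandwich[OF _ _ tendsto_const s]) auto
  qed
  with 1 show ?thesis by simp
qed

lemma filter_entropy_stable_iff:
  assumes "entropy_exp P p q n0 < \<infinity>"
  shows "rel_entropy_stable P p q \<longleftrightarrow> tv_exp P p q"
  using assms entropy_gap_tendsto_0_if_gap[of n0] gap_tendsto_0_if_entropy_gap
  by (auto simp: rel_entropy_stable_def filter_entropy_exp filter_tv_exp_iff)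

text \<open>Almost sure convergence implies convergence in expectation as the distance is at most \<open>2\<close>; the converse is the
consequence of the maximal inequality.\<close>
lemma filter_tv_as_iff: "tv_as P p q \<longleftrightarrow> tv_exp P p q"
proof -
  interpret P: prob_space P by (rule prob_space_law[OF \<mu>])
  have "\<forall>n. \<exists>t. t \<in> borel_measurable (obs_sigma {..<Suc n}) \<and>
    (AE y in distr P (obs_sigma {..<Suc n}) obs_seq. ennreal (tv_norm (p n y) (q n y)) = t y) \<and>
    (\<forall>B\<in>sets (obs_sigma {..<Suc n}). (\<integral>\<^sup>+\<omega>. ennreal (Z \<omega>) * (t (obs_seq \<omega>) * indicator B (obs_seq \<omega>)) \<partial>R)
         = (\<integral>\<^sup>+\<omega>. ennreal \<bar>M n \<omega> - L (Suc n) \<omega>\<bar> * indicator B (obs_seq \<omega>) \<partial>R))"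
    using posterior_tv_gap[OF _ filter_cond_distr_P filter_cond_distr_R] by blast
  then obtain t where t: "\<And>n. t n \<in> borel_measurable (obs_sigma {..<Suc n})"
    and t_eq: "\<And>n. AE y in distr P (obs_sigma {..<Suc n}) obs_seq. ennreal (tv_norm (p n y) (q n y)) = t n y"
    and t_int: "\<And>n B. B \<in> sets (obs_sigma {..<Suc n}) \<Longrightarrow> (\<integral>\<^sup>+\<omega>. ennreal (Z \<omega>) * (t n (obs_seq \<omega>) * indicator B (obs_seq \<omega>)) \<partial>R)
         = (\<integral>\<^sup>+\<omega>. ennreal \<bar>M n \<omega> - L (Suc n) \<omega>\<bar> * indicator B (obs_seq \<omega>) \<partial>R)"
    unfolding choice_iff by blast
  have t_paths: "t n \<in> borel_measurable paths" for n
    by (rule measurable_compose[OF measurable_ident_obs_sigma t])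
  have tP: "(\<lambda>\<omega>. t n (obs_seq \<omega>)) \<in> borel_measurable P" for n
    by (rule measurable_compose[OF measurable_obs_law[OF \<mu>] t])
  have AE_t: "AE \<omega> in P. \<forall>n. ennreal (tv_norm (p n (obs_seq \<omega>)) (q n (obs_seq \<omega>))) = t n (obs_seq \<omega>)"
    unfolding AE_all_countable by (intro allI AE_distrD[OF measurable_obs_law[OF \<mu>] t_eq])
  have prob_pq: "prob_space (p n y)" "sets (p n y) = sets borel" "prob_space (q n y)" "sets (q n y) = sets borel" for n y
    using measurable_space[of "p n" "obs_sigma {..<Suc n}" "prob_algebra borel" y]
      measurable_space[of "q n" "obs_sigma {..<Suc n}" "prob_algebra borel" y] filter_cond_distr_P[of n] filter_cond_distr_R[of n]
    by (auto simp: reg_cond_distr_def space_prob_algebra)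
  have tv0: "0 \<le> tv_norm (p n y) (q n y)" for n y
    by (intro tv_norm_nonneg prob_pq)
  have tendsto_iff: "(\<lambda>n. tv_norm (p n y) (q n y)) \<longlonglongrightarrow> 0 \<longleftrightarrow> (\<lambda>n. ennreal (tv_norm (p n y) (q n y))) \<longlonglongrightarrow> 0" for y
    using tendsto_ennreal_iff[of "\<lambda>n. tv_norm (p n y) (q n y)" sequentially 0] tv0 by simp
  show ?thesis
  proof
    assume "tv_as P p q"
    then obtain A where A: "A \<in> sets paths" "measure P {\<omega> \<in> space P. obs_seq \<omega> \<in> A} = 1"
      and lim: "\<And>y. y \<in> A \<Longrightarrow> (\<lambda>n. tv_norm (p n y) (q n y)) \<longlonglongrightarrow> 0"
      by (auto simp: tv_as_def)
    from AE_obs_in[OF A] have "AE \<omega> in P. (\<lambda>n. t n (obs_seq \<omega>)) \<longlonglongrightarrow> 0"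
      using AE_t
    proof eventually_elim
      case (elim \<omega>)
      from lim[OF elim(1)] have "(\<lambda>n. ennreal (tv_norm (p n (obs_seq \<omega>)) (q n (obs_seq \<omega>)))) \<longlonglongrightarrow> 0"
        by (simp add: tendsto_iff)
      then show ?case by (simp only: elim(2)[rule_format])
    qed
    moreover have "AE \<omega> in P. t n (obs_seq \<omega>) \<le> 2" for n
      using AE_t
    proof eventually_elim
      case (elim \<omega>)
      have "ennreal (tv_norm (p n (obs_seq \<omega>)) (q n (obs_seq \<omega>))) \<le> ennreal 2"
        by (intro ennreal_leI tv_norm_le_2 prob_pq)
      then show ?case by (simp add: elim[rule_format])
    qed
    ultimately have "(\<lambda>n. \<integral>\<^sup>+\<omega>. t n (obs_seq \<omega>) \<partial>P) \<longlonglongrightarrow> (\<integral>\<^sup>+\<omega>. 0 \<partial>P)"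
      by (intro nn_integral_dominated_convergence[where w="\<lambda>_. 2"] tP)
         (auto simp: P.emeasure_space_1)
    moreover have "(\<integral>\<^sup>+\<omega>. t n (obs_seq \<omega>) \<partial>P) = (\<integral>\<^sup>+\<omega>. ennreal (tv_norm (p n (obs_seq \<omega>)) (q n (obs_seq \<omega>))) \<partial>P)" for n
      by (rule nn_integral_cong_AE[symmetric]) (rule AE_distrD[OF measurable_obs_law[OF \<mu>] t_eq])
    ultimately show "tv_exp P p q" by (simp add: tv_exp_def)
  next
    assume "tv_exp P p q"
    then have gap0: "(\<lambda>n. \<integral>\<^sup>+\<omega>. ennreal \<bar>M n \<omega> - L (Suc n) \<omega>\<bar> \<partial>R) \<longlonglongrightarrow> 0"
      by (simp add: filter_tv_exp_iff gap_def[abs_def])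
    have lim: "AE \<omega> in P. (\<lambda>n. t n (obs_seq \<omega>)) \<longlonglongrightarrow> 0"
      unfolding P_eq
    proof (rule AE_tendsto_0[OF measurable_Z_R _ _ gap0])
      show "(\<lambda>\<omega>. t n (obs_seq \<omega>)) \<in> borel_measurable (Fy (Suc n))" for n
        by (rule measurable_obs_Fy[OF t])
      fix n A assume A: "A \<in> sets (Fy (Suc n))"
      obtain B where B: "B \<in> sets (obs_sigma {..<Suc n})" "\<And>\<omega>. indicator A \<omega> = (indicator B (obs_seq \<omega>) :: ennreal)"
        using indicator_Fy[OF A] by blast
      show "(\<integral>\<^sup>+\<omega>. ennreal (Z \<omega>) * (t n (obs_seq \<omega>) * indicator A \<omega>) \<partial>R) = (\<integral>\<^sup>+\<omega>. ennreal \<bar>M n \<omega> - L (Suc n) \<omega>\<bar> * indicator A \<omega> \<partial>R)"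
        unfolding B(2) by (rule t_int[OF B(1)])
    qed
    \<comment> \<open>Almost sure convergence is known along paths; a measurable set of measurement sequences is needed, so the null sets where \<open>t n\<close> is not the distance are removed.\<close>
    have "\<forall>n. \<exists>E. E \<in> null_sets (distr P (obs_sigma {..<Suc n}) obs_seq) \<and> (\<forall>y. y \<notin> E \<longrightarrow> ennreal (tv_norm (p n y) (q n y)) = t n y)"
    proof
      fix n
      from t_eq[of n] obtain E where "{y \<in> space (distr P (obs_sigma {..<Suc n}) obs_seq). \<not> ennreal (tv_norm (p n y) (q n y)) = t n y} \<subseteq> E"
        "E \<in> null_sets (distr P (obs_sigma {..<Suc n}) obs_seq)"
        by (auto simp: eventually_ae_filter)
      then show "\<exists>E. E \<in> null_sets (distr P (obs_sigma {..<Suc n}) obs_seq) \<and> (\<forall>y. y \<notin> E \<longrightarrow> ennreal (tv_norm (p n y) (q n y)) = t n y)"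
        by (intro exI[of _ E]) auto
    qed
    then obtain E where E: "\<And>n. E n \<in> null_sets (distr P (obs_sigma {..<Suc n}) obs_seq)"
      and E_eq: "\<And>n y. y \<notin> E n \<Longrightarrow> ennreal (tv_norm (p n y) (q n y)) = t n y"
      unfolding choice_iff by blast
    define A where "A = (\<lambda>y. limsup (\<lambda>n. t n y)) -` {0} \<inter> space paths - (\<Union>n. E n)"
    have E_paths: "E n \<in> sets paths" for n
      using E[of n] measurable_sets[OF measurable_ident_obs_sigma, of "E n" "{..<Suc n}"] by (auto simp: null_sets_def space_PiM)
    have lim_paths: "(\<lambda>y. limsup (\<lambda>n. t n y)) \<in> borel_measurable paths"
      using t_paths by (rule borel_measurable_limsup)
    have A: "A \<in> sets paths"
      unfolding A_def
    proof (rule sets.Diff)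
      show "(\<lambda>y. limsup (\<lambda>n. t n y)) -` {0} \<inter> space paths \<in> sets paths"
        by (rule measurable_sets[OF lim_paths]) simp
      show "(\<Union>n. E n) \<in> sets paths"
        using E_paths by (intro sets.countable_UN) blast
    qed
    have A_lim: "(\<lambda>n. tv_norm (p n y) (q n y)) \<longlonglongrightarrow> 0" if "y \<in> A" for y
    proof -
      have "(\<lambda>n. t n y) \<longlonglongrightarrow> 0"
        using that by (intro tendsto_0_if_Limsup_eq_0_ennreal) (auto simp: A_def)
      moreover have "t n y = ennreal (tv_norm (p n y) (q n y))" for n
        using that E_eq[of y n] by (auto simp: A_def)
      ultimately show ?thesis by (simp add: tendsto_iff)
    qed
    have "AE \<omega> in P. \<forall>n. obs_seq \<omega> \<notin> E n"
      unfolding AE_all_countable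
      by (intro allI AE_distrD[OF measurable_obs_law[OF \<mu>] AE_not_in[OF E]])
    with lim have "AE \<omega> in P. obs_seq \<omega> \<in> A"
    proof eventually_elim
      case (elim \<omega>)
      have "limsup (\<lambda>n. t n (obs_seq \<omega>)) = 0"
        using lim_imp_Limsup[OF _ elim(1)] by simp
      then show ?case using elim by (auto simp: A_def space_PiM)
    qed
    moreover have ev: "{\<omega> \<in> space P. obs_seq \<omega> \<in> A} \<in> sets P"
      using measurable_sets[OF measurable_obs_seq A] by (simp add: sets_law space_law \<mu> space_PiM vimage_def)
    ultimately have "measure P {\<omega> \<in> space P. obs_seq \<omega> \<in> A} = 1"
      by (subst P.prob_Collect_eq_1) auto
    with A A_lim show "tv_as P p q" unfolding tv_as_def by blast
  qed
qed

end

end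

section \<open>Weak merging along a partition of unity\<close>

text \<open>Schur's theorem: weak convergence to \<open>0\<close> in \<open>l\<^sup>1\<close> is norm convergence. Otherwise, as every coordinate tends to
\<open>0\<close>, one finds a subsequence whose norms stay large while their masses are concentrated on
consecutive disjoint blocks of indices (gliding humps); the bounded sequence \<open>c\<close> that has on each
block the signs of the corresponding hump contradicts weak convergence.\<close>
theorem schur_l1:
  fixes v :: "nat \<Rightarrow> nat \<Rightarrow> real"
  assumes sm: "\<And>n. summable (\<lambda>i. \<bar>v n i\<bar>)"
    and weak: "\<And>c. (\<And>i. \<bar>c i\<bar> \<le> 1) \<Longrightarrow> (\<lambda>n. \<Sum>i. c i * v n i) \<longlonglongrightarrow> 0"
  shows "(\<lambda>n. \<Sum>i. \<bar>v n i\<bar>) \<longlonglongrightarrow> 0"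
proof (rule ccontr)
  let ?N = "\<lambda>n. \<Sum>i. \<bar>v n i\<bar>"
  assume "\<not> ?N \<longlonglongrightarrow> 0"
  then obtain e0 where e0: "0 < e0" "\<forall>n0. \<exists>n\<ge>n0. \<not> norm (?N n - 0) < e0"
    unfolding LIMSEQ_iff by blast
  have N0: "0 \<le> ?N n" for n by (intro suminf_nonneg sm) simp
  define e where "e = e0 / 6"
  have e: "0 < e" using e0 by (simp add: e_def)
  have big: "\<exists>n\<ge>n0. 5 * e < ?N n" for n0
  proof -
    obtain n where "n \<ge> n0" "\<not> norm (?N n - 0) < e0" using e0(2) by blast
    then show ?thesis using N0[of n] e e_def by (intro exI[of _ n]) (auto simp: e_def)
  qed
  have coord: "(\<lambda>n. v n i) \<longlonglongrightarrow> 0" for i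
  proof -
    have "(\<lambda>n. \<Sum>j. (if j = i then 1 else 0) * v n j) \<longlonglongrightarrow> 0" by (rule weak) simp
    moreover have "(\<Sum>j. (if j = i then 1 else 0) * v n j) = v n i" for n
      by (subst suminf_finite[of "{i}"]) auto
    ultimately show ?thesis by simp
  qed
  have head: "\<exists>n0. \<forall>n\<ge>n0. (\<Sum>i<a. \<bar>v n i\<bar>) < e" for a
  proof -
    have "(\<lambda>n. \<Sum>i<a. \<bar>v n i\<bar>) \<longlonglongrightarrow> (\<Sum>i<a. \<bar>0\<bar>)"
      by (intro tendsto_sum tendsto_rabs coord)
    then have "eventually (\<lambda>n. (\<Sum>i<a. \<bar>v n i\<bar>) < e) sequentially"
      using e by (intro order_tendstoD(2)) auto
    then show ?thesis by (simp add: eventually_sequentially)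
  qed
  have tail: "\<exists>b>a. ?N n - e < (\<Sum>i<b. \<bar>v n i\<bar>)" for a n
  proof -
    have "(\<lambda>b. \<Sum>i<b. \<bar>v n i\<bar>) \<longlonglongrightarrow> ?N n" by (rule summable_LIMSEQ[OF sm])
    then have "eventually (\<lambda>b. ?N n - e < (\<Sum>i<b. \<bar>v n i\<bar>)) sequentially"
      using e by (intro order_tendstoD(1)) auto
    then have "eventually (\<lambda>b. ?N n - e < (\<Sum>i<b. \<bar>v n i\<bar>) \<and> a < b) sequentially"
      using eventually_gt_at_top by (rule eventually_conj)
    then show ?thesis by (auto simp: eventually_sequentially)
  qed
  \<comment> \<open>\<open>(n, a, b)\<close>: the \<open>n\<close>-th sequence has norm above \<open>5 * e\<close> and less than \<open>2 * e\<close> of it outside the block from \<open>a\<close> to \<open>b\<close>.\<close>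
  define Hump where "Hump s \<longleftrightarrow> (case s of (n, a, b) \<Rightarrow> a < b \<and> 5 * e < ?N n \<and>
      (\<Sum>i<a. \<bar>v n i\<bar>) < e \<and> ?N n - e < (\<Sum>i<b. \<bar>v n i\<bar>))" for s :: "nat \<times> nat \<times> nat"
  have ex: "\<exists>n b. n \<ge> n0 \<and> Hump (n, a, b)" for n0 a
  proof -
    obtain n1 where n1: "\<forall>n\<ge>n1. (\<Sum>i<a. \<bar>v n i\<bar>) < e" using head by blast
    obtain n where n: "n \<ge> max n0 n1" "5 * e < ?N n" using big by blast
    obtain b where "b > a" "?N n - e < (\<Sum>i<b. \<bar>v n i\<bar>)" using tail by blast
    then show ?thesis using n n1 by (intro exI[of _ n] exI[of _ b]) (auto simp: Hump_def)
  qed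
  have "\<exists>s. \<forall>k. Hump (s k) \<and> (fst (s k) < fst (s (Suc k)) \<and> fst (snd (s (Suc k))) = snd (snd (s k)))"
  proof (rule dependent_nat_choice)
    show "\<exists>s. Hump s" using ex by blast
    fix s k assume "Hump s"
    obtain n b where "n \<ge> Suc (fst s)" "Hump (n, snd (snd s), b)" using ex by blast
    then show "\<exists>t. Hump t \<and> (fst s < fst t \<and> fst (snd t) = snd (snd s))"
      by (intro exI[of _ "(n, snd (snd s), b)"]) auto
  qed
  then obtain s where s: "\<And>k. Hump (s k)" "\<And>k. fst (s k) < fst (s (Suc k))" "\<And>k. fst (snd (s (Suc k))) = snd (snd (s k))"
    by blast
  define n where "n k = fst (s k)" for k
  define a where "a k = fst (snd (s k))" for k
  have hump: "a k < a (Suc k)" "5 * e < ?N (n k)" "(\<Sum>i<a k. \<bar>v (n k) i\<bar>) < e" "?N (n k) - e < (\<Sum>i<a (Suc k). \<bar>v (n k) i\<bar>)" for k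
    using s(1)[of k] s(3)[of k] by (auto simp: Hump_def n_def a_def split: prod.splits)
  have n_mono: "strict_mono n" unfolding strict_mono_Suc_iff n_def using s(2) by blast
  have a_mono: "strict_mono a" unfolding strict_mono_Suc_iff using hump(1) by blast
  \<comment> \<open>The number of the block that contains \<open>i\<close>.\<close>
  define blk where "blk i = (LEAST k. i < a (Suc k))" for i
  have blk: "blk i = k" if "a k \<le> i" "i < a (Suc k)" for i k
    unfolding blk_def
  proof (rule Least_equality)
    fix j assume "i < a (Suc j)"
    show "k \<le> j"
    proof (rule ccontr)
      assume "\<not> k \<le> j"
      then have "a (Suc j) \<le> a k" using a_mono by (simp add: strict_mono_less_eq)
      with that \<open>i < a (Suc j)\<close> show False by simp
    qed
  qed (use that in simp)
  define c where "c i = sgn (v (n (blk i)) i)" for i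
  have c1: "\<bar>c i\<bar> \<le> 1" for i by (simp add: c_def sgn_if)
  have smc: "summable (\<lambda>i. c i * v m i)" for m
    by (rule summable_comparison_test'[OF sm[of m], of 0]) (use c1 in \<open>auto simp: abs_mult intro: mult_left_le_one_le\<close>)
  have lower: "e < (\<Sum>i. c i * v (n k) i)" for k
  proof -
    let ?w = "v (n k)"
    have sm1: "summable (\<lambda>i. \<bar>?w i\<bar> - c i * ?w i)" by (intro summable_diff sm smc)
    let ?I = "{a k..<a (Suc k)}"
    have out: "(\<lambda>i. 2 * (\<bar>?w i\<bar> - (if i \<in> ?I then \<bar>?w i\<bar> else 0))) sums (2 * (?N (n k) - (\<Sum>i\<in>?I. \<bar>?w i\<bar>)))"
      by (intro sums_mult sums_diff summable_sums sm sums_If_finite_set) simp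
    have "(\<Sum>i. \<bar>?w i\<bar> - c i * ?w i) \<le> (\<Sum>i. 2 * (\<bar>?w i\<bar> - (if i \<in> ?I then \<bar>?w i\<bar> else 0)))"
    proof (rule suminf_le[OF _ sm1 sums_summable[OF out]])
      show "\<bar>?w i\<bar> - c i * ?w i \<le> 2 * (\<bar>?w i\<bar> - (if i \<in> ?I then \<bar>?w i\<bar> else 0))" for i
      proof (cases "i \<in> ?I")
        case True
        then have "blk i = k" by (intro blk) auto
        then have "c i * ?w i = \<bar>?w i\<bar>" by (simp add: c_def sgn_if)
        then show ?thesis using True by simp
      next
        case False
        have "\<bar>c i * ?w i\<bar> \<le> \<bar>?w i\<bar>" using c1[of i] by (simp add: abs_mult mult_left_le_one_le)
        then have "- (c i * ?w i) \<le> \<bar>?w i\<bar>" by (rule abs_le_D2)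
        then have "\<bar>?w i\<bar> - c i * ?w i \<le> 2 * \<bar>?w i\<bar>" by linarith
        then show ?thesis unfolding if_not_P[OF False] diff_0_right .
      qed
    qed
    also have "\<dots> = 2 * (?N (n k) - (\<Sum>i\<in>?I. \<bar>?w i\<bar>))"
      by (rule sums_unique[OF out, symmetric])
    finally have "(\<Sum>i. \<bar>?w i\<bar> - c i * ?w i) \<le> 2 * (?N (n k) - (\<Sum>i\<in>?I. \<bar>?w i\<bar>))" .
    moreover have "(\<Sum>i<a (Suc k). \<bar>?w i\<bar>) = (\<Sum>i<a k. \<bar>?w i\<bar>) + (\<Sum>i\<in>?I. \<bar>?w i\<bar>)"
      using hump(1)[of k] by (simp add: lessThan_atLeast0 sum.atLeastLessThan_concat)
    ultimately have "(\<Sum>i. \<bar>?w i\<bar> - c i * ?w i) < 4 * e"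
      using hump(3,4)[of k] by argo
    moreover have "(\<Sum>i. \<bar>?w i\<bar> - c i * ?w i) = ?N (n k) - (\<Sum>i. c i * ?w i)"
      by (rule suminf_diff[symmetric, OF sm smc])
    ultimately show ?thesis using hump(2)[of k] by linarith
  qed
  have "(\<lambda>k. \<Sum>i. c i * v (n k) i) \<longlonglongrightarrow> 0"
    using LIMSEQ_subseq_LIMSEQ[OF weak[OF c1] n_mono] by (simp add: o_def)
  then have "eventually (\<lambda>k. (\<Sum>i. c i * v (n k) i) < e) sequentially"
    using e by (intro order_tendstoD(2)) auto
  then show False using lower by (auto simp: eventually_sequentially) (meson less_asym order_refl)
qed

lemma continuous_on_dominated_suminf:
  fixes \<psi> :: "nat \<Rightarrow> 'x::topological_space \<Rightarrow> real"
  assumes cont: "\<And>i. continuous_on UNIV (\<psi> i)" and bnd: "\<And>i x. \<bar>\<psi> i x\<bar> \<le> B * (1/2)^i"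
  shows "continuous_on UNIV (\<lambda>x. \<Sum>i. \<psi> i x)"
proof -
  have "uniform_limit UNIV (\<lambda>n x. \<Sum>i<n. \<psi> i x) (\<lambda>x. \<Sum>i. \<psi> i x) sequentially"
    by (rule Weierstrass_m_test[where M="\<lambda>i. B * (1/2)^i"]) (use bnd in \<open>auto intro!: summable_mult\<close>)
  then show ?thesis
    by (rule uniform_limit_theorem[rotated]) (auto intro!: always_eventually continuous_on_sum cont)
qed

text \<open>A countable partition of unity subordinate to the balls of radius \<open>r\<close>. It need not be locally finite:
the weights \<open>2\<^bsup>-i\<^esup>\<close> make all series converge uniformly, which is enough for bounded combinations
to be continuous.\<close>
theorem partition_of_unity:
  fixes r :: "'x::{metric_space, second_countable_topology} \<Rightarrow> real"
  assumes r: "\<And>x. 0 < r x"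
  obtains c :: "nat \<Rightarrow> 'x" and \<phi> :: "nat \<Rightarrow> 'x \<Rightarrow> real" where
    "\<And>i x. 0 \<le> \<phi> i x" "\<And>x. (\<lambda>i. \<phi> i x) sums 1" "\<And>i x. \<phi> i x \<noteq> 0 \<Longrightarrow> dist (c i) x < r (c i)"
    "\<And>b B. (\<And>i. \<bar>b i\<bar> \<le> B) \<Longrightarrow> continuous_on UNIV (\<lambda>x. \<Sum>i. b i * \<phi> i x)"
    "\<And>i. continuous_on UNIV (\<phi> i)"
proof -
  obtain F' where F': "F' \<subseteq> (\<lambda>x. ball x (r x)) ` UNIV" "countable F'" "\<Union>F' = \<Union>((\<lambda>x. ball x (r x)) ` UNIV)"
    using Lindelof[of "(\<lambda>x. ball x (r x)) ` UNIV"] by auto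
  obtain C where C: "C \<subseteq> UNIV" "countable C" "F' = (\<lambda>x. ball x (r x)) ` C"
    using countable_subset_image[of F' "\<lambda>x. ball x (r x)" UNIV] F' by blast
  have cover: "\<exists>x\<in>C. y \<in> ball x (r x)" for y
  proof -
    have "y \<in> \<Union>((\<lambda>x. ball x (r x)) ` UNIV)" using r[of y] by (auto intro!: exI[of _ y])
    then show ?thesis unfolding F'(3)[symmetric] C(3) by blast
  qed
  then have "C \<noteq> {}" by blast
  define c where "c = from_nat_into C"
  have c: "\<exists>i. dist (c i) y < r (c i)" for y
    using cover[of y] from_nat_into_surj[OF C(2)] unfolding c_def by (metis mem_ball)
  \<comment> \<open>A bump on the \<open>i\<close>-th ball, scaled so that the sum converges uniformly.\<close>
  define \<psi> where "\<psi> i x = max 0 (min 1 (r (c i) - dist (c i) x)) * (1/2)^i" for i x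
  have \<psi>0: "0 \<le> \<psi> i x" for i x by (simp add: \<psi>_def)
  have \<psi>1: "\<psi> i x \<le> (1/2)^i" for i x
    unfolding \<psi>_def by (rule mult_left_le_one_le) auto
  have \<psi>c: "continuous_on UNIV (\<psi> i)" for i
    unfolding \<psi>_def by (intro continuous_intros)
  define W where "W x = (\<Sum>i. \<psi> i x)" for x
  have sm: "summable (\<lambda>i. \<psi> i x)" for x
    by (rule summable_comparison_test'[of "\<lambda>i. (1/2)^i" 0]) (use \<psi>0 \<psi>1 in auto)
  have W0: "0 < W x" for x
  proof -
    obtain i where "dist (c i) x < r (c i)" using c by blast
    then have "0 < \<psi> i x" by (simp add: \<psi>_def)
    then show ?thesis unfolding W_def by (intro suminf_pos2[OF sm]) (use \<psi>0 in auto)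
  qed
  have Wn: "W x \<noteq> 0" for x using W0[of x] by simp
  have Wc: "continuous_on UNIV W"
    unfolding W_def by (rule continuous_on_dominated_suminf[where B=1, OF \<psi>c]) (use \<psi>0 \<psi>1 in auto)
  define \<phi> where "\<phi> i x = \<psi> i x / W x" for i x
  show ?thesis
  proof
    show "0 \<le> \<phi> i x" for i x using \<psi>0[of i x] W0[of x] by (simp add: \<phi>_def)
    show "(\<lambda>i. \<phi> i x) sums 1" for x
      using sums_divide[OF summable_sums[OF sm[of x]], of "W x"] W0[of x] by (simp add: \<phi>_def W_def)
    show "dist (c i) x < r (c i)" if "\<phi> i x \<noteq> 0" for i x
      using that by (auto simp: \<phi>_def \<psi>_def max_def min_def split: if_splits)
    show "continuous_on UNIV (\<phi> i)" for i
      unfolding \<phi>_def by (intro continuous_on_divide \<psi>c Wc) (simp add: Wn)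
    fix b :: "nat \<Rightarrow> real" and B :: real assume b: "\<And>i. \<bar>b i\<bar> \<le> B"
    have B0: "0 \<le> B" using b[of 0] by linarith
    have le: "\<bar>b i * \<psi> i x\<bar> \<le> B * (1/2)^i" for i x
      unfolding abs_mult using \<psi>0[of i x] \<psi>1[of i x] b[of i] B0 by (intro mult_mono) auto
    have "continuous_on UNIV (\<lambda>x. \<Sum>i. b i * \<psi> i x)"
    proof (rule continuous_on_dominated_suminf)
      show "continuous_on UNIV (\<lambda>x. b i * \<psi> i x)" for i by (intro continuous_intros \<psi>c)
      show "\<bar>b i * \<psi> i x\<bar> \<le> B * (1/2)^i" for i x by (rule le)
    qed
    then have "continuous_on UNIV (\<lambda>x. (\<Sum>i. b i * \<psi> i x) / W x)"
      by (intro continuous_on_divide Wc) (simp_all add: Wn)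
    moreover have "(\<Sum>i. b i * \<psi> i x) / W x = (\<Sum>i. b i * \<phi> i x)" for x
    proof -
      have "summable (\<lambda>i. b i * \<psi> i x)"
        by (rule summable_comparison_test'[of "\<lambda>i. B * (1/2)^i" 0]) (use le in \<open>auto intro!: summable_mult\<close>)
      from suminf_divide[OF this, of "W x"] show ?thesis by (simp add: \<phi>_def)
    qed
    ultimately show "continuous_on UNIV (\<lambda>x. \<Sum>i. b i * \<phi> i x)" by simp
  qed
qed

context
  fixes \<phi> :: "nat \<Rightarrow> 'x::topological_space \<Rightarrow> real"
  assumes \<phi>0: "\<And>i x. 0 \<le> \<phi> i x" and \<phi>1: "\<And>x. (\<lambda>i. \<phi> i x) sums 1"
    and \<phi>c: "\<And>i. continuous_on UNIV (\<phi> i)"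
begin

lemma \<phi>_meas[measurable]: "\<phi> i \<in> borel_measurable borel"
  using \<phi>c by (rule borel_measurable_continuous_onI)

lemma \<phi>_le_1: "\<phi> i x \<le> 1"
  using \<phi>0 sum_le_suminf[OF sums_summable[OF \<phi>1[of x]], of "{i}"] sums_unique[OF \<phi>1[of x]] by auto

lemma
  assumes b: "\<And>i. \<bar>b i\<bar> \<le> B"
  shows combination_summable: "summable (\<lambda>i. \<bar>b i * \<phi> i x\<bar>)"
    and combination_bound: "\<bar>\<Sum>i. b i * \<phi> i x\<bar> \<le> B"
proof -
  have le: "\<bar>b i * \<phi> i x\<bar> \<le> B * \<phi> i x" for i
    unfolding abs_mult using b[of i] \<phi>0[of i x] by (simp add: mult_right_mono)
  have smB: "summable (\<lambda>i. B * \<phi> i x)" by (intro summable_mult sums_summable[OF \<phi>1])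
  show sm: "summable (\<lambda>i. \<bar>b i * \<phi> i x\<bar>)"
    by (rule summable_comparison_test'[OF smB, of 0]) (use le in auto)
  have "\<bar>\<Sum>i. b i * \<phi> i x\<bar> \<le> (\<Sum>i. \<bar>b i * \<phi> i x\<bar>)" by (rule summable_rabs[OF sm])
  also have "\<dots> \<le> (\<Sum>i. B * \<phi> i x)" by (rule suminf_le[OF le sm smB])
  also have "\<dots> = B" using sums_unique[OF sums_mult[OF \<phi>1[of x], of B]] by simp
  finally show "\<bar>\<Sum>i. b i * \<phi> i x\<bar> \<le> B" .
qed

lemma combination_integral:
  assumes M: "prob_space M" "sets M = sets borel" and b: "\<And>i. \<bar>b i\<bar> \<le> B"
  shows "(\<lambda>i. b i * (\<integral>x. \<phi> i x \<partial>M)) sums (\<integral>x. (\<Sum>i. b i * \<phi> i x) \<partial>M)"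
    and "summable (\<lambda>i. \<bar>b i * (\<integral>x. \<phi> i x \<partial>M)\<bar>)"
proof -
  interpret prob_space M by fact
  note [measurable_cong] = M(2)
  have i\<phi>: "integrable M (\<phi> i)" for i
    by (rule integrable_const_bound[where B=1]) (auto simp: \<phi>0 \<phi>_le_1)
  have smI: "summable (\<lambda>i. \<integral>x. \<phi> i x \<partial>M)"
  proof (rule summableI_nonneg_bounded[where x=1])
    show "0 \<le> (\<integral>x. \<phi> i x \<partial>M)" for i by (simp add: \<phi>0)
    fix n
    have "(\<Sum>i<n. \<integral>x. \<phi> i x \<partial>M) = (\<integral>x. (\<Sum>i<n. \<phi> i x) \<partial>M)" using i\<phi> by simp
    also have "\<dots> \<le> (\<integral>x. 1 \<partial>M)"
    proof (rule integral_mono)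
      show "(\<Sum>i<n. \<phi> i x) \<le> 1" for x
        using sum_le_suminf[OF sums_summable[OF \<phi>1[of x]], of "{..<n}"] sums_unique[OF \<phi>1[of x]] \<phi>0 by auto
    qed (use i\<phi> in auto)
    finally show "(\<Sum>i<n. \<integral>x. \<phi> i x \<partial>M) \<le> 1" by (simp add: prob_space)
  qed
  have abs_int: "(\<integral>x. \<bar>b i * \<phi> i x\<bar> \<partial>M) = \<bar>b i\<bar> * (\<integral>x. \<phi> i x \<partial>M)" for i
    using i\<phi> by (simp add: abs_mult \<phi>0)
  have smb: "summable (\<lambda>i. \<bar>b i\<bar> * (\<integral>x. \<phi> i x \<partial>M))"
    by (rule summable_comparison_test'[OF summable_mult[OF smI, of B], of 0])
       (use b in \<open>auto simp: abs_mult \<phi>0 intro!: mult_right_mono integral_nonneg_AE\<close>)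
  show "(\<lambda>i. b i * (\<integral>x. \<phi> i x \<partial>M)) sums (\<integral>x. (\<Sum>i. b i * \<phi> i x) \<partial>M)"
    using sums_integral[of M "\<lambda>i x. b i * \<phi> i x"] i\<phi> smb abs_int combination_summable[OF b] by simp
  show "summable (\<lambda>i. \<bar>b i * (\<integral>x. \<phi> i x \<partial>M)\<bar>)"
    using smb by (simp add: abs_mult \<phi>0)
qed

text \<open>The \<open>l\<^sup>1\<close> distance of the sequences \<open>\<integral> \<phi>\<^sub>i dM\<close> and \<open>\<integral> \<phi>\<^sub>i dN\<close>. It dominates differences of integrals of
functions that vary little on the supports of the \<open>\<phi>\<^sub>i\<close>.\<close>
definition "part_diff M N = (\<Sum>i. \<bar>(\<integral>x. \<phi> i x \<partial>M) - (\<integral>x. \<phi> i x \<partial>N)\<bar>)"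

lemma part_diff_summable:
  assumes M: "prob_space M" "sets M = sets borel" and N: "prob_space N" "sets N = sets borel"
  shows "summable (\<lambda>i. \<bar>(\<integral>x. \<phi> i x \<partial>M) - (\<integral>x. \<phi> i x \<partial>N)\<bar>)"
proof (rule summable_comparison_test'[of _ 0])
  show "summable (\<lambda>i. \<bar>(\<integral>x. \<phi> i x \<partial>M)\<bar> + \<bar>(\<integral>x. \<phi> i x \<partial>N)\<bar>)"
    using combination_integral(2)[OF M, of "\<lambda>_. 1" 1] combination_integral(2)[OF N, of "\<lambda>_. 1" 1]
    by (intro summable_add) auto
qed auto

lemma part_diff_tendsto_0:
  fixes M N :: "nat \<Rightarrow> 'x measure"
  assumes M: "\<And>n. prob_space (M n)" "\<And>n. sets (M n) = sets borel"
    and N: "\<And>n. prob_space (N n)" "\<And>n. sets (N n) = sets borel"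
    and comb: "\<And>b B. (\<And>i. \<bar>b i\<bar> \<le> B) \<Longrightarrow> continuous_on UNIV (\<lambda>x. \<Sum>i. b i * \<phi> i x)"
    and merge: "\<And>f :: 'x \<Rightarrow> real. f \<in> bcontfun \<Longrightarrow> (\<lambda>n. \<bar>(\<integral>x. f x \<partial>M n) - (\<integral>x. f x \<partial>N n)\<bar>) \<longlonglongrightarrow> 0"
  shows "(\<lambda>n. part_diff (M n) (N n)) \<longlonglongrightarrow> 0"
  unfolding part_diff_def
proof (rule schur_l1[OF part_diff_summable[OF M N]])
  fix b :: "nat \<Rightarrow> real" assume b: "\<And>i. \<bar>b i\<bar> \<le> 1"
  let ?f = "\<lambda>x. \<Sum>i. b i * \<phi> i x"
  have "?f \<in> bcontfun"
    unfolding bcontfun_def using comb[OF b] combination_bound[OF b] by (auto intro!: boundedI[where B=1])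
  then have lim: "(\<lambda>n. (\<integral>x. ?f x \<partial>M n) - (\<integral>x. ?f x \<partial>N n)) \<longlonglongrightarrow> 0"
    by (rule tendsto_rabs_zero_cancel[OF merge])
  have "(\<Sum>i. b i * ((\<integral>x. \<phi> i x \<partial>M n) - (\<integral>x. \<phi> i x \<partial>N n))) = (\<integral>x. ?f x \<partial>M n) - (\<integral>x. ?f x \<partial>N n)" for n
    using sums_unique[OF sums_diff[OF combination_integral(1)[OF M[of n] b] combination_integral(1)[OF N[of n] b]]]
    by (simp add: right_diff_distrib)
  with lim show "(\<lambda>n. \<Sum>i. b i * ((\<integral>x. \<phi> i x \<partial>M n) - (\<integral>x. \<phi> i x \<partial>N n))) \<longlonglongrightarrow> 0" by simp
qed

text \<open>\<open>g\<close> is within \<open>e\<close> of the combination \<open>\<Sum>\<^sub>i g(c\<^sub>i) \<phi>\<^sub>i\<close>, whose coefficients are bounded by \<open>B\<close>.\<close>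
lemma integral_diff_le_part_diff:
  fixes g :: "'x \<Rightarrow> real"
  assumes M: "prob_space M" "sets M = sets borel" and N: "prob_space N" "sets N = sets borel"
    and g[measurable]: "g \<in> borel_measurable borel" and B: "\<And>x. \<bar>g x\<bar> \<le> B"
    and osc: "\<And>i x. \<phi> i x \<noteq> 0 \<Longrightarrow> \<bar>g x - g (c i)\<bar> \<le> e"
  shows "\<bar>(\<integral>x. g x \<partial>M) - (\<integral>x. g x \<partial>N)\<bar> \<le> 2 * e + B * part_diff M N"
proof -
  let ?h = "\<lambda>x. \<Sum>i. g (c i) * \<phi> i x"
  have B': "\<bar>g (c i)\<bar> \<le> B" for i by (rule B)
  have near: "\<bar>g x - ?h x\<bar> \<le> e" for x
  proof -
    have sm: "summable (\<lambda>i. g (c i) * \<phi> i x)"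
      using summable_rabs_cancel[OF combination_summable[OF B']] .
    have "(\<lambda>i. g x * \<phi> i x) sums g x" using sums_mult[OF \<phi>1[of x], of "g x"] by simp
    from sums_diff[OF this summable_sums[OF sm]]
    have s: "(\<lambda>i. (g x - g (c i)) * \<phi> i x) sums (g x - ?h x)" by (simp add: left_diff_distrib)
    have le: "\<bar>(g x - g (c i)) * \<phi> i x\<bar> \<le> e * \<phi> i x" for i
      using osc[of i x] \<phi>0[of i x] by (cases "\<phi> i x = 0") (auto simp: abs_mult intro!: mult_right_mono)
    have sme: "summable (\<lambda>i. e * \<phi> i x)" by (intro summable_mult sums_summable[OF \<phi>1])
    have sma: "summable (\<lambda>i. \<bar>(g x - g (c i)) * \<phi> i x\<bar>)"
      by (rule summable_comparison_test'[OF sme, of 0]) (use le in auto)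
    have "\<bar>g x - ?h x\<bar> \<le> (\<Sum>i. \<bar>(g x - g (c i)) * \<phi> i x\<bar>)"
      unfolding sums_unique[OF s] by (rule summable_rabs[OF sma])
    also have "\<dots> \<le> (\<Sum>i. e * \<phi> i x)" by (rule suminf_le[OF le sma sme])
    also have "\<dots> = e" using sums_unique[OF sums_mult[OF \<phi>1[of x], of e]] by simp
    finally show ?thesis .
  qed
  have h[measurable]: "?h \<in> borel_measurable borel" by measurable
  have int: "\<bar>(\<integral>x. g x \<partial>K) - (\<integral>x. ?h x \<partial>K)\<bar> \<le> e" if K: "prob_space K" "sets K = sets borel" for K
  proof -
    interpret K: prob_space K by fact
    note [measurable_cong] = K(2)
    have ig: "integrable K g" by (rule K.integrable_const_bound[where B=B]) (use B in auto)
    have ih: "integrable K ?h" by (rule K.integrable_const_bound[where B=B]) (use combination_bound[OF B'] in auto)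
    have "\<bar>\<integral>x. g x - ?h x \<partial>K\<bar> \<le> (\<integral>x. \<bar>g x - ?h x\<bar> \<partial>K)" by (rule integral_abs_bound)
    also have "\<dots> \<le> (\<integral>x. e \<partial>K)" using ig ih near by (intro integral_mono) auto
    finally show ?thesis using ig ih by (simp add: K.prob_space)
  qed
  have sums: "(\<lambda>i. g (c i) * ((\<integral>x. \<phi> i x \<partial>M) - (\<integral>x. \<phi> i x \<partial>N))) sums ((\<integral>x. ?h x \<partial>M) - (\<integral>x. ?h x \<partial>N))"
    using sums_diff[OF combination_integral(1)[OF M B'] combination_integral(1)[OF N B']]
    by (simp add: right_diff_distrib)
  let ?d = "\<lambda>i. \<bar>(\<integral>x. \<phi> i x \<partial>M) - (\<integral>x. \<phi> i x \<partial>N)\<bar>"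
  have smd: "summable (\<lambda>i. B * ?d i)" by (intro summable_mult part_diff_summable M N)
  have le: "\<bar>g (c i) * ((\<integral>x. \<phi> i x \<partial>M) - (\<integral>x. \<phi> i x \<partial>N))\<bar> \<le> B * ?d i" for i
    unfolding abs_mult by (intro mult_right_mono B) simp
  have sma: "summable (\<lambda>i. \<bar>g (c i) * ((\<integral>x. \<phi> i x \<partial>M) - (\<integral>x. \<phi> i x \<partial>N))\<bar>)"
    by (rule summable_comparison_test'[OF smd, of 0]) (use le in auto)
  have "\<bar>(\<integral>x. ?h x \<partial>M) - (\<integral>x. ?h x \<partial>N)\<bar> \<le> (\<Sum>i. \<bar>g (c i) * ((\<integral>x. \<phi> i x \<partial>M) - (\<integral>x. \<phi> i x \<partial>N))\<bar>)"
    unfolding sums_unique[OF sums] by (rule summable_rabs[OF sma])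
  also have "\<dots> \<le> (\<Sum>i. B * ?d i)" by (rule suminf_le[OF le sma smd])
  also have "\<dots> = B * part_diff M N"
    unfolding part_diff_def by (rule suminf_mult[OF part_diff_summable[OF M N]])
  finally show ?thesis using int[OF M] int[OF N] by linarith
qed

lemma part_diff_bounds:
  assumes M: "prob_space M" "sets M = sets borel" and N: "prob_space N" "sets N = sets borel"
  shows "0 \<le> part_diff M N" "part_diff M N \<le> 2"
proof -
  show "0 \<le> part_diff M N" unfolding part_diff_def by (intro suminf_nonneg part_diff_summable M N) simp
  have one: "(\<lambda>i. \<integral>x. \<phi> i x \<partial>K) sums 1" if K: "prob_space K" "sets K = sets borel" for K
  proof -
    have "(\<Sum>i. \<phi> i x) = 1" for x using sums_unique[OF \<phi>1[of x]] by simp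
    then show ?thesis using combination_integral(1)[OF K, of "\<lambda>_. 1" 1] prob_space.prob_space[OF K(1)] by simp
  qed
  have s: "(\<lambda>i. (\<integral>x. \<phi> i x \<partial>M) + (\<integral>x. \<phi> i x \<partial>N)) sums (1 + 1)"
    by (rule sums_add[OF one[OF M] one[OF N]])
  have "part_diff M N \<le> (\<Sum>i. (\<integral>x. \<phi> i x \<partial>M) + (\<integral>x. \<phi> i x \<partial>N))"
    unfolding part_diff_def
  proof (rule suminf_le[OF _ part_diff_summable[OF M N] sums_summable[OF s]])
    fix i
    have "0 \<le> (\<integral>x. \<phi> i x \<partial>M)" "0 \<le> (\<integral>x. \<phi> i x \<partial>N)" by (simp_all add: \<phi>0)
    then show "\<bar>(\<integral>x. \<phi> i x \<partial>M) - (\<integral>x. \<phi> i x \<partial>N)\<bar> \<le> (\<integral>x. \<phi> i x \<partial>M) + (\<integral>x. \<phi> i x \<partial>N)" by linarith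
  qed
  then show "part_diff M N \<le> 2" using sums_unique[OF s] by simp
qed

end

section \<open>The distance of filters as a difference of predictor integrals\<close>

text \<open>Bounded functions are shifted by \<open>B\<close> to carry statements about integrals of nonnegative functions over to integrals of
real functions.\<close>
lemma (in prob_space) bounded_nn_integral_shift:
  fixes g :: "'a \<Rightarrow> real"
  assumes [measurable]: "g \<in> borel_measurable M" and g: "\<And>x. x \<in> space M \<Longrightarrow> \<bar>g x\<bar> \<le> B"
  shows "(\<integral>\<^sup>+x. ennreal (g x + B) \<partial>M) = ennreal ((\<integral>x. g x \<partial>M) + B)"
    and "integrable M g" and "\<bar>\<integral>x. g x \<partial>M\<bar> \<le> B"
proof -
  show i: "integrable M g" by (rule integrable_const_bound[where B=B]) (use g in \<open>auto intro!: AE_I2\<close>)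
  have "(\<integral>\<^sup>+x. ennreal (g x + B) \<partial>M) = ennreal (\<integral>x. g x + B \<partial>M)"
  proof (rule nn_integral_eq_integral)
    show "AE x in M. 0 \<le> g x + B"
    proof (rule AE_I2)
      fix x assume "x \<in> space M"
      from g[OF this] show "0 \<le> g x + B" by linarith
    qed
  qed (use i in simp)
  then show "(\<integral>\<^sup>+x. ennreal (g x + B) \<partial>M) = ennreal ((\<integral>x. g x \<partial>M) + B)" using i by (simp add: prob_space)
  have "\<bar>\<integral>x. g x \<partial>M\<bar> \<le> (\<integral>x. \<bar>g x\<bar> \<partial>M)" by (rule integral_abs_bound)
  also have "\<dots> \<le> B" using i g by (intro integral_le_const) (auto intro!: AE_I2)
  finally show "\<bar>\<integral>x. g x \<partial>M\<bar> \<le> B" .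
qed

lemma measurable_integral_kernel:
  fixes f :: "'z \<Rightarrow> 'x \<Rightarrow> real"
  assumes \<kappa>: "\<kappa> \<in> N \<rightarrow>\<^sub>M prob_algebra K" and f: "(\<lambda>(y, x). f y x) \<in> borel_measurable (N \<Otimes>\<^sub>M K)"
    and B: "\<And>y x. \<bar>f y x\<bar> \<le> B"
  shows "(\<lambda>y. \<integral>x. f y x \<partial>\<kappa> y) \<in> borel_measurable N"
proof -
  have "(\<lambda>(y, x). ennreal (f y x + B)) \<in> borel_measurable (N \<Otimes>\<^sub>M K)"
    using f by (simp add: split_beta)
  from measurable_nn_integral_kernel[OF \<kappa> this]
  have "(\<lambda>y. enn2real (\<integral>\<^sup>+x. ennreal (f y x + B) \<partial>\<kappa> y) - B) \<in> borel_measurable N" by simp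
  moreover have "enn2real (\<integral>\<^sup>+x. ennreal (f y x + B) \<partial>\<kappa> y) - B = (\<integral>x. f y x \<partial>\<kappa> y)" if y: "y \<in> space N" for y
  proof -
    have \<kappa>y: "prob_space (\<kappa> y)" "sets (\<kappa> y) = sets K"
      using measurable_space[OF \<kappa> y] by (simp_all add: space_prob_algebra)
    have m: "f y \<in> borel_measurable (\<kappa> y)"
      unfolding measurable_cong_sets[OF \<kappa>y(2) refl] using measurable_compose[OF measurable_Pair1'[OF y] f] by simp
    note r = prob_space.bounded_nn_integral_shift[OF \<kappa>y(1) m B]
    have "0 \<le> (\<integral>x. f y x \<partial>\<kappa> y) + B" using r(3) by linarith
    then show ?thesis unfolding r(1) by simp
  qed
  ultimately show ?thesis by (simp cong: measurable_cong)
qed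

lemma reg_cond_distr_integral:
  fixes X :: "'w \<Rightarrow> 'x::topological_space" and f :: "'x \<times> 'n \<Rightarrow> real"
  assumes M: "prob_space M" and r: "reg_cond_distr M X N Y \<kappa>"
    and X: "X \<in> M \<rightarrow>\<^sub>M borel" and Y: "Y \<in> M \<rightarrow>\<^sub>M N"
    and f: "f \<in> borel_measurable (borel \<Otimes>\<^sub>M N)" and B: "\<And>z. \<bar>f z\<bar> \<le> B"
  shows "(\<integral>\<omega>. f (X \<omega>, Y \<omega>) \<partial>M) = (\<integral>\<omega>. \<integral>x. f (x, Y \<omega>) \<partial>\<kappa> (Y \<omega>) \<partial>M)"
    and "(\<lambda>y. \<integral>x. f (x, y) \<partial>\<kappa> y) \<in> borel_measurable N"
    and "\<And>y. y \<in> space N \<Longrightarrow> \<bar>\<integral>x. f (x, y) \<partial>\<kappa> y\<bar> \<le> B"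
proof -
  interpret prob_space M by fact
  have \<kappa>: "\<kappa> \<in> N \<rightarrow>\<^sub>M prob_algebra borel"
    using r by (simp add: reg_cond_distr_def)
  have \<kappa>p: "prob_space (\<kappa> y)" "sets (\<kappa> y) = sets borel" if "y \<in> space N" for y
    using measurable_space[OF \<kappa> that] by (simp_all add: space_prob_algebra)
  have fy: "(\<lambda>x. f (x, y)) \<in> borel_measurable (\<kappa> y)" if "y \<in> space N" for y
    unfolding measurable_cong_sets[OF \<kappa>p(2)[OF that] refl]
    by (rule measurable_compose[OF _ f]) (use that in measurable)
  have fXY: "(\<lambda>\<omega>. f (X \<omega>, Y \<omega>)) \<in> borel_measurable M"
    by (rule measurable_compose[OF measurable_Pair[OF X Y] f])
  show m: "(\<lambda>y. \<integral>x. f (x, y) \<partial>\<kappa> y) \<in> borel_measurable N"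
  proof (rule measurable_integral_kernel[OF \<kappa> _ B])
    show "(\<lambda>(y, x). f (x, y)) \<in> borel_measurable (N \<Otimes>\<^sub>M borel)"
      unfolding split_beta by (rule measurable_compose[OF _ f]) measurable
  qed
  show b: "\<bar>\<integral>x. f (x, y) \<partial>\<kappa> y\<bar> \<le> B" if "y \<in> space N" for y
    by (rule prob_space.bounded_nn_integral_shift(3)[OF \<kappa>p(1)[OF that] fy[OF that] B])
  have mY: "(\<lambda>\<omega>. \<integral>x. f (x, Y \<omega>) \<partial>\<kappa> (Y \<omega>)) \<in> borel_measurable M"
    by (rule measurable_compose[OF Y m])
  have "ennreal ((\<integral>\<omega>. f (X \<omega>, Y \<omega>) \<partial>M) + B) = (\<integral>\<^sup>+\<omega>. ennreal (f (X \<omega>, Y \<omega>) + B) \<partial>M)"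
    by (rule bounded_nn_integral_shift(1)[OF fXY B, symmetric])
  also have "\<dots> = (\<integral>\<^sup>+\<omega>. \<integral>\<^sup>+x. ennreal (f (x, Y \<omega>) + B) \<partial>\<kappa> (Y \<omega>) \<partial>M)"
    using reg_cond_distr_nn_integral[OF M r X Y, of "\<lambda>z. ennreal (f z + B)"] f by simp
  also have "\<dots> = (\<integral>\<^sup>+\<omega>. ennreal ((\<integral>x. f (x, Y \<omega>) \<partial>\<kappa> (Y \<omega>)) + B) \<partial>M)"
  proof (rule nn_integral_cong)
    fix \<omega> assume "\<omega> \<in> space M"
    then have y: "Y \<omega> \<in> space N" using measurable_space[OF Y] by simp
    show "(\<integral>\<^sup>+x. ennreal (f (x, Y \<omega>) + B) \<partial>\<kappa> (Y \<omega>)) = ennreal ((\<integral>x. f (x, Y \<omega>) \<partial>\<kappa> (Y \<omega>)) + B)"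
      by (rule prob_space.bounded_nn_integral_shift(1)[OF \<kappa>p(1)[OF y] fy[OF y] B])
  qed
  also have "\<dots> = ennreal ((\<integral>\<omega>. \<integral>x. f (x, Y \<omega>) \<partial>\<kappa> (Y \<omega>) \<partial>M) + B)"
    using measurable_space[OF Y] by (intro bounded_nn_integral_shift(1)[OF mY] b) auto
  finally have eq: "ennreal ((\<integral>\<omega>. f (X \<omega>, Y \<omega>) \<partial>M) + B) = ennreal ((\<integral>\<omega>. \<integral>x. f (x, Y \<omega>) \<partial>\<kappa> (Y \<omega>) \<partial>M) + B)" .
  have "\<bar>\<integral>\<omega>. f (X \<omega>, Y \<omega>) \<partial>M\<bar> \<le> B" by (rule bounded_nn_integral_shift(3)[OF fXY B])
  moreover have "\<bar>\<integral>\<omega>. \<integral>x. f (x, Y \<omega>) \<partial>\<kappa> (Y \<omega>) \<partial>M\<bar> \<le> B"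
    using measurable_space[OF Y] by (intro bounded_nn_integral_shift(3)[OF mY] b) auto
  ultimately show "(\<integral>\<omega>. f (X \<omega>, Y \<omega>) \<partial>M) = (\<integral>\<omega>. \<integral>x. f (x, Y \<omega>) \<partial>\<kappa> (Y \<omega>) \<partial>M)"
    using eq by (subst (asm) ennreal_inj) linarith+
qed

context controlled_process
begin

text \<open>The conditional expectation of \<open>\<phi>(X\<^sub>n, Y\<^sub>0, \<dots>, Y\<^sub>n)\<close> given \<open>X\<^sub>n\<close> and the measurements before time \<open>n\<close>.\<close>
definition channel_avg :: "nat \<Rightarrow> ('x \<times> (nat \<Rightarrow> 'y) \<Rightarrow> real) \<Rightarrow> 'x \<times> (nat \<Rightarrow> 'y) \<Rightarrow> real" where
  "channel_avg n \<phi> = (\<lambda>(x, y). \<integral>v. \<phi> (x, y(n := v)) \<partial>Q x)"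

lemma prob_channel: "prob_space (Q x)"
  using measurable_space[OF Q, of x] by (simp add: space_prob_algebra)

lemma measurable_obs_upd:
  fixes \<phi> :: "'x \<times> (nat \<Rightarrow> 'y) \<Rightarrow> 'b::t1_space"
  assumes \<phi>: "\<phi> \<in> borel_measurable (borel \<Otimes>\<^sub>M obs_sigma {..<Suc n})"
  shows "(\<lambda>v. \<phi> (x, y(n := v))) \<in> borel_measurable borel"
proof -
  have "\<phi> \<in> borel_measurable (borel \<Otimes>\<^sub>M paths)"
    using \<phi> borel_measurable_pair_obs_sigma[of \<phi> borel "{..<Suc n}"] by blast
  moreover have "(\<lambda>v. (x, y(n := v))) \<in> borel \<rightarrow>\<^sub>M borel \<Otimes>\<^sub>M (paths :: (nat \<Rightarrow> 'y) measure)"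
    by (intro measurable_Pair measurable_upd_paths) (auto simp: space_PiM)
  ultimately show ?thesis by (rule measurable_compose[rotated])
qed

lemma
  assumes \<phi>: "\<phi> \<in> borel_measurable (borel \<Otimes>\<^sub>M obs_sigma {..<Suc n})" and B: "\<And>z. \<bar>\<phi> z\<bar> \<le> B"
  shows channel_avg_measurable: "channel_avg n \<phi> \<in> borel_measurable (borel \<Otimes>\<^sub>M obs_sigma {..<n})"
    and channel_avg_bound: "\<bar>channel_avg n \<phi> z\<bar> \<le> B"
    and channel_avg_integral: "\<rho> \<in> priors \<Longrightarrow>
      (\<integral>\<omega>. \<phi> (fst (\<omega> n), obs_seq \<omega>) \<partial>law \<rho>) = (\<integral>\<omega>. channel_avg n \<phi> (fst (\<omega> n), obs_seq \<omega>) \<partial>law \<rho>)"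
proof -
  let ?nn = "\<lambda>(x, y). \<integral>\<^sup>+v. ennreal (\<phi> (x, y(n := v)) + B) \<partial>Q x"
  have Qm: "(\<lambda>v. \<phi> (x, y(n := v))) \<in> borel_measurable (Q x)" for x y
    unfolding measurable_cong_sets[OF sets_channel refl] by (rule measurable_obs_upd[OF \<phi>])
  have nn: "?nn z = ennreal (channel_avg n \<phi> z + B)" for z
    using prob_space.bounded_nn_integral_shift(1)[OF prob_channel Qm B] by (simp add: channel_avg_def split_beta)
  show bnd: "\<bar>channel_avg n \<phi> z\<bar> \<le> B" for z
    using prob_space.bounded_nn_integral_shift(3)[OF prob_channel Qm B] by (simp add: channel_avg_def split_beta)
  have \<phi>e: "(\<lambda>z. ennreal (\<phi> z + B)) \<in> borel_measurable (borel \<Otimes>\<^sub>M obs_sigma {..<Suc n})"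
    using \<phi> by simp
  have "return borel undefined \<in> (priors :: 'x measure set)"
    by (simp add: space_prob_algebra prob_space_return)
  from nn_integral_law_channel_mult(1)[OF this \<phi>e]
  have "(\<lambda>z. enn2real (?nn z) - B) \<in> borel_measurable (borel \<Otimes>\<^sub>M obs_sigma {..<n})"
    by (intro borel_measurable_diff borel_measurable_enn2real) simp_all
  moreover have "enn2real (?nn z) - B = channel_avg n \<phi> z" for z
  proof -
    have "0 \<le> channel_avg n \<phi> z + B" using bnd[of z] by linarith
    then show ?thesis unfolding nn by simp
  qed
  ultimately show m: "channel_avg n \<phi> \<in> borel_measurable (borel \<Otimes>\<^sub>M obs_sigma {..<n})"
    by auto
  assume \<rho>: "\<rho> \<in> priors"
  interpret prob_space "law \<rho>" by (rule prob_space_law[OF \<rho>])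
  note cong = measurable_cong_sets[OF sets_law[OF \<rho>] refl]
  have m1: "(\<lambda>\<omega>. \<phi> (fst (\<omega> n), obs_seq \<omega>)) \<in> borel_measurable (law \<rho>)"
    unfolding cong by (rule measurable_compose[OF measurable_state_obs \<phi>])
  have m2: "(\<lambda>\<omega>. channel_avg n \<phi> (fst (\<omega> n), obs_seq \<omega>)) \<in> borel_measurable (law \<rho>)"
    unfolding cong by (rule measurable_compose[OF measurable_state_obs m])
  have "ennreal ((\<integral>\<omega>. \<phi> (fst (\<omega> n), obs_seq \<omega>) \<partial>law \<rho>) + B) = (\<integral>\<^sup>+\<omega>. ennreal (\<phi> (fst (\<omega> n), obs_seq \<omega>) + B) \<partial>law \<rho>)"
    by (rule bounded_nn_integral_shift(1)[OF m1 B, symmetric])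
  also have "\<dots> = (\<integral>\<^sup>+\<omega>. ?nn (fst (\<omega> n), obs_seq \<omega>) \<partial>law \<rho>)"
    using nn_integral_law_channel_mult(2)[OF \<rho> \<phi>e, of "\<lambda>_. 1"] by simp
  also have "\<dots> = (\<integral>\<^sup>+\<omega>. ennreal (channel_avg n \<phi> (fst (\<omega> n), obs_seq \<omega>) + B) \<partial>law \<rho>)"
    unfolding nn ..
  also have "\<dots> = ennreal ((\<integral>\<omega>. channel_avg n \<phi> (fst (\<omega> n), obs_seq \<omega>) \<partial>law \<rho>) + B)"
    by (rule bounded_nn_integral_shift(1)[OF m2 bnd])
  finally have eq: "ennreal ((\<integral>\<omega>. \<phi> (fst (\<omega> n), obs_seq \<omega>) \<partial>law \<rho>) + B) = ennreal ((\<integral>\<omega>. channel_avg n \<phi> (fst (\<omega> n), obs_seq \<omega>) \<partial>law \<rho>) + B)" .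
  have "\<bar>\<integral>\<omega>. \<phi> (fst (\<omega> n), obs_seq \<omega>) \<partial>law \<rho>\<bar> \<le> B" by (rule bounded_nn_integral_shift(3)[OF m1 B])
  moreover have "\<bar>\<integral>\<omega>. channel_avg n \<phi> (fst (\<omega> n), obs_seq \<omega>) \<partial>law \<rho>\<bar> \<le> B" by (rule bounded_nn_integral_shift(3)[OF m2 bnd])
  ultimately show "(\<integral>\<omega>. \<phi> (fst (\<omega> n), obs_seq \<omega>) \<partial>law \<rho>) = (\<integral>\<omega>. channel_avg n \<phi> (fst (\<omega> n), obs_seq \<omega>) \<partial>law \<rho>)"
    using eq by (subst (asm) ennreal_inj) linarith+
qed

text \<open>Integrals of functions of \<open>X\<^sub>n\<close> and \<open>Y\<^sub>0, \<dots>, Y\<^sub>n\<close> in terms of the predictor, which does not know \<open>Y\<^sub>n\<close>.\<close>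
lemma predictor_integral:
  assumes \<rho>: "\<rho> \<in> priors" and \<kappa>: "predictor_version T Q \<rho> \<gamma> n \<kappa>"
    and \<phi>: "\<phi> \<in> borel_measurable (borel \<Otimes>\<^sub>M obs_sigma {..<Suc n})" and B: "\<And>z. \<bar>\<phi> z\<bar> \<le> B"
  shows "(\<integral>\<omega>. \<phi> (fst (\<omega> n), obs_seq \<omega>) \<partial>law \<rho>) = (\<integral>\<omega>. \<integral>x. channel_avg n \<phi> (x, obs_seq \<omega>) \<partial>\<kappa> (obs_seq \<omega>) \<partial>law \<rho>)"
  unfolding channel_avg_integral[OF \<phi> B \<rho>]
  using \<kappa> unfolding predictor_version_def
  by (rule reg_cond_distr_integral(1)[OF prob_space_law[OF \<rho>] _ measurable_state_law[OF \<rho>] measurable_obs_law[OF \<rho>]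
        channel_avg_measurable[OF \<phi> B] channel_avg_bound[OF \<phi> B]])

end

context filter_comparison
begin

lemma AE_R_imp_P:
  assumes "AE \<omega> in R. Pr \<omega>"
  shows "AE \<omega> in P. Pr \<omega>"
  unfolding P_eq
  using assms by (rule absolutely_continuous_AE[OF _ absolutely_continuousI_density[OF measurable_Z_R], rotated]) simp

context
  fixes n :: nat and f :: "'x \<Rightarrow> real" and B :: real
    and p q a b :: "(nat \<Rightarrow> 'y) \<Rightarrow> 'x measure"
  assumes f: "f \<in> borel_measurable borel" and B: "0 < B" "\<And>x. \<bar>f x\<bar> \<le> B"
    and p: "filter_version T Q \<mu> \<gamma> n p" and q: "filter_version T Q \<nu> \<gamma> n q"
    and a: "predictor_version T Q \<mu> \<gamma> n a" and b: "predictor_version T Q \<nu> \<gamma> n b"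
begin

lemma reg_cond_distr_versions:
  "reg_cond_distr P (\<lambda>\<omega>. fst (\<omega> n)) (obs_sigma {..<Suc n}) obs_seq p"
  "reg_cond_distr R (\<lambda>\<omega>. fst (\<omega> n)) (obs_sigma {..<Suc n}) obs_seq q"
  "reg_cond_distr P (\<lambda>\<omega>. fst (\<omega> n)) (obs_sigma {..<n}) obs_seq a"
  "reg_cond_distr R (\<lambda>\<omega>. fst (\<omega> n)) (obs_sigma {..<n}) obs_seq b"
  using p q a b by (simp_all add: filter_version_def predictor_version_def lessThan_Suc_atMost)

lemma measurable_versions:
  "p \<in> obs_sigma {..<Suc n} \<rightarrow>\<^sub>M prob_algebra borel" "q \<in> obs_sigma {..<Suc n} \<rightarrow>\<^sub>M prob_algebra borel"
  "a \<in> obs_sigma {..<n} \<rightarrow>\<^sub>M prob_algebra borel" "b \<in> obs_sigma {..<n} \<rightarrow>\<^sub>M prob_algebra borel"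
  using reg_cond_distr_versions by (simp_all add: reg_cond_distr_def)

lemma prob_versions:
  "prob_space (p y)" "sets (p y) = sets borel" "prob_space (q y)" "sets (q y) = sets borel"
  "prob_space (a y)" "sets (a y) = sets borel" "prob_space (b y)" "sets (b y) = sets borel"
  using measurable_versions[THEN measurable_space, of y] by (simp_all add: space_prob_algebra)

text \<open>With \<open>s = diff_sign\<close>, the distance \<open>|\<integral> f dp - \<integral> f dq|\<close> is \<open>s * \<integral> f dp - signed_mean\<close>. Both terms become predictor
integrals after \<open>Y\<^sub>n\<close> has been averaged out: the first is the filter mean of \<open>s * f\<close>, the second a
function of the measurements alone.\<close>
definition "diff_sign y = sgn ((\<integral>x. f x \<partial>p y) - (\<integral>x. f x \<partial>q y))"
definition "signed_mean y = diff_sign y * (\<integral>x. f x \<partial>q y)"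
definition "signed_f_avg = channel_avg n (\<lambda>(x, y). diff_sign y * f x)"
definition "signed_mean_avg = channel_avg n (\<lambda>(x, y). signed_mean y)"

lemma measurable_posterior_mean: "(\<lambda>y. \<integral>x. f x \<partial>p y) \<in> borel_measurable (obs_sigma {..<Suc n})" "(\<lambda>y. \<integral>x. f x \<partial>q y) \<in> borel_measurable (obs_sigma {..<Suc n})"
  using f by (auto intro!: measurable_integral_kernel[OF measurable_versions(1) _ B(2)] measurable_integral_kernel[OF measurable_versions(2) _ B(2)])

lemma posterior_mean_bound: "\<bar>\<integral>x. f x \<partial>p y\<bar> \<le> B" "\<bar>\<integral>x. f x \<partial>q y\<bar> \<le> B"
  using prob_versions[of y] f B by (auto intro!: prob_space.bounded_nn_integral_shift(3) simp: measurable_cong_sets[OF prob_versions(2) refl] measurable_cong_sets[OF prob_versions(4) refl])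

lemma diff_sign: "diff_sign \<in> borel_measurable (obs_sigma {..<Suc n})" "\<bar>diff_sign y\<bar> \<le> 1"
  unfolding diff_sign_def[abs_def] using measurable_posterior_mean by (auto simp: sgn_if intro!: borel_measurable_sgn)

lemma signed_mean: "signed_mean \<in> borel_measurable (obs_sigma {..<Suc n})" "\<bar>signed_mean y\<bar> \<le> B"
proof -
  show "signed_mean \<in> borel_measurable (obs_sigma {..<Suc n})"
    unfolding signed_mean_def[abs_def] by (intro borel_measurable_times diff_sign measurable_posterior_mean)
  have "\<bar>signed_mean y\<bar> \<le> 1 * B"
    unfolding signed_mean_def abs_mult by (intro mult_mono diff_sign posterior_mean_bound) auto
  then show "\<bar>signed_mean y\<bar> \<le> B" by simp
qed

lemma signed_f: "(\<lambda>(x, y). diff_sign y * f x) \<in> borel_measurable (borel \<Otimes>\<^sub>M obs_sigma {..<Suc n})"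
    "\<bar>(\<lambda>(x, y). diff_sign y * f x) z\<bar> \<le> B"
proof -
  show "(\<lambda>(x, y). diff_sign y * f x) \<in> borel_measurable (borel \<Otimes>\<^sub>M obs_sigma {..<Suc n})"
    unfolding split_beta
    by (intro borel_measurable_times measurable_compose[OF measurable_snd diff_sign(1)] measurable_compose[OF measurable_fst f])
  have "\<bar>diff_sign (snd z)\<bar> * \<bar>f (fst z)\<bar> \<le> 1 * B"
    by (intro mult_mono diff_sign B) auto
  then show "\<bar>(\<lambda>(x, y). diff_sign y * f x) z\<bar> \<le> B" by (simp add: split_beta abs_mult)
qed

lemma signed_mean_fst: "(\<lambda>(x, y). signed_mean y) \<in> borel_measurable ((borel :: 'x measure) \<Otimes>\<^sub>M obs_sigma {..<Suc n})"
    "\<bar>(\<lambda>(x :: 'x, y). signed_mean y) z\<bar> \<le> B"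
  unfolding split_beta by (intro measurable_compose[OF measurable_snd signed_mean(1)]) (rule signed_mean(2))

lemma signed_f_avg: "signed_f_avg \<in> borel_measurable (borel \<Otimes>\<^sub>M obs_sigma {..<n})" "\<bar>signed_f_avg z\<bar> \<le> B"
  unfolding signed_f_avg_def by (rule channel_avg_measurable[OF signed_f], rule channel_avg_bound[OF signed_f])

lemma signed_mean_avg: "signed_mean_avg \<in> borel_measurable (borel \<Otimes>\<^sub>M obs_sigma {..<n})" "\<bar>signed_mean_avg z\<bar> \<le> B"
  unfolding signed_mean_avg_def by (rule channel_avg_measurable[OF signed_mean_fst], rule channel_avg_bound[OF signed_mean_fst])

lemma abs_diff_as_predictor_integrals:
  "(\<integral>\<omega>. \<bar>(\<integral>x. f x \<partial>p (obs_seq \<omega>)) - (\<integral>x. f x \<partial>q (obs_seq \<omega>))\<bar> \<partial>P)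
   = (\<integral>\<omega>. \<integral>x. signed_f_avg (x, obs_seq \<omega>) \<partial>a (obs_seq \<omega>) \<partial>P) - (\<integral>\<omega>. \<integral>x. signed_mean_avg (x, obs_seq \<omega>) \<partial>a (obs_seq \<omega>) \<partial>P)"
proof -
  interpret P: prob_space P by (rule prob_space_law[OF \<mu>])
  have Y: "obs_seq \<in> P \<rightarrow>\<^sub>M obs_sigma J" for J by (rule measurable_obs_law[OF \<mu>])
  have 1: "(\<integral>\<omega>. \<integral>x. signed_f_avg (x, obs_seq \<omega>) \<partial>a (obs_seq \<omega>) \<partial>P) = (\<integral>\<omega>. diff_sign (obs_seq \<omega>) * (\<integral>x. f x \<partial>p (obs_seq \<omega>)) \<partial>P)"
    unfolding signed_f_avg_def predictor_integral[OF \<mu> a signed_f, symmetric]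
    using reg_cond_distr_integral(1)[OF P.prob_space_axioms reg_cond_distr_versions(1) measurable_state_law[OF \<mu>] Y signed_f] by simp
  have 2: "(\<integral>\<omega>. \<integral>x. signed_mean_avg (x, obs_seq \<omega>) \<partial>a (obs_seq \<omega>) \<partial>P) = (\<integral>\<omega>. signed_mean (obs_seq \<omega>) \<partial>P)"
    unfolding signed_mean_avg_def predictor_integral[OF \<mu> a signed_mean_fst, symmetric] by simp
  have i1: "integrable P (\<lambda>\<omega>. diff_sign (obs_seq \<omega>) * (\<integral>x. f x \<partial>p (obs_seq \<omega>)))"
  proof (rule P.integrable_const_bound[where B="1 * B"])
    show "AE \<omega> in P. norm (diff_sign (obs_seq \<omega>) * (\<integral>x. f x \<partial>p (obs_seq \<omega>))) \<le> 1 * B"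
      unfolding real_norm_def abs_mult by (intro AE_I2 mult_mono diff_sign posterior_mean_bound) auto
    show "(\<lambda>\<omega>. diff_sign (obs_seq \<omega>) * (\<integral>x. f x \<partial>p (obs_seq \<omega>))) \<in> borel_measurable P"
      by (intro borel_measurable_times measurable_compose[OF Y diff_sign(1)] measurable_compose[OF Y measurable_posterior_mean(1)])
  qed
  have i2: "integrable P (\<lambda>\<omega>. signed_mean (obs_seq \<omega>))"
    by (rule P.integrable_const_bound[where B=B]) (use signed_mean(2) measurable_compose[OF Y signed_mean(1)] in auto)
  have "\<bar>(\<integral>x. f x \<partial>p y) - (\<integral>x. f x \<partial>q y)\<bar> = diff_sign y * (\<integral>x. f x \<partial>p y) - signed_mean y" for y
    unfolding signed_mean_def diff_sign_def by (auto simp: sgn_if)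
  then show ?thesis unfolding 1 2 using i1 i2 by simp
qed

text \<open>Under \<open>\<nu>\<close> both functions have the same predictor integral: \<open>signed_mean\<close> is the conditional mean of \<open>s * f(X\<^sub>n)\<close>
given \<open>Y\<^sub>0, \<dots>, Y\<^sub>n\<close>, so both have the same conditional mean given \<open>Y\<^sub>0, \<dots>, Y\<^bsub>n-1\<^esub>\<close>.\<close>
lemma predictor_integrals_agree:
  "AE \<omega> in P. (\<integral>x. signed_f_avg (x, obs_seq \<omega>) \<partial>b (obs_seq \<omega>)) = (\<integral>x. signed_mean_avg (x, obs_seq \<omega>) \<partial>b (obs_seq \<omega>))"
proof (rule AE_R_imp_P)
  have Y: "obs_seq \<in> R \<rightarrow>\<^sub>M obs_sigma J" for J by (rule measurable_obs_law[OF \<nu>])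
  let ?w1 = "\<lambda>y. \<integral>x. signed_f_avg (x, y) \<partial>b y" and ?w2 = "\<lambda>y. \<integral>x. signed_mean_avg (x, y) \<partial>b y"
  have w1: "?w1 \<in> borel_measurable (obs_sigma {..<n})" "\<bar>?w1 y\<bar> \<le> B"
    and w2: "?w2 \<in> borel_measurable (obs_sigma {..<n})" "\<bar>?w2 y\<bar> \<le> B" for y
    using reg_cond_distr_integral(2,3)[OF prob_space_axioms reg_cond_distr_versions(4) measurable_state_law[OF \<nu>] Y signed_f_avg]
      reg_cond_distr_integral(2,3)[OF prob_space_axioms reg_cond_distr_versions(4) measurable_state_law[OF \<nu>] Y signed_mean_avg] by simp_all
  have eq: "(\<integral>\<omega>. ?w1 (obs_seq \<omega>) * indicator C (obs_seq \<omega>) \<partial>R) = (\<integral>\<omega>. ?w2 (obs_seq \<omega>) * indicator C (obs_seq \<omega>) \<partial>R)"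
    if C: "C \<in> sets (obs_sigma {..<n})" for C
  proof -
    let ?c = "\<lambda>y. indicator C y :: real"
    have cn: "?c \<in> borel_measurable (obs_sigma {..<n})" using C by simp
    have c_paths: "?c \<in> borel_measurable paths" and c_inv: "?c (restrict y {..<n}) = ?c y" for y
      using cn unfolding borel_measurable_obs_sigma by auto
    have c_upd: "?c (y(n := v)) = ?c y" for y v
    proof -
      have "restrict (y(n := v)) {..<n} = restrict y {..<n}" by auto
      then show ?thesis by (metis c_inv)
    qed
    have cs: "?c \<in> borel_measurable (obs_sigma {..<Suc n})"
      unfolding borel_measurable_obs_sigma
    proof (intro conjI allI c_paths)
      fix y :: "nat \<Rightarrow> 'y"
      have "restrict (restrict y {..<Suc n}) {..<n} = restrict y {..<n}" by auto
      then show "?c (restrict y {..<Suc n}) = ?c y" by (metis c_inv)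
    qed
    have c_le: "\<bar>t * ?c y\<bar> \<le> B" if "\<bar>t\<bar> \<le> B" for t y
      using that B(1) by (auto simp: indicator_def)
    have cut: "(\<lambda>(x, y). g (x, y) * ?c y) \<in> borel_measurable ((borel :: 'x measure) \<Otimes>\<^sub>M obs_sigma {..<Suc n})"
      "\<bar>(\<lambda>(x, y). g (x, y) * ?c y) z\<bar> \<le> B"
      if "g \<in> borel_measurable (borel \<Otimes>\<^sub>M obs_sigma {..<Suc n})" "\<And>z. \<bar>g z\<bar> \<le> B" for g :: "'x \<times> (nat \<Rightarrow> 'y) \<Rightarrow> real" and z
    proof -
      show "(\<lambda>(x, y). g (x, y) * ?c y) \<in> borel_measurable ((borel :: 'x measure) \<Otimes>\<^sub>M obs_sigma {..<Suc n})"
      proof -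
        have "(\<lambda>z. g z * ?c (snd z)) \<in> borel_measurable ((borel :: 'x measure) \<Otimes>\<^sub>M obs_sigma {..<Suc n})"
          by (intro borel_measurable_times that(1) measurable_compose[OF measurable_snd cs])
        then show ?thesis by (simp add: case_prod_unfold)
      qed
      show "\<bar>(\<lambda>(x, y). g (x, y) * ?c y) z\<bar> \<le> B" unfolding split_beta by (intro c_le that(2))
    qed
    have avg: "channel_avg n (\<lambda>(x, y). g (x, y) * ?c y) = (\<lambda>(x, y). channel_avg n g (x, y) * ?c y)" for g
      by (rule ext) (simp add: channel_avg_def split_beta c_upd)
    have pred: "(\<integral>\<omega>. (\<integral>x. channel_avg n g (x, obs_seq \<omega>) \<partial>b (obs_seq \<omega>)) * ?c (obs_seq \<omega>) \<partial>R)
        = (\<integral>\<omega>. g (fst (\<omega> n), obs_seq \<omega>) * ?c (obs_seq \<omega>) \<partial>R)"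
      if g: "g \<in> borel_measurable (borel \<Otimes>\<^sub>M obs_sigma {..<Suc n})" "\<And>z. \<bar>g z\<bar> \<le> B" for g :: "'x \<times> (nat \<Rightarrow> 'y) \<Rightarrow> real"
      using predictor_integral[OF \<nu> b cut[OF g]] unfolding avg by simp
    have "(\<integral>\<omega>. ?w1 (obs_seq \<omega>) * ?c (obs_seq \<omega>) \<partial>R) = (\<integral>\<omega>. (diff_sign (obs_seq \<omega>) * f (fst (\<omega> n))) * ?c (obs_seq \<omega>) \<partial>R)"
      using pred[OF signed_f] by (simp add: signed_f_avg_def)
    also have "\<dots> = (\<integral>\<omega>. signed_mean (obs_seq \<omega>) * ?c (obs_seq \<omega>) \<partial>R)"
      using reg_cond_distr_integral(1)[OF prob_space_axioms reg_cond_distr_versions(2) measurable_state_law[OF \<nu>] Y cut[OF signed_f]]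
      by (simp add: signed_mean_def mult.assoc mult.commute mult.left_commute)
    also have "\<dots> = (\<integral>\<omega>. ?w2 (obs_seq \<omega>) * ?c (obs_seq \<omega>) \<partial>R)"
      using pred[OF signed_mean_fst] by (simp add: signed_mean_avg_def)
    finally show ?thesis .
  qed
  have "AE y in distr R (obs_sigma {..<n}) obs_seq. ennreal (?w1 y + B) = ennreal (?w2 y + B)"
  proof (rule AE_eq_if_integrals_eq[OF prob_space_axioms Y])
    show "(\<lambda>y. ennreal (?w1 y + B)) \<in> borel_measurable (obs_sigma {..<n})" "(\<lambda>y. ennreal (?w2 y + B)) \<in> borel_measurable (obs_sigma {..<n})"
      using w1(1) w2(1) by simp_all
    fix C assume C: "C \<in> sets (obs_sigma {..<n} :: (nat \<Rightarrow> 'y) measure)"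
    have cY: "(\<lambda>\<omega>. indicator C (obs_seq \<omega>) :: real) \<in> borel_measurable R"
      using C by (intro measurable_compose[OF Y borel_measurable_indicator])
    have nn: "(\<integral>\<^sup>+\<omega>. ennreal (w (obs_seq \<omega>) + B) * indicator C (obs_seq \<omega>) \<partial>R)
      = ennreal ((\<integral>\<omega>. w (obs_seq \<omega>) * indicator C (obs_seq \<omega>) \<partial>R) + B * (\<integral>\<omega>. indicator C (obs_seq \<omega>) \<partial>R))"
      if w: "w \<in> borel_measurable (obs_sigma {..<n})" "\<And>y. \<bar>w y\<bar> \<le> B" for w
    proof -
      have wY: "(\<lambda>\<omega>. w (obs_seq \<omega>)) \<in> borel_measurable R" by (rule measurable_compose[OF Y w(1)])
      have i1: "integrable R (\<lambda>\<omega>. w (obs_seq \<omega>) * indicator C (obs_seq \<omega>))"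
        by (rule integrable_const_bound[where B=B])
           (use w(2) B(1) wY cY in \<open>auto intro!: AE_I2 simp: indicator_def\<close>)
      have i2: "integrable R (\<lambda>\<omega>. B * indicator C (obs_seq \<omega>))"
        by (rule integrable_const_bound[where B=B]) (use B(1) cY in \<open>auto intro!: AE_I2 simp: indicator_def\<close>)
      have pos: "0 \<le> w y + B" for y using w(2)[of y] by linarith
      have "(\<integral>\<^sup>+\<omega>. ennreal (w (obs_seq \<omega>) + B) * indicator C (obs_seq \<omega>) \<partial>R)
        = (\<integral>\<^sup>+\<omega>. ennreal (w (obs_seq \<omega>) * indicator C (obs_seq \<omega>) + B * indicator C (obs_seq \<omega>)) \<partial>R)"
        by (intro nn_integral_cong) (simp add: indicator_def)
      also have "\<dots> = ennreal (\<integral>\<omega>. w (obs_seq \<omega>) * indicator C (obs_seq \<omega>) + B * indicator C (obs_seq \<omega>) \<partial>R)"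
        by (intro nn_integral_eq_integral Bochner_Integration.integrable_add i1 i2 AE_I2)
           (simp add: indicator_def pos)
      finally show ?thesis using i1 i2 by simp
    qed
    show "(\<integral>\<^sup>+\<omega>. ennreal (?w1 (obs_seq \<omega>) + B) * indicator C (obs_seq \<omega>) \<partial>R) = (\<integral>\<^sup>+\<omega>. ennreal (?w2 (obs_seq \<omega>) + B) * indicator C (obs_seq \<omega>) \<partial>R)"
      unfolding nn[OF w1] nn[OF w2] eq[OF C] ..
  qed
  from AE_distrD[OF Y this] show "AE \<omega> in R. ?w1 (obs_seq \<omega>) = ?w2 (obs_seq \<omega>)"
  proof eventually_elim
    case (elim \<omega>)
    have "0 \<le> ?w1 (obs_seq \<omega>) + B" "0 \<le> ?w2 (obs_seq \<omega>) + B"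
      using w1(2)[of "obs_seq \<omega>"] w2(2)[of "obs_seq \<omega>"] by linarith+
    with elim show ?case by simp
  qed
qed

text \<open>Adding and subtracting the predictor integrals for \<open>\<nu>\<close>, which agree, leaves for each of the two functions the
difference between the predictors. On the support of \<open>\<phi>\<^sub>i\<close> both functions vary by at most
\<open>(1 + B) * d\<close>, uniformly in the measurements: \<open>f\<close> varies by at most \<open>d\<close>, and an average over the channel of a
function bounded by \<open>B\<close> varies by at most \<open>B * d\<close>.\<close>
lemma filter_diff_le_predictor_part_diff:
  fixes \<phi> :: "nat \<Rightarrow> 'x \<Rightarrow> real" and c :: "nat \<Rightarrow> 'x"
  assumes \<phi>: "\<And>i x. 0 \<le> \<phi> i x" "\<And>x. (\<lambda>i. \<phi> i x) sums 1" "\<And>i. continuous_on UNIV (\<phi> i)"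
    and osc_f: "\<And>i x. \<phi> i x \<noteq> 0 \<Longrightarrow> \<bar>f x - f (c i)\<bar> \<le> d"
    and osc_Q: "\<And>i x. \<phi> i x \<noteq> 0 \<Longrightarrow> tv_norm (Q x) (Q (c i)) \<le> d"
  shows "(\<lambda>y. part_diff \<phi> (a y) (b y)) \<in> borel_measurable (obs_sigma {..<n})"
    and "(\<integral>\<^sup>+\<omega>. ennreal \<bar>(\<integral>x. f x \<partial>p (obs_seq \<omega>)) - (\<integral>x. f x \<partial>q (obs_seq \<omega>))\<bar> \<partial>P)
      \<le> ennreal (4 * (1 + B) * d + 2 * B * (\<integral>\<omega>. part_diff \<phi> (a (obs_seq \<omega>)) (b (obs_seq \<omega>)) \<partial>P))"
proof -
  interpret P: prob_space P by (rule prob_space_law[OF \<mu>])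
  have Y: "obs_seq \<in> P \<rightarrow>\<^sub>M obs_sigma J" for J by (rule measurable_obs_law[OF \<mu>])
  have \<phi>m: "\<phi> i \<in> borel_measurable borel" for i using \<phi>(3) by (rule borel_measurable_continuous_onI)
  have d0: "0 \<le> d"
  proof -
    have "\<exists>i. \<phi> i undefined \<noteq> 0"
    proof (rule ccontr)
      assume "\<not> (\<exists>i. \<phi> i undefined \<noteq> 0)"
      then have "(\<lambda>i. 0::real) sums 1" using \<phi>(2)[of undefined] by simp
      then show False using sums_unique[of "\<lambda>_. 0 :: real" 1] by simp
    qed
    then show ?thesis using osc_f abs_ge_zero order_trans by blast
  qed
  show pd: "(\<lambda>y. part_diff \<phi> (a y) (b y)) \<in> borel_measurable (obs_sigma {..<n})"
    unfolding part_diff_def[OF \<phi>]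
  proof (rule borel_measurable_suminf)
    fix i
    have "(\<lambda>y. \<integral>x. \<phi> i x \<partial>k y) \<in> borel_measurable (obs_sigma {..<n})" if "k \<in> obs_sigma {..<n} \<rightarrow>\<^sub>M prob_algebra borel" for k
    proof (rule measurable_integral_kernel[OF that, where B=1])
      show "\<bar>\<phi> i x\<bar> \<le> 1" for x
        using \<phi>_le_1[OF \<phi>, of i x] \<phi>(1)[of i x] by simp
    qed (use \<phi>m[of i] in simp)
    from this[OF measurable_versions(3)] this[OF measurable_versions(4)]
    show "(\<lambda>y. \<bar>(\<integral>x. \<phi> i x \<partial>a y) - (\<integral>x. \<phi> i x \<partial>b y)\<bar>) \<in> borel_measurable (obs_sigma {..<n})" by simp
  qed
  have upd: "(\<lambda>v. g (y(n := v))) \<in> borel_measurable borel" if g: "g \<in> borel_measurable (obs_sigma {..<Suc n})" for g :: "(nat \<Rightarrow> 'y) \<Rightarrow> real" and y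
  proof -
    have "(\<lambda>(x :: 'x, y). g y) \<in> borel_measurable (borel \<Otimes>\<^sub>M obs_sigma {..<Suc n})"
      unfolding split_beta by (rule measurable_compose[OF measurable_snd g])
    from measurable_obs_upd[OF this] show ?thesis by simp
  qed
  \<comment> \<open>Continuity in total variation is uniform over bounded integrands, hence over the past measurements.\<close>
  have Q_diff: "\<bar>(\<integral>v. g (z(n := v)) \<partial>Q x) - (\<integral>v. g (z(n := v)) \<partial>Q x')\<bar> \<le> C * tv_norm (Q x) (Q x')"
    if g: "g \<in> borel_measurable (obs_sigma {..<Suc n})" "\<And>y. \<bar>g y\<bar> \<le> C" and C: "0 < C" for g :: "(nat \<Rightarrow> 'y) \<Rightarrow> real" and z x x' C
  proof -
    have "\<bar>(\<integral>v. g (z(n := v)) / C \<partial>Q x) - (\<integral>v. g (z(n := v)) / C \<partial>Q x')\<bar> \<le> tv_norm (Q x) (Q x')"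
      using upd[OF g(1), of z] g(2) C
      by (intro abs_integral_diff_le_tv_norm prob_channel sets_channel) (simp_all add: divide_le_eq)
    then have "\<bar>((\<integral>v. g (z(n := v)) \<partial>Q x) - (\<integral>v. g (z(n := v)) \<partial>Q x')) / C\<bar> \<le> tv_norm (Q x) (Q x')"
      by (simp add: diff_divide_distrib)
    then show ?thesis using C by (simp add: abs_divide divide_le_eq mult.commute)
  qed
  have osc1: "\<bar>signed_f_avg (x, y) - signed_f_avg (c i, y)\<bar> \<le> (1 + B) * d" if i: "\<phi> i x \<noteq> 0" for i x y
  proof -
    let ?S = "\<lambda>x. \<integral>v. diff_sign (y(n := v)) \<partial>Q x"
    have S1: "\<bar>?S x\<bar> \<le> 1"
      using upd[OF diff_sign(1), of y] diff_sign(2)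
      by (intro prob_space.bounded_nn_integral_shift(3)[OF prob_channel]) (simp_all add: measurable_cong_sets[OF sets_channel refl])
    have eq: "signed_f_avg (x, y) - signed_f_avg (c i, y) = ?S x * (f x - f (c i)) + (?S x - ?S (c i)) * f (c i)"
      by (simp add: signed_f_avg_def channel_avg_def algebra_simps)
    have "\<bar>signed_f_avg (x, y) - signed_f_avg (c i, y)\<bar> \<le> \<bar>?S x\<bar> * \<bar>f x - f (c i)\<bar> + \<bar>?S x - ?S (c i)\<bar> * \<bar>f (c i)\<bar>"
      unfolding eq abs_mult[symmetric] by (rule abs_triangle_ineq)
    also have "\<dots> \<le> 1 * d + d * B"
    proof (intro add_mono mult_mono S1 osc_f[OF i] B(2))
      show "\<bar>?S x - ?S (c i)\<bar> \<le> d"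
      proof -
        have "\<bar>?S x - ?S (c i)\<bar> \<le> 1 * tv_norm (Q x) (Q (c i))"
          by (rule Q_diff[OF diff_sign zero_less_one])
        then show ?thesis using osc_Q[OF i] by simp
      qed
    qed (use d0 in auto)
    finally show ?thesis by (simp add: algebra_simps)
  qed
  have osc2: "\<bar>signed_mean_avg (x, y) - signed_mean_avg (c i, y)\<bar> \<le> (1 + B) * d" if i: "\<phi> i x \<noteq> 0" for i x y
  proof -
    have "\<bar>signed_mean_avg (x, y) - signed_mean_avg (c i, y)\<bar> \<le> B * tv_norm (Q x) (Q (c i))"
      unfolding signed_mean_avg_def channel_avg_def prod.case by (rule Q_diff[OF signed_mean B(1)])
    also have "\<dots> \<le> B * d" using B(1) osc_Q[OF i] by (intro mult_left_mono) auto
    also have "\<dots> \<le> (1 + B) * d" using d0 by (simp add: algebra_simps)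
    finally show ?thesis .
  qed
  have u_meas: "(\<lambda>x. u (x, y)) \<in> borel_measurable borel" if "u \<in> borel_measurable (borel \<Otimes>\<^sub>M obs_sigma {..<n})" for u :: "'x \<times> (nat \<Rightarrow> 'y) \<Rightarrow> real" and y
    by (rule measurable_compose[OF _ that]) simp
  let ?\<sigma> = "\<lambda>\<omega>. part_diff \<phi> (a (obs_seq \<omega>)) (b (obs_seq \<omega>))"
  have bound: "\<bar>(\<integral>x. u (x, y) \<partial>a y) - (\<integral>x. u (x, y) \<partial>b y)\<bar> \<le> 2 * ((1 + B) * d) + B * part_diff \<phi> (a y) (b y)"
    if "u \<in> borel_measurable (borel \<Otimes>\<^sub>M obs_sigma {..<n})" "\<And>z. \<bar>u z\<bar> \<le> B"
      "\<And>i x. \<phi> i x \<noteq> 0 \<Longrightarrow> \<bar>u (x, y) - u (c i, y)\<bar> \<le> (1 + B) * d" for u and y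
    using that(2,3) by (intro integral_diff_le_part_diff[OF \<phi> prob_versions(5,6,7,8) u_meas[OF that(1)]])
  have wm: "(\<lambda>\<omega>. \<integral>x. u (x, obs_seq \<omega>) \<partial>a (obs_seq \<omega>)) \<in> borel_measurable P" "integrable P (\<lambda>\<omega>. \<integral>x. u (x, obs_seq \<omega>) \<partial>a (obs_seq \<omega>))"
    if u: "u \<in> borel_measurable (borel \<Otimes>\<^sub>M obs_sigma {..<n})" "\<And>z. \<bar>u z\<bar> \<le> B" for u
  proof -
    note r = reg_cond_distr_integral(2,3)[OF P.prob_space_axioms reg_cond_distr_versions(3) measurable_state_law[OF \<mu>] Y u]
    show m: "(\<lambda>\<omega>. \<integral>x. u (x, obs_seq \<omega>) \<partial>a (obs_seq \<omega>)) \<in> borel_measurable P" by (rule measurable_compose[OF Y r(1)])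
    show "integrable P (\<lambda>\<omega>. \<integral>x. u (x, obs_seq \<omega>) \<partial>a (obs_seq \<omega>))"
      by (rule P.integrable_const_bound[where B=B, OF AE_I2 m]) (use r(2) in simp)
  qed
  have i\<sigma>: "integrable P ?\<sigma>"
  proof (rule P.integrable_const_bound[where B=2])
    show "?\<sigma> \<in> borel_measurable P" by (rule measurable_compose[OF Y pd])
    show "AE \<omega> in P. norm (?\<sigma> \<omega>) \<le> 2"
      using part_diff_bounds[OF \<phi> prob_versions(5,6,7,8)] by (intro AE_I2) simp
  qed
  have "(\<integral>\<omega>. \<bar>(\<integral>x. f x \<partial>p (obs_seq \<omega>)) - (\<integral>x. f x \<partial>q (obs_seq \<omega>))\<bar> \<partial>P)
    = (\<integral>\<omega>. (\<integral>x. signed_f_avg (x, obs_seq \<omega>) \<partial>a (obs_seq \<omega>)) - (\<integral>x. signed_mean_avg (x, obs_seq \<omega>) \<partial>a (obs_seq \<omega>)) \<partial>P)"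
    unfolding abs_diff_as_predictor_integrals using wm(2)[OF signed_f_avg] wm(2)[OF signed_mean_avg] by simp
  also have "\<dots> \<le> (\<integral>\<omega>. 4 * (1 + B) * d + 2 * B * ?\<sigma> \<omega> \<partial>P)"
  proof (rule integral_mono_AE)
    show "AE \<omega> in P. (\<integral>x. signed_f_avg (x, obs_seq \<omega>) \<partial>a (obs_seq \<omega>)) - (\<integral>x. signed_mean_avg (x, obs_seq \<omega>) \<partial>a (obs_seq \<omega>)) \<le> 4 * (1 + B) * d + 2 * B * ?\<sigma> \<omega>"
      using predictor_integrals_agree
    proof eventually_elim
      case (elim \<omega>)
      have "4 * (1 + B) * d + 2 * B * ?\<sigma> \<omega> = (2 * ((1 + B) * d) + B * ?\<sigma> \<omega>) + (2 * ((1 + B) * d) + B * ?\<sigma> \<omega>)"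
        by (simp add: algebra_simps)
      then show ?case
        using bound[OF signed_f_avg osc1, of "obs_seq \<omega>"] bound[OF signed_mean_avg osc2, of "obs_seq \<omega>"] elim by linarith
    qed
  qed (use wm(2)[OF signed_f_avg] wm(2)[OF signed_mean_avg] i\<sigma> in auto)
  also have "\<dots> = 4 * (1 + B) * d + 2 * B * (\<integral>\<omega>. ?\<sigma> \<omega> \<partial>P)"
    using i\<sigma> by (simp add: P.prob_space)
  finally have le: "(\<integral>\<omega>. \<bar>(\<integral>x. f x \<partial>p (obs_seq \<omega>)) - (\<integral>x. f x \<partial>q (obs_seq \<omega>))\<bar> \<partial>P) \<le> 4 * (1 + B) * d + 2 * B * (\<integral>\<omega>. ?\<sigma> \<omega> \<partial>P)" .
  have "integrable P (\<lambda>\<omega>. \<bar>(\<integral>x. f x \<partial>p (obs_seq \<omega>)) - (\<integral>x. f x \<partial>q (obs_seq \<omega>))\<bar>)"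
  proof (rule P.integrable_const_bound[where B="2 * B"])
    show "AE \<omega> in P. norm \<bar>(\<integral>x. f x \<partial>p (obs_seq \<omega>)) - (\<integral>x. f x \<partial>q (obs_seq \<omega>))\<bar> \<le> 2 * B"
    proof (rule AE_I2)
      fix \<omega>
      show "norm \<bar>(\<integral>x. f x \<partial>p (obs_seq \<omega>)) - (\<integral>x. f x \<partial>q (obs_seq \<omega>))\<bar> \<le> 2 * B"
        using posterior_mean_bound[of "obs_seq \<omega>"] by simp
    qed
    show "(\<lambda>\<omega>. \<bar>(\<integral>x. f x \<partial>p (obs_seq \<omega>)) - (\<integral>x. f x \<partial>q (obs_seq \<omega>))\<bar>) \<in> borel_measurable P"
      by (intro borel_measurable_abs borel_measurable_diff measurable_compose[OF Y measurable_posterior_mean(1)] measurable_compose[OF Y measurable_posterior_mean(2)])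
  qed
  then have "(\<integral>\<^sup>+\<omega>. ennreal \<bar>(\<integral>x. f x \<partial>p (obs_seq \<omega>)) - (\<integral>x. f x \<partial>q (obs_seq \<omega>))\<bar> \<partial>P)
    = ennreal (\<integral>\<omega>. \<bar>(\<integral>x. f x \<partial>p (obs_seq \<omega>)) - (\<integral>x. f x \<partial>q (obs_seq \<omega>))\<bar> \<partial>P)"
    by (intro nn_integral_eq_integral) auto
  also have "\<dots> \<le> ennreal (4 * (1 + B) * d + 2 * B * (\<integral>\<omega>. ?\<sigma> \<omega> \<partial>P))"
    by (rule ennreal_leI[OF le])
  finally show "(\<integral>\<^sup>+\<omega>. ennreal \<bar>(\<integral>x. f x \<partial>p (obs_seq \<omega>)) - (\<integral>x. f x \<partial>q (obs_seq \<omega>))\<bar> \<partial>P)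
      \<le> ennreal (4 * (1 + B) * d + 2 * B * (\<integral>\<omega>. ?\<sigma> \<omega> \<partial>P))" .
qed

end

end

section \<open>Weak merging of filters\<close>

lemma tv_continuous_ball:
  assumes Q: "tv_continuous Q" and d: "0 < d"
  shows "\<exists>r>0. \<forall>x'. dist x x' < r \<longrightarrow> tv_norm (Q x') (Q (x :: 'x::metric_space)) \<le> d"
proof (rule ccontr)
  assume "\<not> ?thesis"
  then have "\<forall>n. \<exists>x'. dist x x' < 1 / Suc n \<and> d < tv_norm (Q x') (Q x)"
    by (auto simp: not_le)
  then obtain a where a: "\<And>n. dist x (a n) < 1 / Suc n" "\<And>n. d < tv_norm (Q (a n)) (Q x)"
    by metis
  have "a \<longlonglongrightarrow> x"
  proof (rule tendstoI)
    fix e :: real assume "0 < e"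
    then have "eventually (\<lambda>n. 1 / Suc n < e) sequentially"
      using lim_1_over_n by (intro order_tendstoD(2)[OF LIMSEQ_Suc]) auto
    then show "eventually (\<lambda>n. dist (a n) x < e) sequentially"
      by eventually_elim (use a(1) in \<open>auto simp: dist_commute intro: less_trans\<close>)
  qed
  then have "(\<lambda>n. tv_norm (Q (a n)) (Q x)) \<longlonglongrightarrow> 0"
    using Q by (simp add: tv_continuous_def)
  then have "eventually (\<lambda>n. tv_norm (Q (a n)) (Q x) < d) sequentially"
    using d by (intro order_tendstoD(2)) auto
  then obtain n where "tv_norm (Q (a n)) (Q x) < d"
    by (auto simp: eventually_sequentially)
  with a(2)[of n] show False by simp
qed

context filter_comparison
begin

text \<open>The radii are chosen so small that \<open>f\<close> and the channel vary by at most \<open>d\<close> on each ball; the partition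
of unity is fixed before \<open>n\<close> tends to infinity, and \<open>part_diff\<close>, bounded by \<open>2\<close>, converges almost
surely.\<close>
theorem filter_weak_exp_if_predictor_weak_as:
  assumes Qc: "tv_continuous Q"
    and p: "\<And>n. filter_version T Q \<mu> \<gamma> n (p n)" and q: "\<And>n. filter_version T Q \<nu> \<gamma> n (q n)"
    and a: "\<And>n. n \<ge> 1 \<Longrightarrow> predictor_version T Q \<mu> \<gamma> n (a n)"
    and b: "\<And>n. n \<ge> 1 \<Longrightarrow> predictor_version T Q \<nu> \<gamma> n (b n)"
    and weak: "weak_as P a b"
  shows "weak_exp P p q"
  unfolding weak_exp_def
proof (intro allI impI)
  fix f :: "'x \<Rightarrow> real" assume f: "f \<in> bcontfun"
  interpret P: prob_space P by (rule prob_space_law[OF \<mu>])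
  obtain A where A: "A \<in> sets paths" "measure P {\<omega> \<in> space P. obs_seq \<omega> \<in> A} = 1"
    and lim: "\<And>y f. y \<in> A \<Longrightarrow> (f :: 'x \<Rightarrow> real) \<in> bcontfun \<Longrightarrow> (\<lambda>n. \<bar>(\<integral>x. f x \<partial>a n y) - (\<integral>x. f x \<partial>b n y)\<bar>) \<longlonglongrightarrow> 0"
    using weak unfolding weak_as_def by blast
  have f_cont: "continuous_on UNIV f" and f_bdd: "bounded (range f)"
    using f by (auto simp: bcontfun_def)
  then have f_meas: "f \<in> borel_measurable borel" by (intro borel_measurable_continuous_onI)
  obtain B0 where B0: "\<And>x. \<bar>f x\<bar> \<le> B0"
    using f_bdd by (auto simp: bounded_iff)
  define B where "B = max 1 B0"
  have B: "0 < B" "\<And>x. \<bar>f x\<bar> \<le> B" using B0 by (auto simp: B_def le_max_iff_disj)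
  show "(\<lambda>n. \<integral>\<^sup>+\<omega>. ennreal \<bar>(\<integral>x. f x \<partial>p n (obs_seq \<omega>)) - (\<integral>x. f x \<partial>q n (obs_seq \<omega>))\<bar> \<partial>P) \<longlonglongrightarrow> 0"
  proof (rule ennreal_tendsto_0I)
    fix e :: real assume e: "0 < e"
    define d where "d = e / (8 * (1 + B))"
    have d: "0 < d" using e B(1) by (simp add: d_def)
    have "\<exists>r>0. \<forall>x'. dist x x' < r \<longrightarrow> \<bar>f x' - f x\<bar> \<le> d \<and> tv_norm (Q x') (Q x) \<le> d" for x
    proof -
      obtain r1 where r1: "0 < r1" "\<And>x'. dist x' x < r1 \<Longrightarrow> dist (f x') (f x) < d"
        using f_cont d unfolding continuous_on_iff by (metis UNIV_I)
      obtain r2 where r2: "0 < r2" "\<And>x'. dist x x' < r2 \<Longrightarrow> tv_norm (Q x') (Q x) \<le> d"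
        using tv_continuous_ball[OF Qc d] by blast
      show ?thesis
      proof (intro exI[of _ "min r1 r2"] conjI allI impI)
        fix x' assume x': "dist x x' < min r1 r2"
        then show "\<bar>f x' - f x\<bar> \<le> d" using r1(2)[of x'] by (simp add: dist_commute dist_real_def)
        show "tv_norm (Q x') (Q x) \<le> d" using r2(2)[of x'] x' by simp
      qed (use r1 r2 in simp)
    qed
    then obtain r where r: "\<And>x. 0 < r x" and
      osc: "\<And>x x'. dist x x' < r x \<Longrightarrow> \<bar>f x' - f x\<bar> \<le> d \<and> tv_norm (Q x') (Q x) \<le> d"
      by metis
    obtain c :: "nat \<Rightarrow> 'x" and \<phi> :: "nat \<Rightarrow> 'x \<Rightarrow> real" where \<phi>0: "\<And>i x. 0 \<le> \<phi> i x" "\<And>x. (\<lambda>i. \<phi> i x) sums 1"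
      and supp: "\<And>i x. \<phi> i x \<noteq> 0 \<Longrightarrow> dist (c i) x < r (c i)"
      and comb: "\<And>b B. (\<And>i. \<bar>b i\<bar> \<le> B) \<Longrightarrow> continuous_on UNIV (\<lambda>x. \<Sum>i. b i * \<phi> i x)"
      and \<phi>1: "\<And>i. continuous_on UNIV (\<phi> i)"
    proof (rule partition_of_unity[OF r])
      fix c \<phi>
      assume "\<And>i x. (0::real) \<le> \<phi> i x" "\<And>x. (\<lambda>i. \<phi> i x) sums 1" "\<And>i x. \<phi> i x \<noteq> 0 \<Longrightarrow> dist (c i) x < r (c i)"
        "\<And>b B. (\<And>i. \<bar>b i\<bar> \<le> B) \<Longrightarrow> continuous_on UNIV (\<lambda>x. \<Sum>i. b i * \<phi> i x)" "\<And>i. continuous_on UNIV (\<phi> i)"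
      then show thesis by (rule that)
    qed
    note \<phi> = \<phi>0 \<phi>1
    let ?\<sigma> = "\<lambda>n \<omega>. part_diff \<phi> (a n (obs_seq \<omega>)) (b n (obs_seq \<omega>))"
    have probs: "prob_space (a (Suc n) y)" "sets (a (Suc n) y) = sets borel" "prob_space (b (Suc n) y)" "sets (b (Suc n) y) = sets borel" for n y
      using a[of "Suc n"] b[of "Suc n"]
      by (auto simp: predictor_version_def reg_cond_distr_def space_prob_algebra dest!: measurable_space[where x=y])
    have \<sigma>_meas: "?\<sigma> (Suc n) \<in> borel_measurable P"
      and le: "(\<integral>\<^sup>+\<omega>. ennreal \<bar>(\<integral>x. f x \<partial>p (Suc n) (obs_seq \<omega>)) - (\<integral>x. f x \<partial>q (Suc n) (obs_seq \<omega>))\<bar> \<partial>P)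
        \<le> ennreal (4 * (1 + B) * d + 2 * B * (\<integral>\<omega>. ?\<sigma> (Suc n) \<omega> \<partial>P))" for n
    proof -
      have n: "Suc n \<ge> 1" by simp
      note r = filter_diff_le_predictor_part_diff[OF f_meas B p q a[OF n] b[OF n] \<phi>]
      have "(\<lambda>y. part_diff \<phi> (a (Suc n) y) (b (Suc n) y)) \<in> borel_measurable (obs_sigma {..<Suc n})"
        by (rule r(1)) (use osc supp in blast)+
      then show "?\<sigma> (Suc n) \<in> borel_measurable P" by (rule measurable_compose[OF measurable_obs_law[OF \<mu>]])
      show "(\<integral>\<^sup>+\<omega>. ennreal \<bar>(\<integral>x. f x \<partial>p (Suc n) (obs_seq \<omega>)) - (\<integral>x. f x \<partial>q (Suc n) (obs_seq \<omega>))\<bar> \<partial>P)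
        \<le> ennreal (4 * (1 + B) * d + 2 * B * (\<integral>\<omega>. ?\<sigma> (Suc n) \<omega> \<partial>P))"
        by (rule r(2)) (use osc supp in blast)+
    qed
    have "(\<lambda>n. \<integral>\<omega>. ?\<sigma> (Suc n) \<omega> \<partial>P) \<longlonglongrightarrow> (\<integral>\<omega>. 0 \<partial>P)"
    proof (rule integral_dominated_convergence[where w="\<lambda>_. 2"])
      show "AE \<omega> in P. (\<lambda>n. ?\<sigma> (Suc n) \<omega>) \<longlonglongrightarrow> 0"
        using AE_obs_in[OF A]
      proof eventually_elim
        case (elim \<omega>)
        show ?case
          by (rule part_diff_tendsto_0[OF \<phi> probs comb]) (auto intro: LIMSEQ_Suc[OF lim[OF elim]])
      qed
      show "AE \<omega> in P. norm (?\<sigma> (Suc n) \<omega>) \<le> 2" for n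
        using part_diff_bounds[OF \<phi> probs] by (intro AE_I2) simp
    qed (use \<sigma>_meas in auto)
    then have "(\<lambda>n. 2 * B * (\<integral>\<omega>. ?\<sigma> (Suc n) \<omega> \<partial>P)) \<longlonglongrightarrow> 2 * B * 0"
      by (intro tendsto_mult_left) simp
    then have "eventually (\<lambda>n. 2 * B * (\<integral>\<omega>. ?\<sigma> (Suc n) \<omega> \<partial>P) < e / 2) sequentially"
      using e by (intro order_tendstoD(2)) auto
    then have "eventually (\<lambda>n. (\<integral>\<^sup>+\<omega>. ennreal \<bar>(\<integral>x. f x \<partial>p (Suc n) (obs_seq \<omega>)) - (\<integral>x. f x \<partial>q (Suc n) (obs_seq \<omega>))\<bar> \<partial>P) \<le> ennreal e) sequentially"
    proof eventually_elim
      case (elim n)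
      have "4 * (1 + B) * d = e / 2" using B(1) by (simp add: d_def field_simps)
      with elim have "4 * (1 + B) * d + 2 * B * (\<integral>\<omega>. ?\<sigma> (Suc n) \<omega> \<partial>P) \<le> e" by linarith
      then show ?case using le[of n] by (meson ennreal_leI order_trans)
    qed
    then show "eventually (\<lambda>n. (\<integral>\<^sup>+\<omega>. ennreal \<bar>(\<integral>x. f x \<partial>p n (obs_seq \<omega>)) - (\<integral>x. f x \<partial>q n (obs_seq \<omega>))\<bar> \<partial>P) \<le> ennreal e) sequentially"
      by (subst (asm) eventually_sequentially_Suc)
  qed
qed

end

section \<open>Stability under all policies\<close>

lemma filter_comparison_exists:
  fixes T :: "'x::polish_space \<times> 'u::polish_space \<Rightarrow> 'x measure"
    and Q :: "'x \<Rightarrow> 'y::polish_space measure"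
  assumes T: "T \<in> borel \<rightarrow>\<^sub>M prob_algebra borel" and Q: "Q \<in> borel \<rightarrow>\<^sub>M prob_algebra borel"
    and \<gamma>: "\<gamma> \<in> policies" and \<mu>: "\<mu> \<in> priors" and \<nu>: "\<nu> \<in> priors" and ac: "absolutely_continuous \<nu> \<mu>"
  obtains h where "filter_comparison T Q \<gamma> \<nu> h \<mu>"
proof -
  have \<mu>': "prob_space \<mu>" "sets \<mu> = sets borel" and \<nu>': "prob_space \<nu>" "sets \<nu> = sets borel"
    using \<mu> \<nu> by (auto simp: space_prob_algebra)
  interpret N: prob_space \<nu> by (rule \<nu>'(1))
  have fin: "finite_measure \<mu>" using \<mu>'(1) by (simp add: prob_space_def)
  have se: "sets \<mu> = sets \<nu>" using \<mu>' \<nu>' by simp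
  obtain h where h: "h \<in> borel_measurable \<nu>" "AE x in \<nu>. RN_deriv \<nu> \<mu> x = ennreal (h x)" "\<And>x. 0 \<le> h x"
    using N.real_RN_deriv[OF fin ac se] by blast
  have "\<mu> = density \<nu> (RN_deriv \<nu> \<mu>)"
    by (rule N.density_RN_deriv[OF ac se, symmetric])
  also have "\<dots> = density \<nu> h"
    using h by (intro density_cong) auto
  finally have "\<mu> = density \<nu> h" .
  moreover have "h \<in> borel_measurable borel"
    using h(1) by (simp add: measurable_cong_sets[OF \<nu>'(2) refl])
  ultimately have "filter_comparison T Q \<gamma> \<nu> h \<mu>"
    using T Q \<gamma> \<mu> \<nu> h(3) by unfold_locales auto
  then show thesis by (rule that)
qed

theorem theorem3p6:
  fixes T :: "'x::polish_space \<times> 'u::polish_space \<Rightarrow> 'x measure"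
    and Q :: "'x \<Rightarrow> 'y::polish_space measure"
    and \<mu> :: "'x measure"
    and filt pred :: "'x measure \<Rightarrow> ('y, 'u) policy \<Rightarrow> ('x, 'y) posterior"
  assumes "sigma_compact_space TYPE('x)"
    and "T \<in> borel \<rightarrow>\<^sub>M prob_algebra borel"
    and "Q \<in> borel \<rightarrow>\<^sub>M prob_algebra borel"
    and "\<mu> \<in> priors"
    and "\<And>\<rho> \<gamma> n. \<rho> \<in> priors \<Longrightarrow> \<gamma> \<in> policies \<Longrightarrow> filter_version T Q \<rho> \<gamma> n (filt \<rho> \<gamma> n)"
    and "\<And>\<rho> \<gamma> n. \<rho> \<in> priors \<Longrightarrow> \<gamma> \<in> policies \<Longrightarrow> n \<ge> 1 \<Longrightarrow> predictor_version T Q \<rho> \<gamma> n (pred \<rho> \<gamma> n)"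
  shows "(tv_continuous Q \<longrightarrow> universally_stable weak_as T Q pred \<mu> \<longrightarrow>
            universally_stable weak_exp T Q filt \<mu>)
       \<and> (universally_stable tv_exp T Q filt \<mu> \<longleftrightarrow> universally_stable tv_exp T Q pred \<mu>)
       \<and> (universally_stable tv_exp T Q filt \<mu> \<longleftrightarrow> universally_stable tv_as T Q filt \<mu>)
       \<and> (\<forall>\<nu> \<in> priors. absolutely_continuous \<nu> \<mu> \<longrightarrow>
            (\<forall>\<gamma> \<in> policies.
               (\<exists>n. entropy_exp (strategic T Q \<mu> \<gamma>) (filt \<mu> \<gamma>) (filt \<nu> \<gamma>) n < \<infinity>) \<and>
               (\<exists>m. (\<integral>\<^sup>+\<omega>. rel_entropy (restrict_FY m (strategic T Q \<mu> \<gamma>))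
                                      (restrict_FY m (strategic T Q \<nu> \<gamma>)) \<partial>strategic T Q \<mu> \<gamma>) < \<infinity>)) \<longrightarrow>
            (universally_stable_wrt rel_entropy_stable T Q filt \<mu> \<nu> \<longleftrightarrow>
             universally_stable_wrt tv_exp T Q filt \<mu> \<nu>))"
proof -
  have weak: "weak_exp (strategic T Q \<mu> \<gamma>) (filt \<mu> \<gamma>) (filt \<nu> \<gamma>)"
    if cont: "tv_continuous Q" and merge: "weak_as (strategic T Q \<mu> \<gamma>) (pred \<mu> \<gamma>) (pred \<nu> \<gamma>)"
      and \<gamma>: "\<gamma> \<in> policies" and \<nu>: "\<nu> \<in> priors" "absolutely_continuous \<nu> \<mu>" for \<nu> \<gamma>
  proof -
    obtain h where "filter_comparison T Q \<gamma> \<nu> h \<mu>"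
      using filter_comparison_exists[OF assms(2,3) \<gamma> assms(4) \<nu>] .
    then interpret filter_comparison T Q \<gamma> \<nu> h \<mu> .
    show ?thesis
      by (rule filter_weak_exp_if_predictor_weak_as[OF cont _ _ _ _ merge]) (use assms(4-6) \<gamma> \<nu> in auto)
  qed
  have pred: "tv_exp (strategic T Q \<mu> \<gamma>) (filt \<mu> \<gamma>) (filt \<nu> \<gamma>) \<longleftrightarrow> tv_exp (strategic T Q \<mu> \<gamma>) (pred \<mu> \<gamma>) (pred \<nu> \<gamma>)"
    and tv_as: "tv_as (strategic T Q \<mu> \<gamma>) (filt \<mu> \<gamma>) (filt \<nu> \<gamma>) \<longleftrightarrow> tv_exp (strategic T Q \<mu> \<gamma>) (filt \<mu> \<gamma>) (filt \<nu> \<gamma>)"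
    and ent: "entropy_exp (strategic T Q \<mu> \<gamma>) (filt \<mu> \<gamma>) (filt \<nu> \<gamma>) n < \<infinity> \<Longrightarrow>
      rel_entropy_stable (strategic T Q \<mu> \<gamma>) (filt \<mu> \<gamma>) (filt \<nu> \<gamma>) \<longleftrightarrow> tv_exp (strategic T Q \<mu> \<gamma>) (filt \<mu> \<gamma>) (filt \<nu> \<gamma>)"
    if \<gamma>: "\<gamma> \<in> policies" and \<nu>: "\<nu> \<in> priors" "absolutely_continuous \<nu> \<mu>" for \<nu> \<gamma> n
  proof -
    obtain h where "filter_comparison T Q \<gamma> \<nu> h \<mu>"
      using filter_comparison_exists[OF assms(2,3) \<gamma> assms(4) \<nu>] .
    then interpret filter_comparison T Q \<gamma> \<nu> h \<mu> .
    have f: "\<And>n. filter_version T Q \<mu> \<gamma> n (filt \<mu> \<gamma> n)" "\<And>n. filter_version T Q \<nu> \<gamma> n (filt \<nu> \<gamma> n)"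
      using assms(4,5) \<gamma> \<nu> by auto
    have p: "\<And>n. n \<ge> 1 \<Longrightarrow> predictor_version T Q \<mu> \<gamma> n (pred \<mu> \<gamma> n)" "\<And>n. n \<ge> 1 \<Longrightarrow> predictor_version T Q \<nu> \<gamma> n (pred \<nu> \<gamma> n)"
      using assms(4,6) \<gamma> \<nu> by auto
    show "tv_exp (strategic T Q \<mu> \<gamma>) (filt \<mu> \<gamma>) (filt \<nu> \<gamma>) \<longleftrightarrow> tv_exp (strategic T Q \<mu> \<gamma>) (pred \<mu> \<gamma>) (pred \<nu> \<gamma>)"
      using filter_tv_exp_iff[OF f] predictor_tv_exp_iff[OF f p] by simp
    show "tv_as (strategic T Q \<mu> \<gamma>) (filt \<mu> \<gamma>) (filt \<nu> \<gamma>) \<longleftrightarrow> tv_exp (strategic T Q \<mu> \<gamma>) (filt \<mu> \<gamma>) (filt \<nu> \<gamma>)"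
      by (rule filter_tv_as_iff[OF f])
    show "entropy_exp (strategic T Q \<mu> \<gamma>) (filt \<mu> \<gamma>) (filt \<nu> \<gamma>) n < \<infinity> \<Longrightarrow>
      rel_entropy_stable (strategic T Q \<mu> \<gamma>) (filt \<mu> \<gamma>) (filt \<nu> \<gamma>) \<longleftrightarrow> tv_exp (strategic T Q \<mu> \<gamma>) (filt \<mu> \<gamma>) (filt \<nu> \<gamma>)"
      by (rule filter_entropy_stable_iff[OF f])
  qed
  show ?thesis
  proof (intro conjI)
    show "tv_continuous Q \<longrightarrow> universally_stable weak_as T Q pred \<mu> \<longrightarrow> universally_stable weak_exp T Q filt \<mu>"
      unfolding universally_stable_def universally_stable_wrt_def using weak by blast
    show "universally_stable tv_exp T Q filt \<mu> \<longleftrightarrow> universally_stable tv_exp T Q pred \<mu>"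
      unfolding universally_stable_def universally_stable_wrt_def using pred by blast
    show "universally_stable tv_exp T Q filt \<mu> \<longleftrightarrow> universally_stable tv_as T Q filt \<mu>"
      unfolding universally_stable_def universally_stable_wrt_def using tv_as by blast
    show "\<forall>\<nu> \<in> priors. absolutely_continuous \<nu> \<mu> \<longrightarrow>
            (\<forall>\<gamma> \<in> policies.
               (\<exists>n. entropy_exp (strategic T Q \<mu> \<gamma>) (filt \<mu> \<gamma>) (filt \<nu> \<gamma>) n < \<infinity>) \<and>
               (\<exists>m. (\<integral>\<^sup>+\<omega>. rel_entropy (restrict_FY m (strategic T Q \<mu> \<gamma>))
                                      (restrict_FY m (strategic T Q \<nu> \<gamma>)) \<partial>strategic T Q \<mu> \<gamma>) < \<infinity>)) \<longrightarrow>
            (universally_stable_wrt rel_entropy_stable T Q filt \<mu> \<nu> \<longleftrightarrow>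
             universally_stable_wrt tv_exp T Q filt \<mu> \<nu>)"
      unfolding universally_stable_wrt_def using ent by blast
  qed
qed

end
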